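(* Let $G$ be a transitive network with $\|P\|_{\mathrm{bub}}<\infty$, and let $\mathfrak F$ be the (oriented) wired uniform spanning forest of $G$, with $\mathfrak P(v)$ denoting the past of $v$ in $\mathfrak F$. Then there exist constants $0<c\le C<\infty$, depending only on $G$, such that for every vertex $v$ and every $R\geq 1$, $$ cR^{-1}\le \mathbb P\bigl(\mathrm{diam}_{\mathrm{int}}(\mathfrak P(v))\geq R\bigr)\le C R^{-1}\qquad\text{and}\qquad cR^{-1/2}\le \mathbb P\bigl(|\mathfrak P(v)|\geq R\bigr)\le C R^{-1/2}.$$
   Context: A network is a connected graph $G=(V,E)$ (loops and multiple edges allowed) together with conductances $c:E\to(0,\infty)$ such that the vertex conductance $c(v)$, the sum of $c(e)$ over edges $e$ incident to $v$, is finite for every $v\in V$. It is transitive if for every $u,v\in V$ there is a conductance-preserving graph automorphism mapping $u$ to $v$. The random walk on $G$ at each step crosses an edge emanating from its current position chosen with probability proportional to its conductance; $P$ is its Markov operator and $p_n(u,v)$ is the probability that the walk started at $u$ is at $v$ at time $n$. Set $\|P^n\|_{1\to\infty}=\sup_{u,v\in V}p_n(u,v)$ and define the bubble norm $\|P\|_{\mathrm{bub}}=\sum_{n\ge0}(n+1)\|P^n\|_{1\to\infty}$. (If it is finite then $G$ is infinite and transient.) Wired uniform spanning forest (WUSF): the uniform spanning tree of a finite network is the random spanning tree chosen with probability proportional to the product of the conductances of its edges. Let $(V_n)$ be an increasing sequence of finite sets with union $V$, and let $G_n^*$ be obtained from $G$ by contracting $V\setminus V_n$ to a single vertex $\partial_n$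 and deleting the resulting self-loops at $\partial_n$. Orient the uniform spanning tree of $G_n^*$ towards $\partial_n$. For transient $G$, the oriented WUSF of $G$ is the weak limit of these random oriented trees (it exists and does not depend on the exhaustion); almost surely every vertex has exactly one outgoing edge in it. The past $\mathfrak P(v)$ of $v$ is the subgraph of $\mathfrak F$ induced by $v$ together with all vertices $u$ in the same tree as $v$ such that every edge of the path from $u$ to $v$ in $\mathfrak F$ is oriented in the direction of $v$. $\mathrm{diam}_{\mathrm{int}}(K)$ is the diameter of the graph $K$ in its own graph metric, and $|K|$ is its number of vertices. *)

theory Defs
  imports "HOL-Probability.Probability"
begin

section \<open>Multigraphs\<close>

text \<open>
  Undirected graphs with loops and multiple edges. The edge \<open>e\<close> has the set of endpoints
  \<open>ends G e\<close>, which is a singleton when \<open>e\<close> is a loop.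
\<close>

record ('v, 'e) multigraph =
  verts :: "'v set"
  edges :: "'e set"
  ends :: "'e \<Rightarrow> 'v set"

record ('v, 'e) weighted_graph = "('v, 'e) multigraph" +
  cond :: "'e \<Rightarrow> real"

text \<open>A walk is the list of its steps: the edge crossed, paired with the vertex it leads to.\<close>

fun walk :: "('v, 'e, 'x) multigraph_scheme \<Rightarrow> 'v \<Rightarrow> ('e \<times> 'v) list \<Rightarrow> 'v \<Rightarrow> bool" where
  "walk G x [] y \<longleftrightarrow> x = y"
| "walk G x ((e, z) # p) y \<longleftrightarrow> e \<in> edges G \<and> ends G e = {x, z} \<and> walk G z p y"

definition path :: "('v, 'e, 'x) multigraph_scheme \<Rightarrow> 'v \<Rightarrow> ('e \<times> 'v) list \<Rightarrow> 'v \<Rightarrow> bool" where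
  "path G x p y \<longleftrightarrow> walk G x p y \<and> distinct (x # map snd p)"

text \<open>
  Distinctness of the edges only matters for cycles of length two, where it excludes going
  back and forth along a single edge. A loop is a cycle of length one.
\<close>

definition cycle :: "('v, 'e, 'x) multigraph_scheme \<Rightarrow> 'v \<Rightarrow> ('e \<times> 'v) list \<Rightarrow> bool" where
  "cycle G x p \<longleftrightarrow> p \<noteq> [] \<and> walk G x p x \<and> distinct (map snd p) \<and> distinct (map fst p)"

definition connected_graph :: "('v, 'e, 'x) multigraph_scheme \<Rightarrow> bool" where
  "connected_graph G \<longleftrightarrow>
     verts G \<noteq> {} \<and> (\<forall>x\<in>verts G. \<forall>y\<in>verts G. \<exists>p. walk G x p y)"

definition tree_graph :: "('v, 'e, 'x) multigraph_scheme \<Rightarrow> bool" where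
  "tree_graph G \<longleftrightarrow> connected_graph G \<and> (\<nexists>x p. cycle G x p)"

definition graph_dist :: "('v, 'e, 'x) multigraph_scheme \<Rightarrow> 'v \<Rightarrow> 'v \<Rightarrow> enat" where
  "graph_dist G x y = (INF p\<in>{p. walk G x p y}. enat (length p))"

definition graph_diam :: "('v, 'e, 'x) multigraph_scheme \<Rightarrow> enat" where
  "graph_diam G = (SUP x\<in>verts G. SUP y\<in>verts G. graph_dist G x y)"

definition num_verts :: "('v, 'e, 'x) multigraph_scheme \<Rightarrow> enat" where
  "num_verts G = (if finite (verts G) then enat (card (verts G)) else \<infinity>)"

section \<open>Networks and random walk\<close>

definition incident :: "('v, 'e, 'x) multigraph_scheme \<Rightarrow> 'v \<Rightarrow> 'e set" where
  "incident G v = {e \<in> edges G. v \<in> ends G e}"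

text \<open>Vertices may have infinite degree; a loop at \<open>v\<close> contributes once to \<open>vertex_cond G v\<close>.\<close>

definition vertex_cond :: "('v, 'e) weighted_graph \<Rightarrow> 'v \<Rightarrow> real" where
  "vertex_cond G v = (\<Sum>\<^sub>\<infinity>e\<in>incident G v. cond G e)"

definition network :: "('v, 'e) weighted_graph \<Rightarrow> bool" where
  "network G \<longleftrightarrow>
     connected_graph G \<and>
     (\<forall>e\<in>edges G. ends G e \<subseteq> verts G \<and> card (ends G e) \<in> {1, 2}) \<and>
     (\<forall>e\<in>edges G. 0 < cond G e) \<and>
     (\<forall>v\<in>verts G. cond G summable_on incident G v)"

definition network_automorphism ::
    "('v, 'e) weighted_graph \<Rightarrow> ('v \<Rightarrow> 'v) \<Rightarrow> ('e \<Rightarrow> 'e) \<Rightarrow> bool" where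
  "network_automorphism G \<phi> \<psi> \<longleftrightarrow>
     bij_betw \<phi> (verts G) (verts G) \<and> bij_betw \<psi> (edges G) (edges G) \<and>
     (\<forall>e\<in>edges G. ends G (\<psi> e) = \<phi> ` ends G e \<and> cond G (\<psi> e) = cond G e)"

definition transitive_network :: "('v, 'e) weighted_graph \<Rightarrow> bool" where
  "transitive_network G \<longleftrightarrow>
     (\<forall>u\<in>verts G. \<forall>v\<in>verts G. \<exists>\<phi> \<psi>. network_automorphism G \<phi> \<psi> \<and> \<phi> u = v)"

text \<open>For a loop at \<open>v\<close> this is \<open>v\<close> itself.\<close>

definition other_end :: "('v, 'e, 'x) multigraph_scheme \<Rightarrow> 'v \<Rightarrow> 'e \<Rightarrow> 'v" where
  "other_end G v e = (THE w. ends G e = {v, w})"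

text \<open>
  The case of no incident edge only arises for the network with one vertex and no edges; there
  the walk stays put, so that the bubble norm is infinite, as on every finite network.
\<close>

definition walk_step :: "('v, 'e) weighted_graph \<Rightarrow> 'v \<Rightarrow> 'v pmf" where
  "walk_step G v =
     (if incident G v = {} then return_pmf v
      else map_pmf (other_end G v)
        (embed_pmf (\<lambda>e. if e \<in> incident G v then cond G e / vertex_cond G v else 0)))"

primrec walk_at :: "('v, 'e) weighted_graph \<Rightarrow> nat \<Rightarrow> 'v \<Rightarrow> 'v pmf" where
  "walk_at G 0 u = return_pmf u"
| "walk_at G (Suc n) u = bind_pmf (walk_at G n u) (walk_step G)"

definition norm_1_inf :: "('v, 'e) weighted_graph \<Rightarrow> nat \<Rightarrow> ennreal" where
  "norm_1_inf G n = (SUP u\<in>verts G. SUP v\<in>verts G. ennreal (pmf (walk_at G n u) v))"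

definition bubble_norm :: "('v, 'e) weighted_graph \<Rightarrow> ennreal" where
  "bubble_norm G = (\<Sum>n. of_nat (n + 1) * norm_1_inf G n)"

section \<open>Uniform spanning trees\<close>

definition spanning_trees :: "('v, 'e, 'x) multigraph_scheme \<Rightarrow> 'e set set" where
  "spanning_trees G = {T. T \<subseteq> edges G \<and> tree_graph (G\<lparr>edges := T\<rparr>)}"

definition tree_weight :: "('v, 'e) weighted_graph \<Rightarrow> 'e set \<Rightarrow> real" where
  "tree_weight G T = (\<Prod>e\<in>T. cond G e)"

text \<open>
  For connected networks with finitely many vertices. There may be infinitely many parallel
  edges and hence infinitely many spanning trees, but each of them is finite and their total
  weight is finite.
\<close>

definition ust :: "('v, 'e) weighted_graph \<Rightarrow> 'e set pmf" where
  "ust G = embed_pmf (\<lambda>T. if T \<in> spanning_trees G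
     then tree_weight G T / (\<Sum>\<^sub>\<infinity>T'\<in>spanning_trees G. tree_weight G T') else 0)"

text \<open>
  An oriented edge is a pair \<open>(u, e)\<close> of an edge \<open>e\<close> and its tail \<open>u\<close>. (Loops, for which this
  gives a single orientation, are never part of a tree.) In a tree oriented towards \<open>r\<close>, the edge
  leading out of \<open>u\<close> is the first one on the path from \<open>u\<close> to \<open>r\<close>.
\<close>

definition oriented_edges :: "('v, 'e, 'x) multigraph_scheme \<Rightarrow> ('v \<times> 'e) set" where
  "oriented_edges G = {(u, e). e \<in> edges G \<and> u \<in> ends G e}"

definition orient_towards ::
    "('v, 'e, 'x) multigraph_scheme \<Rightarrow> 'e set \<Rightarrow> 'v \<Rightarrow> ('v \<times> 'e) set" where
  "orient_towards G T r = {(u, e). \<exists>w p. path (G\<lparr>edges := T\<rparr>) u ((e, w) # p) r}"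

section \<open>The oriented wired uniform spanning forest\<close>

text \<open>
  The network obtained by contracting the complement of \<open>W\<close> to the single vertex \<open>None\<close> and
  deleting the loops this creates there. Its edges are edges of \<open>G\<close>.
\<close>

definition contract_compl :: "('v, 'e) weighted_graph \<Rightarrow> 'v set \<Rightarrow> ('v option, 'e) weighted_graph" where
  "contract_compl G W =
     \<lparr>verts = insert None (Some ` W),
      edges = {e \<in> edges G. ends G e \<inter> W \<noteq> {}},
      ends = (\<lambda>e. (\<lambda>v. if v \<in> W then Some v else None) ` ends G e),
      cond = cond G\<rparr>"

text \<open>
  Random sets of oriented edges are represented by their indicator functions in
  \<open>{False, True}\<^sup>D\<close>, with \<open>D\<close> the (countable) set of oriented edges of \<open>G\<close>, under the product
  topology and the product sigma-algebra.
\<close>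

definition config_space :: "('v, 'e, 'x) multigraph_scheme \<Rightarrow> ('v \<times> 'e \<Rightarrow> bool) measure" where
  "config_space G = PiM (oriented_edges G) (\<lambda>_. count_space UNIV)"

definition config_topology :: "('v, 'e, 'x) multigraph_scheme \<Rightarrow> ('v \<times> 'e \<Rightarrow> bool) topology" where
  "config_topology G = product_topology (\<lambda>_. discrete_topology UNIV) (oriented_edges G)"

definition weak_conv_in :: "'a topology \<Rightarrow> (nat \<Rightarrow> 'a measure) \<Rightarrow> 'a measure \<Rightarrow> bool" where
  "weak_conv_in X M N \<longleftrightarrow>
     (\<forall>f. continuous_map X euclideanreal f \<and> bounded (f ` topspace X) \<longrightarrow>
        (\<lambda>n. \<integral>x. f x \<partial>M n) \<longlonglongrightarrow> (\<integral>x. f x \<partial>N))"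

text \<open>
  The tail of an oriented tree edge is never the root \<open>None\<close>, so that the oriented trees of the
  contracted network are sets of oriented edges of \<open>G\<close>.
\<close>

definition wired_tree_law ::
    "('v, 'e) weighted_graph \<Rightarrow> 'v set \<Rightarrow> ('v \<times> 'e \<Rightarrow> bool) measure" where
  "wired_tree_law G W =
     distr (measure_pmf (ust (contract_compl G W))) (config_space G)
       (\<lambda>T. \<lambda>(u, e)\<in>oriented_edges G. (Some u, e) \<in> orient_towards (contract_compl G W) T None)"

definition exhaustion :: "('v, 'e, 'x) multigraph_scheme \<Rightarrow> (nat \<Rightarrow> 'v set) \<Rightarrow> bool" where
  "exhaustion G W \<longleftrightarrow> incseq W \<and> (\<forall>n. finite (W n)) \<and> (\<Union>n. W n) = verts G"

text \<open>
  \<open>\<mu>\<close> is the law of the oriented wired uniform spanning forest of the transient network \<open>G\<close>.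
  The limit exists and is the same for all exhaustions, so asking for some exhaustion or
  for all of them amounts to the same.
\<close>

definition oriented_wusf :: "('v, 'e) weighted_graph \<Rightarrow> ('v \<times> 'e \<Rightarrow> bool) measure \<Rightarrow> bool" where
  "oriented_wusf G \<mu> \<longleftrightarrow>
     prob_space \<mu> \<and> sets \<mu> = sets (config_space G) \<and>
     (\<exists>W. exhaustion G W \<and> weak_conv_in (config_topology G) (\<lambda>n. wired_tree_law G (W n)) \<mu>)"

definition config_edges :: "('v, 'e, 'x) multigraph_scheme \<Rightarrow> ('v \<times> 'e \<Rightarrow> bool) \<Rightarrow> ('v \<times> 'e) set" where
  "config_edges G \<omega> = {d \<in> oriented_edges G. \<omega> d}"

section \<open>The past\<close>

text \<open>Whether there is a path from \<open>u\<close> to \<open>v\<close> all of whose edges are in \<open>F\<close>, oriented towards \<open>v\<close>.\<close>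

definition flows_to ::
    "('v, 'e, 'x) multigraph_scheme \<Rightarrow> ('v \<times> 'e) set \<Rightarrow> 'v \<Rightarrow> 'v \<Rightarrow> bool" where
  "flows_to G F u v \<longleftrightarrow> (\<lambda>x y. \<exists>e. (x, e) \<in> F \<and> ends G e = {x, y})\<^sup>*\<^sup>* u v"

definition past :: "('v, 'e, 'x) multigraph_scheme \<Rightarrow> ('v \<times> 'e) set \<Rightarrow> 'v \<Rightarrow> ('v, 'e) multigraph" where
  "past G F v =
     (let A = {u. flows_to G F u v}
      in \<lparr>verts = A, edges = {e \<in> snd ` F. ends G e \<subseteq> A}, ends = ends G\<rparr>)"

end

theory Submission
  imports Defs
begin

text \<open>
  The steps of the walk from the vertices of a finite set \<open>S\<close>, drawn independently and conditioned
  to form no cycle, are the oriented spanning tree of the network wired outside of \<open>S\<close>. Under this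
  law the probability that a given path is directed towards its first vertex is the product of its
  transition probabilities and a ratio of acyclicity probabilities. The walk from \<open>x\<close> to \<open>y\<close>
  decomposes into its loop erasure and loops, so these probabilities sum to Green functions, and
  together with symmetry and transitivity the bubble norm bounds the expected number of vertices of
  the past at each height.

  The conditioned law is stationary for the excursions of the walk that redirect the arrow of each
  visited vertex along the last exit from it. A path of length \<open>n\<close> typically has bounded potential
  at most of its vertices, again by the bubble norm, so it is likely to be hit, and its long
  continuations to be destroyed, by an excursion from a suitably distributed starting point. This
  yields a recursion for the probability that the height is at least \<open>2 n\<close> in terms of the one for
  \<open>n\<close>, whose solution is of order \<open>1 / n\<close>. The upper bound for the volume follows by Markov's inequality for the part of the past below height \<open>sqrt R\<close>.

  For the lower bounds, first moments are submultiplicative and their sum over the height diverges;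
  hence the expected number \<open>N\<close> of vertices of the past at heights between \<open>n\<close> and \<open>M n\<close> is at least
  \<open>n\<close>. Its second moment is of order \<open>n ^ 3\<close>, and \<open>N > 0\<close> has probability of order \<open>1 / n\<close> by the upper
  bound, so that the Paley--Zygmund argument makes \<open>N\<close> of order \<open>n\<^sup>2\<close> with probability of order \<open>1 / n\<close>.

  The events used pass to the limit because they are increasing unions of events that depend on
  finitely many edges. Almost surely every finite part of the forest occurs in the tree of some
  finite network, where heights differ by one along each edge; directed paths are therefore geodesics
  of the past.
\<close>

section \<open>Killed random walk and Green function\<close>

text \<open>Conditioning independent arrows makes every path probability a ratio of acyclicity
  probabilities, hence a product of diagonal Green functions. Transitivity makes the kernel
  symmetric, and this is decisive twice: reversing a path turns a piece of a past into a piece of a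
  future, and pieces of futures of equal length are disjoint events; and the exit probability
  \<open>kill\<close> becomes a starting measure from which every vertex is visited once on average
  while the root is hit with mass at most one. Excursions from small multiples of this measure play
  the role of the trajectories of random interlacements. The bubble norm bounds sums over lengths at
  one vertex; moving near-optimal configurations to a common vertex allows the supremum over
  vertices inside the sum. For a root with its own arrow the path weight grows with the finite
  network while the escape factor shrinks, so lower bounds go through infinite-volume limits of the
  two factors. Since infinitely many parallel edges are allowed, a step between two given vertices
  is not a local event; lower bounds are therefore proved inside finite windows of edges.\<close>

primrec kpow :: "('v \<Rightarrow> 'v pmf) \<Rightarrow> 'v set \<Rightarrow> nat \<Rightarrow> 'v \<Rightarrow> 'v \<Rightarrow> real" where
  "kpow P S 0 x y = (if x = y then 1 else 0)"
| "kpow P S (Suc n) x y = (\<Sum>w\<in>S. kpow P S n x w * pmf (P w) y)"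

lemma kpow_nonneg: "0 \<le> kpow P S n x y"
  by (induction n arbitrary: y) (auto intro!: sum_nonneg)

lemma sum_pmf_le_1: "finite S \<Longrightarrow> (\<Sum>y\<in>S. pmf M y) \<le> 1"
  by (metis measure_measure_pmf_finite measure_pmf.prob_le_1)

lemma kpow_Suc_front:
  assumes "finite S" "x \<in> S" "y \<in> S"
  shows "kpow P S (Suc n) x y = (\<Sum>w\<in>S. pmf (P x) w * kpow P S n w y)"
  using assms(3)
proof (induction n arbitrary: y)
  case 0
  have "(\<Sum>w\<in>S. kpow P S 0 x w * pmf (P w) y) = (\<Sum>w\<in>S. if w = x then pmf (P x) y else 0)"
    by (rule sum.cong) auto
  moreover have "(\<Sum>w\<in>S. pmf (P x) w * kpow P S 0 w y) = (\<Sum>w\<in>S. if w = y then pmf (P x) y else 0)"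
    by (rule sum.cong) auto
  ultimately show ?case using assms 0 by (simp del: kpow.simps(1) add: sum.delta)
next
  case (Suc n)
  have "kpow P S (Suc (Suc n)) x y = (\<Sum>w\<in>S. (\<Sum>u\<in>S. pmf (P x) u * kpow P S n u w) * pmf (P w) y)"
    unfolding kpow.simps(2)[of P S "Suc n"] by (rule sum.cong) (simp_all only: Suc.IH)
  also have "\<dots> = (\<Sum>u\<in>S. \<Sum>w\<in>S. pmf (P x) u * (kpow P S n u w * pmf (P w) y))"
    by (subst sum.swap) (simp add: sum_distrib_right mult.assoc)
  also have "\<dots> = (\<Sum>u\<in>S. pmf (P x) u * kpow P S (Suc n) u y)"
    by (simp add: sum_distrib_left)
  finally show ?case .
qed

lemma kpow_mono:
  assumes "finite S'" "S \<subseteq> S'"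
  shows "kpow P S n x y \<le> kpow P S' n x y"
proof (induction n arbitrary: y)
  case (Suc n)
  have "kpow P S (Suc n) x y \<le> (\<Sum>w\<in>S. kpow P S' n x w * pmf (P w) y)"
    by (auto intro!: sum_mono mult_right_mono Suc)
  also have "\<dots> \<le> kpow P S' (Suc n) x y"
    using assms by (auto intro!: sum_mono2 mult_nonneg_nonneg kpow_nonneg)
  finally show ?case .
qed simp

lemma kpow_add:
  assumes "finite S" "x \<in> S" "y \<in> S"
  shows "kpow P S (n + m) x y = (\<Sum>w\<in>S. kpow P S n x w * kpow P S m w y)"
  using assms(3)
proof (induction m arbitrary: y)
  case 0
  have "(\<Sum>w\<in>S. kpow P S n x w * kpow P S 0 w y) = (\<Sum>w\<in>S. if w = y then kpow P S n x y else 0)"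
    by (rule sum.cong) auto
  then show ?case using assms 0 by (simp del: kpow.simps(1))
next
  case (Suc m)
  have "kpow P S (n + Suc m) x y = (\<Sum>u\<in>S. (\<Sum>w\<in>S. kpow P S n x w * kpow P S m w u) * pmf (P u) y)"
    by (simp add: Suc.IH)
  also have "\<dots> = (\<Sum>w\<in>S. \<Sum>u\<in>S. kpow P S n x w * (kpow P S m w u * pmf (P u) y))"
    by (subst sum.swap) (simp add: sum_distrib_right mult.assoc)
  also have "\<dots> = (\<Sum>w\<in>S. kpow P S n x w * kpow P S (Suc m) w y)"
    by (simp add: sum_distrib_left)
  finally show ?case .
qed

lemma kpow_bij:
  assumes "finite S" "inj_on \<phi> S" "x \<in> S" "y \<in> S"
    and "\<And>u w. u \<in> S \<Longrightarrow> w \<in> S \<Longrightarrow> pmf (P (\<phi> u)) (\<phi> w) = pmf (P u) w"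
  shows "kpow P (\<phi> ` S) n (\<phi> x) (\<phi> y) = kpow P S n x y"
  using assms(4)
proof (induction n arbitrary: y)
  case 0
  then show ?case using assms by (auto dest: inj_onD)
next
  case (Suc n)
  then show ?case using assms by (simp add: sum.reindex)
qed

definition green :: "('v \<Rightarrow> 'v pmf) \<Rightarrow> 'v set \<Rightarrow> 'v \<Rightarrow> 'v \<Rightarrow> real" where
  "green P S x y = (\<Sum>n. kpow P S n x y)"

text \<open>The probability that the walk from \<open>x\<close> leaves \<open>S\<close> at \<open>z \<notin> S\<close>.\<close>

definition hit :: "('v \<Rightarrow> 'v pmf) \<Rightarrow> 'v set \<Rightarrow> 'v \<Rightarrow> 'v \<Rightarrow> real" where
  "hit P S x z = (if x \<in> S then \<Sum>u\<in>S. green P S x u * pmf (P u) z else if x = z then 1 else 0)"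

section \<open>Potential theory of a symmetric chain with a summable bound on its transition
  probabilities\<close>

locale symmetric_chain =
  fixes V :: "'v set" and P :: "'v \<Rightarrow> 'v pmf" and b :: "nat \<Rightarrow> real"
  assumes closed: "x \<in> V \<Longrightarrow> set_pmf (P x) \<subseteq> V"
    and sym: "x \<in> V \<Longrightarrow> y \<in> V \<Longrightarrow> pmf (P x) y = pmf (P y) x"
    and kpow_bound: "finite S \<Longrightarrow> S \<subseteq> V \<Longrightarrow> x \<in> S \<Longrightarrow> y \<in> S \<Longrightarrow> kpow P S n x y \<le> b n"
    and summable_b: "summable (\<lambda>n. real (n + 1) * b n)"
    and V_nonempty: "V \<noteq> {}"
begin

text \<open>For a network \<open>b n\<close> will be the supremum of the n-step transition
  probabilities, so this is its bubble norm.\<close>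

definition bubble :: real where "bubble = (\<Sum>n. real (n + 1) * b n)"

definition dom :: "'v set \<Rightarrow> bool" where "dom S \<longleftrightarrow> finite S \<and> S \<subseteq> V"

lemma domD: "dom S \<Longrightarrow> finite S" "dom S \<Longrightarrow> S \<subseteq> V" "dom S \<Longrightarrow> x \<in> S \<Longrightarrow> x \<in> V"
  by (auto simp: dom_def)

lemma dom_mono: "dom S \<Longrightarrow> A \<subseteq> S \<Longrightarrow> dom A"
  by (auto simp: dom_def intro: finite_subset)

lemma dom_diff [intro]: "dom S \<Longrightarrow> dom (S - A)"
  by (auto simp: dom_def)

lemma dom_insert: "dom (insert x S) \<longleftrightarrow> x \<in> V \<and> dom S"
  by (auto simp: dom_def)

abbreviation p :: "'v \<Rightarrow> 'v \<Rightarrow> real" where "p x y \<equiv> pmf (P x) y"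
abbreviation pk where "pk \<equiv> kpow P"
abbreviation gr where "gr \<equiv> green P"

lemma b_nonneg: "0 \<le> b n"
proof -
  obtain x where "x \<in> V" using V_nonempty by blast
  then show ?thesis using kpow_bound[of "{x}" x x n] kpow_nonneg[of P "{x}" n x x] by auto
qed

lemma summable_b': "summable b"
  by (rule summable_comparison_test'[OF summable_b, of 0])
     (use mult_right_mono[of 1 "real (_+1)" "b _"] in \<open>auto simp: b_nonneg\<close>)

lemma b_le_bubble_terms: "b n \<le> real (n + 1) * b n"
  using mult_right_mono[of 1 "real (n+1)" "b n"] b_nonneg by auto

lemma suminf_b_le_bubble: "suminf b \<le> bubble"
  unfolding bubble_def by (intro suminf_le summable_b summable_b' b_le_bubble_terms)

lemma bubble_ge_1: "1 \<le> bubble"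
proof -
  obtain x where "x \<in> V" using V_nonempty by blast
  then have "1 \<le> b 0" using kpow_bound[of "{x}" x x 0] by auto
  also have "\<dots> \<le> suminf b"
    using sum_le_suminf[OF summable_b', of "{0}"] b_nonneg by auto
  finally show ?thesis using suminf_b_le_bubble by linarith
qed

lemma pk_sym:
  assumes "dom S" "x \<in> S" "y \<in> S"
  shows "pk S n x y = pk S n y x"
  using assms(2,3)
proof (induction n arbitrary: x y)
  case (Suc n)
  have "pk S (Suc n) x y = (\<Sum>w\<in>S. pk S n x w * p w y)" by simp
  also have "\<dots> = (\<Sum>w\<in>S. p y w * pk S n w x)"
    using Suc assms(1) by (intro sum.cong) (auto simp: domD sym mult.commute)
  also have "\<dots> = pk S (Suc n) y x"
    using kpow_Suc_front[of S y x P n] Suc assms(1) by (simp add: domD)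
  finally show ?case .
qed auto

lemma summable_pk:
  assumes "dom S" "x \<in> S" "y \<in> S"
  shows "summable (\<lambda>n. pk S n x y)"
  by (rule summable_comparison_test'[OF summable_b', of 0])
     (use assms kpow_bound[of S x y] in \<open>auto simp: kpow_nonneg dom_def\<close>)

lemma gr_nonneg: "dom S \<Longrightarrow> x \<in> S \<Longrightarrow> y \<in> S \<Longrightarrow> 0 \<le> gr S x y"
  unfolding green_def by (intro suminf_nonneg summable_pk) (auto simp: kpow_nonneg)

lemma gr_sym: "dom S \<Longrightarrow> x \<in> S \<Longrightarrow> y \<in> S \<Longrightarrow> gr S x y = gr S y x"
  unfolding green_def by (simp cong: suminf_cong add: pk_sym)

lemma gr_mono:
  assumes "dom S'" "S \<subseteq> S'" "x \<in> S" "y \<in> S"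
  shows "gr S x y \<le> gr S' x y"
  unfolding green_def
  by (intro suminf_le summable_pk) (use assms in \<open>auto intro: kpow_mono domD dom_mono\<close>)

lemma gr_le_bubble:
  assumes "dom S" "x \<in> S" "y \<in> S"
  shows "gr S x y \<le> bubble"
proof -
  have "gr S x y \<le> suminf b"
    unfolding green_def using assms
    by (intro suminf_le summable_pk summable_b') (auto intro: kpow_bound domD)
  then show ?thesis using suminf_b_le_bubble by linarith
qed

lemma gr_diag_ge_1:
  assumes "dom S" "x \<in> S"
  shows "1 \<le> gr S x x"
  using sum_le_suminf[OF summable_pk[OF assms(1,2,2)], of "{0}"]
  by (auto simp: green_def kpow_nonneg)

lemma gr_front:
  assumes "dom S" "x \<in> S" "y \<in> S"
  shows "gr S x y = (if x = y then 1 else 0) + (\<Sum>w\<in>S. p x w * gr S w y)"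
proof -
  have "gr S x y = pk S 0 x y + (\<Sum>n. pk S (Suc n) x y)"
    unfolding green_def using suminf_split_head[OF summable_pk[OF assms]] by simp
  also have "(\<Sum>n. pk S (Suc n) x y) = (\<Sum>n. \<Sum>w\<in>S. p x w * pk S n w y)"
    using kpow_Suc_front[of S x y P] assms by (simp add: domD del: kpow.simps)
  also have "\<dots> = (\<Sum>w\<in>S. \<Sum>n. p x w * pk S n w y)"
    by (rule suminf_sum) (auto intro!: summable_mult summable_pk assms)
  also have "\<dots> = (\<Sum>w\<in>S. p x w * gr S w y)"
    unfolding green_def by (intro sum.cong refl suminf_mult summable_pk assms)
  finally show ?thesis by simp
qed

lemma gr_back:
  assumes "dom S" "x \<in> S" "y \<in> S"
  shows "gr S x y = (if x = y then 1 else 0) + (\<Sum>w\<in>S. gr S x w * p w y)"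
proof -
  have "(\<Sum>w\<in>S. p y w * gr S w x) = (\<Sum>w\<in>S. gr S x w * p w y)"
    by (intro sum.cong refl) (metis assms(1) assms(2) assms(3) domD(3) gr_sym mult.commute sym)
  then show ?thesis
    using gr_front[of S y x] gr_sym[OF assms] assms by auto
qed

text \<open>The Green function inverts the identity minus the killed kernel. Applied to particular
  functions h, this yields the formulas for \<open>kill\<close> and \<open>meet\<close>
  below.\<close>

lemma gr_inverse:
  assumes "dom S" "x \<in> S"
  shows "h x = (\<Sum>y\<in>S. gr S x y * (h y - (\<Sum>w\<in>S. p y w * h w)))"
proof -
  have "(\<Sum>y\<in>S. gr S x y * (\<Sum>w\<in>S. p y w * h w)) = (\<Sum>w\<in>S. (\<Sum>y\<in>S. gr S x y * p y w) * h w)"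
    by (simp add: sum_distrib_left sum_distrib_right mult.assoc) (rule sum.swap)
  also have "\<dots> = (\<Sum>w\<in>S. (gr S x w - (if x = w then 1 else 0)) * h w)"
    by (intro sum.cong refl) (simp add: gr_back[OF assms])
  also have "\<dots> = (\<Sum>w\<in>S. gr S x w * h w) - (\<Sum>w\<in>S. (if x = w then h w else 0))"
    by (subst sum_subtractf[symmetric], intro sum.cong) (auto simp: algebra_simps)
  also have "(\<Sum>w\<in>S. (if x = w then h w else 0)) = h x"
    using assms by (simp add: domD)
  finally show ?thesis by (simp add: right_diff_distrib sum_subtractf)
qed

text \<open>Minimum principle. Off A the function is the potential, for the walk killed on A as
  well, of its defect from harmonicity, and this defect is nonnegative because the values on A
  are.\<close>

lemma superharmonic_nonneg:
  assumes "dom S" "\<And>y. y \<in> S - A \<Longrightarrow> (\<Sum>w\<in>S. p y w * h w) \<le> h y"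
    and "\<And>y. y \<in> S \<inter> A \<Longrightarrow> 0 \<le> h y" and "x \<in> S"
  shows "0 \<le> h x"
proof (cases "x \<in> A")
  case False
  have "0 \<le> (\<Sum>y\<in>S - A. gr (S - A) x y * (h y - (\<Sum>w\<in>S - A. p y w * h w)))"
  proof (intro sum_nonneg mult_nonneg_nonneg gr_nonneg)
    fix y assume y: "y \<in> S - A"
    have "(\<Sum>w\<in>S - A. p y w * h w) \<le> (\<Sum>w\<in>S. p y w * h w)"
      using assms by (intro sum_mono2) (auto simp: domD)
    then show "0 \<le> h y - (\<Sum>w\<in>S - A. p y w * h w)" using assms(2)[OF y] by simp
  qed (use assms False in auto)
  then show ?thesis using gr_inverse[OF dom_diff[OF assms(1)], of x A h] assms(4) False by simp
qed (use assms in auto)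

text \<open>The weight k + 1 of the bubble norm comes from here: a return of length k can be cut at
  any of its k + 1 times, so the Cauchy product of the two Green series collects k + 1 copies of
  each return probability.\<close>

lemma green_square_le_bubble:
  assumes "dom S" "x \<in> S"
  shows "(\<Sum>y\<in>S. gr S x y * gr S y x) \<le> bubble"
proof -
  have prod: "(\<lambda>k. \<Sum>i\<le>k. pk S i x y * pk S (k - i) y x) sums (gr S x y * gr S y x)" if "y \<in> S" for y
    unfolding green_def using assms that
    by (intro Cauchy_product_sums) (auto simp: kpow_nonneg summable_pk)
  have "(\<lambda>k. \<Sum>y\<in>S. \<Sum>i\<le>k. pk S i x y * pk S (k - i) y x) sums (\<Sum>y\<in>S. gr S x y * gr S y x)"
    by (intro sums_sum prod)
  moreover have "(\<Sum>y\<in>S. \<Sum>i\<le>k. pk S i x y * pk S (k - i) y x) = real (k + 1) * pk S k x x" for k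
  proof -
    have "(\<Sum>y\<in>S. \<Sum>i\<le>k. pk S i x y * pk S (k - i) y x) = (\<Sum>i\<le>k. \<Sum>y\<in>S. pk S i x y * pk S (k - i) y x)"
      by (rule sum.swap)
    also have "\<dots> = (\<Sum>i\<le>k. pk S k x x)"
      by (rule sum.cong) (use assms kpow_add[of S x x P, symmetric] in \<open>auto simp: domD\<close>)
    finally show ?thesis by simp
  qed
  ultimately have s: "(\<lambda>k. real (k + 1) * pk S k x x) sums (\<Sum>y\<in>S. gr S x y * gr S y x)" by simp
  show ?thesis
    unfolding bubble_def sums_unique[OF s]
    by (intro suminf_le summable_b sums_summable[OF s] mult_left_mono kpow_bound)
       (use assms in \<open>auto simp: dom_def\<close>)
qed

abbreviation ht where "ht \<equiv> hit P"

lemma hit_nonneg: "dom S \<Longrightarrow> 0 \<le> ht S x z"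
  by (auto simp: hit_def intro!: sum_nonneg mult_nonneg_nonneg gr_nonneg)

lemma hit_mono:
  assumes "dom S'" "S \<subseteq> S'" "z \<notin> S'"
  shows "ht S x z \<le> ht S' x z"
proof (cases "x \<in> S")
  case True
  have "(\<Sum>u\<in>S. gr S x u * p u z) \<le> (\<Sum>u\<in>S. gr S' x u * p u z)"
    using assms True by (intro sum_mono mult_right_mono gr_mono) auto
  also have "\<dots> \<le> (\<Sum>u\<in>S'. gr S' x u * p u z)"
    using assms True by (intro sum_mono2 mult_nonneg_nonneg gr_nonneg) (auto simp: domD)
  finally show ?thesis using True assms by (auto simp: hit_def)
next
  case False
  then show ?thesis using assms hit_nonneg[of S' x z] by (auto simp: hit_def)
qed

lemma hit_step:
  assumes "dom S" "x \<in> S" "z \<notin> S"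
  shows "ht S x z = (\<Sum>w\<in>S. p x w * ht S w z) + p x z"
proof -
  have "ht S x z = (\<Sum>u\<in>S. ((if x = u then 1 else 0) + (\<Sum>w\<in>S. p x w * gr S w u)) * p u z)"
    using assms by (simp add: hit_def gr_front)
  also have "\<dots> = (\<Sum>u\<in>S. (if x = u then p u z else 0)) + (\<Sum>u\<in>S. (\<Sum>w\<in>S. p x w * gr S w u) * p u z)"
    by (subst sum.distrib[symmetric], intro sum.cong) (auto simp: algebra_simps)
  also have "(\<Sum>u\<in>S. (if x = u then p u z else 0)) = p x z"
    using assms by (simp add: domD)
  also have "(\<Sum>u\<in>S. (\<Sum>w\<in>S. p x w * gr S w u) * p u z) = (\<Sum>w\<in>S. p x w * (\<Sum>u\<in>S. gr S w u * p u z))"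
    by (simp add: sum_distrib_left sum_distrib_right mult.assoc) (rule sum.swap)
  finally show ?thesis by (simp add: hit_def)
qed

section \<open>The exit measure as a starting distribution\<close>

definition kill :: "'v set \<Rightarrow> 'v \<Rightarrow> real" where
  "kill S x = 1 - (\<Sum>w\<in>S. p x w)"

lemma kill_nonneg: "dom S \<Longrightarrow> 0 \<le> kill S x"
  by (simp add: kill_def sum_pmf_le_1 domD)

text \<open>The walk from x leaves S once, which is \<open>gr_inverse\<close> for the constant 1.
  Read backwards by symmetry, this says that the walk started from the measure \<open>kill\<close>
  visits each vertex of S once on average.\<close>

lemma kill_green:
  assumes "dom S" "x \<in> S"
  shows "(\<Sum>y\<in>S. kill S y * gr S y x) = 1"
proof -
  have "1 = (\<Sum>y\<in>S. gr S x y * (1 - (\<Sum>w\<in>S. p y w * 1)))"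
    by (rule gr_inverse[OF assms])
  also have "\<dots> = (\<Sum>y\<in>S. kill S y * gr S y x)"
    using assms by (intro sum.cong) (auto simp: kill_def gr_sym)
  finally show ?thesis by simp
qed

text \<open>Summing over the last vertex y before v, the expected number of visits to y is one, so
  only the sum of p(v, y) over S is left.\<close>

lemma kill_hit_le_1:
  assumes "dom S" "v \<in> V" "v \<notin> S"
  shows "(\<Sum>x\<in>S. kill S x * ht S x v) \<le> 1"
proof -
  have "(\<Sum>x\<in>S. kill S x * ht S x v) = (\<Sum>y\<in>S. (\<Sum>x\<in>S. kill S x * gr S x y) * p y v)"
    by (simp add: hit_def sum_distrib_left sum_distrib_right mult.assoc) (rule sum.swap)
  also have "\<dots> = (\<Sum>y\<in>S. p v y)"
    using assms by (intro sum.cong) (auto simp: kill_green sym domD)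
  also have "\<dots> \<le> 1" using assms by (simp add: sum_pmf_le_1 domD)
  finally show ?thesis .
qed

text \<open>The walk from \<open>w\<close> meets \<open>A\<close> before leaving \<open>S\<close>; the walk from \<open>y \<in> A\<close> leaves \<open>S\<close>
  without returning to \<open>A\<close>.\<close>

definition meet :: "'v set \<Rightarrow> 'v set \<Rightarrow> 'v \<Rightarrow> real" where
  "meet S A w = (\<Sum>a\<in>A. ht (S - A) w a)"

definition esc :: "'v set \<Rightarrow> 'v set \<Rightarrow> 'v \<Rightarrow> real" where
  "esc S A y = 1 - (\<Sum>w\<in>S. p y w * meet S A w)"

lemma meet_in: "dom S \<Longrightarrow> A \<subseteq> S \<Longrightarrow> w \<in> A \<Longrightarrow> meet S A w = 1"
  using finite_subset[OF _ domD(1)] by (fastforce simp: meet_def hit_def domD)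

lemma meet_out: "dom S \<Longrightarrow> A \<subseteq> S \<Longrightarrow> w \<notin> S \<Longrightarrow> meet S A w = 0"
  by (auto simp: meet_def hit_def intro!: sum.neutral)

lemma meet_nonneg: "dom S \<Longrightarrow> 0 \<le> meet S A w"
  unfolding meet_def by (intro sum_nonneg hit_nonneg) auto

lemma meet_harmonic:
  assumes "dom S" "A \<subseteq> S" "w \<in> S - A"
  shows "meet S A w = (\<Sum>u\<in>S. p w u * meet S A u)"
proof -
  have fin: "finite A" "finite (S - A)" using assms by (auto intro: finite_subset domD)
  have "meet S A w = (\<Sum>a\<in>A. (\<Sum>u\<in>S-A. p w u * ht (S-A) u a) + p w a)"
    unfolding meet_def using assms by (intro sum.cong refl hit_step) auto
  also have "\<dots> = (\<Sum>u\<in>S-A. p w u * meet S A u) + (\<Sum>a\<in>A. p w a)"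
    by (simp add: sum.distrib meet_def sum_distrib_left) (rule sum.swap)
  also have "(\<Sum>a\<in>A. p w a) = (\<Sum>a\<in>A. p w a * meet S A a)"
    using assms by (intro sum.cong) (auto simp: meet_in)
  also have "(\<Sum>u\<in>S-A. p w u * meet S A u) + (\<Sum>a\<in>A. p w a * meet S A a) = (\<Sum>u\<in>S. p w u * meet S A u)"
    using assms by (intro sum.subset_diff[symmetric]) (auto simp: domD)
  finally show ?thesis .
qed

text \<open>Last exit decomposition: \<open>meet\<close> is harmonic off A, so in
  \<open>gr_inverse\<close> only A contributes, and there the defect from harmonicity is
  \<open>esc\<close>.\<close>

lemma meet_green:
  assumes "dom S" "A \<subseteq> S" "x \<in> S"
  shows "meet S A x = (\<Sum>a\<in>A. gr S x a * esc S A a)"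
proof -
  have "meet S A x = (\<Sum>y\<in>S. gr S x y * (meet S A y - (\<Sum>w\<in>S. p y w * meet S A w)))"
    by (rule gr_inverse) (use assms in auto)
  also have "\<dots> = (\<Sum>y\<in>A. gr S x y * (meet S A y - (\<Sum>w\<in>S. p y w * meet S A w)))"
    using assms meet_harmonic[of S A] by (intro sum.mono_neutral_right) (auto simp: domD)
  also have "\<dots> = (\<Sum>a\<in>A. gr S x a * esc S A a)"
    using assms by (intro sum.cong) (auto simp: esc_def meet_in)
  finally show ?thesis .
qed

lemma last_visit:
  assumes "dom S" "A \<subseteq> S" "x \<in> A"
  shows "(\<Sum>a\<in>A. gr S x a * esc S A a) = 1"
  using meet_green[of S A x] meet_in[of S A x] assms by auto

lemma meet_le_1:
  assumes "dom S" "A \<subseteq> S"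
  shows "meet S A w \<le> 1"
proof (cases "w \<in> S")
  case True
  have "0 \<le> 1 - meet S A w"
  proof (rule superharmonic_nonneg[OF assms(1), where A = A])
    fix y assume "y \<in> S - A"
    then have "(\<Sum>w\<in>S. p y w * (1 - meet S A w)) = (\<Sum>w\<in>S. p y w) - meet S A y"
      using meet_harmonic[OF assms] by (simp add: right_diff_distrib sum_subtractf)
    then show "(\<Sum>w\<in>S. p y w * (1 - meet S A w)) \<le> 1 - meet S A y"
      using sum_pmf_le_1[of S "P y"] assms by (simp add: domD)
  qed (use assms True in \<open>auto simp: meet_in\<close>)
  then show ?thesis by simp
qed (use assms in \<open>simp add: meet_out\<close>)

lemma meet_mono_set:
  assumes "dom S" "A \<subseteq> A'" "A' \<subseteq> S"
  shows "meet S A w \<le> meet S A' w"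
proof (cases "w \<in> S")
  case True
  have "0 \<le> meet S A' w - meet S A w"
  proof (rule superharmonic_nonneg[OF assms(1), where A = A'])
    fix y assume y: "y \<in> S - A'"
    then have y': "y \<in> S - A" using assms(2) by auto
    have "(\<Sum>w\<in>S. p y w * (meet S A' w - meet S A w)) = meet S A' y - meet S A y"
      using meet_harmonic[OF assms(1) order_trans[OF assms(2,3)] y'] meet_harmonic[OF assms(1,3) y]
      by (simp add: right_diff_distrib sum_subtractf)
    then show "(\<Sum>w\<in>S. p y w * (meet S A' w - meet S A w)) \<le> meet S A' y - meet S A y" by simp
  qed (use assms True in \<open>auto simp: meet_in meet_le_1\<close>)
  then show ?thesis by simp
qed (use assms in \<open>simp add: meet_out\<close>)

lemma esc_antimono_set:
  assumes "dom S" "A \<subseteq> A'" "A' \<subseteq> S"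
  shows "esc S A' y \<le> esc S A y"
  unfolding esc_def by (simp add: sum_mono mult_left_mono meet_mono_set[OF assms])

lemma meet_mono:
  assumes "dom S'" "S \<subseteq> S'" "A \<subseteq> S"
  shows "meet S A w \<le> meet S' A w"
  unfolding meet_def using assms by (intro sum_mono hit_mono) auto

text \<open>A larger S postpones the killing, so a return to A becomes more likely. This is opposite
  to the monotonicity of the Green function.\<close>

lemma esc_antimono:
  assumes "dom S'" "S \<subseteq> S'" "A \<subseteq> S"
  shows "esc S' A y \<le> esc S A y"
proof -
  have "(\<Sum>w\<in>S. p y w * meet S A w) \<le> (\<Sum>w\<in>S. p y w * meet S' A w)"
    by (intro sum_mono mult_left_mono meet_mono assms) auto
  also have "\<dots> \<le> (\<Sum>w\<in>S'. p y w * meet S' A w)"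
    using assms by (intro sum_mono2 mult_nonneg_nonneg meet_nonneg) (auto simp: domD)
  finally show ?thesis by (simp add: esc_def)
qed

lemma esc_nonneg:
  assumes "dom S" "A \<subseteq> S"
  shows "0 \<le> esc S A y"
proof -
  have "(\<Sum>w\<in>S. p y w * meet S A w) \<le> (\<Sum>w\<in>S. p y w * 1)"
    by (intro sum_mono mult_left_mono meet_le_1 assms) auto
  also have "\<dots> \<le> 1" using sum_pmf_le_1[of S "P y"] assms by (simp add: domD)
  finally show ?thesis by (simp add: esc_def)
qed

lemma esc_le_1: "dom S \<Longrightarrow> esc S A y \<le> 1"
  by (auto simp: esc_def intro!: sum_nonneg mult_nonneg_nonneg meet_nonneg)

end

section \<open>Orbits of a map and the current position of an excursion\<close>

text \<open>An orbit that stays in S forever leads nowhere. On a finite set \<open>acyc\<close>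
  therefore excludes cycles without having to mention them.\<close>

inductive leads :: "'v set \<Rightarrow> ('v \<Rightarrow> 'v) \<Rightarrow> 'v \<Rightarrow> 'v \<Rightarrow> bool" for S f where
  stop: "y \<notin> S \<Longrightarrow> leads S f y y"
| step: "x \<in> S \<Longrightarrow> leads S f (f x) y \<Longrightarrow> leads S f x y"

definition acyc :: "'v set \<Rightarrow> ('v \<Rightarrow> 'v) \<Rightarrow> bool" where
  "acyc S f \<longleftrightarrow> (\<forall>x\<in>S. \<exists>y. leads S f x y)"

lemma leads_notin: "leads S f x y \<Longrightarrow> y \<notin> S"
  by (induction rule: leads.induct) auto

lemma leads_outside: "leads S f x y \<Longrightarrow> x \<notin> S \<Longrightarrow> y = x"
  by (erule leads.cases) auto

lemma leads_stepD: "leads S f x y \<Longrightarrow> x \<in> S \<Longrightarrow> leads S f (f x) y"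
  by (erule leads.cases) auto

lemma leads_det: "leads S f x y \<Longrightarrow> leads S f x z \<Longrightarrow> y = z"
  by (induction rule: leads.induct) (auto dest: leads_outside leads_stepD)

lemma leads_cong: "leads S f x y \<Longrightarrow> (\<And>x. x \<in> S \<Longrightarrow> f x = g x) \<Longrightarrow> leads S g x y"
proof (induction rule: leads.induct)
  case (step x y)
  then have "leads S g (g x) y" by simp
  then show ?case by (rule leads.step[OF step.hyps(1)])
qed (rule leads.stop)

lemma leads_restrict: "leads S f x y \<Longrightarrow> T \<subseteq> S \<Longrightarrow> \<exists>z. leads T f x z \<and> leads S f z y"
proof (induction rule: leads.induct)
  case (stop y)
  then show ?case by (meson leads.stop subsetD)
next
  case (step x y)
  then show ?case by (metis leads.intros)
qed

lemma leads_trans: "leads T f x z \<Longrightarrow> T \<subseteq> S \<Longrightarrow> leads S f z y \<Longrightarrow> leads S f x y"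
  by (induction rule: leads.induct) (auto intro: leads.step)

lemma leads_enlarge: "leads T f x z \<Longrightarrow> T \<subseteq> S \<Longrightarrow> z \<notin> S \<Longrightarrow> leads S f x z"
  by (erule leads_trans) (auto intro: leads.stop)

lemma acyc_leads: "acyc S f \<Longrightarrow> \<exists>y. leads S f x y"
  by (cases "x \<in> S") (auto simp: acyc_def intro: leads.stop)

lemma acyc_cong: "(\<And>x. x \<in> S \<Longrightarrow> f x = g x) \<Longrightarrow> acyc S f \<longleftrightarrow> acyc S g"
  unfolding acyc_def using leads_cong[of S f _ _ g] leads_cong[of S g _ _ f] by metis

lemma leads_cong': "(\<And>x. x \<in> S \<Longrightarrow> f x = g x) \<Longrightarrow> leads S f x y \<longleftrightarrow> leads S g x y"
  using leads_cong[of S f x y g] leads_cong[of S g x y f] by metis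

lemma acyc_mono: "acyc S f \<Longrightarrow> T \<subseteq> S \<Longrightarrow> acyc T f"
  unfolding acyc_def by (meson leads_restrict subsetD)

lemma acyc_empty [simp]: "acyc {} f"
  by (simp add: acyc_def)

lemma leads_cycle:
  assumes "leads (U - {t}) f (f t) t" "t \<in> U"
  shows "\<not> leads U f t r"
proof
  assume l: "leads U f t r"
  have "leads U f w r \<Longrightarrow> leads (U - {t}) f w t \<Longrightarrow> False" for w
  proof (induction rule: leads.induct)
    case (stop y)
    then show ?case using assms leads_outside[of "U - {t}" f y t] by auto
  next
    case (step x y)
    then show ?case using assms(1) by (cases "x = t") (auto dest: leads_stepD)
  qed
  from this[OF l] show False by (simp add: leads.stop)
qed

text \<open>Either the orbit meets f y before y and stops there, or it passes through y and takes
  its arrow.\<close>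

lemma leads_pass:
  assumes "leads (S - {y}) f w y" "y \<in> S"
  shows "leads (S - {f y}) f w (f y)"
proof -
  have "leads (S - {y}) f w u \<Longrightarrow> u = y \<Longrightarrow> leads (S - {f y}) f w (f y)" for u
  proof (induction rule: leads.induct)
    case (stop z)
    then show ?case using assms(2)
      by (cases "z = f y") (auto intro: leads.intros)
  next
    case (step z u)
    then show ?case by (cases "z = f y") (auto intro: leads.intros)
  qed
  then show ?thesis using assms by blast
qed

lemma leads_last:
  assumes "leads S f x r" "x \<in> S"
  shows "\<exists>y\<in>S. f y = r \<and> leads (S - {y}) f x y"
  using assms
proof (induction rule: leads.induct)
  case (step x r)
  show ?case
  proof (cases "f x \<in> S")
    case True
    then obtain y where "y \<in> S" "f y = r" "leads (S - {y}) f (f x) y" using step by blast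
    then show ?thesis using step by (cases "x = y") (auto intro: leads.intros)
  next
    case False
    then have "f x = r" using step leads_outside by metis
    then show ?thesis using step by (auto intro: leads.intros)
  qed
qed auto

text \<open>
  Positions of a walker whose past excursion from \<open>x\<close> has left the last exit arrows \<open>f\<close>.
\<close>

definition walker :: "'v set \<Rightarrow> ('v \<Rightarrow> 'v) \<Rightarrow> 'v \<Rightarrow> 'v \<Rightarrow> bool" where
  "walker S f x y \<longleftrightarrow> y \<in> S \<and> acyc (S - {y}) f \<and> leads (S - {y}) f x y"

lemma walker_upd [simp]: "walker S (f(y := w)) x y \<longleftrightarrow> walker S f x y"
proof -
  have "acyc (S - {y}) (f(y := w)) \<longleftrightarrow> acyc (S - {y}) f" by (rule acyc_cong) auto
  moreover have "leads (S - {y}) (f(y := w)) x y \<longleftrightarrow> leads (S - {y}) f x y"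
    by (rule leads_cong') auto
  ultimately show ?thesis by (simp add: walker_def)
qed

text \<open>After the move the arrow of f y is the free one. Whatever led to y now continues along
  the arrow of y to f y; and if f y were x in an acyclic map, the path from x to y would be closed
  to a cycle.\<close>

lemma walker_step:
  assumes w: "walker S f x y" and z: "f y \<in> S" and x: "x \<in> S"
  shows "walker S f x (f y) \<and> \<not> (acyc S f \<and> f y = x)"
proof -
  from w have y: "y \<in> S" "acyc (S - {y}) f" "leads (S - {y}) f x y" by (auto simp: walker_def)
  have "\<exists>r. leads (S - {f y}) f w r" for w
  proof -
    obtain r where r: "leads (S - {y}) f w r" using y(2) acyc_leads by metis
    show ?thesis
    proof (cases "r = y")
      case True
      then show ?thesis using leads_pass r y(1) by metis
    next
      case False
      then have "r \<notin> S" using leads_notin[OF r] by auto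
      then have "leads S f w r" using leads_enlarge[OF r] by auto
      then show ?thesis using leads_restrict by (metis Diff_subset)
    qed
  qed
  then have "walker S f x (f y)"
    using leads_pass[OF y(3,1)] z by (auto simp: walker_def acyc_def)
  moreover have "\<not> (acyc S f \<and> f y = x)"
    using leads_cycle[of S y f] y acyc_leads[of S f y] by auto
  ultimately show ?thesis by simp
qed

text \<open>Stop the orbit of x at the first of the two vertices.\<close>

lemma walker_first:
  assumes "walker S f x y" "walker S f x y'" "y \<noteq> y'"
  shows "(leads (S - {y'}) f y y' \<and> leads (S - {y, y'}) f x y) \<or>
    (leads (S - {y}) f y' y \<and> leads (S - {y, y'}) f x y')"
proof -
  from assms have y: "y \<in> S" "leads (S - {y}) f x y" "y' \<in> S" "leads (S - {y'}) f x y'"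
    by (auto simp: walker_def)
  obtain t where t: "leads (S - {y, y'}) f x t" "leads (S - {y}) f t y"
    using leads_restrict[OF y(2), of "S - {y, y'}"] by auto
  obtain t' where t': "leads (S - {y, y'}) f x t'" "leads (S - {y'}) f t' y'"
    using leads_restrict[OF y(4), of "S - {y, y'}"] by auto
  have "t' = t" using leads_det[OF t(1) t'(1)] by simp
  moreover have "t \<in> S" using leads_outside[OF t(2)] y by auto
  then have "t = y \<or> t = y'" using leads_notin[OF t(1)] by auto
  ultimately show ?thesis using t t' by auto
qed

text \<open>One of two distinct walkers is met first by the orbit of x. From a common successor
  inside S the orbit would reach one of them before the other and close a cycle that avoids the
  other, which \<open>walker\<close> excludes.\<close>

lemma walker_inj:
  assumes "walker S f x y" "walker S f x y'" "f y = f y'" "f y \<in> S"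
  shows "y = y'"
proof (rule ccontr)
  assume neq: "y \<noteq> y'"
  have main: False
    if a: "walker S f x a" "walker S f x a'" "f a = f a'" "a \<noteq> a'"
      and l: "leads (S - {a'}) f a a'" for a a'
  proof -
    have S: "a \<in> S" "a' \<in> S" "acyc (S - {a}) f" using a by (auto simp: walker_def)
    have e: "S - {a, a'} = S - {a'} - {a}" "S - {a, a'} = S - {a} - {a'}" by auto
    have l': "leads (S - {a'}) f (f a) a'" using leads_stepD[OF l] S a by auto
    obtain t where t: "leads (S - {a, a'}) f (f a) t" "leads (S - {a'}) f t a'"
      using leads_restrict[OF l', of "S - {a, a'}"] by auto
    have "t \<in> S" using leads_outside[OF t(2)] S by auto
    then have "t = a \<or> t = a'" using leads_notin[OF t(1)] by auto
    then show False
    proof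
      assume "t = a"
      then have "leads (S - {a'} - {a}) f (f a) a" using t e(1) by simp
      then show False using leads_cycle[of "S - {a'}" a f] S a l by auto
    next
      assume "t = a'"
      then have "leads (S - {a} - {a'}) f (f a') a'" using t a e(2) by simp
      then show False using leads_cycle[of "S - {a}" a' f] S a acyc_leads[of "S - {a}" f a'] by auto
    qed
  qed
  from walker_first[OF assms(1,2) neq] show False
    using main[of y y'] main[of y' y] assms neq by auto
qed

text \<open>If the arrow of z leads back to z, the predecessor is the last vertex before z on this
  cycle, or z itself for a fixed point. Otherwise the map is acyclic and the predecessor is the last
  vertex before z on the path from x.\<close>

lemma walker_surj:
  assumes z: "walker S f x z" and n: "\<not> (acyc S f \<and> z = x)" and x: "x \<in> S"
  shows "\<exists>y. walker S f x y \<and> f y = z"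
proof -
  from z have zS: "z \<in> S" "acyc (S - {z}) f" "leads (S - {z}) f x z" by (auto simp: walker_def)
  obtain r where r: "leads (S - {z}) f (f z) r" using acyc_leads zS(2) by metis
  show ?thesis
  proof (cases "r = z")
    case True
    show ?thesis
    proof (cases "f z = z")
      case False
      have "f z \<in> S - {z}"
      proof (rule ccontr)
        assume "f z \<notin> S - {z}"
        from leads_outside[OF r this] show False using True False by simp
      qed
      from leads_last[OF r this, unfolded True] obtain y
        where y: "y \<in> S - {z}" "f y = z" "leads (S - {z} - {y}) f (f z) y"
        by (elim bexE conjE) (rule that)
      have bk: "leads (S - {y}) f (f z) y"
      proof (rule leads_enlarge[OF y(3)])
        show "S - {z} - {y} \<subseteq> S - {y}" by blast
        show "y \<notin> S - {y}" by blast
      qed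
      have to_y: "leads (S - {y}) f w y" if w: "leads (S - {z}) f w z" for w
      proof -
        obtain t where t: "leads (S - {z} - {y}) f w t" "leads (S - {z}) f t z"
          using leads_restrict[OF w, of "S - {z} - {y}"] by auto
        have "t \<in> S" using leads_outside[OF t(2)] zS by auto
        then have "t = y \<or> t = z" using leads_notin[OF t(1)] by auto
        moreover have "leads (S - {y}) f y y" by (rule leads.stop) auto
        moreover have "leads (S - {y}) f z y"
          by (rule leads.step[OF _ bk]) (use y zS in auto)
        ultimately have "leads (S - {y}) f t y" by metis
        then show ?thesis by (intro leads_trans[OF t(1)]) auto
      qed
      have "\<exists>r. leads (S - {y}) f w r" for w
      proof -
        obtain r' where r': "leads (S - {z}) f w r'" using acyc_leads zS(2) by metis
        show ?thesis
        proof (cases "r' = z")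
          case False
          then have "r' \<notin> S" using leads_notin[OF r'] by auto
          then have "leads S f w r'" using leads_enlarge[OF r'] by auto
          then show ?thesis using leads_restrict by (metis Diff_subset)
        qed (use to_y r' in blast)
      qed
      then have "walker S f x y" using y to_y[OF zS(3)] by (auto simp: walker_def acyc_def)
      then show ?thesis using y by auto
    qed (use z in blast)
  next
    case False
    then have rS: "r \<notin> S" using leads_notin[OF r] by auto
    have zr: "leads S f z r"
      by (rule leads.step[OF zS(1)]) (rule leads_enlarge[OF r _ rS], auto)
    have ac: "acyc S f" unfolding acyc_def
    proof
      fix w assume "w \<in> S"
      obtain r' where r': "leads (S - {z}) f w r'" using acyc_leads zS(2) by metis
      show "\<exists>r. leads S f w r"
      proof (cases "r' = z")
        case True
        then show ?thesis using leads_trans[OF r' _] zr by auto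
      next
        case False
        then have "r' \<notin> S" using leads_notin[OF r'] by auto
        then show ?thesis using leads_enlarge[OF r'] by auto
      qed
    qed
    with n have "x \<in> S - {z}" using x by auto
    from leads_last[OF zS(3) this] obtain y
      where y: "y \<in> S - {z}" "f y = z" "leads (S - {z} - {y}) f x y"
      by (elim bexE conjE) (rule that)
    have "leads (S - {y}) f x y" by (rule leads_enlarge[OF y(3)]) auto
    then have "walker S f x y" using y acyc_mono[OF ac] by (auto simp: walker_def)
    then show ?thesis using y by auto
  qed
qed

lemma walker_start: "acyc S f \<Longrightarrow> x \<in> S \<Longrightarrow> walker S f x x"
  by (auto simp: walker_def intro: acyc_mono leads.stop)

lemma walker_exit:
  assumes "walker S f x y" "f y \<notin> S"
  shows "acyc S f" "leads S f x (f y)"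
proof -
  from assms have y: "y \<in> S" "acyc (S - {y}) f" "leads (S - {y}) f x y" by (auto simp: walker_def)
  have yl: "leads S f y (f y)" by (rule leads.step[where x = y, OF y(1)], rule leads.stop, fact assms(2))
  show "leads S f x (f y)" by (rule leads_trans[OF y(3) _ yl]) auto
  show "acyc S f" unfolding acyc_def
  proof
    fix w assume "w \<in> S"
    obtain r where r: "leads (S - {y}) f w r" using acyc_leads y(2) by metis
    show "\<exists>r. leads S f w r"
    proof (cases "r = y")
      case True
      then show ?thesis using leads_trans[OF r _] yl by auto
    next
      case False
      then have "r \<notin> S" using leads_notin[OF r] by auto
      then show ?thesis using leads_enlarge[OF r] by auto
    qed
  qed
qed

lemma walker_exit_unique:
  assumes "walker S f x y" "walker S f x y'" "f y \<notin> S" "f y' \<notin> S"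
  shows "y = y'"
proof (rule ccontr)
  assume neq: "y \<noteq> y'"
  have main: False
    if "leads (S - {a'}) f a a'" "a \<in> S" "a' \<in> S" "a \<noteq> a'" "f a \<notin> S" for a a'
  proof -
    have "leads (S - {a'}) f (f a) a'" by (rule leads_stepD) (use that in auto)
    then show False using leads_outside that by (metis DiffE)
  qed
  from walker_first[OF assms(1,2) neq] show False
    using main[of y' y] main[of y y'] assms neq unfolding walker_def by metis
qed

lemma walker_exit_exists:
  assumes "acyc S f" "x \<in> S"
  shows "\<exists>y. walker S f x y \<and> f y \<notin> S"
proof -
  obtain r where r: "leads S f x r" using acyc_leads assms by metis
  obtain y where "y \<in> S" "f y = r" "leads (S - {y}) f x y" using leads_last[OF r assms(2)] by auto
  then show ?thesis using leads_notin[OF r] acyc_mono[OF assms(1)] by (auto simp: walker_def)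
qed

text \<open>Conservation of flow for a fixed map. If the map is acyclic, the walkers are the
  vertices on the path from x: each step leads to the next one, x is never entered and exactly one
  walker exits. Otherwise the walkers, if there are any, form a single cycle and are permuted by the
  map.\<close>

lemma sum_walker_step:
  fixes F :: "'v \<Rightarrow> real"
  assumes "finite S" "x \<in> S"
  shows "(\<Sum>y\<in>S. of_bool (walker S f x y) * (if f y \<in> S then F (f y) else c)) =
    (\<Sum>y\<in>S. of_bool (walker S f x y) * F y) + of_bool (acyc S f) * (c - F x)"
proof -
  let ?W = "{y. walker S f x y}"
  have fin: "finite ?W" by (rule finite_subset[OF _ assms(1)]) (auto simp: walker_def)
  have sub: "?W \<subseteq> S" by (auto simp: walker_def)
  have to_W: "(\<Sum>y\<in>S. of_bool (walker S f x y) * G y) = sum G ?W" for G :: "'v \<Rightarrow> real"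
  proof -
    have "(\<Sum>y\<in>S. of_bool (walker S f x y) * G y) = (\<Sum>y\<in>S. if walker S f x y then G y else 0)"
      by (rule sum.cong) auto
    also have "\<dots> = sum G {y \<in> S. walker S f x y}" by (rule sum.inter_filter[OF assms(1), symmetric])
    also have "{y \<in> S. walker S f x y} = ?W" using sub by auto
    finally show ?thesis .
  qed
  let ?I = "{y. walker S f x y \<and> f y \<in> S}" and ?O = "{y. walker S f x y \<and> f y \<notin> S}"
  have split: "sum G ?W = sum G ?I + sum G ?O" for G :: "'v \<Rightarrow> real"
  proof -
    have eq: "?W = ?I \<union> ?O" by auto
    have "sum G (?I \<union> ?O) = sum G ?I + sum G ?O"
      by (rule sum.union_disjoint) (auto intro: finite_subset[OF _ fin])
    then show ?thesis by (subst eq)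
  qed
  have inj: "inj_on f ?I" by (auto intro!: inj_onI dest: walker_inj)
  have img: "f ` ?I = ?W - (if acyc S f then {x} else {})"
  proof
    show "f ` ?I \<subseteq> ?W - (if acyc S f then {x} else {})"
      using walker_step[OF _ _ assms(2)] by auto
    show "?W - (if acyc S f then {x} else {}) \<subseteq> f ` ?I"
    proof
      fix z assume "z \<in> ?W - (if acyc S f then {x} else {})"
      then have z: "walker S f x z" "\<not> (acyc S f \<and> z = x)" by (auto split: if_splits)
      then obtain y where "walker S f x y" "f y = z" using walker_surj[OF _ _ assms(2)] by metis
      then show "z \<in> f ` ?I" using z by (auto simp: walker_def)
    qed
  qed
  have I: "(\<Sum>y\<in>?I. F (f y)) = sum F ?W - of_bool (acyc S f) * F x"
  proof -
    have "(\<Sum>y\<in>?I. F (f y)) = sum F (?W - (if acyc S f then {x} else {}))"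
      unfolding img[symmetric] by (simp add: sum.reindex[OF inj])
    then show ?thesis
      using walker_start[OF _ assms(2), of f] fin by (auto simp: sum_diff1)
  qed
  have O: "(\<Sum>y\<in>?O. c) = of_bool (acyc S f) * c"
  proof (cases "acyc S f")
    case True
    then obtain y where "walker S f x y" "f y \<notin> S" using walker_exit_exists assms by metis
    then have "?O = {y}" using walker_exit_unique by fastforce
    then show ?thesis using True by simp
  next
    case False
    then have "?O = {}" using walker_exit(1)[of S f x] by auto
    then show ?thesis using False by (simp only: sum.empty) simp
  qed
  have "(\<Sum>y\<in>S. of_bool (walker S f x y) * (if f y \<in> S then F (f y) else c)) =
      (\<Sum>y\<in>?I. F (f y)) + (\<Sum>y\<in>?O. c)"
    unfolding to_W split by (intro arg_cong2[where f = "(+)"] sum.cong) auto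
  then show ?thesis unfolding I O to_W by (simp add: algebra_simps)
qed

section \<open>Product measures and forests\<close>

lemma integrable_pmf_bounded:
  fixes g :: "'a \<Rightarrow> real"
  assumes "\<And>x. \<bar>g x\<bar> \<le> K"
  shows "integrable (measure_pmf M) g"
  by (rule measure_pmf.integrable_const_bound[where B = K]) (use assms in auto)

lemma expectation_bounds:
  fixes g :: "'a \<Rightarrow> real"
  assumes "\<And>x. a \<le> g x" "\<And>x. g x \<le> b"
  shows "a \<le> measure_pmf.expectation M g" "measure_pmf.expectation M g \<le> b"
proof -
  have "\<bar>g x\<bar> \<le> \<bar>a\<bar> + \<bar>b\<bar>" for x using assms[of x] by linarith
  then have int: "integrable (measure_pmf M) g" by (rule integrable_pmf_bounded)
  show "a \<le> measure_pmf.expectation M g"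
    using assms by (intro measure_pmf.integral_ge_const int) auto
  show "measure_pmf.expectation M g \<le> b"
    using assms by (intro measure_pmf.integral_le_const int) auto
qed

lemma expectation_mono_bounded:
  fixes g h :: "'a \<Rightarrow> real"
  assumes "\<And>x. \<bar>g x\<bar> \<le> K" "\<And>x. \<bar>h x\<bar> \<le> L" "\<And>x. x \<in> set_pmf M \<Longrightarrow> g x \<le> h x"
  shows "measure_pmf.expectation M g \<le> measure_pmf.expectation M h"
  by (intro integral_mono_AE integrable_pmf_bounded[OF assms(1)] integrable_pmf_bounded[OF assms(2)])
     (use assms(3) in \<open>auto simp: AE_measure_pmf_iff\<close>)

lemma expectation_of_bool: "measure_pmf.expectation M (\<lambda>x. of_bool (E x)) = measure_pmf.prob M {x. E x}"
proof -
  have "(\<lambda>x. of_bool (E x)) = (indicator {x. E x} :: _ \<Rightarrow> real)" by (auto simp: indicator_def)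
  then show ?thesis by simp
qed

lemma expectation_bind_bounded:
  fixes g :: "'b \<Rightarrow> real"
  assumes "\<And>x. \<bar>g x\<bar> \<le> K"
  shows "measure_pmf.expectation (bind_pmf M N) g =
    measure_pmf.expectation M (\<lambda>x. measure_pmf.expectation (N x) g)"
proof -
  have K: "0 \<le> K" using assms[of undefined] by linarith
  have pos: "0 \<le> g x + K" for x using assms[of x] by linarith
  have le: "\<bar>g x + K\<bar> \<le> 2 * K" for x using assms[of x] by linarith
  have int: "integrable (measure_pmf M') (\<lambda>x. g x + K)" for M' by (rule integrable_pmf_bounded[OF le])
  have intg: "integrable (measure_pmf M') g" for M' by (rule integrable_pmf_bounded[OF assms])
  have bd: "\<bar>measure_pmf.expectation (N x) g\<bar> \<le> K" for x
  proof -
    have "- K \<le> g y" "g y \<le> K" for y using assms[of y] by linarith+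
    from expectation_bounds[of "-K" g K "N x", OF this] show ?thesis by linarith
  qed
  have shift: "measure_pmf.expectation M' (\<lambda>x. g x + K) = measure_pmf.expectation M' g + K" for M'
    by (simp add: intg)
  have e: "ennreal (measure_pmf.expectation M' (\<lambda>x. g x + K)) = (\<integral>\<^sup>+x. g x + K \<partial>measure_pmf M')" for M'
    by (rule nn_integral_eq_integral[symmetric, OF int]) (use pos in auto)
  have "ennreal (measure_pmf.expectation (bind_pmf M N) (\<lambda>x. g x + K)) =
      (\<integral>\<^sup>+x. \<integral>\<^sup>+y. ennreal (g y + K) \<partial>N x \<partial>M)" by (simp add: e)
  also have "\<dots> = (\<integral>\<^sup>+x. ennreal (measure_pmf.expectation (N x) g + K) \<partial>M)"
    by (simp add: e[symmetric] shift)
  also have "\<dots> = ennreal (measure_pmf.expectation M (\<lambda>x. measure_pmf.expectation (N x) g + K))"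
  proof (rule nn_integral_eq_integral)
    show "integrable (measure_pmf M) (\<lambda>x. measure_pmf.expectation (N x) g + K)"
    proof (rule integrable_pmf_bounded)
      fix x show "\<bar>measure_pmf.expectation (N x) g + K\<bar> \<le> 2 * K" using bd[of x] by linarith
    qed
    have "0 \<le> measure_pmf.expectation (N x) g + K" for x using bd[of x] by linarith
    then show "AE x in measure_pmf M. 0 \<le> measure_pmf.expectation (N x) g + K" by simp
  qed
  finally have "measure_pmf.expectation (bind_pmf M N) (\<lambda>x. g x + K) =
      measure_pmf.expectation M (\<lambda>x. measure_pmf.expectation (N x) g + K)"
  proof (subst (asm) ennreal_inj)
    show "0 \<le> measure_pmf.expectation (bind_pmf M N) (\<lambda>x. g x + K)"
      by (rule integral_nonneg_AE) (use pos in auto)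
    show "0 \<le> measure_pmf.expectation M (\<lambda>x. measure_pmf.expectation (N x) g + K)"
    proof (rule integral_nonneg_AE)
      have "0 \<le> measure_pmf.expectation (N x) g + K" for x using bd[of x] by linarith
      then show "AE x in measure_pmf M. 0 \<le> measure_pmf.expectation (N x) g + K" by simp
    qed
  qed simp
  moreover have "measure_pmf.expectation M (\<lambda>x. measure_pmf.expectation (N x) g + K) =
      measure_pmf.expectation M (\<lambda>x. measure_pmf.expectation (N x) g) + K"
    by (simp add: integrable_pmf_bounded[OF bd])
  ultimately show ?thesis unfolding shift by simp
qed

lemma Pi_pmf_resample:
  assumes "finite S" "y \<in> S"
  shows "Pi_pmf S d q = bind_pmf (Pi_pmf S d q) (\<lambda>f. map_pmf (\<lambda>w. f(y := w)) (q y))"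
proof -
  have S: "S = insert y (S - {y})" using assms by auto
  have upd: "fun_upd (f(y := v)) y = fun_upd f y" for f :: "'a \<Rightarrow> 'b" and v
    by (simp add: fun_eq_iff)
  have e: "Pi_pmf S d q = do {w \<leftarrow> q y; f \<leftarrow> Pi_pmf (S - {y}) d q; return_pmf (f(y := w))}"
    by (subst S, subst Pi_pmf_insert') (use assms in auto)
  also have "\<dots> = do {f \<leftarrow> Pi_pmf (S - {y}) d q; map_pmf (\<lambda>w. f(y := w)) (q y)}"
    unfolding map_pmf_def by (rule bind_commute_pmf)
  also have "\<dots> = do {v \<leftarrow> q y; f \<leftarrow> Pi_pmf (S - {y}) d q; map_pmf (\<lambda>w. f(y := w)) (q y)}"
    by simp
  also have "\<dots> = bind_pmf (do {w \<leftarrow> q y; f \<leftarrow> Pi_pmf (S - {y}) d q; return_pmf (f(y := w))})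
      (\<lambda>f. map_pmf (\<lambda>w. f(y := w)) (q y))"
    by (simp add: bind_assoc_pmf bind_return_pmf upd)
  finally show ?thesis unfolding e[symmetric] .
qed

lemma expectation_resample:
  fixes g :: "('a \<Rightarrow> 'b) \<Rightarrow> real"
  assumes "finite S" "y \<in> S" "\<And>f. \<bar>g f\<bar> \<le> K"
  shows "measure_pmf.expectation (Pi_pmf S d q) g =
    measure_pmf.expectation (Pi_pmf S d q) (\<lambda>f. measure_pmf.expectation (q y) (\<lambda>w. g (f(y := w))))"
proof -
  have "measure_pmf.expectation (Pi_pmf S d q) g = measure_pmf.expectation
      (bind_pmf (Pi_pmf S d q) (\<lambda>f. map_pmf (\<lambda>w. f(y := w)) (q y))) g"
    using Pi_pmf_resample[OF assms(1,2)] by metis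
  also have "\<dots> = measure_pmf.expectation (Pi_pmf S d q)
      (\<lambda>f. measure_pmf.expectation (q y) (\<lambda>w. g (f(y := w))))"
    by (subst expectation_bind_bounded[OF assms(3)]) simp
  finally show ?thesis .
qed

lemma prob_Pi_pmf_split:
  assumes "finite S" "A \<subseteq> S"
    and "\<And>f g. (\<And>x. x \<in> S - A \<Longrightarrow> f x = g x) \<Longrightarrow> E f \<longleftrightarrow> E g"
  shows "measure_pmf.prob (Pi_pmf S d q) {f. (\<forall>a\<in>A. f a \<in> B a) \<and> E f} =
    (\<Prod>a\<in>A. measure_pmf.prob (q a) (B a)) * measure_pmf.prob (Pi_pmf (S - A) d q) {f. E f}"
proof -
  have "finite A" using assms finite_subset by blast
  then show ?thesis using assms
  proof (induction A arbitrary: S rule: finite_induct)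
    case empty
    show ?case by simp
  next
    case (insert a A)
    let ?E = "\<lambda>f. (\<forall>a\<in>A. f a \<in> B a) \<and> E f"
    have S: "S = insert a (S - {a})" using insert.prems(1,2) by auto
    have upd: "?E (f(a := w)) \<longleftrightarrow> ?E f" for f w
    proof -
      have "E (f(a := w)) \<longleftrightarrow> E f" by (rule insert.prems(3)) auto
      then show ?thesis using insert.hyps by auto
    qed
    have "measure_pmf.prob (Pi_pmf S d q) {f. (\<forall>a\<in>insert a A. f a \<in> B a) \<and> E f} =
        measure_pmf.expectation (Pi_pmf S d q) (\<lambda>f. of_bool (f a \<in> B a) * of_bool (?E f))"
      by (subst expectation_of_bool[symmetric]) (rule Bochner_Integration.integral_cong, auto)
    also have "\<dots> = measure_pmf.expectation (Pi_pmf S d q)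
        (\<lambda>f. measure_pmf.expectation (q a) (\<lambda>w. of_bool (w \<in> B a) * of_bool (?E f)))"
      by (subst expectation_resample[of S a _ 1])
         (use insert.prems(1,2) upd in \<open>auto simp del: fun_upd_apply simp: fun_upd_same\<close>)
    also have "\<dots> = measure_pmf.prob (q a) (B a) * measure_pmf.prob (Pi_pmf S d q) {f. ?E f}"
      by (simp add: expectation_of_bool[of "q a" "\<lambda>w. w \<in> B a", simplified]
        expectation_of_bool[of _ ?E, simplified])
    also have "measure_pmf.prob (Pi_pmf S d q) {f. ?E f} = measure_pmf.prob (Pi_pmf (S - {a}) d q) {f. ?E f}"
    proof -
      have "measure_pmf.prob (Pi_pmf (S - {a}) d q) {f. ?E f} =
          measure_pmf.prob (Pi_pmf S d q) {f. ?E (f(a := d))}"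
        by (subst Pi_pmf_remove) (use insert.prems(1,2) in \<open>auto simp del: fun_upd_apply\<close>)
      then show ?thesis unfolding upd by simp
    qed
    also have "\<dots> = (\<Prod>a\<in>A. measure_pmf.prob (q a) (B a)) *
        measure_pmf.prob (Pi_pmf (S - {a} - A) d q) {f. E f}"
    proof (rule insert.IH)
      show "finite (S - {a})" "A \<subseteq> S - {a}" using insert.hyps insert.prems(1,2) by auto
      fix f g :: "'a \<Rightarrow> 'b" assume "\<And>x. x \<in> S - {a} - A \<Longrightarrow> f x = g x"
      then show "E f \<longleftrightarrow> E g" by (intro insert.prems(3)) auto
    qed
    also have "S - {a} - A = S - insert a A" by auto
    finally show ?case using insert.hyps by simp
  qed
qed

lemma prob_Pi_pmf_subset:
  assumes "finite S" "T \<subseteq> S"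
    and "\<And>f g. (\<And>x. x \<in> T \<Longrightarrow> f x = g x) \<Longrightarrow> E f \<longleftrightarrow> E g"
  shows "measure_pmf.prob (Pi_pmf S d q) {f. E f} = measure_pmf.prob (Pi_pmf T d q) {f. E f}"
proof -
  have "S - (S - T) = T" using assms(2) by auto
  moreover have "measure_pmf.prob (Pi_pmf S d q) {f. (\<forall>a\<in>S - T. f a \<in> UNIV) \<and> E f} =
      (\<Prod>a\<in>S - T. measure_pmf.prob (q a) UNIV) * measure_pmf.prob (Pi_pmf (S - (S - T)) d q) {f. E f}"
  proof (rule prob_Pi_pmf_split)
    fix f g :: "'a \<Rightarrow> 'b" assume "\<And>x. x \<in> S - (S - T) \<Longrightarrow> f x = g x"
    then show "E f \<longleftrightarrow> E g" by (intro assms(3)) (use assms(2) in auto)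
  qed (use assms(1) in auto)
  ultimately show ?thesis by simp
qed

section \<open>Acyclicity probabilities and excursions\<close>

context symmetric_chain
begin

abbreviation arrows :: "'v set \<Rightarrow> ('v \<Rightarrow> 'v) pmf" where
  "arrows S \<equiv> Pi_pmf S undefined P"

text \<open>By \<open>Z_remove\<close> this is a product of reciprocals of Green functions, namely
  the determinant of the identity minus the kernel killed outside S.\<close>

definition Z :: "'v set \<Rightarrow> real" where
  "Z S = measure_pmf.prob (arrows S) {f. acyc S f}"

text \<open>Whether the walker stands at y does not depend on the arrow of y, so this arrow may be
  redrawn from the kernel. The pointwise conservation law \<open>sum_walker_step\<close> then
  integrates to a law for the random walk.\<close>

lemma flow_identity:
  fixes F :: "'v \<Rightarrow> ('v \<Rightarrow> 'v) \<Rightarrow> real"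
  assumes "finite S" "x \<in> S" and F: "\<And>y f. \<bar>F y f\<bar> \<le> K" and \<Phi>: "\<And>f. \<bar>\<Phi> f\<bar> \<le> K"
    and upd: "\<And>y f w. F y (f(y := w)) = F y f"
  shows "(\<Sum>y\<in>S. measure_pmf.expectation (arrows S) (\<lambda>f. of_bool (walker S f x y) *
      measure_pmf.expectation (P y) (\<lambda>w. if w \<in> S then F w (f(y := w)) else \<Phi> (f(y := w))))) =
    (\<Sum>y\<in>S. measure_pmf.expectation (arrows S) (\<lambda>f. of_bool (walker S f x y) * F y f)) +
    measure_pmf.expectation (arrows S) (\<lambda>f. of_bool (acyc S f) * (\<Phi> f - F x f))"
proof -
  let ?E = "measure_pmf.expectation (arrows S)"
  let ?g = "\<lambda>y f. of_bool (walker S f x y) * (if f y \<in> S then F (f y) f else \<Phi> f)"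
  have bd: "\<bar>?g y f\<bar> \<le> K" for y f
    using F[of "f y" f] \<Phi>[of f] by (cases "walker S f x y") auto
  have bd': "\<bar>of_bool (walker S f x y) * F y f\<bar> \<le> K" for y f
    using F[of y f] by (cases "walker S f x y") auto
  have bd'': "\<bar>of_bool (acyc S f) * (\<Phi> f - F x f)\<bar> \<le> 2 * K" for f
    using F[of x f] \<Phi>[of f] by (cases "acyc S f") auto
  have pt: "(\<Sum>y\<in>S. ?g y f) =
      (\<Sum>y\<in>S. of_bool (walker S f x y) * F y f) + of_bool (acyc S f) * (\<Phi> f - F x f)" for f
    by (rule sum_walker_step[OF assms(1,2), of f "\<lambda>y. F y f" "\<Phi> f"])
  have "?E (\<lambda>f. of_bool (walker S f x y) *
      measure_pmf.expectation (P y) (\<lambda>w. if w \<in> S then F w (f(y := w)) else \<Phi> (f(y := w)))) = ?E (?g y)"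
    if "y \<in> S" for y
    by (subst expectation_resample[OF assms(1) that bd]) (simp cong: if_cong)
  then have "(\<Sum>y\<in>S. ?E (\<lambda>f. of_bool (walker S f x y) *
      measure_pmf.expectation (P y) (\<lambda>w. if w \<in> S then F w (f(y := w)) else \<Phi> (f(y := w))))) =
      (\<Sum>y\<in>S. ?E (?g y))" by simp
  also have "\<dots> = ?E (\<lambda>f. \<Sum>y\<in>S. ?g y f)"
    by (rule Bochner_Integration.integral_sum[symmetric]) (rule integrable_pmf_bounded[OF bd])
  also have "\<dots> = ?E (\<lambda>f. (\<Sum>y\<in>S. of_bool (walker S f x y) * F y f) + of_bool (acyc S f) * (\<Phi> f - F x f))"
    by (simp only: pt)
  also have "\<dots> = ?E (\<lambda>f. \<Sum>y\<in>S. of_bool (walker S f x y) * F y f) +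
      ?E (\<lambda>f. of_bool (acyc S f) * (\<Phi> f - F x f))"
    by (intro Bochner_Integration.integral_add Bochner_Integration.integrable_sum
        integrable_pmf_bounded[OF bd'] integrable_pmf_bounded[OF bd''])
  also have "?E (\<lambda>f. \<Sum>y\<in>S. of_bool (walker S f x y) * F y f) =
      (\<Sum>y\<in>S. ?E (\<lambda>f. of_bool (walker S f x y) * F y f))"
    by (rule Bochner_Integration.integral_sum) (rule integrable_pmf_bounded[OF bd'])
  finally show ?thesis .
qed

text \<open>With the Green function towards z as F, the flow identity tests the law of the walker
  against (1 - P) G, which is the indicator of z, and returns \<open>Z S\<close> times the Green
  function at the starting point.\<close>

lemma prob_walker:
  assumes S: "dom S" "x \<in> S" "z \<in> S"
  shows "measure_pmf.prob (arrows S) {f. walker S f x z} = Z S * gr S x z"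
proof -
  let ?m = "\<lambda>y. measure_pmf.prob (arrows S) {f. walker S f x y}"
  let ?F = "\<lambda>y (f :: 'v \<Rightarrow> 'v). if y \<in> S then gr S y z else 0"
  have F: "\<bar>?F y f\<bar> \<le> bubble" for y f
    using gr_le_bubble[OF S(1) _ S(3)] gr_nonneg[OF S(1) _ S(3)] bubble_ge_1 by auto
  have ex: "measure_pmf.expectation (P y) (\<lambda>w. if w \<in> S then gr S w z else 0) = (\<Sum>w\<in>S. p y w * gr S w z)" for y
    by (subst integral_measure_pmf_real[of S]) (use S in \<open>auto simp: domD mult.commute intro!: sum.cong split: if_splits\<close>)
  have "(\<Sum>y\<in>S. measure_pmf.expectation (arrows S) (\<lambda>f. of_bool (walker S f x y) *
      measure_pmf.expectation (P y) (\<lambda>w. if w \<in> S then ?F w (f(y := w)) else 0))) =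
    (\<Sum>y\<in>S. measure_pmf.expectation (arrows S) (\<lambda>f. of_bool (walker S f x y) * ?F y f)) +
    measure_pmf.expectation (arrows S) (\<lambda>f. of_bool (acyc S f) * (0 - ?F x f))"
    by (rule flow_identity[where K = bubble]) (use S bubble_ge_1 in \<open>auto simp: domD F\<close>)
  moreover have "(\<Sum>y\<in>S. measure_pmf.expectation (arrows S) (\<lambda>f. of_bool (walker S f x y) *
      measure_pmf.expectation (P y) (\<lambda>w. if w \<in> S then ?F w (f(y := w)) else 0))) =
      (\<Sum>y\<in>S. ?m y * (\<Sum>w\<in>S. p y w * gr S w z))"
    by (intro sum.cong refl) (simp add: ex expectation_of_bool cong: if_cong)
  moreover have "(\<Sum>y\<in>S. measure_pmf.expectation (arrows S) (\<lambda>f. of_bool (walker S f x y) * ?F y f)) =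
      (\<Sum>y\<in>S. ?m y * gr S y z)"
    by (intro sum.cong refl) (simp add: expectation_of_bool)
  moreover have "measure_pmf.expectation (arrows S) (\<lambda>f. of_bool (acyc S f) * (0 - ?F x f)) = - (Z S * gr S x z)"
    using S by (simp add: expectation_of_bool Z_def)
  ultimately have "(\<Sum>y\<in>S. ?m y * gr S y z) - (\<Sum>y\<in>S. ?m y * (\<Sum>w\<in>S. p y w * gr S w z)) = Z S * gr S x z"
    by linarith
  also have "(\<Sum>y\<in>S. ?m y * gr S y z) - (\<Sum>y\<in>S. ?m y * (\<Sum>w\<in>S. p y w * gr S w z)) =
      (\<Sum>y\<in>S. if y = z then ?m y else 0)"
    by (subst sum_subtractf[symmetric], intro sum.cong refl)
       (auto simp: gr_front[OF S(1) _ S(3)] algebra_simps)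
  also have "\<dots> = ?m z" using S by (simp add: domD)
  finally show ?thesis by simp
qed

lemma walker_refl: "walker S f x x \<longleftrightarrow> x \<in> S \<and> acyc (S - {x}) f"
  by (auto simp: walker_def intro: leads.stop)

lemma prob_acyc_subset:
  assumes "finite S" "T \<subseteq> S"
  shows "measure_pmf.prob (arrows S) {f. acyc T f} = Z T"
  unfolding Z_def by (rule prob_Pi_pmf_subset[OF assms]) (rule acyc_cong)

text \<open>At its starting point x the walker only requires acyclicity off x, so this is
  \<open>prob_walker\<close> with x = z.\<close>

lemma Z_remove:
  assumes "dom S" "x \<in> S"
  shows "Z (S - {x}) = Z S * gr S x x"
  using prob_walker[OF assms assms(2)] prob_acyc_subset[of S "S - {x}"] assms
  by (simp add: walker_refl domD)

lemma Z_empty [simp]: "Z {} = 1"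
  by (simp add: Z_def)

lemma Z_pos: "dom S \<Longrightarrow> 0 < Z S"
proof -
  assume S: "dom S"
  then have "finite S" by (rule domD)
  then show "0 < Z S" using S
  proof (induction S rule: finite_induct)
    case (insert x S)
    then have "0 < Z S" using dom_mono by blast
    moreover have "Z S = Z (insert x S) * gr (insert x S) x x"
      using Z_remove[OF insert.prems, of x] insert.hyps by simp
    moreover have "0 \<le> Z (insert x S)" by (simp add: Z_def)
    ultimately show ?case by (metis mult_zero_left order_less_irrefl order_le_less)
  qed simp
qed

text \<open>The flow identity with F = 0 counts only exits. A walker at y leaves at z with
  probability p(y, z), and by \<open>walker_exit\<close> the resulting map is acyclic and leads x to
  z.\<close>

lemma prob_leads:
  assumes S: "dom S" "z \<notin> S"
  shows "measure_pmf.prob (arrows S) {f. acyc S f \<and> leads S f x z} = Z S * ht S x z"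
proof (cases "x \<in> S")
  case True
  let ?\<Phi> = "\<lambda>f. of_bool (leads S f x z) :: real"
  let ?E = "measure_pmf.expectation (arrows S)"
  have "(\<Sum>y\<in>S. ?E (\<lambda>f. of_bool (walker S f x y) *
      measure_pmf.expectation (P y) (\<lambda>w. if w \<in> S then 0 else ?\<Phi> (f(y := w))))) =
    (\<Sum>y\<in>S. ?E (\<lambda>f. of_bool (walker S f x y) * 0)) + ?E (\<lambda>f. of_bool (acyc S f) * (?\<Phi> f - 0))"
    by (rule flow_identity[where K = 1 and F = "\<lambda>_ _. 0" and \<Phi> = ?\<Phi>]) (use S True in \<open>auto simp: domD\<close>)
  also have "\<dots> = measure_pmf.prob (arrows S) {f. acyc S f \<and> leads S f x z}"
    by (simp add: expectation_of_bool[symmetric] of_bool_conj)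
  also have "(\<Sum>y\<in>S. ?E (\<lambda>f. of_bool (walker S f x y) *
      measure_pmf.expectation (P y) (\<lambda>w. if w \<in> S then 0 else ?\<Phi> (f(y := w))))) =
      (\<Sum>y\<in>S. measure_pmf.prob (arrows S) {f. walker S f x y} * p y z)"
  proof (rule sum.cong[OF refl])
    fix y assume y: "y \<in> S"
    have pt: "of_bool (walker S f x y) * measure_pmf.expectation (P y) (\<lambda>w. if w \<in> S then 0 else ?\<Phi> (f(y := w))) =
        of_bool (walker S f x y) * p y z" for f
    proof (cases "walker S f x y")
      case w: True
      have "leads S (f(y := w)) x z \<longleftrightarrow> w = z" if "w \<notin> S" for w
      proof -
        have "leads S (f(y := w)) x w" using walker_exit(2)[of S "f(y := w)" x y] w that by simp
        then show ?thesis using leads_det by metis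
      qed
      then have "(\<lambda>w. if w \<in> S then 0 else ?\<Phi> (f(y := w))) = (\<lambda>w. of_bool (w = z))"
        using S by auto
      then show ?thesis using w by (simp add: expectation_of_bool pmf.rep_eq)
    qed simp
    show "?E (\<lambda>f. of_bool (walker S f x y) *
        measure_pmf.expectation (P y) (\<lambda>w. if w \<in> S then 0 else ?\<Phi> (f(y := w)))) =
        measure_pmf.prob (arrows S) {f. walker S f x y} * p y z"
      by (simp only: pt) (simp add: expectation_of_bool)
  qed
  also have "\<dots> = Z S * ht S x z"
    using S True by (simp add: prob_walker hit_def sum_distrib_left mult.assoc)
  finally show ?thesis by simp
next
  case False
  then have "{f. acyc S f \<and> leads S f x z} = (if x = z then {f. acyc S f} else {})"
    by (auto dest: leads_outside intro: leads.stop)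
  then show ?thesis using False by (simp add: hit_def Z_def)
qed

definition wired :: "'v set \<Rightarrow> ('v \<Rightarrow> 'v) pmf" where
  "wired S = cond_pmf (arrows S) {f. acyc S f}"

lemma acyc_nonempty: "dom S \<Longrightarrow> set_pmf (arrows S) \<inter> {f. acyc S f} \<noteq> {}"
  using Z_pos[of S] unfolding Z_def
  by (metis measure_pmf_zero_iff order_less_irrefl)

lemma prob_wired:
  assumes "dom S"
  shows "measure_pmf.prob (wired S) {f. E f} = measure_pmf.prob (arrows S) {f. acyc S f \<and> E f} / Z S"
proof -
  have "measure (uniform_measure (measure_pmf (arrows S)) {f. acyc S f}) {f. E f} =
      measure_pmf.prob (arrows S) ({f. acyc S f} \<inter> {f. E f}) / measure_pmf.prob (arrows S) {f. acyc S f}"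
    by (rule measure_uniform_measure) (use Z_pos[OF assms] in \<open>auto simp: Z_def measure_pmf.emeasure_eq_measure\<close>)
  then show ?thesis
    unfolding wired_def cond_pmf.rep_eq[OF acyc_nonempty[OF assms]] by (simp add: Z_def Collect_conj_eq)
qed

lemma expectation_wired:
  fixes g :: "('v \<Rightarrow> 'v) \<Rightarrow> real"
  assumes "dom S" "\<And>f. \<bar>g f\<bar> \<le> K"
  shows "measure_pmf.expectation (wired S) g =
    measure_pmf.expectation (arrows S) (\<lambda>f. of_bool (acyc S f) * g f) / Z S"
proof -
  have Z: "Z S \<noteq> 0" "0 < Z S" using Z_pos[OF assms(1)] by auto
  have "measure_pmf.expectation (wired S) g = (\<integral>f. g f \<partial>density (measure_pmf (arrows S)) (\<lambda>f. ennreal (of_bool (acyc S f) / Z S)))"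
  proof -
    have "(\<lambda>x. indicator {f. acyc S f} x / emeasure (measure_pmf (arrows S)) {f. acyc S f}) = (\<lambda>f. ennreal (of_bool (acyc S f) / Z S))"
      using Z by (auto simp: Z_def measure_pmf.emeasure_eq_measure fun_eq_iff indicator_def divide_ennreal ennreal_1[symmetric] simp del: ennreal_1)
    then show ?thesis
      unfolding wired_def cond_pmf.rep_eq[OF acyc_nonempty[OF assms(1)]] uniform_measure_def by simp
  qed
  also have "\<dots> = (\<integral>f. (of_bool (acyc S f) / Z S) * g f \<partial>measure_pmf (arrows S))"
    by (subst integral_density) (use Z in auto)
  finally show ?thesis by simp
qed

text \<open>
  The expected value of \<open>\<Phi>\<close> after an excursion from \<open>y\<close> that leaves \<open>S\<close> within \<open>n\<close> steps and
  redirects the arrow of each vertex it visits along its last exit from that vertex.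
\<close>

primrec excursion :: "'v set \<Rightarrow> (('v \<Rightarrow> 'v) \<Rightarrow> real) \<Rightarrow> nat \<Rightarrow> 'v \<Rightarrow> ('v \<Rightarrow> 'v) \<Rightarrow> real" where
  "excursion S \<Phi> 0 y f = 0"
| "excursion S \<Phi> (Suc n) y f = measure_pmf.expectation (P y)
     (\<lambda>w. if w \<in> S then excursion S \<Phi> n w (f(y := w)) else \<Phi> (f(y := w)))"

lemma excursion_upd [simp]: "excursion S \<Phi> n y (f(y := w)) = excursion S \<Phi> n y f"
  by (cases n) (auto cong: if_cong)

lemma excursion_bounds:
  assumes "\<And>f. 0 \<le> \<Phi> f" "\<And>f. \<Phi> f \<le> 1"
  shows "0 \<le> excursion S \<Phi> n y f \<and> excursion S \<Phi> n y f \<le> 1"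
proof (induction n arbitrary: y f)
  case (Suc n)
  then show ?case using assms by (auto intro!: expectation_bounds)
qed simp

text \<open>The wired forest is stationary under excursions, since the errors telescope.\<close>

lemma excursion_inequality:
  assumes S: "dom S" "x \<in> S" and \<Phi>: "\<And>f. 0 \<le> \<Phi> f" "\<And>f. \<Phi> f \<le> 1"
    and bd: "\<And>f. \<bar>\<beta> f\<bar> \<le> K" and le: "\<And>n f. acyc S f \<Longrightarrow> excursion S \<Phi> n x f \<le> \<beta> f"
  shows "measure_pmf.expectation (wired S) \<Phi> \<le> measure_pmf.expectation (wired S) \<beta>"
proof -
  let ?E = "measure_pmf.expectation (arrows S)"
  define m where "m n = (\<Sum>y\<in>S. ?E (\<lambda>f. of_bool (walker S f x y) * excursion S \<Phi> n y f))" for n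
  define D where "D = ?E (\<lambda>f. of_bool (acyc S f) * \<Phi> f) - ?E (\<lambda>f. of_bool (acyc S f) * \<beta> f)"
  note V = excursion_bounds[OF \<Phi>, of S]
  have absV: "\<bar>excursion S \<Phi> n y f\<bar> \<le> 1" for n y f using V[where n = n and y = y and f = f] by auto
  have abs\<Phi>: "\<bar>\<Phi> f\<bar> \<le> 1" for f using \<Phi>[of f] by auto
  have K: "0 \<le> K" using bd[of undefined] by linarith
  have i1: "integrable (measure_pmf (arrows S)) (\<lambda>f. of_bool (acyc S f) * \<Phi> f)"
    by (rule integrable_pmf_bounded[of _ 1]) (use abs\<Phi> in \<open>auto simp: of_bool_def\<close>)
  have i2: "integrable (measure_pmf (arrows S)) (\<lambda>f. of_bool (acyc S f) * excursion S \<Phi> n x f)" for n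
    by (rule integrable_pmf_bounded[of _ 1]) (use absV in \<open>auto simp: of_bool_def\<close>)
  have i3: "integrable (measure_pmf (arrows S)) (\<lambda>f. of_bool (acyc S f) * \<beta> f)"
    by (rule integrable_pmf_bounded[of _ K]) (use bd K in \<open>auto simp: of_bool_def\<close>)
  \<comment> \<open>Each further step adds the gap between the value of \<Phi> in the forest and its
    value after an excursion of at most n steps. If D were positive, m would grow linearly, but it
    is at most \<open>card S\<close>.\<close>
  have step: "m n + D \<le> m (Suc n)" for n
  proof -
    have "m (Suc n) = m n + ?E (\<lambda>f. of_bool (acyc S f) * (\<Phi> f - excursion S \<Phi> n x f))"
      unfolding m_def excursion.simps by (rule flow_identity[where K = 1]) (use S absV abs\<Phi> in \<open>auto simp: domD\<close>)
    also have "?E (\<lambda>f. of_bool (acyc S f) * (\<Phi> f - excursion S \<Phi> n x f)) =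
        ?E (\<lambda>f. of_bool (acyc S f) * \<Phi> f) - ?E (\<lambda>f. of_bool (acyc S f) * excursion S \<Phi> n x f)"
      by (simp add: right_diff_distrib i1 i2)
    moreover have "?E (\<lambda>f. of_bool (acyc S f) * excursion S \<Phi> n x f) \<le> ?E (\<lambda>f. of_bool (acyc S f) * \<beta> f)"
      by (intro integral_mono i2 i3) (auto simp: of_bool_def le)
    ultimately show ?thesis unfolding D_def by linarith
  qed
  have m0: "m 0 = 0" by (simp add: m_def)
  have "real n * D \<le> m n" for n
  proof (induction n)
    case (Suc n)
    then show ?case using step[of n] by (simp add: algebra_simps)
  qed (simp add: m0)
  moreover have "m n \<le> real (card S)" for n
  proof -
    have "m n \<le> (\<Sum>y\<in>S. 1)"
      unfolding m_def by (intro sum_mono expectation_bounds(2)[where a = 0]) (use V in \<open>auto simp: of_bool_def\<close>)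
    then show ?thesis by simp
  qed
  ultimately have *: "real n * D \<le> real (card S)" for n using order_trans by blast
  have "D \<le> 0"
  proof (rule ccontr)
    assume "\<not> D \<le> 0"
    then obtain n where "real (card S) < real n * D" using reals_Archimedean3[of D] by auto
    then show False using *[of n] by linarith
  qed
  then show ?thesis
    using Z_pos[OF S(1)] unfolding D_def
    by (simp add: expectation_wired[OF S(1) abs\<Phi>] expectation_wired[OF S(1) bd] divide_right_mono)
qed

end

section \<open>Paths in the forest\<close>

text \<open>Lists are read towards the root: the arrow of each entry points to the entry before it.\<close>

fun follows :: "('v \<Rightarrow> 'v) \<Rightarrow> 'v list \<Rightarrow> bool" where
  "follows f (a # b # r) \<longleftrightarrow> f b = a \<and> follows f (b # r)"
| "follows f _ \<longleftrightarrow> True"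

fun path_weight :: "('v \<Rightarrow> 'v pmf) \<Rightarrow> 'v list \<Rightarrow> real" where
  "path_weight P (a # b # r) = pmf (P b) a * path_weight P (b # r)"
| "path_weight P _ = 1"

text \<open>Only the vertices whose arrows the path uses must lie in S. The first vertex may be a
  root outside S or a vertex of S with an arrow of its own.\<close>

definition paths :: "'v set \<Rightarrow> nat \<Rightarrow> 'v \<Rightarrow> 'v list set" where
  "paths S n v = {\<gamma>. length \<gamma> = Suc n \<and> hd \<gamma> = v \<and> distinct \<gamma> \<and> set (tl \<gamma>) \<subseteq> S}"

lemma pathsD:
  assumes "\<gamma> \<in> paths S n v"
  shows "length \<gamma> = Suc n" "hd \<gamma> = v" "distinct \<gamma>" "set (tl \<gamma>) \<subseteq> S" "\<gamma> \<noteq> []"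
    "set \<gamma> = insert v (set (tl \<gamma>))" "v \<notin> set (tl \<gamma>)" "finite (set \<gamma>)"
proof -
  show *: "length \<gamma> = Suc n" "hd \<gamma> = v" "distinct \<gamma>" "set (tl \<gamma>) \<subseteq> S" "\<gamma> \<noteq> []"
    using assms by (auto simp: paths_def)
  show "set \<gamma> = insert v (set (tl \<gamma>))" "v \<notin> set (tl \<gamma>)" "finite (set \<gamma>)"
    using *(2,3,5) by (cases \<gamma>; auto)+
qed

lemma finite_paths: "finite S \<Longrightarrow> finite (paths S n v)"
proof (rule finite_subset[OF _ finite_lists_length_eq[of "insert v S" "Suc n"]])
  show "paths S n v \<subseteq> {xs. set xs \<subseteq> insert v S \<and> length xs = Suc n}"
  proof
    fix \<gamma> assume \<gamma>: "\<gamma> \<in> paths S n v"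
    have "set \<gamma> \<subseteq> insert v S" unfolding pathsD(6)[OF \<gamma>] using pathsD(4)[OF \<gamma>] by auto
    then show "\<gamma> \<in> {xs. set xs \<subseteq> insert v S \<and> length xs = Suc n}" using pathsD(1)[OF \<gamma>] by simp
  qed
qed simp

lemma paths_mono: "S \<subseteq> T \<Longrightarrow> paths S n v \<subseteq> paths T n v"
  by (auto simp: paths_def)

lemma path_weight_nonneg: "0 \<le> path_weight P \<gamma>"
  by (induction P \<gamma> rule: path_weight.induct) auto

lemma follows_append: "follows f (xs @ [a, b]) \<longleftrightarrow> follows f (xs @ [a]) \<and> f b = a"
  by (induction f xs rule: follows.induct) auto

lemma path_weight_append: "path_weight P (xs @ [a, b]) = path_weight P (xs @ [a]) * pmf (P b) a"
  by (induction P xs rule: path_weight.induct) auto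

lemma follows_snoc: "\<gamma> \<noteq> [] \<Longrightarrow> follows f (\<gamma> @ [b]) \<longleftrightarrow> follows f \<gamma> \<and> f b = last \<gamma>"
  by (metis append.assoc append_Cons append_Nil append_butlast_last_id follows_append)

lemma follows_split:
  "i < length \<gamma> \<Longrightarrow> follows f \<gamma> \<longleftrightarrow> follows f (take (Suc i) \<gamma>) \<and> follows f (drop i \<gamma>)"
proof (induction f \<gamma> arbitrary: i rule: follows.induct)
  case (1 f a b r)
  then show ?case by (cases i) auto
qed (auto simp: less_Suc_eq_0_disj)

lemma path_weight_split:
  "i < length \<gamma> \<Longrightarrow> path_weight P \<gamma> = path_weight P (take (Suc i) \<gamma>) * path_weight P (drop i \<gamma>)"
proof (induction P \<gamma> arbitrary: i rule: path_weight.induct)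
  case (1 P a b r)
  then show ?case by (cases i) (auto simp: mult.assoc)
qed (auto simp: less_Suc_eq_0_disj)

lemma follows_cong: "(\<And>a. a \<in> set (tl \<gamma>) \<Longrightarrow> f a = g a) \<Longrightarrow> follows f \<gamma> \<longleftrightarrow> follows g \<gamma>"
  by (induction f \<gamma> rule: follows.induct) auto

lemma follows_prev: "follows f \<gamma> \<Longrightarrow> a \<in> set (tl \<gamma>) \<Longrightarrow> f a \<in> set \<gamma>"
  by (induction f \<gamma> rule: follows.induct) auto

lemma follows_nth:
  "follows f \<gamma> \<Longrightarrow> i < length \<gamma> \<Longrightarrow> \<gamma> ! i = (f ^^ (length \<gamma> - 1 - i)) (last \<gamma>)"
proof (induction f \<gamma> arbitrary: i rule: follows.induct)
  case (1 f a b r)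
  show ?case
  proof (cases i)
    case 0
    have "b = (f ^^ length r) (last (b # r))" using 1(1)[of 0] 1(2) by auto
    then show ?thesis using 0 1 by auto
  next
    case (Suc j)
    then show ?thesis using 1(1)[of j] 1(2,3) by auto
  qed
qed auto

text \<open>If one list were longer, iterating the map from the common last vertex would produce the
  common first vertex at two positions of the longer list.\<close>

lemma follows_unique:
  assumes "follows f \<gamma>" "follows f \<gamma>'" "\<gamma> \<noteq> []" "\<gamma>' \<noteq> []" "last \<gamma> = last \<gamma>'" "hd \<gamma> = hd \<gamma>'"
    "distinct \<gamma>" "distinct \<gamma>'"
  shows "\<gamma> = \<gamma>'"
proof -
  have aux: False
    if *: "follows f \<gamma>" "follows f \<gamma>'" "\<gamma> \<noteq> []" "\<gamma>' \<noteq> []" "last \<gamma> = last \<gamma>'" "hd \<gamma> = hd \<gamma>'"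
      "distinct \<gamma>'" "length \<gamma> < length \<gamma>'" for \<gamma> \<gamma>' :: "'a list"
  proof -
    let ?k = "length \<gamma>' - length \<gamma>"
    have "\<gamma> ! 0 = (f ^^ (length \<gamma> - 1)) (last \<gamma>)" using follows_nth[OF *(1), of 0] * by auto
    moreover have "\<gamma>' ! ?k = (f ^^ (length \<gamma>' - 1 - ?k)) (last \<gamma>')"
      using * by (intro follows_nth) (auto simp: diff_less)
    moreover have "length \<gamma>' - 1 - ?k = length \<gamma> - 1" using *(8) by auto
    ultimately have "\<gamma>' ! ?k = \<gamma>' ! 0" using * by (simp add: hd_conv_nth)
    then show False using *(3,4,7,8) by (subst (asm) nth_eq_iff_index_eq) (auto simp: diff_less)
  qed
  have "length \<gamma> = length \<gamma>'"
    using aux[of \<gamma> \<gamma>'] aux[of \<gamma>' \<gamma>] assms by (metis nat_neq_iff)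
  then show ?thesis
    using follows_nth[OF assms(1)] follows_nth[OF assms(2)] assms(5) by (intro nth_equalityI) auto
qed

lemma follows_leads:
  assumes "follows f \<gamma>" "\<gamma> \<noteq> []" "set (tl \<gamma>) \<subseteq> S" "leads S f (hd \<gamma>) y" "a \<in> set \<gamma>"
  shows "leads S f a y"
  using assms
proof (induction f \<gamma> rule: follows.induct)
  case (1 f a' b r)
  have "leads S f b y" using 1 by (auto intro: leads.step)
  then show ?case using 1 by auto
qed auto

lemma leads_path:
  assumes "finite T" "leads T f y x"
  shows "\<exists>\<gamma>. \<gamma> \<noteq> [] \<and> hd \<gamma> = x \<and> last \<gamma> = y \<and> follows f \<gamma> \<and> distinct \<gamma> \<and> set (tl \<gamma>) \<subseteq> T"
  using assms
proof (induction "card T" arbitrary: T y rule: less_induct)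
  case less
  show ?case
  proof (cases "y \<in> T")
    case True
    obtain z where z: "leads (T - {y}) f (f y) z" "leads T f z x"
      using leads_restrict[OF leads_stepD[OF less.prems(2) True], of "T - {y}"] by auto
    have "z \<noteq> y" using leads_cycle[of T y f x] z True less.prems(2) by auto
    then have "z \<notin> T" using leads_notin[OF z(1)] by auto
    then have "z = x" using leads_outside[OF z(2)] by simp
    moreover have "card (T - {y}) < card T" using True less.prems(1) by (intro card_Diff1_less) auto
    ultimately obtain \<gamma> where \<gamma>: "\<gamma> \<noteq> []" "hd \<gamma> = x" "last \<gamma> = f y" "follows f \<gamma>" "distinct \<gamma>"
      "set (tl \<gamma>) \<subseteq> T - {y}" using less.hyps[of "T - {y}" "f y"] less.prems(1) z by auto
    have "x \<notin> T" using leads_notin[OF less.prems(2)] .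
    then have "y \<notin> set \<gamma>" using \<gamma> True by (cases \<gamma>) auto
    then have "hd (\<gamma> @ [y]) = x \<and> last (\<gamma> @ [y]) = y \<and> follows f (\<gamma> @ [y]) \<and> distinct (\<gamma> @ [y]) \<and>
        set (tl (\<gamma> @ [y])) \<subseteq> T"
      using \<gamma> True by (auto simp: follows_snoc)
    then show ?thesis by blast
  next
    case False
    then show ?thesis using leads_outside[OF less.prems(2)] by (intro exI[of _ "[y]"]) auto
  qed
qed

text \<open>Following a path prescribes one arrow for each vertex but the first. In this form the
  event is a rectangle for the product measure.\<close>

lemma follows_assign:
  "distinct \<gamma> \<Longrightarrow> \<exists>g. (\<forall>f. follows f \<gamma> \<longleftrightarrow> (\<forall>a\<in>set (tl \<gamma>). f a = g a)) \<and>
    path_weight P \<gamma> = (\<Prod>a\<in>set (tl \<gamma>). pmf (P a) (g a))"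
proof (induction P \<gamma> rule: path_weight.induct)
  case (1 P a b r)
  then obtain g where g: "\<And>f. follows f (b # r) \<longleftrightarrow> (\<forall>a\<in>set r. f a = g a)"
    "path_weight P (b # r) = (\<Prod>a\<in>set r. pmf (P a) (g a))" by auto
  have "b \<notin> set r" using 1 by auto
  moreover have "(\<Prod>x\<in>set r. pmf (P x) ((g(b := a)) x)) = (\<Prod>x\<in>set r. pmf (P x) (g x))"
    using \<open>b \<notin> set r\<close> by (intro prod.cong) auto
  ultimately show ?case using g by (intro exI[of _ "g(b := a)"]) auto
qed auto

lemma paths_take_drop:
  assumes "\<gamma> \<in> paths S n v" "i \<le> n"
  shows "take (Suc i) \<gamma> \<in> paths S i v" "last (take (Suc i) \<gamma>) = \<gamma> ! i" "hd (drop i \<gamma>) = \<gamma> ! i"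
    "drop i \<gamma> \<in> paths (S - set (take (Suc i) \<gamma>)) (n - i) (\<gamma> ! i)"
    "take (Suc i) \<gamma> @ tl (drop i \<gamma>) = \<gamma>" "last (drop i \<gamma>) = last \<gamma>"
proof -
  note \<gamma> = pathsD[OF assms(1)]
  have len: "i < length \<gamma>" using \<gamma> assms by auto
  obtain r where r: "\<gamma> = v # r" using \<gamma>(2,5) by (cases \<gamma>) auto
  show "take (Suc i) \<gamma> \<in> paths S i v"
    using \<gamma> assms set_take_subset[of i r] by (auto simp: paths_def r)
  show last: "last (take (Suc i) \<gamma>) = \<gamma> ! i" using len by (simp add: take_Suc_conv_app_nth)
  show hd: "hd (drop i \<gamma>) = \<gamma> ! i" using len by (simp add: hd_drop_conv_nth)
  have tl: "tl (drop i \<gamma>) = drop (Suc i) \<gamma>" by (simp add: drop_Suc tl_drop)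
  show "take (Suc i) \<gamma> @ tl (drop i \<gamma>) = \<gamma>" unfolding tl by simp
  have "set (take (Suc i) \<gamma>) \<inter> set (drop (Suc i) \<gamma>) = {}"
    using \<gamma>(3) by (rule set_take_disj_set_drop_if_distinct) simp
  moreover have "set (drop (Suc i) \<gamma>) \<subseteq> S"
    using \<gamma>(4) set_drop_subset[of i r] by (auto simp: r)
  ultimately show "drop i \<gamma> \<in> paths (S - set (take (Suc i) \<gamma>)) (n - i) (\<gamma> ! i)"
    using \<gamma> assms hd tl by (auto simp: paths_def)
  show "last (drop i \<gamma>) = last \<gamma>" using len by simp
qed

lemma paths_join:
  assumes "\<gamma>' \<in> paths S i v" "\<gamma>'' \<in> paths (S - set \<gamma>') m (last \<gamma>')"
  shows "\<gamma>' @ tl \<gamma>'' \<in> paths S (i + m) v" "take (Suc i) (\<gamma>' @ tl \<gamma>'') = \<gamma>'"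
    "drop i (\<gamma>' @ tl \<gamma>'') = \<gamma>''"
proof -
  note a = pathsD[OF assms(1)] and b = pathsD[OF assms(2)]
  show "\<gamma>' @ tl \<gamma>'' \<in> paths S (i + m) v" using a b by (auto simp: paths_def distinct_tl)
  show "take (Suc i) (\<gamma>' @ tl \<gamma>'') = \<gamma>'" using a by simp
  have "drop i \<gamma>' = [last \<gamma>']"
    using a by (metis Cons_nth_drop_Suc diff_Suc_1 drop_all last_conv_nth lessI order_refl)
  then show "drop i (\<gamma>' @ tl \<gamma>'') = \<gamma>''" using a b by (cases \<gamma>'') auto
qed

lemma sum_paths_split:
  assumes "finite S" "i \<le> n"
  shows "(\<Sum>\<gamma>\<in>paths S n v. K (take (Suc i) \<gamma>) (drop i \<gamma>)) =
    (\<Sum>\<gamma>'\<in>paths S i v. \<Sum>\<gamma>''\<in>paths (S - set \<gamma>') (n - i) (last \<gamma>'). K \<gamma>' \<gamma>'')"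
proof -
  have "(\<Sum>\<gamma>'\<in>paths S i v. \<Sum>\<gamma>''\<in>paths (S - set \<gamma>') (n - i) (last \<gamma>'). K \<gamma>' \<gamma>'') =
      (\<Sum>(\<gamma>', \<gamma>'')\<in>Sigma (paths S i v) (\<lambda>\<gamma>'. paths (S - set \<gamma>') (n - i) (last \<gamma>')). K \<gamma>' \<gamma>'')"
    by (rule sum.Sigma) (auto intro: finite_paths assms)
  also have "\<dots> = (\<Sum>\<gamma>\<in>paths S n v. K (take (Suc i) \<gamma>) (drop i \<gamma>))"
  proof (rule sum.reindex_bij_witness[where i = "\<lambda>\<gamma>. (take (Suc i) \<gamma>, drop i \<gamma>)" and j = "\<lambda>(a, b). a @ tl b"])
    fix c assume "c \<in> Sigma (paths S i v) (\<lambda>\<gamma>'. paths (S - set \<gamma>') (n - i) (last \<gamma>'))"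
    then obtain a b where c: "c = (a, b)" "a \<in> paths S i v" "b \<in> paths (S - set a) (n - i) (last a)" by auto
    note j = paths_join[OF c(2,3)]
    show "(take (Suc i) (case c of (a, b) \<Rightarrow> a @ tl b), drop i (case c of (a, b) \<Rightarrow> a @ tl b)) = c"
      using j c by simp
    show "(case c of (a, b) \<Rightarrow> a @ tl b) \<in> paths S n v" using j(1) c assms by simp
    show "K (take (Suc i) (case c of (a, b) \<Rightarrow> a @ tl b)) (drop i (case c of (a, b) \<Rightarrow> a @ tl b)) =
        (case c of (\<gamma>', \<gamma>'') \<Rightarrow> K \<gamma>' \<gamma>'')" using j c by simp
  next
    fix \<gamma> assume "\<gamma> \<in> paths S n v"
    note t = paths_take_drop[OF this assms(2)]
    show "(case (take (Suc i) \<gamma>, drop i \<gamma>) of (a, b) \<Rightarrow> a @ tl b) = \<gamma>" using t by simp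
    show "(take (Suc i) \<gamma>, drop i \<gamma>) \<in> Sigma (paths S i v) (\<lambda>\<gamma>'. paths (S - set \<gamma>') (n - i) (last \<gamma>'))"
      using t by simp
  qed
  finally show ?thesis by simp
qed

lemma sum_prob_disjoint:
  assumes "finite I" "\<And>f i j. f \<in> set_pmf M \<Longrightarrow> i \<in> I \<Longrightarrow> j \<in> I \<Longrightarrow> E i f \<Longrightarrow> E j f \<Longrightarrow> i = j"
  shows "(\<Sum>i\<in>I. measure_pmf.prob M {f. E i f}) = measure_pmf.prob M {f. \<exists>i\<in>I. E i f}"
proof -
  have "measure_pmf.prob M {f. E i f} = measure_pmf.prob M ({f. E i f} \<inter> set_pmf M)" for i
    by (simp add: measure_Int_set_pmf)
  then have "(\<Sum>i\<in>I. measure_pmf.prob M {f. E i f}) = (\<Sum>i\<in>I. measure_pmf.prob M ({f. E i f} \<inter> set_pmf M))" by simp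
  also have "\<dots> = measure_pmf.prob M (\<Union>i\<in>I. {f. E i f} \<inter> set_pmf M)"
    by (rule measure_pmf.finite_measure_finite_Union[symmetric])
       (use assms in \<open>auto simp: disjoint_family_on_def\<close>)
  also have "(\<Union>i\<in>I. {f. E i f} \<inter> set_pmf M) = {f. \<exists>i\<in>I. E i f} \<inter> set_pmf M" by auto
  finally show ?thesis by (simp add: measure_Int_set_pmf)
qed

text \<open>The map may vary with the coordinate, as the other end of an edge depends on the vertex
  from which it is crossed.\<close>

lemma Pi_pmf_map_dep:
  assumes "finite A"
  shows "Pi_pmf A d' (\<lambda>x. map_pmf (t x) (g x)) =
    map_pmf (\<lambda>h x. if x \<in> A then t x (h x) else d') (Pi_pmf A d g)"
  using assms
proof (induction A rule: finite_induct)
  case (insert a A)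
  have "map_pmf (\<lambda>h x. if x \<in> insert a A then t x (h x) else d') (Pi_pmf (insert a A) d g) =
      do {y \<leftarrow> g a; f \<leftarrow> Pi_pmf A d g; return_pmf ((\<lambda>x. if x \<in> A then t x (f x) else d')(a := t a y))}"
    using insert.hyps
    by (subst Pi_pmf_insert')
       (auto simp: map_bind_pmf map_return_pmf fun_eq_iff intro!: bind_pmf_cong arg_cong[where f = return_pmf])
  then show ?case using insert
    by (subst Pi_pmf_insert') (auto simp: bind_map_pmf)
qed (simp add: map_pmf_const)

section \<open>Weights of paths in the forest\<close>

context symmetric_chain
begin

abbreviation pw where "pw \<equiv> path_weight P"

text \<open>The product of the Green functions seen while the vertices of A are removed from S one
  after the other; for A inside S, the determinant of the Green function restricted to A.\<close>

definition decay :: "'v set \<Rightarrow> 'v set \<Rightarrow> real" where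
  "decay S A = Z (S - A) / Z S"

lemma decay_pos: "dom S \<Longrightarrow> 0 < decay S A"
  by (auto simp: decay_def intro!: divide_pos_pos Z_pos)

lemma decay_insert:
  assumes "dom S"
  shows "decay S (insert x A) = decay S A * (if x \<in> S - A then gr (S - A) x x else 1)"
proof (cases "x \<in> S - A")
  case True
  have "S - insert x A = (S - A) - {x}" by auto
  then show ?thesis using Z_remove[of "S - A" x] True assms by (simp add: decay_def dom_diff)
next
  case False
  then have "S - insert x A = S - A" by auto
  then show ?thesis by (simp only: decay_def False if_False mult_1_right)
qed

lemma decay_le_insert:
  assumes "dom S" shows "decay S A \<le> decay S (insert x A)"
  using mult_left_mono[of 1 "gr (S - A) x x" "decay S A"] gr_diag_ge_1[of "S - A" x] assms decay_pos[OF assms, of A]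
  by (auto simp: decay_insert dom_diff)

lemma decay_Un: "dom S \<Longrightarrow> decay S (A \<union> B) = decay S A * decay (S - A) B"
proof -
  assume S: "dom S"
  have "S - (A \<union> B) = S - A - B" by auto
  then show ?thesis using Z_pos[OF dom_diff[OF S, of A]] by (simp add: decay_def)
qed

lemma decay_mono:
  assumes "dom S'" "S \<subseteq> S'" "finite A"
  shows "decay S A \<le> decay S' A"
  using assms(3)
proof (induction A rule: finite_induct)
  case empty
  then show ?case using Z_pos[OF assms(1)] Z_pos[OF dom_mono[OF assms(1,2)]] by (simp add: decay_def)
next
  case (insert x A)
  have S: "dom S" using dom_mono assms by blast
  show ?case
  proof (cases "x \<in> S - A")
    case True
    then have "gr (S - A) x x \<le> gr (S' - A) x x" using assms by (intro gr_mono) auto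
    then have "decay S A * gr (S - A) x x \<le> decay S' A * gr (S' - A) x x"
      using insert.IH True assms S decay_pos[OF assms(1), of A] gr_nonneg[of "S - A" x x]
      by (intro mult_mono) auto
    then show ?thesis using True assms S by (auto simp: decay_insert)
  next
    case False
    then have "decay S (insert x A) = decay S A" by (simp only: decay_insert[OF S] if_False mult_1_right)
    also have "\<dots> \<le> decay S' (insert x A)" using insert.IH decay_le_insert[OF assms(1)] order_trans by blast
    finally show ?thesis .
  qed
qed

text \<open>For a root outside S this is the probability that the path is followed; for a root in S
  the factor \<open>esc\<close> has to be added. For a path inside S it is also the total weight of
  the walks from its last to its first vertex whose loop erasure it is.\<close>

definition wt :: "'v set \<Rightarrow> 'v list \<Rightarrow> real" where
  "wt S \<gamma> = pw \<gamma> * decay S (set \<gamma>)"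

lemma wt_nonneg: "dom S \<Longrightarrow> 0 \<le> wt S \<gamma>"
  using less_imp_le[OF decay_pos[of S]] by (simp add: wt_def path_weight_nonneg)

lemma wt_mono: "dom S' \<Longrightarrow> S \<subseteq> S' \<Longrightarrow> wt S \<gamma> \<le> wt S' \<gamma>"
  unfolding wt_def by (intro mult_left_mono decay_mono path_weight_nonneg) auto

lemma wt_split:
  assumes "dom S" "i < length \<gamma>"
  shows "wt S \<gamma> = wt S (take (Suc i) \<gamma>) * wt (S - set (take (Suc i) \<gamma>)) (drop i \<gamma>)"
proof -
  have "set \<gamma> = set (take (Suc i) \<gamma>) \<union> set (drop (Suc i) \<gamma>)"
    by (metis append_take_drop_id set_append)
  moreover have "set (drop (Suc i) \<gamma>) \<subseteq> set (drop i \<gamma>)" by (simp add: set_drop_subset_set_drop)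
  moreover have "set (drop i \<gamma>) \<subseteq> set \<gamma>" by (rule set_drop_subset)
  ultimately have "set \<gamma> = set (take (Suc i) \<gamma>) \<union> set (drop i \<gamma>)" by blast
  then have "decay S (set \<gamma>) = decay S (set (take (Suc i) \<gamma>)) * decay (S - set (take (Suc i) \<gamma>)) (set (drop i \<gamma>))"
    using decay_Un[OF assms(1)] by simp
  then show ?thesis unfolding wt_def using path_weight_split[OF assms(2), of P] by simp
qed

lemma acyc_follows:
  assumes "follows f \<gamma>" "\<gamma> \<noteq> []" "set (tl \<gamma>) \<subseteq> S" "acyc (S - set \<gamma>) f" "leads S f (hd \<gamma>) y"
  shows "acyc S f"
  unfolding acyc_def
proof
  fix w assume "w \<in> S"
  obtain r where r: "leads (S - set \<gamma>) f w r" using acyc_leads assms(4) by metis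
  show "\<exists>y. leads S f w y"
  proof (cases "r \<in> set \<gamma>")
    case True
    then have "leads S f r y" using follows_leads assms by metis
    then show ?thesis using leads_trans[OF r] by auto
  next
    case False
    then have "r \<notin> S" using leads_notin[OF r] by auto
    then show ?thesis using leads_enlarge[OF r] by auto
  qed
qed

text \<open>Spatial Markov property. The root lies outside S, so a followed path leads out of S and
  cannot meet a cycle; the remaining arrows only have to be acyclic off the path.\<close>

lemma prob_follows:
  assumes S: "dom S" "v \<notin> S" "\<gamma> \<in> paths S n v"
    and E: "\<And>f g. (\<And>x. x \<in> S - set \<gamma> \<Longrightarrow> f x = g x) \<Longrightarrow> E f \<longleftrightarrow> E g"
  shows "measure_pmf.prob (wired S) {f. follows f \<gamma> \<and> E f} =
    wt S \<gamma> * measure_pmf.prob (wired (S - set \<gamma>)) {f. E f}"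
proof -
  note \<gamma> = pathsD[OF S(3)]
  obtain g where g: "\<And>f. follows f \<gamma> \<longleftrightarrow> (\<forall>a\<in>set (tl \<gamma>). f a = g a)"
    "pw \<gamma> = (\<Prod>a\<in>set (tl \<gamma>). p a (g a))" using follows_assign[OF \<gamma>(3), of P] by auto
  have T: "S - set (tl \<gamma>) = S - set \<gamma>" using \<gamma>(6) S by auto
  have ev: "acyc S f \<and> follows f \<gamma> \<and> E f \<longleftrightarrow>
      (\<forall>a\<in>set (tl \<gamma>). f a \<in> {g a}) \<and> (acyc (S - set \<gamma>) f \<and> E f)" for f
    using acyc_follows[of f \<gamma> S v] \<gamma> S(2) acyc_mono[of S f "S - set \<gamma>"] g(1)[of f]
    by (auto intro: leads.stop)
  have "measure_pmf.prob (arrows S) {f. acyc S f \<and> follows f \<gamma> \<and> E f} =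
      (\<Prod>a\<in>set (tl \<gamma>). measure_pmf.prob (P a) {g a}) *
      measure_pmf.prob (arrows (S - set (tl \<gamma>))) {f. acyc (S - set \<gamma>) f \<and> E f}"
    unfolding ev
  proof (rule prob_Pi_pmf_split)
    show "finite S" "set (tl \<gamma>) \<subseteq> S" using S \<gamma> by (auto simp: domD)
    fix f h :: "'v \<Rightarrow> 'v" assume "\<And>x. x \<in> S - set (tl \<gamma>) \<Longrightarrow> f x = h x"
    then have eq: "\<And>x. x \<in> S - set \<gamma> \<Longrightarrow> f x = h x" using T by simp
    show "(acyc (S - set \<gamma>) f \<and> E f) \<longleftrightarrow> (acyc (S - set \<gamma>) h \<and> E h)"
    proof -
      have "acyc (S - set \<gamma>) f \<longleftrightarrow> acyc (S - set \<gamma>) h" by (rule acyc_cong) (rule eq)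
      moreover have "E f \<longleftrightarrow> E h" by (rule E) (rule eq)
      ultimately show ?thesis by simp
    qed
  qed
  then show ?thesis
    unfolding prob_wired[OF S(1)] prob_wired[OF dom_diff[OF S(1)]] T
    using Z_pos[OF dom_diff[OF S(1), of "set \<gamma>"]] Z_pos[OF S(1)]
    by (simp add: wt_def decay_def g(2) pmf.rep_eq)
qed

text \<open>Given the first step w from y, the orbit of w enters A with conditional probability
  \<open>meet S A w\<close>, as \<open>prob_leads\<close> shows for each possible entrance.\<close>

lemma prob_escape:
  assumes S: "dom S" "A \<subseteq> S" "y \<in> A"
  shows "measure_pmf.prob (arrows (insert y (S - A)))
      {f. acyc (S - A) f \<and> (\<exists>r. leads (S - A) f (f y) r \<and> r \<notin> A)} = Z (S - A) * esc S A y"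
proof -
  let ?T = "S - A"
  have T: "dom ?T" "finite ?T" "y \<notin> ?T" "finite A" using S by (auto simp: domD intro: finite_subset)
  let ?E = "\<lambda>w f. acyc ?T f \<and> (\<exists>r. leads ?T f w r \<and> r \<notin> A)"
  have upd: "?E w (f(y := w')) \<longleftrightarrow> ?E w f" for w w' f
  proof -
    have eq: "\<And>x. x \<in> ?T \<Longrightarrow> (f(y := w')) x = f x" using T by auto
    have "acyc ?T (f(y := w')) \<longleftrightarrow> acyc ?T f" by (rule acyc_cong) (rule eq)
    moreover have "leads ?T (f(y := w')) w r \<longleftrightarrow> leads ?T f w r" for w r by (rule leads_cong') (rule eq)
    ultimately show ?thesis by simp
  qed
  have e: "measure_pmf.prob (arrows ?T) {f. ?E w f} = Z ?T * (1 - meet S A w)" for w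
  proof -
    have "(\<Sum>a\<in>A. measure_pmf.prob (arrows ?T) {f. acyc ?T f \<and> leads ?T f w a}) =
        measure_pmf.prob (arrows ?T) {f. \<exists>a\<in>A. acyc ?T f \<and> leads ?T f w a}"
      by (rule sum_prob_disjoint) (use T leads_det in auto)
    moreover have "(\<Sum>a\<in>A. measure_pmf.prob (arrows ?T) {f. acyc ?T f \<and> leads ?T f w a}) = Z ?T * meet S A w"
      unfolding meet_def sum_distrib_left by (intro sum.cong refl prob_leads) (use T in auto)
    moreover have "Z ?T = measure_pmf.prob (arrows ?T) {f. ?E w f} +
        measure_pmf.prob (arrows ?T) {f. \<exists>a\<in>A. acyc ?T f \<and> leads ?T f w a}"
    proof -
      have "{f. acyc ?T f} = {f. ?E w f} \<union> {f. \<exists>a\<in>A. acyc ?T f \<and> leads ?T f w a}"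
        using acyc_leads[of ?T _ w] by blast
      moreover have "{f. ?E w f} \<inter> {f. \<exists>a\<in>A. acyc ?T f \<and> leads ?T f w a} = {}"
        by (auto dest: leads_det)
      ultimately show ?thesis unfolding Z_def
        by (simp only:) (rule measure_pmf.finite_measure_Union, auto)
    qed
    ultimately show ?thesis by (simp add: algebra_simps)
  qed
  have "measure_pmf.prob (arrows (insert y ?T)) {f. ?E (f y) f} =
      measure_pmf.expectation (do {w \<leftarrow> P y; f \<leftarrow> arrows ?T; return_pmf (f(y := w))}) (\<lambda>f. of_bool (?E (f y) f))"
    by (subst Pi_pmf_insert'[symmetric]) (use T in \<open>auto simp: expectation_of_bool\<close>)
  also have "\<dots> = measure_pmf.expectation (P y) (\<lambda>w. measure_pmf.expectation (arrows ?T) (\<lambda>f. of_bool (?E w (f(y := w)))))"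
    by (subst expectation_bind_bounded[where K = 1], simp,
        subst expectation_bind_bounded[where K = 1]) auto
  also have "\<dots> = measure_pmf.expectation (P y) (\<lambda>w. Z ?T * (1 - meet S A w))"
    by (simp only: upd expectation_of_bool e)
  also have "\<dots> = Z ?T * measure_pmf.expectation (P y) (\<lambda>w. 1 - meet S A w)" by simp
  also have "measure_pmf.expectation (P y) (\<lambda>w. 1 - meet S A w) = 1 - measure_pmf.expectation (P y) (\<lambda>w. meet S A w)"
  proof -
    have "integrable (measure_pmf (P y)) (meet S A)"
      by (rule integrable_pmf_bounded[of _ 1]) (use meet_nonneg[OF S(1)] meet_le_1[OF S(1,2)] in auto)
    then show ?thesis by simp
  qed
  also have "measure_pmf.expectation (P y) (\<lambda>w. meet S A w) = (\<Sum>w\<in>S. p y w * meet S A w)"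
    by (subst integral_measure_pmf_real[of S])
       (use S meet_out[OF S(1,2)] in \<open>auto simp: domD mult.commute\<close>)
  finally show ?thesis by (simp add: esc_def)
qed

text \<open>
  Arrows may carry more information than their target, such as the edge that is used.
\<close>

lemma prob_follows_escape:
  fixes q :: "'v \<Rightarrow> 'a pmf" and tgt :: "'v \<Rightarrow> 'a \<Rightarrow> 'v"
  assumes S: "dom S" "set \<gamma> \<subseteq> S" "distinct \<gamma>" "\<gamma> \<noteq> []"
    and q: "\<And>u. u \<in> S \<Longrightarrow> map_pmf (tgt u) (q u) = P u"
    and B: "\<And>f. (\<And>a. a \<in> set (tl \<gamma>) \<Longrightarrow> f a \<in> B a) \<Longrightarrow> follows (\<lambda>u. tgt u (f u)) \<gamma>"
  shows "measure_pmf.prob (Pi_pmf S d q)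
      {f. acyc S (\<lambda>u. tgt u (f u)) \<and> (\<forall>a\<in>set (tl \<gamma>). f a \<in> B a)} =
    (\<Prod>a\<in>set (tl \<gamma>). measure_pmf.prob (q a) (B a)) * (Z (S - set \<gamma>) * esc S (set \<gamma>) (hd \<gamma>))"
proof -
  let ?T = "S - set \<gamma>" and ?y = "hd \<gamma>"
  define E where "E F = (acyc ?T F \<and> (\<exists>r. leads ?T F (F ?y) r \<and> r \<notin> set \<gamma>))" for F
  have y: "?y \<in> set \<gamma>" "?y \<in> S" using S by auto
  have T: "S - set (tl \<gamma>) = insert ?y ?T" using S by (cases \<gamma>) auto
  have Econg: "E F \<longleftrightarrow> E F'" if "\<And>x. x \<in> insert ?y ?T \<Longrightarrow> F x = F' x" for F F'
  proof -
    have eq: "\<And>x. x \<in> ?T \<Longrightarrow> F x = F' x" using that by simp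
    have "acyc ?T F \<longleftrightarrow> acyc ?T F'" by (rule acyc_cong) (rule eq)
    moreover have "leads ?T F w r \<longleftrightarrow> leads ?T F' w r" for w r by (rule leads_cong') (rule eq)
    ultimately show ?thesis unfolding E_def using that[of ?y] by simp
  qed
  have ev: "acyc S (\<lambda>u. tgt u (f u)) \<and> (\<forall>a\<in>set (tl \<gamma>). f a \<in> B a) \<longleftrightarrow>
      (\<forall>a\<in>set (tl \<gamma>). f a \<in> B a) \<and> E (\<lambda>u. tgt u (f u))" for f
  proof (cases "\<forall>a\<in>set (tl \<gamma>). f a \<in> B a")
    case True
    let ?F = "\<lambda>u. tgt u (f u)"
    have fol: "follows ?F \<gamma>" using B[of f] True by auto
    have tl: "set (tl \<gamma>) \<subseteq> S" using S(2,4) by (cases \<gamma>) auto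
    \<comment> \<open>The first vertex of the path has an arrow of its own. If the orbit along it
      returned to the path, it would be carried back to that vertex and close a cycle.\<close>
    have "acyc S ?F \<longleftrightarrow> E ?F"
    proof
      assume ac: "acyc S ?F"
      then obtain r where r: "leads S ?F ?y r" using acyc_leads by metis
      then have r': "leads S ?F (?F ?y) r" using leads_stepD y by metis
      obtain z where z: "leads ?T ?F (?F ?y) z" "leads S ?F z r"
        using leads_restrict[OF r', of ?T] by auto
      have "z \<notin> set \<gamma>"
      proof
        assume "z \<in> set \<gamma>"
        have "leads S ?F (?F ?y) ?y \<or> True" by simp
        obtain s where s: "leads (S - {?y}) ?F (?F ?y) s" "leads S ?F s r"
          using leads_restrict[OF r', of "S - {?y}"] by auto
        have "leads (S - {?y}) ?F z ?y"
          by (rule follows_leads[OF fol S(4) _ _ \<open>z \<in> set \<gamma>\<close>])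
             (use S(2-4) in \<open>cases \<gamma>, auto intro: leads.stop\<close>)
        then have "leads (S - {?y}) ?F (?F ?y) ?y"
          using leads_trans[OF z(1), of "S - {?y}"] y by auto
        then show False using leads_cycle[of S ?y ?F r] y r by auto
      qed
      then show "E ?F" using z acyc_mono[OF ac] by (auto simp: E_def)
    next
      assume "E ?F"
      then obtain r where r: "acyc ?T ?F" "leads ?T ?F (?F ?y) r" "r \<notin> set \<gamma>" by (auto simp: E_def)
      then have "r \<notin> S" using leads_notin[OF r(2)] by auto
      then have "leads S ?F (?F ?y) r" using leads_enlarge[OF r(2)] by auto
      then have "leads S ?F ?y r" using y by (auto intro: leads.step)
      then show "acyc S ?F" using acyc_follows[OF fol S(4) tl r(1)] by auto
    qed
    then show ?thesis using True by auto
  qed auto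
  have "measure_pmf.prob (Pi_pmf S d q)
      {f. acyc S (\<lambda>u. tgt u (f u)) \<and> (\<forall>a\<in>set (tl \<gamma>). f a \<in> B a)} =
    (\<Prod>a\<in>set (tl \<gamma>). measure_pmf.prob (q a) (B a)) *
    measure_pmf.prob (Pi_pmf (S - set (tl \<gamma>)) d q) {f. E (\<lambda>u. tgt u (f u))}"
    unfolding ev
  proof (rule prob_Pi_pmf_split)
    show "finite S" "set (tl \<gamma>) \<subseteq> S" using S by (cases \<gamma>; auto simp: domD)+
    fix f h :: "'v \<Rightarrow> 'a" assume "\<And>x. x \<in> S - set (tl \<gamma>) \<Longrightarrow> f x = h x"
    then show "E (\<lambda>u. tgt u (f u)) \<longleftrightarrow> E (\<lambda>u. tgt u (h u))" unfolding T by (intro Econg) simp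
  qed
  also have "measure_pmf.prob (Pi_pmf (S - set (tl \<gamma>)) d q) {f. E (\<lambda>u. tgt u (f u))} =
      measure_pmf.prob (arrows (insert ?y ?T)) {f. E f}"
  proof -
    have "arrows (insert ?y ?T) = Pi_pmf (insert ?y ?T) undefined (\<lambda>u. map_pmf (tgt u) (q u))"
      by (rule Pi_pmf_cong) (use q y in auto)
    also have "\<dots> = map_pmf (\<lambda>h x. if x \<in> insert ?y ?T then tgt x (h x) else undefined) (Pi_pmf (insert ?y ?T) d q)"
      by (rule Pi_pmf_map_dep) (use S in \<open>auto simp: domD\<close>)
    finally have "measure_pmf.prob (arrows (insert ?y ?T)) {f. E f} =
        measure_pmf.prob (Pi_pmf (insert ?y ?T) d q) {h. E (\<lambda>x. if x \<in> insert ?y ?T then tgt x (h x) else undefined)}"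
      by simp
    also have "\<dots> = measure_pmf.prob (Pi_pmf (insert ?y ?T) d q) {h. E (\<lambda>x. tgt x (h x))}"
      by (intro arg_cong2[where f = measure_pmf.prob] refl Collect_cong Econg) auto
    finally show ?thesis unfolding T by simp
  qed
  also have "\<dots> = Z ?T * esc S (set \<gamma>) ?y"
    unfolding E_def using prob_escape[OF S(1,2) y(1)] by simp
  finally show ?thesis .
qed

end

section \<open>First moments\<close>

lemma follows_unique_length:
  assumes "follows f \<gamma>" "follows f \<gamma>'" "length \<gamma> = length \<gamma>'" "last \<gamma> = last \<gamma>'"
  shows "\<gamma> = \<gamma>'"
  using follows_nth[OF assms(1)] follows_nth[OF assms(2)] assms by (intro nth_equalityI) auto

lemma path_weight_map:
  "(\<And>u w. u \<in> set \<gamma> \<Longrightarrow> w \<in> set \<gamma> \<Longrightarrow> pmf (P (\<phi> u)) (\<phi> w) = pmf (P u) w) \<Longrightarrow>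
    path_weight P (map \<phi> \<gamma>) = path_weight P \<gamma>"
  by (induction P \<gamma> rule: path_weight.induct) auto

definition all_paths :: "'v set \<Rightarrow> nat \<Rightarrow> 'v \<Rightarrow> 'v list set" where
  "all_paths S N v = (\<Union>n<N. paths S n v)"

lemma finite_all_paths: "finite S \<Longrightarrow> finite (all_paths S N v)"
  by (auto simp: all_paths_def finite_paths)

lemma sum_all_paths:
  "finite S \<Longrightarrow> (\<Sum>\<gamma>\<in>all_paths S N v. F \<gamma>) = (\<Sum>n<N. \<Sum>\<gamma>\<in>paths S n v. F \<gamma>)"
  unfolding all_paths_def
proof (rule sum.UNION_disjoint)
  show "\<forall>i\<in>{..<N}. \<forall>j\<in>{..<N}. i \<noteq> j \<longrightarrow> paths S i v \<inter> paths S j v = {}"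
    by (auto simp: paths_def)
qed (auto simp: finite_paths)

lemma paths_last_in: "\<gamma> \<in> paths S n v \<Longrightarrow> v \<in> S \<or> 0 < n \<Longrightarrow> last \<gamma> \<in> S"
proof -
  assume a: "\<gamma> \<in> paths S n v" "v \<in> S \<or> 0 < n"
  show "last \<gamma> \<in> S"
  proof (cases n)
    case 0
    then show ?thesis using a pathsD[OF a(1)] by (cases \<gamma>) auto
  next
    case (Suc m)
    then have "tl \<gamma> \<noteq> []" using pathsD(1)[OF a(1)] by (cases \<gamma>) auto
    then have "last \<gamma> \<in> set (tl \<gamma>)" using last_in_set[of "tl \<gamma>"] by (simp add: last_tl)
    then show ?thesis using pathsD(4)[OF a(1)] by auto
  qed
qed

section \<open>Sums over paths and Green functions\<close>

context symmetric_chain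
begin

lemma pw_rev: "set \<gamma> \<subseteq> V \<Longrightarrow> pw (rev \<gamma>) = pw \<gamma>"
proof (induction \<gamma> rule: induct_list012)
  case (3 a b r)
  have "pw (rev (a # b # r)) = pw (rev r @ [b, a])" by simp
  also have "\<dots> = pw (rev (b # r)) * p a b" by (simp only: path_weight_append rev.simps)
  also have "\<dots> = pw (a # b # r)" using 3 by (simp add: sym)
  finally show ?case .
qed auto

lemma prob_follows_wt:
  "dom S \<Longrightarrow> v \<notin> S \<Longrightarrow> \<gamma> \<in> paths S n v \<Longrightarrow> measure_pmf.prob (wired S) {f. follows f \<gamma>} = wt S \<gamma>"
  using prob_follows[of S v \<gamma> n "\<lambda>_. True"] by simp

lemma prob_follows_esc:
  assumes "dom S" "set \<gamma> \<subseteq> S" "distinct \<gamma>" "\<gamma> \<noteq> []"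
  shows "measure_pmf.prob (wired S) {f. follows f \<gamma>} = wt S \<gamma> * esc S (set \<gamma>) (hd \<gamma>)"
proof -
  obtain g where g: "\<And>f. follows f \<gamma> \<longleftrightarrow> (\<forall>a\<in>set (tl \<gamma>). f a = g a)"
    "pw \<gamma> = (\<Prod>a\<in>set (tl \<gamma>). p a (g a))" using follows_assign[OF assms(3), of P] by auto
  have "measure_pmf.prob (arrows S) {f. acyc S (\<lambda>u. f u) \<and> (\<forall>a\<in>set (tl \<gamma>). f a \<in> {g a})} =
      (\<Prod>a\<in>set (tl \<gamma>). measure_pmf.prob (P a) {g a}) * (Z (S - set \<gamma>) * esc S (set \<gamma>) (hd \<gamma>))"
    by (rule prob_follows_escape[where tgt = "\<lambda>u a. a", OF assms]) (use g in \<open>auto simp: map_pmf_ident\<close>)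
  then show ?thesis
    unfolding prob_wired[OF assms(1)] g(1) wt_def decay_def g(2) by (simp add: pmf.rep_eq)
qed

lemma wt_rev: "dom S \<Longrightarrow> set \<gamma> \<subseteq> S \<Longrightarrow> wt S (rev \<gamma>) = wt S \<gamma>"
  using pw_rev[of \<gamma>] by (auto simp: wt_def dest: domD)

text \<open>By symmetry the weights may be read backwards. The reversed paths are the possible
  initial pieces of length n of the orbit of v, and an orbit has only one.\<close>

lemma future_sum_le_1:
  assumes S: "dom S" "v \<in> S"
  shows "(\<Sum>\<gamma>\<in>paths S n v. wt S \<gamma> * esc S (set \<gamma>) (last \<gamma>)) \<le> 1"
proof -
  have "wt S \<gamma> * esc S (set \<gamma>) (last \<gamma>) = measure_pmf.prob (wired S) {f. follows f (rev \<gamma>)}"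
    if "\<gamma> \<in> paths S n v" for \<gamma>
  proof -
    note \<gamma> = pathsD[OF that]
    have "set \<gamma> \<subseteq> S" using \<gamma> S by auto
    then show ?thesis
      using prob_follows_esc[of S "rev \<gamma>"] \<gamma> S wt_rev[of S \<gamma>] by (simp add: hd_rev)
  qed
  then have "(\<Sum>\<gamma>\<in>paths S n v. wt S \<gamma> * esc S (set \<gamma>) (last \<gamma>)) =
      (\<Sum>\<gamma>\<in>paths S n v. measure_pmf.prob (wired S) {f. follows f (rev \<gamma>)})" by simp
  also have "\<dots> = measure_pmf.prob (wired S) {f. \<exists>\<gamma>\<in>paths S n v. follows f (rev \<gamma>)}"
  proof (rule sum_prob_disjoint)
    show "finite (paths S n v)" using S by (simp add: finite_paths domD)
    fix f \<gamma> \<gamma>' assume "\<gamma> \<in> paths S n v" "\<gamma>' \<in> paths S n v" "follows f (rev \<gamma>)" "follows f (rev \<gamma>')"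
    then show "\<gamma> = \<gamma>'"
      using follows_unique_length[of f "rev \<gamma>" "rev \<gamma>'"] by (simp add: paths_def last_rev)
  qed
  also have "\<dots> \<le> 1" by simp
  finally show ?thesis .
qed

text \<open>With x made the root, the paths ending at y are disjoint events that together say that y
  leads to x; the factor \<open>gr S x x\<close> restores the arrow of x. Paths have distinct
  vertices and thus fewer than \<open>card S\<close> steps, which gives equality for large
  N.\<close>

lemma green_paths_aux:
  assumes S: "dom S" "x \<in> S" "y \<in> S"
  shows "(\<Sum>\<gamma>\<in>{\<gamma> \<in> all_paths S N x. last \<gamma> = y}. wt S \<gamma>) \<le> gr S y x"
    and "card S \<le> N \<Longrightarrow> (\<Sum>\<gamma>\<in>{\<gamma> \<in> all_paths S N x. last \<gamma> = y}. wt S \<gamma>) = gr S y x"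
proof -
  let ?T = "S - {x}"
  let ?I = "{\<gamma> \<in> all_paths S N x. last \<gamma> = y}"
  have T: "dom ?T" "x \<notin> ?T" "finite ?T" using S by (auto simp: domD)
  have in_T: "\<exists>n<N. \<gamma> \<in> paths ?T n x" if mem: "\<gamma> \<in> all_paths S N x" for \<gamma>
  proof -
    obtain n where n: "n < N" "\<gamma> \<in> paths S n x" using mem by (auto simp: all_paths_def)
    then have "\<gamma> \<in> paths ?T n x" using pathsD[OF n(2)] by (auto simp: paths_def)
    then show ?thesis using n by auto
  qed
  have wt: "wt S \<gamma> = measure_pmf.prob (wired ?T) {f. follows f \<gamma>} * gr S x x" if mem: "\<gamma> \<in> all_paths S N x" for \<gamma>
  proof -
    obtain n where n: "\<gamma> \<in> paths ?T n x" using in_T[OF mem] by auto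
    have "?T - set \<gamma> = S - set \<gamma>" using pathsD[OF n] by auto
    then have "wt S \<gamma> = wt ?T \<gamma> * gr S x x"
      using Z_remove[OF S(1,2)] Z_pos[OF S(1)] gr_diag_ge_1[OF S(1,2)]
      by (simp add: wt_def decay_def field_simps)
    then show ?thesis using prob_follows_wt[OF T(1,2) n] by simp
  qed
  have green: "gr S y x = measure_pmf.prob (wired ?T) {f. leads ?T f y x} * gr S x x"
  proof -
    have "Z S * gr S y x = measure_pmf.prob (arrows S) {f. acyc ?T f \<and> leads ?T f y x}"
      using prob_walker[OF S(1,3,2)] S by (simp add: walker_def)
    also have "\<dots> = measure_pmf.prob (arrows ?T) {f. acyc ?T f \<and> leads ?T f y x}"
    proof (rule prob_Pi_pmf_subset)
      fix f g :: "'v \<Rightarrow> 'v" assume eq: "\<And>u. u \<in> ?T \<Longrightarrow> f u = g u"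
      have "acyc ?T f \<longleftrightarrow> acyc ?T g" by (rule acyc_cong) (rule eq)
      moreover have "leads ?T f y x \<longleftrightarrow> leads ?T g y x" by (rule leads_cong') (rule eq)
      ultimately show "(acyc ?T f \<and> leads ?T f y x) \<longleftrightarrow> (acyc ?T g \<and> leads ?T g y x)" by simp
    qed (use S in \<open>auto simp: domD\<close>)
    also have "\<dots> = measure_pmf.prob (wired ?T) {f. leads ?T f y x} * Z ?T"
      using Z_pos[OF T(1)] by (simp add: prob_wired[OF T(1)])
    finally show ?thesis using Z_remove[OF S(1,2)] Z_pos[OF S(1)] by (simp add: field_simps)
  qed
  have sum: "(\<Sum>\<gamma>\<in>?I. wt S \<gamma>) = measure_pmf.prob (wired ?T) {f. \<exists>\<gamma>\<in>?I. follows f \<gamma>} * gr S x x"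
  proof -
    have "(\<Sum>\<gamma>\<in>?I. wt S \<gamma>) = (\<Sum>\<gamma>\<in>?I. measure_pmf.prob (wired ?T) {f. follows f \<gamma>}) * gr S x x"
      by (simp add: sum_distrib_right wt)
    also have "(\<Sum>\<gamma>\<in>?I. measure_pmf.prob (wired ?T) {f. follows f \<gamma>}) =
        measure_pmf.prob (wired ?T) {f. \<exists>\<gamma>\<in>?I. follows f \<gamma>}"
    proof (rule sum_prob_disjoint)
      show "finite ?I" using finite_all_paths[of S N x] S by (simp add: domD)
      fix f \<gamma> \<gamma>' assume "\<gamma> \<in> ?I" "\<gamma>' \<in> ?I" "follows f \<gamma>" "follows f \<gamma>'"
      then show "\<gamma> = \<gamma>'"
        by (intro follows_unique[of f]) (auto simp: all_paths_def dest: pathsD)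
    qed
    finally show ?thesis .
  qed
  have to_leads: "leads ?T f y x" if "\<gamma> \<in> ?I" "follows f \<gamma>" for \<gamma> f
  proof -
    obtain n where n: "\<gamma> \<in> paths ?T n x" using in_T[of \<gamma>] \<open>\<gamma> \<in> ?I\<close> by auto
    show ?thesis
      by (rule follows_leads[OF that(2)]) (use pathsD[OF n] that in \<open>auto intro: leads.stop\<close>)
  qed
  have gx: "0 \<le> gr S x x" by (rule gr_nonneg[OF S(1,2,2)])
  show "(\<Sum>\<gamma>\<in>?I. wt S \<gamma>) \<le> gr S y x"
    unfolding sum green
    by (intro mult_right_mono gx measure_pmf.finite_measure_mono) (use to_leads in auto)
  show "(\<Sum>\<gamma>\<in>?I. wt S \<gamma>) = gr S y x" if N: "card S \<le> N"
  proof -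
    have "{f. \<exists>\<gamma>\<in>?I. follows f \<gamma>} = {f. leads ?T f y x}"
    proof (intro equalityI subsetI)
      fix f assume "f \<in> {f. leads ?T f y x}"
      then obtain \<gamma> where \<gamma>: "\<gamma> \<noteq> []" "hd \<gamma> = x" "last \<gamma> = y" "follows f \<gamma>" "distinct \<gamma>" "set (tl \<gamma>) \<subseteq> ?T"
        using leads_path[OF T(3)] by blast
      have "set \<gamma> \<subseteq> S" using \<gamma> S by (cases \<gamma>) auto
      then have "length \<gamma> \<le> card S"
        using \<gamma>(5) S by (metis card_mono distinct_card domD(1))
      then have "length \<gamma> - 1 < N" using N \<gamma>(1) by (cases \<gamma>) auto
      moreover have "\<gamma> \<in> paths S (length \<gamma> - 1) x" using \<gamma> by (auto simp: paths_def)
      ultimately show "f \<in> {f. \<exists>\<gamma>\<in>?I. follows f \<gamma>}" using \<gamma> by (auto simp: all_paths_def)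
    qed (use to_leads in auto)
    then show ?thesis unfolding sum green by simp
  qed
qed

lemma green_paths:
  assumes S: "dom S" "x \<in> S" and h: "\<And>y. y \<in> S \<Longrightarrow> 0 \<le> h y"
  shows "(\<Sum>n<N. \<Sum>\<gamma>\<in>paths S n x. wt S \<gamma> * h (last \<gamma>)) \<le> (\<Sum>y\<in>S. gr S y x * h y)"
    and "card S \<le> N \<Longrightarrow>
      (\<Sum>n<N. \<Sum>\<gamma>\<in>paths S n x. wt S \<gamma> * h (last \<gamma>)) = (\<Sum>y\<in>S. gr S y x * h y)"
proof -
  have fin: "finite S" using S by (simp add: domD)
  have "(\<Sum>n<N. \<Sum>\<gamma>\<in>paths S n x. wt S \<gamma> * h (last \<gamma>)) = (\<Sum>\<gamma>\<in>all_paths S N x. wt S \<gamma> * h (last \<gamma>))"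
    by (rule sum_all_paths[OF fin, symmetric])
  also have "\<dots> = (\<Sum>y\<in>S. \<Sum>\<gamma>\<in>{\<gamma> \<in> all_paths S N x. last \<gamma> = y}. wt S \<gamma> * h (last \<gamma>))"
    by (rule sum.group[symmetric])
       (use fin S in \<open>auto simp: finite_paths all_paths_def dest: paths_last_in\<close>)
  also have "\<dots> = (\<Sum>y\<in>S. (\<Sum>\<gamma>\<in>{\<gamma> \<in> all_paths S N x. last \<gamma> = y}. wt S \<gamma>) * h y)"
    by (simp add: sum_distrib_right)
  finally have *: "(\<Sum>n<N. \<Sum>\<gamma>\<in>paths S n x. wt S \<gamma> * h (last \<gamma>)) =
      (\<Sum>y\<in>S. (\<Sum>\<gamma>\<in>{\<gamma> \<in> all_paths S N x. last \<gamma> = y}. wt S \<gamma>) * h y)" .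
  show "(\<Sum>n<N. \<Sum>\<gamma>\<in>paths S n x. wt S \<gamma> * h (last \<gamma>)) \<le> (\<Sum>y\<in>S. gr S y x * h y)"
    unfolding * by (intro sum_mono mult_right_mono green_paths_aux(1)[OF S] h)
  show "card S \<le> N \<Longrightarrow>
      (\<Sum>n<N. \<Sum>\<gamma>\<in>paths S n x. wt S \<gamma> * h (last \<gamma>)) = (\<Sum>y\<in>S. gr S y x * h y)"
    unfolding * by (intro sum.cong refl arg_cong2[where f = "(*)"] green_paths_aux(2)[OF S]) auto
qed

definition fm :: "'v set \<Rightarrow> nat \<Rightarrow> 'v \<Rightarrow> real" where
  "fm S n v = (\<Sum>\<gamma>\<in>paths S n v. wt S \<gamma>)"

text \<open>The part of the bubble sum in which the loop-erased connection from x has l steps and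
  the way back is free. Over all l these parts make up a sum of squares of the Green
  function.\<close>

definition bt :: "'v set \<Rightarrow> nat \<Rightarrow> 'v \<Rightarrow> real" where
  "bt S l x = (\<Sum>\<gamma>\<in>paths S l x. wt S \<gamma> * gr S x (last \<gamma>))"

lemma fm_nonneg: "dom S \<Longrightarrow> 0 \<le> fm S n v"
  by (simp add: fm_def sum_nonneg wt_nonneg)

lemma fm_mono: "dom S' \<Longrightarrow> S \<subseteq> S' \<Longrightarrow> fm S n v \<le> fm S' n v"
proof -
  assume S: "dom S'" "S \<subseteq> S'"
  have "fm S n v \<le> (\<Sum>\<gamma>\<in>paths S n v. wt S' \<gamma>)"
    unfolding fm_def by (intro sum_mono wt_mono S)
  also have "\<dots> \<le> fm S' n v"
    unfolding fm_def by (intro sum_mono2 finite_paths paths_mono wt_nonneg) (use S in \<open>auto simp: domD\<close>)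
  finally show ?thesis .
qed

lemma bt_nonneg: "dom S \<Longrightarrow> x \<in> S \<Longrightarrow> 0 \<le> bt S l x"
  unfolding bt_def by (intro sum_nonneg mult_nonneg_nonneg wt_nonneg gr_nonneg) (auto dest: paths_last_in)

lemma bt_mono:
  assumes S: "dom S'" "S \<subseteq> S'" "x \<in> S"
  shows "bt S l x \<le> bt S' l x"
proof -
  have "dom S" using S dom_mono by blast
  then have "bt S l x \<le> (\<Sum>\<gamma>\<in>paths S l x. wt S' \<gamma> * gr S' x (last \<gamma>))"
    unfolding bt_def
    by (intro sum_mono mult_mono wt_mono gr_mono S wt_nonneg gr_nonneg) (use S in \<open>auto dest: paths_last_in\<close>)
  also have "\<dots> \<le> bt S' l x"
    unfolding bt_def
    by (intro sum_mono2 finite_paths paths_mono mult_nonneg_nonneg wt_nonneg gr_nonneg)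
       (use S in \<open>auto simp: domD dest: paths_last_in\<close>)
  finally show ?thesis .
qed

lemma bt_sum_le_bubble:
  assumes "dom S" "x \<in> S"
  shows "(\<Sum>l<N. bt S l x) \<le> bubble"
proof -
  have "(\<Sum>l<N. bt S l x) \<le> (\<Sum>y\<in>S. gr S y x * gr S x y)"
    unfolding bt_def by (rule green_paths(1)[OF assms]) (rule gr_nonneg[OF assms])
  also have "\<dots> = (\<Sum>y\<in>S. gr S x y * gr S y x)" by (simp add: mult.commute)
  finally show ?thesis using green_square_le_bubble[OF assms] by linarith
qed

lemma bt_le_bubble: "dom S \<Longrightarrow> x \<in> S \<Longrightarrow> bt S l x \<le> bubble"
  using bt_sum_le_bubble[of S x "Suc l"] sum_nonneg[of "{..<l}" "\<lambda>l. bt S l x"] bt_nonneg[of S x] by simp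

text \<open>
  Decomposing the walk from the last vertex of a path according to its last visit to the path
  bounds the first moment, since the piece up to the visited vertex is then an initial piece of
  the future of \<open>v\<close>.
\<close>

lemma fm_le_sum:
  assumes S: "dom S" "v \<in> S" and \<beta>: "\<And>x l. x \<in> S \<Longrightarrow> bt S l x \<le> \<beta> l"
  shows "fm S n v \<le> (\<Sum>i\<le>n. \<beta> (n - i))"
proof -
  have fin: "finite S" using S by (simp add: domD)
  let ?K = "\<lambda>\<gamma>' \<gamma>''. (wt S \<gamma>' * esc S (set \<gamma>') (last \<gamma>')) * (wt S \<gamma>'' * gr S (hd \<gamma>'') (last \<gamma>''))"
  have "wt S \<gamma> \<le> (\<Sum>i\<le>n. ?K (take (Suc i) \<gamma>) (drop i \<gamma>))" if \<gamma>: "\<gamma> \<in> paths S n v" for \<gamma>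
  proof -
    note g = pathsD[OF \<gamma>]
    have sub: "set \<gamma> \<subseteq> S" using g S by auto
    have bij: "bij_betw ((!) \<gamma>) {..n} (set \<gamma>)"
      by (rule bij_betw_nth) (use g in auto)
    \<comment> \<open>The walk from the last vertex of \<gamma> is on \<gamma> at time 0, so it has
      a last visit to \<gamma> and the probabilities for its position add up to one.\<close>
    have "1 = (\<Sum>a\<in>set \<gamma>. gr S (last \<gamma>) a * esc S (set \<gamma>) a)"
      using last_visit[OF S(1) sub last_in_set[OF g(5)]] by simp
    also have "\<dots> = (\<Sum>i\<le>n. gr S (last \<gamma>) (\<gamma> ! i) * esc S (set \<gamma>) (\<gamma> ! i))"
      by (rule sum.reindex_bij_betw[OF bij, symmetric])
    finally have "wt S \<gamma> = (\<Sum>i\<le>n. wt S \<gamma> * (gr S (last \<gamma>) (\<gamma> ! i) * esc S (set \<gamma>) (\<gamma> ! i)))"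
      by (metis mult_1_right sum_distrib_left)
    also have "\<dots> \<le> (\<Sum>i\<le>n. ?K (take (Suc i) \<gamma>) (drop i \<gamma>))"
    proof (rule sum_mono)
      fix i assume "i \<in> {..n}"
      then have i: "i \<le> n" "i < length \<gamma>" using g by auto
      note t = paths_take_drop[OF \<gamma> i(1)]
      have iS: "\<gamma> ! i \<in> S" using sub i by auto
      have lS: "last \<gamma> \<in> S" using subsetD[OF sub last_in_set[OF g(5)]] .
      have tsub: "set (take (Suc i) \<gamma>) \<subseteq> set \<gamma>" by (rule set_take_subset)
      have "wt S \<gamma> \<le> wt S (take (Suc i) \<gamma>) * wt S (drop i \<gamma>)"
        unfolding wt_split[OF S(1) i(2)]
        by (intro mult_left_mono wt_mono S wt_nonneg) auto
      moreover have "gr S (last \<gamma>) (\<gamma> ! i) = gr S (hd (drop i \<gamma>)) (last (drop i \<gamma>))"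
        using gr_sym[OF S(1) lS iS] t by simp
      \<comment> \<open>Escaping from the initial piece alone is easier than from all of \<gamma>;
        with this factor the weight of the initial piece becomes the probability of a piece of the
        future of v.\<close>
      moreover have "esc S (set \<gamma>) (\<gamma> ! i) \<le> esc S (set (take (Suc i) \<gamma>)) (last (take (Suc i) \<gamma>))"
        unfolding t(2) by (rule esc_antimono_set[OF S(1) tsub sub])
      ultimately have "wt S \<gamma> * (gr S (last \<gamma>) (\<gamma> ! i) * esc S (set \<gamma>) (\<gamma> ! i)) \<le>
          (wt S (take (Suc i) \<gamma>) * wt S (drop i \<gamma>)) *
          (gr S (hd (drop i \<gamma>)) (last (drop i \<gamma>)) * esc S (set (take (Suc i) \<gamma>)) (last (take (Suc i) \<gamma>)))"
        by (intro mult_mono mult_nonneg_nonneg wt_nonneg S gr_nonneg esc_nonneg)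
           (use gr_nonneg[OF S(1) lS iS] t sub lS iS in \<open>auto simp: mult_left_mono\<close>)
      then show "wt S \<gamma> * (gr S (last \<gamma>) (\<gamma> ! i) * esc S (set \<gamma>) (\<gamma> ! i)) \<le> ?K (take (Suc i) \<gamma>) (drop i \<gamma>)"
        by (simp add: mult_ac)
    qed
    finally show ?thesis .
  qed
  then have "fm S n v \<le> (\<Sum>\<gamma>\<in>paths S n v. \<Sum>i\<le>n. ?K (take (Suc i) \<gamma>) (drop i \<gamma>))"
    unfolding fm_def by (rule sum_mono)
  also have "\<dots> = (\<Sum>i\<le>n. \<Sum>\<gamma>\<in>paths S n v. ?K (take (Suc i) \<gamma>) (drop i \<gamma>))" by (rule sum.swap)
  also have "\<dots> \<le> (\<Sum>i\<le>n. \<beta> (n - i))"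
  proof (rule sum_mono)
    fix i assume "i \<in> {..n}"
    then have i: "i \<le> n" by simp
    have \<beta>0: "0 \<le> \<beta> (n - i)" using \<beta>[OF S(2), of "n - i"] bt_nonneg[OF S, of "n - i"] by linarith
    have e0: "0 \<le> wt S \<gamma>' * esc S (set \<gamma>') (last \<gamma>')" if "\<gamma>' \<in> paths S i v" for \<gamma>'
      using pathsD[OF that] S by (intro mult_nonneg_nonneg wt_nonneg esc_nonneg) auto
    have "(\<Sum>\<gamma>\<in>paths S n v. ?K (take (Suc i) \<gamma>) (drop i \<gamma>)) =
        (\<Sum>\<gamma>'\<in>paths S i v. \<Sum>\<gamma>''\<in>paths (S - set \<gamma>') (n - i) (last \<gamma>'). ?K \<gamma>' \<gamma>'')"
      by (rule sum_paths_split[OF fin i])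
    also have "\<dots> = (\<Sum>\<gamma>'\<in>paths S i v. (wt S \<gamma>' * esc S (set \<gamma>') (last \<gamma>')) *
        (\<Sum>\<gamma>''\<in>paths (S - set \<gamma>') (n - i) (last \<gamma>'). wt S \<gamma>'' * gr S (hd \<gamma>'') (last \<gamma>'')))"
      by (simp only: sum_distrib_left)
    also have "\<dots> \<le> (\<Sum>\<gamma>'\<in>paths S i v. (wt S \<gamma>' * esc S (set \<gamma>') (last \<gamma>')) * \<beta> (n - i))"
    proof (intro sum_mono mult_left_mono)
      fix \<gamma>' assume g': "\<gamma>' \<in> paths S i v"
      then have l: "last \<gamma>' \<in> S" using paths_last_in S by metis
      have "(\<Sum>\<gamma>''\<in>paths (S - set \<gamma>') (n - i) (last \<gamma>'). wt S \<gamma>'' * gr S (hd \<gamma>'') (last \<gamma>'')) \<le>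
          (\<Sum>\<gamma>''\<in>paths S (n - i) (last \<gamma>'). wt S \<gamma>'' * gr S (hd \<gamma>'') (last \<gamma>''))"
        by (intro sum_mono2 finite_paths paths_mono mult_nonneg_nonneg wt_nonneg gr_nonneg)
           (use S fin l in \<open>auto dest: paths_last_in pathsD\<close>)
      also have "\<dots> = bt S (n - i) (last \<gamma>')"
        unfolding bt_def by (intro sum.cong refl) (auto dest: pathsD)
      also have "\<dots> \<le> \<beta> (n - i)" using \<beta> l by blast
      finally show "(\<Sum>\<gamma>''\<in>paths (S - set \<gamma>') (n - i) (last \<gamma>'). wt S \<gamma>'' * gr S (hd \<gamma>'') (last \<gamma>'')) \<le> \<beta> (n - i)" .
    qed (rule e0)
    also have "\<dots> = (\<Sum>\<gamma>'\<in>paths S i v. wt S \<gamma>' * esc S (set \<gamma>') (last \<gamma>')) * \<beta> (n - i)"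
      by (rule sum_distrib_right[symmetric])
    also have "\<dots> \<le> 1 * \<beta> (n - i)" by (intro mult_right_mono future_sum_le_1 S \<beta>0)
    finally show "(\<Sum>\<gamma>\<in>paths S n v. ?K (take (Suc i) \<gamma>) (drop i \<gamma>)) \<le> \<beta> (n - i)" by simp
  qed
  finally show ?thesis .
qed

end

section \<open>Uniform bounds from transitivity\<close>

locale transitive_chain = symmetric_chain V P b for V :: "'v set" and P b +
  assumes transitive: "x \<in> V \<Longrightarrow> y \<in> V \<Longrightarrow> \<exists>\<phi>. bij_betw \<phi> V V \<and> \<phi> x = y \<and>
    (\<forall>u\<in>V. \<forall>w\<in>V. pmf (P (\<phi> u)) (\<phi> w) = pmf (P u) w)"
begin

definition auto :: "('v \<Rightarrow> 'v) \<Rightarrow> bool" where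
  "auto \<phi> \<longleftrightarrow> bij_betw \<phi> V V \<and> (\<forall>u\<in>V. \<forall>w\<in>V. p (\<phi> u) (\<phi> w) = p u w)"

lemma auto_exists: "x \<in> V \<Longrightarrow> y \<in> V \<Longrightarrow> \<exists>\<phi>. auto \<phi> \<and> \<phi> x = y"
  using transitive unfolding auto_def by blast

lemma auto_inj: "auto \<phi> \<Longrightarrow> S \<subseteq> V \<Longrightarrow> inj_on \<phi> S"
  by (auto simp: auto_def bij_betw_def intro: inj_on_subset)

lemma auto_dom: "auto \<phi> \<Longrightarrow> dom S \<Longrightarrow> dom (\<phi> ` S)"
  by (auto simp: auto_def dom_def bij_betw_def)

lemma auto_image_diff: "auto \<phi> \<Longrightarrow> S \<subseteq> V \<Longrightarrow> A \<subseteq> V \<Longrightarrow> \<phi> ` (S - A) = \<phi> ` S - \<phi> ` A"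
  by (metis auto_inj inj_on_image_set_diff order_refl Diff_subset order_trans)

lemma auto_gr:
  assumes "auto \<phi>" "dom S" "x \<in> S" "y \<in> S"
  shows "gr (\<phi> ` S) (\<phi> x) (\<phi> y) = gr S x y"
proof -
  have "pk (\<phi> ` S) n (\<phi> x) (\<phi> y) = pk S n x y" for n
    by (rule kpow_bij) (use assms auto_inj in \<open>auto simp: auto_def domD\<close>)
  then show ?thesis by (simp add: green_def)
qed

lemma auto_decay:
  assumes "auto \<phi>" "dom S" "finite A" "A \<subseteq> V"
  shows "decay (\<phi> ` S) (\<phi> ` A) = decay S A"
  using assms(3,4)
proof (induction A rule: finite_induct)
  case empty
  then show ?case using Z_pos[OF assms(2)] Z_pos[OF auto_dom[OF assms(1,2)]] by (simp add: decay_def)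
next
  case (insert x A)
  have SV: "S \<subseteq> V" using assms by (simp add: domD)
  have diff: "\<phi> ` (S - A) = \<phi> ` S - \<phi> ` A"
    by (rule auto_image_diff[OF assms(1) SV]) (use insert in auto)
  have mem: "\<phi> x \<in> \<phi> ` S - \<phi> ` A \<longleftrightarrow> x \<in> S - A"
    unfolding diff[symmetric] using auto_inj[OF assms(1) order_refl] SV insert.prems
    by (subst inj_on_image_mem_iff) auto
  have "gr (\<phi> ` S - \<phi> ` A) (\<phi> x) (\<phi> x) = gr (S - A) x x" if "x \<in> S - A"
    unfolding diff[symmetric] using auto_gr[OF assms(1) dom_diff[OF assms(2)] that that] .
  then show ?case
    using insert auto_dom[OF assms(1,2)] assms mem
    by (simp only: image_insert decay_insert) auto
qed

lemma auto_wt: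
  assumes "auto \<phi>" "dom S" "set \<gamma> \<subseteq> V"
  shows "wt (\<phi> ` S) (map \<phi> \<gamma>) = wt S \<gamma>"
proof -
  have "pw (map \<phi> \<gamma>) = pw \<gamma>"
    by (rule path_weight_map) (use assms in \<open>auto simp: auto_def subset_iff\<close>)
  then show ?thesis unfolding wt_def using auto_decay[OF assms(1,2) _ assms(3)] by simp
qed

lemma auto_paths:
  assumes "auto \<phi>" "S \<subseteq> V" "v \<in> V" "\<gamma> \<in> paths S n v"
  shows "map \<phi> \<gamma> \<in> paths (\<phi> ` S) n (\<phi> v)"
proof -
  note g = pathsD[OF assms(4)]
  have "set \<gamma> \<subseteq> V" using g assms by auto
  then have "inj_on \<phi> (set \<gamma>)" by (rule auto_inj[OF assms(1)])
  then show ?thesis using g by (auto simp: paths_def distinct_map hd_map map_tl[symmetric])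
qed

lemma auto_bt:
  assumes "auto \<phi>" "dom S" "x \<in> S"
  shows "bt S l x \<le> bt (\<phi> ` S) l (\<phi> x)"
proof -
  have V: "S \<subseteq> V" "finite S" "x \<in> V" using assms by (auto simp: domD)
  have gV: "set \<gamma> \<subseteq> V" if "\<gamma> \<in> paths S l x" for \<gamma> using pathsD[OF that] V by auto
  have inj: "inj_on (map \<phi>) (paths S l x)"
  proof (rule inj_onI)
    fix a b assume ab: "a \<in> paths S l x" "b \<in> paths S l x" "map \<phi> a = map \<phi> b"
    have "set a \<union> set b \<subseteq> V" using gV[OF ab(1)] gV[OF ab(2)] by simp
    from map_inj_on[OF ab(3) auto_inj[OF assms(1) this]] show "a = b" .
  qed
  have "bt S l x = (\<Sum>\<gamma>\<in>paths S l x. wt (\<phi> ` S) (map \<phi> \<gamma>) * gr (\<phi> ` S) (\<phi> x) (last (map \<phi> \<gamma>)))"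
    unfolding bt_def
  proof (intro sum.cong refl)
    fix \<gamma> assume \<gamma>: "\<gamma> \<in> paths S l x"
    have "last (map \<phi> \<gamma>) = \<phi> (last \<gamma>)" using pathsD[OF \<gamma>] by (simp add: last_map)
    moreover have "last \<gamma> \<in> S" using paths_last_in[OF \<gamma>] assms by simp
    ultimately show "wt S \<gamma> * gr S x (last \<gamma>) = wt (\<phi> ` S) (map \<phi> \<gamma>) * gr (\<phi> ` S) (\<phi> x) (last (map \<phi> \<gamma>))"
      using auto_wt[OF assms(1,2) gV[OF \<gamma>]] auto_gr[OF assms] by simp
  qed
  also have "\<dots> = (\<Sum>\<gamma>\<in>map \<phi> ` paths S l x. wt (\<phi> ` S) \<gamma> * gr (\<phi> ` S) (\<phi> x) (last \<gamma>))"
    by (simp add: sum.reindex[OF inj])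
  also have "\<dots> \<le> bt (\<phi> ` S) l (\<phi> x)"
    unfolding bt_def
  proof (intro sum_mono2 finite_paths mult_nonneg_nonneg wt_nonneg gr_nonneg)
    show "map \<phi> ` paths S l x \<subseteq> paths (\<phi> ` S) l (\<phi> x)" using auto_paths[OF assms(1) V(1,3)] by blast
  qed (use assms V auto_dom in \<open>auto dest: paths_last_in\<close>)
  finally show ?thesis .
qed

definition \<beta> :: "nat \<Rightarrow> real" where
  "\<beta> l = (SUP (S, x)\<in>{(S, x). dom S \<and> x \<in> S}. bt S l x)"

lemma bdd_bt: "bdd_above ((\<lambda>(S, x). bt S l x) ` {(S, x). dom S \<and> x \<in> S})"
  by (rule bdd_aboveI[of _ bubble]) (auto simp: bt_le_bubble)

lemma bt_le_\<beta>: "dom S \<Longrightarrow> x \<in> S \<Longrightarrow> bt S l x \<le> \<beta> l"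
  unfolding \<beta>_def by (rule cSUP_upper2[OF bdd_bt, of "(S, x)"]) auto

lemma \<beta>_nonneg: "0 \<le> \<beta> l"
proof -
  obtain x where x: "x \<in> V" using V_nonempty by blast
  then have "dom {x}" by (auto simp: dom_def)
  then show ?thesis using bt_nonneg[of "{x}" x l] bt_le_\<beta>[of "{x}" x l] by simp
qed

lemma \<beta>_approx:
  assumes "\<delta> > 0" "o' \<in> V"
  shows "\<exists>S. dom S \<and> o' \<in> S \<and> \<beta> l - \<delta> < bt S l o'"
proof -
  have ne: "{(S, x). dom S \<and> x \<in> S} \<noteq> {}" using assms(2) by (auto intro!: exI[of _ "{o'}"] simp: dom_def)
  have "\<beta> l - \<delta> < \<beta> l" using assms by simp
  then obtain S x where S: "dom S" "x \<in> S" "\<beta> l - \<delta> < bt S l x"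
    unfolding \<beta>_def using less_cSUP_iff[OF ne bdd_bt] by auto
  obtain \<phi> where \<phi>: "auto \<phi>" "\<phi> x = o'" using auto_exists[of x o'] S assms by (auto simp: domD)
  show ?thesis
    using auto_dom[OF \<phi>(1) S(1)] auto_bt[OF \<phi>(1) S(1,2), of l] S \<phi>(2)
    by (intro exI[of _ "\<phi> ` S"]) auto
qed

text \<open>For each l a nearly optimal domain can be moved by an automorphism so that its vertex
  becomes x. The union of these finitely many domains serves all l at once, so the bound for a
  single vertex applies to the sum of the suprema.\<close>

lemma sum_\<beta>_le_bubble: "(\<Sum>l<N. \<beta> l) \<le> bubble"
proof (rule field_le_epsilon)
  fix e :: real assume e: "e > 0"
  obtain x where x: "x \<in> V" using V_nonempty by blast
  define \<delta> where "\<delta> = e / real (Suc N)"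
  have \<delta>: "\<delta> > 0" using e by (simp add: \<delta>_def)
  obtain T where T: "\<And>l. dom (T l) \<and> x \<in> T l \<and> \<beta> l - \<delta> < bt (T l) l x"
    using \<beta>_approx[OF \<delta> x] by metis
  define S where "S = (\<Union>l<Suc N. T l)"
  have S: "dom S" "x \<in> S" using T by (auto simp: S_def dom_def)
  have "(\<Sum>l<N. \<beta> l) \<le> (\<Sum>l<N. bt S l x + \<delta>)"
  proof (rule sum_mono)
    fix l assume "l \<in> {..<N}"
    then have "l \<in> {..<Suc N}" by simp
    then have "T l \<subseteq> S" unfolding S_def by blast
    then have "bt (T l) l x \<le> bt S l x" using bt_mono[OF S(1)] T by blast
    then show "\<beta> l \<le> bt S l x + \<delta>" using T[of l] by linarith
  qed
  also have "\<dots> = (\<Sum>l<N. bt S l x) + real N * \<delta>" by (simp add: sum.distrib)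
  also have "real N * \<delta> \<le> e" using e by (simp add: \<delta>_def field_simps)
  finally show "(\<Sum>l<N. \<beta> l) \<le> bubble + e" using bt_sum_le_bubble[OF S, of N] by linarith
qed

section \<open>Uniform first moments and the energy of a path\<close>

lemma fm_le_bubble:
  assumes "dom S" "v \<in> V"
  shows "fm S n v \<le> bubble"
proof -
  have S: "dom (insert v S)" "v \<in> insert v S" using assms by (auto simp: dom_insert)
  have "fm S n v \<le> fm (insert v S) n v" by (rule fm_mono[OF S(1)]) auto
  also have "\<dots> \<le> (\<Sum>i\<le>n. \<beta> (n - i))" by (rule fm_le_sum[OF S]) (rule bt_le_\<beta>[OF S(1)])
  also have "\<dots> = (\<Sum>i<Suc n. \<beta> i)"
    by (rule sum.reindex_bij_witness[of _ "\<lambda>i. n - i" "\<lambda>i. n - i"]) auto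
  finally show ?thesis using sum_\<beta>_le_bubble[of "Suc n"] by linarith
qed

text \<open>Energy of the counting measure on the path, a measure of how much the path crowds around
  itself. The indices start at 1 because the root may lie outside S.\<close>

definition energy :: "'v set \<Rightarrow> 'v list \<Rightarrow> real" where
  "energy S \<gamma> = (\<Sum>i\<in>{1..<length \<gamma>}. \<Sum>j\<in>{1..<length \<gamma>}. gr S (\<gamma> ! i) (\<gamma> ! j))"

text \<open>Cut at i and j. The first and the last piece each cost a first moment, and the middle
  piece together with the Green function between its ends is a bubble term of length j - i.\<close>

lemma pair_energy_bound:
  assumes S: "dom S" "v \<in> V" "1 \<le> i" "i \<le> j" "j \<le> n"
  shows "(\<Sum>\<gamma>\<in>paths S n v. wt S \<gamma> * gr S (\<gamma> ! i) (\<gamma> ! j)) \<le> bubble\<^sup>2 * \<beta> (j - i)"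
proof -
  have fin: "finite S" using S by (simp add: domD)
  have B0: "0 \<le> bubble" using bubble_ge_1 by simp
  let ?g = "\<lambda>\<gamma>. gr S (\<gamma> ! i) (last \<gamma>)"
  have nthS: "\<gamma> ! k \<in> S" if "\<gamma> \<in> paths S m v" "1 \<le> k" "k \<le> m" for \<gamma> k m
  proof -
    have "\<gamma> ! k = tl \<gamma> ! (k - 1)" using pathsD(1,5)[OF that(1)] that by (cases \<gamma>) auto
    then have "\<gamma> ! k \<in> set (tl \<gamma>)" using pathsD(1)[OF that(1)] that by auto
    then show ?thesis using pathsD(4)[OF that(1)] by auto
  qed
  have "(\<Sum>\<gamma>\<in>paths S n v. wt S \<gamma> * gr S (\<gamma> ! i) (\<gamma> ! j)) =
      (\<Sum>\<gamma>\<in>paths S n v. (\<lambda>a b. wt S a * ?g a * wt (S - set a) b) (take (Suc j) \<gamma>) (drop j \<gamma>))"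
  proof (intro sum.cong refl)
    fix \<gamma> assume \<gamma>: "\<gamma> \<in> paths S n v"
    have "j < length \<gamma>" using pathsD(1)[OF \<gamma>] S by simp
    then show "wt S \<gamma> * gr S (\<gamma> ! i) (\<gamma> ! j) =
        (\<lambda>a b. wt S a * ?g a * wt (S - set a) b) (take (Suc j) \<gamma>) (drop j \<gamma>)"
      using wt_split[OF S(1), of j \<gamma>] paths_take_drop(2)[OF \<gamma> S(5)] S(4) by simp
  qed
  also have "\<dots> = (\<Sum>a\<in>paths S j v. \<Sum>b\<in>paths (S - set a) (n - j) (last a). wt S a * ?g a * wt (S - set a) b)"
    by (rule sum_paths_split[OF fin S(5)])
  also have "\<dots> = (\<Sum>a\<in>paths S j v. wt S a * ?g a * fm (S - set a) (n - j) (last a))"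
    by (simp add: fm_def sum_distrib_left)
  also have "\<dots> \<le> (\<Sum>a\<in>paths S j v. wt S a * ?g a * bubble)"
  proof (intro sum_mono mult_left_mono)
    fix a assume a: "a \<in> paths S j v"
    have l: "last a \<in> S" using paths_last_in[OF a] S by simp
    show "fm (S - set a) (n - j) (last a) \<le> bubble"
      using l S by (intro fm_le_bubble) (auto simp: domD)
    show "0 \<le> wt S a * ?g a"
      by (intro mult_nonneg_nonneg wt_nonneg gr_nonneg nthS[OF a] l S)
  qed
  also have "\<dots> = bubble * (\<Sum>a\<in>paths S j v. wt S a * ?g a)"
    by (simp add: sum_distrib_left mult_ac)
  also have "(\<Sum>a\<in>paths S j v. wt S a * ?g a) =
      (\<Sum>a\<in>paths S j v. (\<lambda>a b. wt S a * (wt (S - set a) b * gr S (hd b) (last b))) (take (Suc i) a) (drop i a))"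
  proof (intro sum.cong refl)
    fix a assume a: "a \<in> paths S j v"
    have "i < length a" using pathsD(1)[OF a] S by simp
    then show "wt S a * ?g a =
        (\<lambda>a b. wt S a * (wt (S - set a) b * gr S (hd b) (last b))) (take (Suc i) a) (drop i a)"
      using wt_split[OF S(1), of i a] paths_take_drop(3,6)[OF a S(4)] by simp
  qed
  also have "\<dots> = (\<Sum>a\<in>paths S i v. \<Sum>b\<in>paths (S - set a) (j - i) (last a).
      wt S a * (wt (S - set a) b * gr S (hd b) (last b)))"
    by (rule sum_paths_split[OF fin S(4)])
  also have "\<dots> = (\<Sum>a\<in>paths S i v. wt S a * (\<Sum>b\<in>paths (S - set a) (j - i) (last a).
      wt (S - set a) b * gr S (hd b) (last b)))"
    by (simp add: sum_distrib_left)
  also have "\<dots> \<le> (\<Sum>a\<in>paths S i v. wt S a * \<beta> (j - i))"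
  proof (intro sum_mono mult_left_mono wt_nonneg S)
    fix a assume a: "a \<in> paths S i v"
    have l: "last a \<in> S" using paths_last_in[OF a] S by simp
    have "(\<Sum>b\<in>paths (S - set a) (j - i) (last a). wt (S - set a) b * gr S (hd b) (last b)) \<le>
        (\<Sum>b\<in>paths (S - set a) (j - i) (last a). wt S b * gr S (hd b) (last b))"
    proof (intro sum_mono mult_right_mono wt_mono S gr_nonneg)
      fix b assume b: "b \<in> paths (S - set a) (j - i) (last a)"
      then have b': "b \<in> paths S (j - i) (last a)" using paths_mono[of "S - set a" S] by auto
      show "hd b \<in> S" "last b \<in> S" using pathsD(2)[OF b'] paths_last_in[OF b'] l by auto
    qed auto
    also have "\<dots> \<le> (\<Sum>b\<in>paths S (j - i) (last a). wt S b * gr S (hd b) (last b))"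
      by (intro sum_mono2 finite_paths paths_mono mult_nonneg_nonneg wt_nonneg gr_nonneg)
         (use S fin l in \<open>auto dest: paths_last_in pathsD\<close>)
    also have "\<dots> = bt S (j - i) (last a)"
      unfolding bt_def by (intro sum.cong refl) (auto dest: pathsD)
    also have "\<dots> \<le> \<beta> (j - i)" by (rule bt_le_\<beta>[OF S(1) l])
    finally show "(\<Sum>b\<in>paths (S - set a) (j - i) (last a). wt (S - set a) b * gr S (hd b) (last b)) \<le> \<beta> (j - i)" .
  qed
  also have "\<dots> = fm S i v * \<beta> (j - i)" by (simp add: fm_def sum_distrib_right)
  also have "\<dots> \<le> bubble * \<beta> (j - i)" by (intro mult_right_mono fm_le_bubble S \<beta>_nonneg)
  finally show ?thesis using B0 by (simp add: power2_eq_square mult_left_mono mult.assoc)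
qed

lemma energy_bound:
  assumes S: "dom S" "v \<in> V" "v \<notin> S"
  shows "(\<Sum>\<gamma>\<in>paths S n v. wt S \<gamma> * energy S \<gamma>) \<le> real n * (2 * bubble ^ 3)"
proof -
  let ?W = "\<lambda>i j. (\<Sum>\<gamma>\<in>paths S n v. wt S \<gamma> * gr S (\<gamma> ! i) (\<gamma> ! j))"
  have nthS: "\<gamma> ! k \<in> S" if "\<gamma> \<in> paths S n v" "k \<in> {1..n}" for \<gamma> k
  proof -
    have "\<gamma> ! k = tl \<gamma> ! (k - 1)" using pathsD(1,5)[OF that(1)] that by (cases \<gamma>) auto
    then have "\<gamma> ! k \<in> set (tl \<gamma>)" using pathsD(1)[OF that(1)] that by auto
    then show ?thesis using pathsD(4)[OF that(1)] by auto
  qed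
  have W0: "0 \<le> ?W i j" if "i \<in> {1..n}" "j \<in> {1..n}" for i j
    by (intro sum_nonneg mult_nonneg_nonneg wt_nonneg gr_nonneg S nthS that)
  have Wsym: "?W i j = ?W j i" if "i \<in> {1..n}" "j \<in> {1..n}" for i j
  proof (intro sum.cong refl)
    fix \<gamma> assume "\<gamma> \<in> paths S n v"
    then show "wt S \<gamma> * gr S (\<gamma> ! i) (\<gamma> ! j) = wt S \<gamma> * gr S (\<gamma> ! j) (\<gamma> ! i)"
      using gr_sym[OF S(1) nthS[OF _ that(1)] nthS[OF _ that(2)]] by simp
  qed
  have half: "(\<Sum>j\<in>{i..n}. ?W i j) \<le> bubble ^ 3" if "i \<in> {1..n}" for i
  proof -
    have "(\<Sum>j\<in>{i..n}. ?W i j) \<le> (\<Sum>j\<in>{i..n}. bubble\<^sup>2 * \<beta> (j - i))"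
      by (intro sum_mono pair_energy_bound) (use S that in auto)
    also have "\<dots> = bubble\<^sup>2 * (\<Sum>j\<in>{i..n}. \<beta> (j - i))" by (simp add: sum_distrib_left)
    also have "(\<Sum>j\<in>{i..n}. \<beta> (j - i)) = (\<Sum>l<Suc n - i. \<beta> l)"
      by (rule sum.reindex_bij_witness[of _ "\<lambda>l. l + i" "\<lambda>j. j - i"]) auto
    also have "bubble\<^sup>2 * \<dots> \<le> bubble\<^sup>2 * bubble" by (intro mult_left_mono sum_\<beta>_le_bubble) auto
    finally show ?thesis by (simp add: power2_eq_square power3_eq_cube)
  qed
  have "(\<Sum>\<gamma>\<in>paths S n v. wt S \<gamma> * energy S \<gamma>) =
      (\<Sum>\<gamma>\<in>paths S n v. \<Sum>i\<in>{1..n}. \<Sum>j\<in>{1..n}. wt S \<gamma> * gr S (\<gamma> ! i) (\<gamma> ! j))"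
    by (intro sum.cong refl)
       (simp add: energy_def pathsD(1) sum_distrib_left atLeastLessThanSuc_atLeastAtMost)
  also have "\<dots> = (\<Sum>i\<in>{1..n}. \<Sum>\<gamma>\<in>paths S n v. \<Sum>j\<in>{1..n}. wt S \<gamma> * gr S (\<gamma> ! i) (\<gamma> ! j))"
    by (rule sum.swap)
  also have "\<dots> = (\<Sum>i\<in>{1..n}. \<Sum>j\<in>{1..n}. ?W i j)"
    by (intro sum.cong refl sum.swap)
  \<comment> \<open>Both halves contain the diagonal. The symmetry of the Green function turns the
    second half into the first, to which \<open>half\<close> applies.\<close>
  also have "\<dots> \<le> (\<Sum>i\<in>{1..n}. (\<Sum>j\<in>{i..n}. ?W i j) + (\<Sum>j\<in>{1..i}. ?W i j))"
  proof (intro sum_mono)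
    fix i assume i: "i \<in> {1..n}"
    have "(\<Sum>j\<in>{1..n}. ?W i j) \<le> (\<Sum>j\<in>{i..n} \<union> {1..i}. ?W i j)"
      by (intro sum_mono2 W0) (use i in auto)
    also have "\<dots> \<le> (\<Sum>j\<in>{i..n}. ?W i j) + (\<Sum>j\<in>{1..i}. ?W i j)"
      using sum.union_inter[of "{i..n}" "{1..i}" "?W i"]
        sum_nonneg[of "{i..n} \<inter> {1..i}" "?W i"] W0 i by fastforce
    finally show "(\<Sum>j\<in>{1..n}. ?W i j) \<le> (\<Sum>j\<in>{i..n}. ?W i j) + (\<Sum>j\<in>{1..i}. ?W i j)" .
  qed
  also have "\<dots> = (\<Sum>i\<in>{1..n}. \<Sum>j\<in>{i..n}. ?W i j) + (\<Sum>i\<in>{1..n}. \<Sum>j\<in>{1..i}. ?W j i)"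
    unfolding sum.distrib by (intro arg_cong2[where f = "(+)"] sum.cong refl Wsym) auto
  also have "(\<Sum>i\<in>{1..n}. \<Sum>j\<in>{1..i}. ?W j i) = (\<Sum>j\<in>{1..n}. \<Sum>i\<in>{j..n}. ?W j i)"
    by (subst (1 2) sum.Sigma; (rule sum.reindex_bij_witness[of _ "\<lambda>(a, b). (b, a)" "\<lambda>(a, b). (b, a)"])?) auto
  also have "(\<Sum>i\<in>{1..n}. \<Sum>j\<in>{i..n}. ?W i j) + \<dots> \<le> (\<Sum>i\<in>{1..n}. bubble ^ 3) + (\<Sum>i\<in>{1..n}. bubble ^ 3)"
    by (intro add_mono sum_mono half) auto
  finally show ?thesis by simp
qed

end

section \<open>The height of the past\<close>

text \<open>
  The paths \<open>\<gamma>\<close> of length \<open>n\<close> into \<open>v\<close> followed by \<open>f\<close> that are continued by a path \<open>\<delta>\<close> of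
  length \<open>n\<close> into the last vertex of \<open>\<gamma>\<close>, both avoiding \<open>X\<close>.
\<close>

definition long_paths :: "'v set \<Rightarrow> nat \<Rightarrow> 'v \<Rightarrow> ('v \<Rightarrow> 'v) \<Rightarrow> 'v set \<Rightarrow> 'v list set" where
  "long_paths S n v f X = {\<gamma> \<in> paths S n v. follows f \<gamma> \<and>
     (\<exists>\<delta>\<in>paths (S - set \<gamma>) n (last \<gamma>). follows f \<delta> \<and> (set \<gamma> \<union> set \<delta>) \<inter> X = {})}"

lemma finite_long_paths: "finite S \<Longrightarrow> finite (long_paths S n v f X)"
  by (rule finite_subset[OF _ finite_paths[of S n v]]) (auto simp: long_paths_def)

text \<open>A path using the new arrow of y would contain w, which is excluded both when w is in X
  and when w lies outside S and differs from v. Hence the path avoids y and existed before: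
  redirecting an arrow in this way can only destroy long paths.\<close>

lemma long_paths_redirect:
  assumes "y \<in> S" "v \<notin> S" "w \<in> X \<or> w \<notin> insert v S"
  shows "long_paths S n v (f(y := w)) X \<subseteq> long_paths S n v f {y}"
proof
  fix \<gamma> assume "\<gamma> \<in> long_paths S n v (f(y := w)) X"
  then obtain \<delta> where \<gamma>: "\<gamma> \<in> paths S n v" "follows (f(y := w)) \<gamma>"
    and \<delta>: "\<delta> \<in> paths (S - set \<gamma>) n (last \<gamma>)" "follows (f(y := w)) \<delta>"
    and X: "(set \<gamma> \<union> set \<delta>) \<inter> X = {}"
    unfolding long_paths_def by blast
  note g = pathsD[OF \<gamma>(1)] and d = pathsD[OF \<delta>(1)]
  have last: "last \<gamma> \<in> set \<gamma>" using g(5) by simp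
  have gS: "set \<gamma> \<subseteq> insert v S" using g(4,6) by auto
  have "set \<delta> \<subseteq> insert v S" unfolding d(6) using d(4) last gS by auto
  then have w: "w \<notin> set \<gamma>" "w \<notin> set \<delta>" using assms(3) X gS by auto
  have y: "y \<notin> set \<gamma>"
  proof
    assume "y \<in> set \<gamma>"
    then have "y \<in> set (tl \<gamma>)" using g(6) assms by auto
    from follows_prev[OF \<gamma>(2) this] show False using w by simp
  qed
  moreover have y': "y \<notin> set \<delta>"
  proof
    assume "y \<in> set \<delta>"
    then have "y \<in> set (tl \<delta>)" using d(6) y last by auto
    from follows_prev[OF \<delta>(2) this] show False using w by simp
  qed
  moreover have "follows f \<gamma>"
  proof -
    have "follows (f(y := w)) \<gamma> \<longleftrightarrow> follows f \<gamma>"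
      by (rule follows_cong) (use y g(6) in auto)
    then show ?thesis using \<gamma> by simp
  qed
  moreover have "follows f \<delta>"
  proof -
    have "follows (f(y := w)) \<delta> \<longleftrightarrow> follows f \<delta>"
      by (rule follows_cong) (use y' d(6) in auto)
    then show ?thesis using \<delta> by simp
  qed
  ultimately show "\<gamma> \<in> long_paths S n v f {y}"
    unfolding long_paths_def using \<gamma>(1) \<delta>(1) by (auto intro!: bexI[of _ \<delta>])
qed

section \<open>Destroying long paths by excursions\<close>

context symmetric_chain
begin

definition tall :: "'v set \<Rightarrow> nat \<Rightarrow> 'v \<Rightarrow> real" where
  "tall S n v = measure_pmf.prob (wired S) {f. \<exists>\<gamma>\<in>paths S n v. follows f \<gamma>}"

text \<open>An excursion that leaves S at v may create long paths; it is charged the full value 1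
  and occurs with probability \<open>ht S y v\<close>. After any other excursion a surviving long
  path was there before and has been missed. As \<psi> is subharmonic off \<gamma> and at most 1, it
  is a lower bound for the probability of hitting \<gamma>. The set {y} expresses that the arrow of
  the current position is about to be replaced.\<close>

lemma excursion_long_paths:
  fixes a :: "'v list \<Rightarrow> real" and \<psi> :: "'v list \<Rightarrow> 'v \<Rightarrow> real" and S v n
  defines "\<Phi> \<equiv> \<lambda>c a f. min 1 (c + (\<Sum>\<gamma>\<in>long_paths S n v f {}. a \<gamma> :: real))"
  assumes S: "dom S" "v \<notin> S" and a: "\<And>\<gamma>. \<gamma> \<in> paths S n v \<Longrightarrow> 0 \<le> a \<gamma>" and c: "0 \<le> c"
    and \<psi>1: "\<And>\<gamma> y. \<gamma> \<in> paths S n v \<Longrightarrow> y \<in> S \<Longrightarrow> \<psi> \<gamma> y \<le> 1"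
    and \<psi>: "\<And>\<gamma> y. \<gamma> \<in> paths S n v \<Longrightarrow> y \<in> S - set \<gamma> \<Longrightarrow> \<psi> \<gamma> y \<le> (\<Sum>w\<in>S. p y w * \<psi> \<gamma> w)"
  shows "y \<in> S \<Longrightarrow> excursion S (\<Phi> c a) N y f \<le>
    c + ht S y v + (\<Sum>\<gamma>\<in>long_paths S n v f {y}. a \<gamma> * (1 - \<psi> \<gamma> y))"
proof (induction N arbitrary: y f)
  case 0
  have "0 \<le> (\<Sum>\<gamma>\<in>long_paths S n v f {y}. a \<gamma> * (1 - \<psi> \<gamma> y))"
    using 0 by (intro sum_nonneg mult_nonneg_nonneg a) (auto simp: long_paths_def \<psi>1)
  then show ?case using c hit_nonneg[OF S(1), of y v] by simp
next
  case (Suc N)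
  have fin: "finite S" using S by (simp add: domD)
  let ?G = "long_paths S n v f {y}"
  have G: "finite ?G" "\<And>\<gamma>. \<gamma> \<in> ?G \<Longrightarrow> \<gamma> \<in> paths S n v" "\<And>\<gamma>. \<gamma> \<in> ?G \<Longrightarrow> y \<notin> set \<gamma>"
    by (rule finite_long_paths[OF fin]) (auto simp: long_paths_def)
  define K0 where "K0 = c + (\<Sum>\<gamma>\<in>?G. a \<gamma>)"
  \<comment> \<open>\<open>K0\<close> is the part of the bound that is the same for all next
    positions w, and u the part to be averaged. Outside S and away from v the excursion ends without
    creating anything, so u is 0 there.\<close>
  define u where "u w = (if w \<in> S then ht S w v - (\<Sum>\<gamma>\<in>?G. a \<gamma> * \<psi> \<gamma> w) else if w = v then 1 else 0)" for w
  let ?h = "\<lambda>w. if w \<in> S then excursion S (\<Phi> c a) N w (f(y := w)) else \<Phi> c a (f(y := w))"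
  have a0: "0 \<le> (\<Sum>\<gamma>\<in>?G. a \<gamma>)" by (intro sum_nonneg a G)
  have \<Phi>: "0 \<le> \<Phi> c a f" "\<Phi> c a f \<le> 1" for f
  proof -
    have "0 \<le> (\<Sum>\<gamma>\<in>long_paths S n v f {}. a \<gamma>)"
      by (intro sum_nonneg a) (auto simp: long_paths_def)
    then show "0 \<le> \<Phi> c a f" "\<Phi> c a f \<le> 1" using c by (auto simp: \<Phi>_def)
  qed
  have le: "?h w \<le> K0 + u w" for w
  proof (cases "w \<in> S")
    case True
    have "excursion S (\<Phi> c a) N w (f(y := w)) \<le>
        c + ht S w v + (\<Sum>\<gamma>\<in>long_paths S n v (f(y := w)) {w}. a \<gamma> * (1 - \<psi> \<gamma> w))"
      by (rule Suc.IH[OF True])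
    also have "(\<Sum>\<gamma>\<in>long_paths S n v (f(y := w)) {w}. a \<gamma> * (1 - \<psi> \<gamma> w)) \<le> (\<Sum>\<gamma>\<in>?G. a \<gamma> * (1 - \<psi> \<gamma> w))"
      by (intro sum_mono2 long_paths_redirect mult_nonneg_nonneg a)
         (use Suc.prems S True G \<psi>1 in auto)
    finally show ?thesis using True
      by (simp add: K0_def u_def right_diff_distrib sum_subtractf)
  next
    case False
    show ?thesis
    proof (cases "w = v")
      case True
      then show ?thesis using False \<Phi>(2)[of "f(y := w)"] a0 c by (simp add: K0_def u_def)
    next
      case wv: False
      have "\<Phi> c a (f(y := w)) \<le> c + (\<Sum>\<gamma>\<in>long_paths S n v (f(y := w)) {}. a \<gamma>)" by (simp add: \<Phi>_def)
      also have "(\<Sum>\<gamma>\<in>long_paths S n v (f(y := w)) {}. a \<gamma>) \<le> (\<Sum>\<gamma>\<in>?G. a \<gamma>)"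
        by (intro sum_mono2 long_paths_redirect a) (use Suc.prems S False wv G in auto)
      finally show ?thesis using False wv by (simp add: K0_def u_def)
    qed
  qed
  have ub: "\<bar>u w\<bar> \<le> (\<Sum>x\<in>insert v S. \<bar>u x\<bar>)" for w
  proof (cases "w \<in> insert v S")
    case True
    then show ?thesis using member_le_sum[of w "insert v S" "\<lambda>x. \<bar>u x\<bar>"] fin by auto
  next
    case False
    then show ?thesis by (auto simp: u_def intro: sum_nonneg)
  qed
  have hb: "\<bar>?h w\<bar> \<le> 1" for w
    using \<Phi>[of "f(y := w)"] excursion_bounds[of "\<Phi> c a" S N w "f(y := w)", OF \<Phi>] by auto
  have "excursion S (\<Phi> c a) (Suc N) y f \<le> measure_pmf.expectation (P y) (\<lambda>w. K0 + u w)"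
    unfolding excursion.simps
  proof (rule expectation_mono_bounded)
    show "\<bar>K0 + u w\<bar> \<le> \<bar>K0\<bar> + (\<Sum>x\<in>insert v S. \<bar>u x\<bar>)" for w using ub[of w] by linarith
    show "\<bar>?h w\<bar> \<le> 1" for w by (rule hb)
    show "?h w \<le> K0 + u w" for w by (rule le)
  qed
  also have "\<dots> = K0 + measure_pmf.expectation (P y) u"
    by (simp add: integrable_pmf_bounded[OF ub])
  also have "measure_pmf.expectation (P y) u = (\<Sum>w\<in>insert v S. u w * p y w)"
    by (rule integral_measure_pmf_real) (use fin in \<open>auto simp: u_def split: if_splits\<close>)
  also have "\<dots> = p y v + (\<Sum>w\<in>S. (ht S w v - (\<Sum>\<gamma>\<in>?G. a \<gamma> * \<psi> \<gamma> w)) * p y w)"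
    using fin S by (simp add: u_def)
  also have "(\<Sum>w\<in>S. (ht S w v - (\<Sum>\<gamma>\<in>?G. a \<gamma> * \<psi> \<gamma> w)) * p y w) =
      (\<Sum>w\<in>S. p y w * ht S w v) - (\<Sum>w\<in>S. \<Sum>\<gamma>\<in>?G. a \<gamma> * (p y w * \<psi> \<gamma> w))"
    by (simp add: algebra_simps sum_subtractf sum_distrib_left)
  also have "(\<Sum>w\<in>S. \<Sum>\<gamma>\<in>?G. a \<gamma> * (p y w * \<psi> \<gamma> w)) = (\<Sum>\<gamma>\<in>?G. a \<gamma> * (\<Sum>w\<in>S. p y w * \<psi> \<gamma> w))"
    by (simp add: sum_distrib_left) (rule sum.swap)
  finally have "excursion S (\<Phi> c a) (Suc N) y f \<le>
      K0 + ((p y v + (\<Sum>w\<in>S. p y w * ht S w v)) - (\<Sum>\<gamma>\<in>?G. a \<gamma> * (\<Sum>w\<in>S. p y w * \<psi> \<gamma> w)))"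
    by simp
  also have "p y v + (\<Sum>w\<in>S. p y w * ht S w v) = ht S y v"
    using hit_step[OF S(1) Suc.prems S(2)] by simp
  also have "K0 + (ht S y v - (\<Sum>\<gamma>\<in>?G. a \<gamma> * (\<Sum>w\<in>S. p y w * \<psi> \<gamma> w))) \<le>
      K0 + (ht S y v - (\<Sum>\<gamma>\<in>?G. a \<gamma> * \<psi> \<gamma> y))"
    by (intro add_left_mono diff_left_mono sum_mono mult_left_mono \<psi> a G) (use Suc.prems G in auto)
  finally show ?case by (simp add: K0_def right_diff_distrib sum_subtractf)
qed

text \<open>The starting point has law \<alpha>, and with the remaining probability there is no
  excursion. Since \<open>min 1\<close> is concave, the average over starting points may be taken
  inside it.\<close>

lemma excursion_mixture:
  fixes a :: "'v list \<Rightarrow> real" and \<psi> :: "'v list \<Rightarrow> 'v \<Rightarrow> real" and S v n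
  defines "\<Phi> \<equiv> \<lambda>c a f. min 1 (c + (\<Sum>\<gamma>\<in>long_paths S n v f {}. a \<gamma> :: real))"
  assumes S: "dom S" "v \<notin> S" and a: "\<And>\<gamma>. \<gamma> \<in> paths S n v \<Longrightarrow> 0 \<le> a \<gamma>" and c: "0 \<le> c"
    and \<psi>1: "\<And>\<gamma> y. \<gamma> \<in> paths S n v \<Longrightarrow> y \<in> S \<Longrightarrow> \<psi> \<gamma> y \<le> 1"
    and \<psi>: "\<And>\<gamma> y. \<gamma> \<in> paths S n v \<Longrightarrow> y \<in> S - set \<gamma> \<Longrightarrow> \<psi> \<gamma> y \<le> (\<Sum>w\<in>S. p y w * \<psi> \<gamma> w)"
    and \<alpha>: "\<And>x. x \<in> S \<Longrightarrow> 0 \<le> \<alpha> x" "(\<Sum>x\<in>S. \<alpha> x) \<le> 1" and \<eta>: "(\<Sum>x\<in>S. \<alpha> x * ht S x v) \<le> \<eta>"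
  shows "measure_pmf.expectation (wired S) (\<Phi> c a) \<le>
    measure_pmf.expectation (wired S) (\<Phi> (c + \<eta>) (\<lambda>\<gamma>. a \<gamma> * (1 - (\<Sum>x\<in>S. \<alpha> x * \<psi> \<gamma> x))))"
proof -
  let ?E = "measure_pmf.expectation (wired S)"
  have fin: "finite S" using S by (simp add: domD)
  let ?G = "\<lambda>f. long_paths S n v f {}"
  have G: "finite (?G f)" "\<And>\<gamma>. \<gamma> \<in> ?G f \<Longrightarrow> \<gamma> \<in> paths S n v" for f
    by (rule finite_long_paths[OF fin]) (auto simp: long_paths_def)
  let ?b = "\<lambda>x. \<Phi> (c + ht S x v) (\<lambda>\<gamma>. a \<gamma> * (1 - \<psi> \<gamma> x))"
  have \<Phi>: "0 \<le> \<Phi> c' a' f \<and> \<Phi> c' a' f \<le> 1" if "0 \<le> c'" "\<And>\<gamma>. \<gamma> \<in> paths S n v \<Longrightarrow> 0 \<le> a' \<gamma>" for c' a' f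
  proof -
    have "0 \<le> (\<Sum>\<gamma>\<in>?G f. a' \<gamma>)" by (intro sum_nonneg that G)
    then show ?thesis using that by (auto simp: \<Phi>_def)
  qed
  have \<Phi>a: "0 \<le> \<Phi> c a f \<and> \<Phi> c a f \<le> 1" for f by (rule \<Phi>[OF c a])
  have \<Phi>b: "0 \<le> ?b x f \<and> ?b x f \<le> 1" if "x \<in> S" for x f
    by (rule \<Phi>) (use c hit_nonneg[OF S(1), of x v] a \<psi>1 that in auto)
  have ha: "0 \<le> \<eta>"
  proof -
    have "0 \<le> (\<Sum>x\<in>S. \<alpha> x * ht S x v)" by (intro sum_nonneg mult_nonneg_nonneg \<alpha> hit_nonneg S)
    then show ?thesis using \<eta> by linarith
  qed
  have \<alpha>\<psi>: "(\<Sum>x\<in>S. \<alpha> x * \<psi> \<gamma> x) \<le> 1" if "\<gamma> \<in> paths S n v" for \<gamma>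
  proof -
    have "(\<Sum>x\<in>S. \<alpha> x * \<psi> \<gamma> x) \<le> (\<Sum>x\<in>S. \<alpha> x * 1)" by (intro sum_mono mult_left_mono \<psi>1 that \<alpha>)
    then show ?thesis using \<alpha> by simp
  qed
  let ?r = "\<Phi> (c + \<eta>) (\<lambda>\<gamma>. a \<gamma> * (1 - (\<Sum>x\<in>S. \<alpha> x * \<psi> \<gamma> x)))"
  have \<Phi>r: "0 \<le> ?r f \<and> ?r f \<le> 1" for f
    by (rule \<Phi>) (use c ha a \<alpha>\<psi> in auto)
  have one: "?E (\<Phi> c a) \<le> ?E (?b x)" if x: "x \<in> S" for x
  proof (rule excursion_inequality[OF S(1) x, where K = 1])
    fix N f
    have "excursion S (\<Phi> c a) N x f \<le> c + ht S x v + (\<Sum>\<gamma>\<in>long_paths S n v f {x}. a \<gamma> * (1 - \<psi> \<gamma> x))"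
      unfolding \<Phi>_def by (rule excursion_long_paths) (use S a c \<psi>1 \<psi> x in auto)
    also have "(\<Sum>\<gamma>\<in>long_paths S n v f {x}. a \<gamma> * (1 - \<psi> \<gamma> x)) \<le> (\<Sum>\<gamma>\<in>?G f. a \<gamma> * (1 - \<psi> \<gamma> x))"
    proof (rule sum_mono2)
      show "long_paths S n v f {x} \<subseteq> ?G f" by (auto simp: long_paths_def)
      fix \<gamma> assume "\<gamma> \<in> ?G f - long_paths S n v f {x}"
      then have "\<gamma> \<in> paths S n v" by (auto simp: long_paths_def)
      then show "0 \<le> a \<gamma> * (1 - \<psi> \<gamma> x)" using a \<psi>1[OF _ x] by simp
    qed (rule G)
    finally show "excursion S (\<Phi> c a) N x f \<le> ?b x f"
      using excursion_bounds[of "\<Phi> c a" S N x f] \<Phi>a by (simp add: \<Phi>_def)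
  qed (use \<Phi>a \<Phi>b[OF x] in \<open>auto simp: abs_le_iff intro: order_trans[of _ 0]\<close>)
  have ia: "integrable (measure_pmf (wired S)) (\<Phi> c a)"
    by (rule integrable_pmf_bounded[of _ 1]) (use \<Phi>a in \<open>auto simp: abs_le_iff intro: order_trans[of _ 0]\<close>)
  have ib: "integrable (measure_pmf (wired S)) (?b x)" if "x \<in> S" for x
    by (rule integrable_pmf_bounded[of _ 1]) (use \<Phi>b[OF that] in \<open>auto simp: abs_le_iff intro: order_trans[of _ 0]\<close>)
  have ir: "integrable (measure_pmf (wired S)) ?r"
    by (rule integrable_pmf_bounded[of _ 1]) (use \<Phi>r in \<open>auto simp: abs_le_iff intro: order_trans[of _ 0]\<close>)
  let ?A = "\<Sum>x\<in>S. \<alpha> x"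
  have "?E (\<Phi> c a) = (1 - ?A) * ?E (\<Phi> c a) + (\<Sum>x\<in>S. \<alpha> x * ?E (\<Phi> c a))"
    by (simp add: sum_distrib_right[symmetric] algebra_simps)
  also have "\<dots> \<le> (1 - ?A) * ?E (\<Phi> c a) + (\<Sum>x\<in>S. \<alpha> x * ?E (?b x))"
    by (intro add_left_mono sum_mono mult_left_mono one \<alpha>)
  also have "\<dots> = ?E (\<lambda>f. (1 - ?A) * \<Phi> c a f + (\<Sum>x\<in>S. \<alpha> x * ?b x f))"
    by (simp add: ia ib)
  also have "\<dots> \<le> ?E ?r"
  proof (rule integral_mono)
    fix f
    have "(1 - ?A) * \<Phi> c a f + (\<Sum>x\<in>S. \<alpha> x * ?b x f) \<le> (1 - ?A) * 1 + (\<Sum>x\<in>S. \<alpha> x * 1)"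
      by (intro add_mono mult_left_mono sum_mono) (use \<alpha> \<Phi>a \<Phi>b in auto)
    then have le1: "(1 - ?A) * \<Phi> c a f + (\<Sum>x\<in>S. \<alpha> x * ?b x f) \<le> 1" by simp
    have "(1 - ?A) * \<Phi> c a f + (\<Sum>x\<in>S. \<alpha> x * ?b x f) \<le>
        (1 - ?A) * (c + (\<Sum>\<gamma>\<in>?G f. a \<gamma>)) +
        (\<Sum>x\<in>S. \<alpha> x * (c + ht S x v + (\<Sum>\<gamma>\<in>?G f. a \<gamma> * (1 - \<psi> \<gamma> x))))"
      by (intro add_mono mult_left_mono sum_mono) (use \<alpha> in \<open>auto simp: \<Phi>_def\<close>)
    also have "(\<Sum>x\<in>S. \<alpha> x * (c + ht S x v + (\<Sum>\<gamma>\<in>?G f. a \<gamma> * (1 - \<psi> \<gamma> x)))) =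
        ?A * (c + (\<Sum>\<gamma>\<in>?G f. a \<gamma>)) + (\<Sum>x\<in>S. \<alpha> x * ht S x v) - (\<Sum>x\<in>S. \<Sum>\<gamma>\<in>?G f. a \<gamma> * (\<alpha> x * \<psi> \<gamma> x))"
    proof -
      define s where "s = (\<Sum>\<gamma>\<in>?G f. a \<gamma>)"
      have e: "(\<Sum>\<gamma>\<in>?G f. a \<gamma> * (1 - \<psi> \<gamma> x)) = s - (\<Sum>\<gamma>\<in>?G f. a \<gamma> * \<psi> \<gamma> x)" for x
        by (simp add: right_diff_distrib sum_subtractf s_def)
      show ?thesis unfolding e s_def[symmetric]
        by (simp add: algebra_simps sum.distrib sum_subtractf sum_distrib_left)
    qed
    also have "(\<Sum>x\<in>S. \<Sum>\<gamma>\<in>?G f. a \<gamma> * (\<alpha> x * \<psi> \<gamma> x)) = (\<Sum>\<gamma>\<in>?G f. a \<gamma> * (\<Sum>x\<in>S. \<alpha> x * \<psi> \<gamma> x))"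
      by (simp add: sum_distrib_left) (rule sum.swap)
    finally have "(1 - ?A) * \<Phi> c a f + (\<Sum>x\<in>S. \<alpha> x * ?b x f) \<le>
        c + (\<Sum>x\<in>S. \<alpha> x * ht S x v) + (\<Sum>\<gamma>\<in>?G f. a \<gamma> * (1 - (\<Sum>x\<in>S. \<alpha> x * \<psi> \<gamma> x)))"
      by (simp add: algebra_simps sum_subtractf)
    then show "(1 - ?A) * \<Phi> c a f + (\<Sum>x\<in>S. \<alpha> x * ?b x f) \<le> ?r f"
      using le1 \<eta> by (simp add: \<Phi>_def)
  qed (use ia ib ir in auto)
  finally show ?thesis .
qed

text \<open>Each round adds \<eta> to the constant and multiplies the weight of every path by one
  minus its bound for being hit.\<close>

lemma excursion_iterate:
  fixes \<psi> :: "'v list \<Rightarrow> 'v \<Rightarrow> real" and S v n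
  defines "\<Phi> \<equiv> \<lambda>c a f. min 1 (c + (\<Sum>\<gamma>\<in>long_paths S n v f {}. a \<gamma> :: real))"
  assumes S: "dom S" "v \<notin> S"
    and \<psi>1: "\<And>\<gamma> y. \<gamma> \<in> paths S n v \<Longrightarrow> y \<in> S \<Longrightarrow> \<psi> \<gamma> y \<le> 1"
    and \<psi>: "\<And>\<gamma> y. \<gamma> \<in> paths S n v \<Longrightarrow> y \<in> S - set \<gamma> \<Longrightarrow> \<psi> \<gamma> y \<le> (\<Sum>w\<in>S. p y w * \<psi> \<gamma> w)"
    and \<alpha>: "\<And>x. x \<in> S \<Longrightarrow> 0 \<le> \<alpha> x" "(\<Sum>x\<in>S. \<alpha> x) \<le> 1" and \<eta>: "(\<Sum>x\<in>S. \<alpha> x * ht S x v) \<le> \<eta>"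
  shows "measure_pmf.expectation (wired S) (\<Phi> 0 (\<lambda>_. 1)) \<le>
    measure_pmf.expectation (wired S) (\<Phi> (real M * \<eta>) (\<lambda>\<gamma>. (1 - (\<Sum>x\<in>S. \<alpha> x * \<psi> \<gamma> x)) ^ M))"
proof (induction M)
  case (Suc M)
  have \<alpha>\<psi>: "(\<Sum>x\<in>S. \<alpha> x * \<psi> \<gamma> x) \<le> 1" if "\<gamma> \<in> paths S n v" for \<gamma>
  proof -
    have "(\<Sum>x\<in>S. \<alpha> x * \<psi> \<gamma> x) \<le> (\<Sum>x\<in>S. \<alpha> x * 1)" by (intro sum_mono mult_left_mono \<psi>1 that \<alpha>)
    then show ?thesis using \<alpha> by simp
  qed
  have ha: "0 \<le> \<eta>"
  proof -
    have "0 \<le> (\<Sum>x\<in>S. \<alpha> x * ht S x v)" by (intro sum_nonneg mult_nonneg_nonneg \<alpha> hit_nonneg S)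
    then show ?thesis using \<eta> by linarith
  qed
  note Suc.IH
  also have "measure_pmf.expectation (wired S) (\<Phi> (real M * \<eta>) (\<lambda>\<gamma>. (1 - (\<Sum>x\<in>S. \<alpha> x * \<psi> \<gamma> x)) ^ M)) \<le>
      measure_pmf.expectation (wired S)
        (\<Phi> (real M * \<eta> + \<eta>) (\<lambda>\<gamma>. (1 - (\<Sum>x\<in>S. \<alpha> x * \<psi> \<gamma> x)) ^ M * (1 - (\<Sum>x\<in>S. \<alpha> x * \<psi> \<gamma> x))))"
    unfolding \<Phi>_def
    by (rule excursion_mixture) (use S \<psi>1 \<psi> \<alpha> \<eta> \<alpha>\<psi> ha in auto)
  finally show ?case by (simp add: algebra_simps)
qed simp

text \<open>A path of length 2 n is cut into \<gamma> and a continuation of length n. M rounds with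
  starting measure \<epsilon> / M times \<open>kill\<close> hit v with total mass at most
  \<epsilon>, by \<open>kill_hit_le_1\<close>, and spare \<gamma> with at most the exponential
  factor, as a Poisson number of excursions would.\<close>

lemma tall_doubling:
  fixes \<psi> :: "'v list \<Rightarrow> 'v \<Rightarrow> real"
  assumes S: "dom S" "v \<in> V" "v \<notin> S" and \<epsilon>: "0 \<le> \<epsilon>"
    and \<psi>0: "\<And>\<gamma> y. \<gamma> \<in> paths S n v \<Longrightarrow> y \<in> S \<Longrightarrow> 0 \<le> \<psi> \<gamma> y"
    and \<psi>1: "\<And>\<gamma> y. \<gamma> \<in> paths S n v \<Longrightarrow> y \<in> S \<Longrightarrow> \<psi> \<gamma> y \<le> 1"
    and \<psi>: "\<And>\<gamma> y. \<gamma> \<in> paths S n v \<Longrightarrow> y \<in> S - set \<gamma> \<Longrightarrow> \<psi> \<gamma> y \<le> (\<Sum>w\<in>S. p y w * \<psi> \<gamma> w)"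
  shows "tall S (2 * n) v \<le> \<epsilon> + (\<Sum>\<gamma>\<in>paths S n v. wt S \<gamma> * tall (S - set \<gamma>) n (last \<gamma>) *
    exp (- \<epsilon> * (\<Sum>x\<in>S. kill S x * \<psi> \<gamma> x)))"
proof -
  have fin: "finite S" using S by (simp add: domD)
  let ?E = "measure_pmf.expectation (wired S)"
  define \<Phi> where "\<Phi> c a f = min 1 (c + (\<Sum>\<gamma>\<in>long_paths S n v f {}. a \<gamma>))" for c :: real and a f
  let ?\<kappa> = "\<lambda>\<gamma>. \<Sum>x\<in>S. kill S x * \<psi> \<gamma> x"
  \<comment> \<open>The measure \<epsilon> times \<open>kill\<close> may have total mass above 1; it
    is spread over enough rounds to be a subprobability in each of them.\<close>
  obtain M :: nat where M: "real M > \<epsilon> * (\<Sum>x\<in>S. kill S x)" "real M > 0"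
    using reals_Archimedean2[of "max 0 (\<epsilon> * (\<Sum>x\<in>S. kill S x))"] by auto
  define \<alpha> where "\<alpha> x = \<epsilon> / real M * kill S x" for x
  have \<alpha>: "0 \<le> \<alpha> x" for x using \<epsilon> M kill_nonneg[OF S(1)] by (simp add: \<alpha>_def)
  have \<alpha>sum: "(\<Sum>x\<in>S. \<alpha> x) \<le> 1"
  proof -
    have "(\<Sum>x\<in>S. \<alpha> x) = \<epsilon> * (\<Sum>x\<in>S. kill S x) / real M"
      unfolding \<alpha>_def sum_distrib_left[symmetric] by simp
    then show ?thesis using M by simp
  qed
  have \<eta>: "(\<Sum>x\<in>S. \<alpha> x * ht S x v) \<le> \<epsilon> / real M"
  proof -
    have "(\<Sum>x\<in>S. \<alpha> x * ht S x v) = \<epsilon> / real M * (\<Sum>x\<in>S. kill S x * ht S x v)"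
      by (simp add: \<alpha>_def sum_distrib_left mult.assoc)
    also have "\<dots> \<le> \<epsilon> / real M * 1" by (intro mult_left_mono kill_hit_le_1 S) (use \<epsilon> M in auto)
    finally show ?thesis by simp
  qed
  have \<alpha>\<psi>: "(\<Sum>x\<in>S. \<alpha> x * \<psi> \<gamma> x) = \<epsilon> / real M * ?\<kappa> \<gamma>" for \<gamma>
    by (simp add: \<alpha>_def sum_distrib_left mult.assoc)
  have pw: "(1 - (\<Sum>x\<in>S. \<alpha> x * \<psi> \<gamma> x)) ^ M \<le> exp (- \<epsilon> * ?\<kappa> \<gamma>)" if \<gamma>: "\<gamma> \<in> paths S n v" for \<gamma>
  proof -
    have "(\<Sum>x\<in>S. \<alpha> x * \<psi> \<gamma> x) \<le> (\<Sum>x\<in>S. \<alpha> x * 1)" by (intro sum_mono mult_left_mono \<psi>1 \<gamma> \<alpha>)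
    then have "0 \<le> 1 - (\<Sum>x\<in>S. \<alpha> x * \<psi> \<gamma> x)" using \<alpha>sum by simp
    moreover have "1 - (\<Sum>x\<in>S. \<alpha> x * \<psi> \<gamma> x) \<le> exp (- (\<Sum>x\<in>S. \<alpha> x * \<psi> \<gamma> x))"
      using exp_ge_add_one_self[of "- (\<Sum>x\<in>S. \<alpha> x * \<psi> \<gamma> x)"] by simp
    ultimately have "(1 - (\<Sum>x\<in>S. \<alpha> x * \<psi> \<gamma> x)) ^ M \<le> exp (- (\<Sum>x\<in>S. \<alpha> x * \<psi> \<gamma> x)) ^ M"
      by (intro power_mono)
    also have "\<dots> = exp (- \<epsilon> * ?\<kappa> \<gamma>)"
      using M unfolding \<alpha>\<psi> by (simp add: exp_of_nat_mult[symmetric])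
    finally show ?thesis .
  qed
  have "tall S (2 * n) v = ?E (\<lambda>f. of_bool (\<exists>\<gamma>\<in>paths S (2 * n) v. follows f \<gamma>))"
    by (simp add: tall_def expectation_of_bool)
  also have "\<dots> \<le> ?E (\<Phi> 0 (\<lambda>_. 1))"
  proof (rule expectation_mono_bounded)
    fix f
    show "\<bar>of_bool (\<exists>\<gamma>\<in>paths S (2 * n) v. follows f \<gamma>) :: real\<bar> \<le> 1" by simp
    show "\<bar>\<Phi> 0 (\<lambda>_. 1) f\<bar> \<le> 1" by (simp add: \<Phi>_def)
    show "of_bool (\<exists>\<gamma>\<in>paths S (2 * n) v. follows f \<gamma>) \<le> \<Phi> 0 (\<lambda>_. 1) f"
    proof (cases "\<exists>\<gamma>\<in>paths S (2 * n) v. follows f \<gamma>")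
      case True
      then obtain \<gamma> where \<gamma>: "\<gamma> \<in> paths S (2 * n) v" "follows f \<gamma>" by auto
      have n: "n \<le> 2 * n" "n < length \<gamma>" using pathsD(1)[OF \<gamma>(1)] by auto
      note t = paths_take_drop[OF \<gamma>(1) n(1)]
      have "take (Suc n) \<gamma> \<in> long_paths S n v f {}"
        unfolding long_paths_def using t follows_split[OF n(2), of f] \<gamma>
        by (auto intro!: bexI[of _ "drop n \<gamma>"])
      then have "card (long_paths S n v f {}) > 0"
        using finite_long_paths[OF fin] by (auto simp: card_gt_0_iff)
      then show ?thesis by (simp add: \<Phi>_def)
    qed (simp add: \<Phi>_def)
  qed
  also have "\<dots> \<le> ?E (\<Phi> (real M * (\<epsilon> / real M)) (\<lambda>\<gamma>. (1 - (\<Sum>x\<in>S. \<alpha> x * \<psi> \<gamma> x)) ^ M))"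
    unfolding \<Phi>_def by (rule excursion_iterate) (use S \<psi>1 \<psi> \<alpha> \<alpha>sum \<eta> in auto)
  also have "\<dots> \<le> ?E (\<lambda>f. \<epsilon> + (\<Sum>\<gamma>\<in>paths S n v. of_bool (\<gamma> \<in> long_paths S n v f {}) * exp (- \<epsilon> * ?\<kappa> \<gamma>)))"
  proof (rule integral_mono)
    show "integrable (measure_pmf (wired S)) (\<lambda>f. \<epsilon> + (\<Sum>\<gamma>\<in>paths S n v. of_bool (\<gamma> \<in> long_paths S n v f {}) * exp (- \<epsilon> * ?\<kappa> \<gamma>)))"
      by (rule Bochner_Integration.integrable_add, simp, rule Bochner_Integration.integrable_sum,
          rule integrable_mult_left, rule integrable_pmf_bounded[where K = 1]) simp
    show "integrable (measure_pmf (wired S)) (\<Phi> (real M * (\<epsilon> / real M)) (\<lambda>\<gamma>. (1 - (\<Sum>x\<in>S. \<alpha> x * \<psi> \<gamma> x)) ^ M))"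
    proof (rule integrable_pmf_bounded[of _ 1])
      fix f
      have "0 \<le> (\<Sum>\<gamma>\<in>long_paths S n v f {}. (1 - (\<Sum>x\<in>S. \<alpha> x * \<psi> \<gamma> x)) ^ M)"
      proof (intro sum_nonneg zero_le_power)
        fix \<gamma> assume "\<gamma> \<in> long_paths S n v f {}"
        then have "(\<Sum>x\<in>S. \<alpha> x * \<psi> \<gamma> x) \<le> (\<Sum>x\<in>S. \<alpha> x * 1)"
          by (intro sum_mono mult_left_mono \<psi>1 \<alpha>) (auto simp: long_paths_def)
        then show "0 \<le> 1 - (\<Sum>x\<in>S. \<alpha> x * \<psi> \<gamma> x)" using \<alpha>sum by simp
      qed
      then show "\<bar>\<Phi> (real M * (\<epsilon> / real M)) (\<lambda>\<gamma>. (1 - (\<Sum>x\<in>S. \<alpha> x * \<psi> \<gamma> x)) ^ M) f\<bar> \<le> 1"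
        using \<epsilon> M by (auto simp: \<Phi>_def)
    qed
    fix f
    have "\<Phi> (real M * (\<epsilon> / real M)) (\<lambda>\<gamma>. (1 - (\<Sum>x\<in>S. \<alpha> x * \<psi> \<gamma> x)) ^ M) f \<le>
        \<epsilon> + (\<Sum>\<gamma>\<in>long_paths S n v f {}. (1 - (\<Sum>x\<in>S. \<alpha> x * \<psi> \<gamma> x)) ^ M)"
      using M by (simp add: \<Phi>_def)
    also have "\<dots> \<le> \<epsilon> + (\<Sum>\<gamma>\<in>long_paths S n v f {}. exp (- \<epsilon> * ?\<kappa> \<gamma>))"
      by (intro add_left_mono sum_mono pw) (auto simp: long_paths_def)
    also have "(\<Sum>\<gamma>\<in>long_paths S n v f {}. exp (- \<epsilon> * ?\<kappa> \<gamma>)) =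
        (\<Sum>\<gamma>\<in>paths S n v. if \<gamma> \<in> long_paths S n v f {} then exp (- \<epsilon> * ?\<kappa> \<gamma>) else 0)"
      by (rule sum.mono_neutral_cong_left) (use fin in \<open>auto simp: finite_paths long_paths_def\<close>)
    also have "\<dots> = (\<Sum>\<gamma>\<in>paths S n v. of_bool (\<gamma> \<in> long_paths S n v f {}) * exp (- \<epsilon> * ?\<kappa> \<gamma>))"
      by (intro sum.cong) auto
    finally show "\<Phi> (real M * (\<epsilon> / real M)) (\<lambda>\<gamma>. (1 - (\<Sum>x\<in>S. \<alpha> x * \<psi> \<gamma> x)) ^ M) f \<le>
        \<epsilon> + (\<Sum>\<gamma>\<in>paths S n v. of_bool (\<gamma> \<in> long_paths S n v f {}) * exp (- \<epsilon> * ?\<kappa> \<gamma>))" .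
  qed
  also have "\<dots> = \<epsilon> + (\<Sum>\<gamma>\<in>paths S n v. measure_pmf.prob (wired S) {f. \<gamma> \<in> long_paths S n v f {}} * exp (- \<epsilon> * ?\<kappa> \<gamma>))"
  proof -
    have i: "integrable (measure_pmf (wired S)) (\<lambda>f. of_bool (\<gamma> \<in> long_paths S n v f {}) * exp (- \<epsilon> * ?\<kappa> \<gamma>))" for \<gamma>
      by (rule integrable_mult_left, rule integrable_pmf_bounded[where K = 1]) simp
    have "?E (\<lambda>f. \<epsilon> + (\<Sum>\<gamma>\<in>paths S n v. of_bool (\<gamma> \<in> long_paths S n v f {}) * exp (- \<epsilon> * ?\<kappa> \<gamma>))) =
        \<epsilon> + ?E (\<lambda>f. \<Sum>\<gamma>\<in>paths S n v. of_bool (\<gamma> \<in> long_paths S n v f {}) * exp (- \<epsilon> * ?\<kappa> \<gamma>))"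
      by (subst Bochner_Integration.integral_add, simp, rule Bochner_Integration.integrable_sum, rule i, simp)
    also have "?E (\<lambda>f. \<Sum>\<gamma>\<in>paths S n v. of_bool (\<gamma> \<in> long_paths S n v f {}) * exp (- \<epsilon> * ?\<kappa> \<gamma>)) =
        (\<Sum>\<gamma>\<in>paths S n v. ?E (\<lambda>f. of_bool (\<gamma> \<in> long_paths S n v f {}) * exp (- \<epsilon> * ?\<kappa> \<gamma>)))"
      by (rule Bochner_Integration.integral_sum) (rule i)
    also have "\<dots> = (\<Sum>\<gamma>\<in>paths S n v. measure_pmf.prob (wired S) {f. \<gamma> \<in> long_paths S n v f {}} * exp (- \<epsilon> * ?\<kappa> \<gamma>))"
      by (intro sum.cong refl) (simp only: integral_mult_left_zero expectation_of_bool)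
    finally show ?thesis .
  qed
  also have "(\<Sum>\<gamma>\<in>paths S n v. measure_pmf.prob (wired S) {f. \<gamma> \<in> long_paths S n v f {}} * exp (- \<epsilon> * ?\<kappa> \<gamma>)) =
      (\<Sum>\<gamma>\<in>paths S n v. wt S \<gamma> * tall (S - set \<gamma>) n (last \<gamma>) * exp (- \<epsilon> * ?\<kappa> \<gamma>))"
  proof (intro sum.cong refl arg_cong2[where f = "(*)"])
    fix \<gamma> assume \<gamma>: "\<gamma> \<in> paths S n v"
    let ?F = "\<lambda>f. \<exists>\<delta>\<in>paths (S - set \<gamma>) n (last \<gamma>). follows f \<delta>"
    have "{f. \<gamma> \<in> long_paths S n v f {}} = {f. follows f \<gamma> \<and> ?F f}"
      using \<gamma> by (auto simp: long_paths_def)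
    moreover have "measure_pmf.prob (wired S) {f. follows f \<gamma> \<and> ?F f} =
        wt S \<gamma> * measure_pmf.prob (wired (S - set \<gamma>)) {f. ?F f}"
    proof (rule prob_follows[OF S(1,3) \<gamma>])
      fix f g :: "'v \<Rightarrow> 'v" assume eq: "\<And>x. x \<in> S - set \<gamma> \<Longrightarrow> f x = g x"
      have "follows f \<delta> \<longleftrightarrow> follows g \<delta>" if "\<delta> \<in> paths (S - set \<gamma>) n (last \<gamma>)" for \<delta>
        by (rule follows_cong) (use eq pathsD(4)[OF that] in auto)
      then show "?F f \<longleftrightarrow> ?F g" by auto
    qed
    ultimately show "measure_pmf.prob (wired S) {f. \<gamma> \<in> long_paths S n v f {}} =
        wt S \<gamma> * tall (S - set \<gamma>) n (last \<gamma>)" by (simp add: tall_def)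
  qed
  finally show ?thesis .
qed

end

context transitive_chain
begin

text \<open>
  The vertices \<open>z\<close> of \<open>\<gamma>\<close> at which the potential of \<open>\<gamma>\<close> is at most \<open>lam\<close> carry a measure whose
  potential is bounded by one; it bounds the probability of hitting \<open>\<gamma>\<close> from below.
\<close>

lemma tall_recursion:
  assumes S: "dom S" "v \<in> V" "v \<notin> S" and \<epsilon>: "0 \<le> \<epsilon>" and lam: "0 < lam" and n: "0 < n"
    and T: "\<And>S v. dom S \<Longrightarrow> v \<in> V \<Longrightarrow> v \<notin> S \<Longrightarrow> tall S n v \<le> T"
  shows "tall S (2 * n) v \<le> \<epsilon> + T * (bubble * exp (- \<epsilon> * real n / (2 * lam)) + 4 * bubble ^ 3 / lam)"
proof -
  have fin: "finite S" using S by (simp add: domD)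
  have T0: "0 \<le> T"
  proof -
    have "dom {}" "v \<in> V" "v \<notin> {}" using S by (auto simp: dom_def)
    from T[OF this] show ?thesis unfolding tall_def by (meson measure_nonneg order_trans)
  qed
  define pot where "pot \<gamma> z = (\<Sum>u\<in>set (tl \<gamma>). gr S z u)" for \<gamma> z
  define L where "L \<gamma> = {z \<in> set (tl \<gamma>). pot \<gamma> z \<le> lam}" for \<gamma>
  define \<psi> where "\<psi> \<gamma> y = (\<Sum>z\<in>L \<gamma>. gr S y z) / lam" for \<gamma> y
  have L: "L \<gamma> \<subseteq> S" "L \<gamma> \<subseteq> set \<gamma>" "finite (L \<gamma>)" if "\<gamma> \<in> paths S n v" for \<gamma>
    using pathsD[OF that] by (auto simp: L_def)
  have \<psi>0: "0 \<le> \<psi> \<gamma> y" if "\<gamma> \<in> paths S n v" "y \<in> S" for \<gamma> y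
    unfolding \<psi>_def using lam L[OF that(1)] that(2) S
    by (intro divide_nonneg_pos sum_nonneg gr_nonneg) auto
  have harm: "(\<Sum>w\<in>S. p y w * \<psi> \<gamma> w) = \<psi> \<gamma> y" if "\<gamma> \<in> paths S n v" "y \<in> S - L \<gamma>" for \<gamma> y
  proof -
    have "(\<Sum>w\<in>S. p y w * \<psi> \<gamma> w) = (\<Sum>z\<in>L \<gamma>. \<Sum>w\<in>S. p y w * gr S w z) / lam"
      unfolding \<psi>_def
      by (simp add: sum_divide_distrib[symmetric] sum_distrib_left) (rule disjI2, rule sum.swap)
    also have "(\<Sum>z\<in>L \<gamma>. \<Sum>w\<in>S. p y w * gr S w z) = (\<Sum>z\<in>L \<gamma>. gr S y z)"
    proof (rule sum.cong[OF refl])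
      fix z assume z: "z \<in> L \<gamma>"
      then show "(\<Sum>w\<in>S. p y w * gr S w z) = gr S y z"
        using gr_front[OF S(1), of y z] that L[OF that(1)] by auto
    qed
    finally show ?thesis by (simp add: \<psi>_def)
  qed
  \<comment> \<open>By the minimum principle only the vertices of \<open>L \<gamma>\<close> have to
    be checked, and there the potential is at most lam by definition.\<close>
  have \<psi>1: "\<psi> \<gamma> y \<le> 1" if \<gamma>: "\<gamma> \<in> paths S n v" and y: "y \<in> S" for \<gamma> y
  proof -
    have "0 \<le> 1 - \<psi> \<gamma> y"
    proof (rule superharmonic_nonneg[OF S(1), where A = "L \<gamma>"])
      fix z assume z: "z \<in> S - L \<gamma>"
      have "(\<Sum>w\<in>S. p z w * (1 - \<psi> \<gamma> w)) = (\<Sum>w\<in>S. p z w) - \<psi> \<gamma> z"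
        by (simp add: right_diff_distrib sum_subtractf harm[OF \<gamma> z])
      then show "(\<Sum>w\<in>S. p z w * (1 - \<psi> \<gamma> w)) \<le> 1 - \<psi> \<gamma> z"
        using sum_pmf_le_1[OF fin, of "P z"] by simp
    next
      fix z assume z: "z \<in> S \<inter> L \<gamma>"
      have "(\<Sum>u\<in>L \<gamma>. gr S z u) \<le> pot \<gamma> z"
        unfolding pot_def
        by (intro sum_mono2 gr_nonneg S) (use z pathsD(4)[OF \<gamma>] in \<open>auto simp: L_def\<close>)
      also have "\<dots> \<le> lam" using z by (simp add: L_def)
      finally show "0 \<le> 1 - \<psi> \<gamma> z" using lam by (simp add: \<psi>_def)
    qed (rule y)
    then show ?thesis by simp
  qed
  \<comment> \<open>From the starting measure \<open>kill\<close> every vertex of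
    \<open>L \<gamma>\<close> is visited once on average.\<close>
  have \<kappa>: "(\<Sum>x\<in>S. kill S x * \<psi> \<gamma> x) = real (card (L \<gamma>)) / lam" if "\<gamma> \<in> paths S n v" for \<gamma>
  proof -
    have "(\<Sum>x\<in>S. kill S x * \<psi> \<gamma> x) = (\<Sum>z\<in>L \<gamma>. \<Sum>x\<in>S. kill S x * gr S x z) / lam"
      unfolding \<psi>_def
      by (simp add: sum_divide_distrib[symmetric] sum_distrib_left) (rule disjI2, rule sum.swap)
    also have "(\<Sum>z\<in>L \<gamma>. \<Sum>x\<in>S. kill S x * gr S x z) = (\<Sum>z\<in>L \<gamma>. 1)"
      by (intro sum.cong refl kill_green S) (use L[OF that] in auto)
    finally show ?thesis by simp
  qed
  have energy: "energy S \<gamma> = (\<Sum>z\<in>set (tl \<gamma>). pot \<gamma> z)" if "\<gamma> \<in> paths S n v" for \<gamma>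
  proof -
    note g = pathsD[OF that]
    have bij: "bij_betw ((!) \<gamma>) {1..<length \<gamma>} (set (tl \<gamma>))"
    proof (rule bij_betw_imageI)
      show "inj_on ((!) \<gamma>) {1..<length \<gamma>}" using g(3) by (auto intro!: inj_onI simp: nth_eq_iff_index_eq)
      have "set (tl \<gamma>) = (!) (tl \<gamma>) ` {0..<length \<gamma> - 1}" by (force simp: set_conv_nth)
      also have "\<dots> = (\<lambda>i. \<gamma> ! Suc i) ` {0..<length \<gamma> - 1}"
        by (intro image_cong refl) (simp add: nth_tl)
      also have "\<dots> = (!) \<gamma> ` Suc ` {0..<length \<gamma> - 1}" by (simp only: image_image)
      also have "Suc ` {0..<length \<gamma> - 1} = {1..<length \<gamma>}" using g(1) by simp
      finally show "(!) \<gamma> ` {1..<length \<gamma>} = set (tl \<gamma>)" ..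
    qed
    have "energy S \<gamma> = (\<Sum>i\<in>{1..<length \<gamma>}. pot \<gamma> (\<gamma> ! i))"
      unfolding energy_def pot_def
      by (intro sum.cong refl) (rule sum.reindex_bij_betw[OF bij])
    also have "\<dots> = (\<Sum>z\<in>set (tl \<gamma>). pot \<gamma> z)" by (rule sum.reindex_bij_betw[OF bij])
    finally show ?thesis .
  qed
  \<comment> \<open>If at least half of the vertices have small potential, the first term dominates.
    Otherwise the other vertices alone give an energy of at least lam * n / 2, and the second term
    is at least 1.\<close>
  have bound: "exp (- \<epsilon> * (\<Sum>x\<in>S. kill S x * \<psi> \<gamma> x)) \<le> exp (- \<epsilon> * real n / (2 * lam)) + 2 * energy S \<gamma> / (lam * real n)"
    if \<gamma>: "\<gamma> \<in> paths S n v" for \<gamma>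
  proof -
    note g = pathsD[OF \<gamma>]
    have pot0: "0 \<le> pot \<gamma> z" if "z \<in> set (tl \<gamma>)" for z
      unfolding pot_def by (intro sum_nonneg gr_nonneg S) (use g that in auto)
    have en0: "0 \<le> energy S \<gamma>" unfolding energy[OF \<gamma>] by (intro sum_nonneg pot0)
    have card: "card (set (tl \<gamma>)) = n" using g(1,3) by (simp add: distinct_card distinct_tl)
    show ?thesis
    proof (cases "real n / 2 \<le> real (card (L \<gamma>))")
      case True
      have "- \<epsilon> * (real (card (L \<gamma>)) / lam) \<le> - \<epsilon> * (real n / 2 / lam)"
        using True lam \<epsilon> by (intro mult_left_mono_neg divide_right_mono) auto
      then have "exp (- \<epsilon> * (real (card (L \<gamma>)) / lam)) \<le> exp (- \<epsilon> * real n / (2 * lam))"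
        by (simp add: mult.commute)
      moreover have "0 \<le> 2 * energy S \<gamma> / (lam * real n)" using en0 lam by simp
      ultimately show ?thesis unfolding \<kappa>[OF \<gamma>] by linarith
    next
      case False
      have "card (set (tl \<gamma>) - L \<gamma>) = n - card (L \<gamma>)"
        unfolding card[symmetric] by (rule card_Diff_subset) (auto simp: L_def)
      then have "real n / 2 \<le> real (card (set (tl \<gamma>) - L \<gamma>))" using False by linarith
      then have "lam * (real n / 2) \<le> (\<Sum>z\<in>set (tl \<gamma>) - L \<gamma>. lam)" using lam by simp
      also have "\<dots> \<le> (\<Sum>z\<in>set (tl \<gamma>) - L \<gamma>. pot \<gamma> z)" by (intro sum_mono) (auto simp: L_def)
      also have "\<dots> \<le> energy S \<gamma>" unfolding energy[OF \<gamma>] by (intro sum_mono2 pot0) auto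
      finally have "1 \<le> 2 * energy S \<gamma> / (lam * real n)" using lam n by (simp add: field_simps)
      moreover have "exp (- \<epsilon> * (\<Sum>x\<in>S. kill S x * \<psi> \<gamma> x)) \<le> 1" unfolding \<kappa>[OF \<gamma>] using \<epsilon> lam by simp
      moreover have "0 \<le> exp (- \<epsilon> * real n / (2 * lam))" by simp
      ultimately show ?thesis by linarith
    qed
  qed
  have "tall S (2 * n) v \<le> \<epsilon> + (\<Sum>\<gamma>\<in>paths S n v. wt S \<gamma> * tall (S - set \<gamma>) n (last \<gamma>) *
      exp (- \<epsilon> * (\<Sum>x\<in>S. kill S x * \<psi> \<gamma> x)))"
  proof (rule tall_doubling[OF S \<epsilon> \<psi>0 \<psi>1])
    fix \<gamma> y assume \<gamma>: "\<gamma> \<in> paths S n v" and y: "y \<in> S - set \<gamma>"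
    then have "y \<in> S - L \<gamma>" using L(2)[OF \<gamma>] by auto
    from harm[OF \<gamma> this] show "\<psi> \<gamma> y \<le> (\<Sum>w\<in>S. p y w * \<psi> \<gamma> w)" by simp
  qed
  also have "\<dots> \<le> \<epsilon> + (\<Sum>\<gamma>\<in>paths S n v. wt S \<gamma> * T *
      (exp (- \<epsilon> * real n / (2 * lam)) + 2 * energy S \<gamma> / (lam * real n)))"
  proof (intro add_left_mono sum_mono mult_mono bound mult_nonneg_nonneg wt_nonneg S T0 order_refl)
    fix \<gamma> assume \<gamma>: "\<gamma> \<in> paths S n v"
    have l: "last \<gamma> \<in> S" using paths_last_in[OF \<gamma>] n by simp
    show "tall (S - set \<gamma>) n (last \<gamma>) \<le> T"
      by (rule T) (use S l pathsD(5)[OF \<gamma>] in \<open>auto simp: domD\<close>)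
  qed (auto simp: tall_def)
  also have "(\<Sum>\<gamma>\<in>paths S n v. wt S \<gamma> * T * (exp (- \<epsilon> * real n / (2 * lam)) + 2 * energy S \<gamma> / (lam * real n))) =
      T * (fm S n v * exp (- \<epsilon> * real n / (2 * lam)) + 2 / (lam * real n) * (\<Sum>\<gamma>\<in>paths S n v. wt S \<gamma> * energy S \<gamma>))"
    by (simp add: fm_def sum_distrib_left sum_distrib_right sum.distrib[symmetric] algebra_simps)
  also have "\<dots> \<le> T * (bubble * exp (- \<epsilon> * real n / (2 * lam)) + 2 / (lam * real n) * (real n * (2 * bubble ^ 3)))"
    by (intro mult_left_mono add_mono mult_right_mono fm_le_bubble energy_bound S T0) (use lam in auto)
  also have "2 / (lam * real n) * (real n * (2 * bubble ^ 3)) = 4 * bubble ^ 3 / lam"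
    using n by simp
  finally show ?thesis by simp
qed

lemma tall_antimono:
  assumes "m \<le> n" shows "tall S n v \<le> tall S m v"
  unfolding tall_def
proof (rule measure_pmf.finite_measure_mono)
  show "{f. \<exists>\<gamma>\<in>paths S n v. follows f \<gamma>} \<subseteq> {f. \<exists>\<gamma>\<in>paths S m v. follows f \<gamma>}"
  proof
    fix f assume "f \<in> {f. \<exists>\<gamma>\<in>paths S n v. follows f \<gamma>}"
    then obtain \<gamma> where \<gamma>: "\<gamma> \<in> paths S n v" "follows f \<gamma>" by auto
    have "m < length \<gamma>" using pathsD(1)[OF \<gamma>(1)] assms by simp
    then have "follows f (take (Suc m) \<gamma>)" using follows_split \<gamma> by metis
    then show "f \<in> {f. \<exists>\<gamma>\<in>paths S m v. follows f \<gamma>}"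
      using paths_take_drop(1)[OF \<gamma>(1) assms] by auto
  qed
qed simp

text \<open>With \<epsilon> = A / n the choices of \<open>lam\<close> and \<open>A\<close> make the
  exponential term and the energy term equal to 1/8 each, so the bound for 2 n is A / n plus a
  quarter of the bound for n. A bound C / n has to be halved only, and the spare quarter absorbs A
  because \<open>A\<close> is at most C / 4.\<close>

lemma tall_bound: "\<exists>C\<ge>1. \<forall>S v n. dom S \<longrightarrow> v \<in> V \<longrightarrow> v \<notin> S \<longrightarrow> 0 < n \<longrightarrow> tall S n v \<le> C / real n"
proof -
  define lam where "lam = 32 * bubble ^ 3"
  define A where "A = 2 * lam * ln (8 * bubble)"
  define C where "C = max 1 (4 * A)"
  have b: "1 \<le> bubble" by (rule bubble_ge_1)
  have lam: "0 < lam" using b by (simp add: lam_def)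
  have A: "0 \<le> A" using b lam by (simp add: A_def)
  have C: "1 \<le> C" "A \<le> C / 4" by (auto simp: C_def)
  have pow: "tall S (2 ^ k) v \<le> C / 2 ^ k" if "dom S" "v \<in> V" "v \<notin> S" for S v k
    using that
  proof (induction k arbitrary: S v)
    case 0
    have "tall S 1 v \<le> 1" by (simp add: tall_def)
    then show ?case using C by simp
  next
    case (Suc k)
    let ?n = "(2::nat) ^ k"
    have "tall S (2 * ?n) v \<le> A / real ?n + C / 2 ^ k *
        (bubble * exp (- (A / real ?n) * real ?n / (2 * lam)) + 4 * bubble ^ 3 / lam)"
      by (rule tall_recursion) (use Suc A lam in auto)
    also have "exp (- (A / real ?n) * real ?n / (2 * lam)) = 1 / (8 * bubble)"
      using b lam by (simp add: A_def exp_minus inverse_eq_divide)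
    also have "bubble * (1 / (8 * bubble)) + 4 * bubble ^ 3 / lam = 1 / 4"
      using b by (simp add: lam_def)
    also have "A / real ?n + C / 2 ^ k * (1 / 4) \<le> C / 4 / 2 ^ k + C / 2 ^ k * (1 / 4)"
      using divide_right_mono[OF C(2), of "2 ^ k"] by simp
    also have "\<dots> = C / 2 ^ Suc k" by (simp add: field_simps)
    finally show ?case by simp
  qed
  have "tall S n v \<le> (2 * C) / real n" if S: "dom S" "v \<in> V" "v \<notin> S" and n: "0 < n" for S v n
  proof -
    obtain k where k: "2 ^ k \<le> n" "n < 2 ^ Suc k" using ex_power_ivl1[of 2 n] n by auto
    have "tall S n v \<le> tall S (2 ^ k) v" by (rule tall_antimono) (rule k)
    also have "\<dots> \<le> C / 2 ^ k" by (rule pow[OF S])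
    also have "\<dots> \<le> (2 * C) / real n"
    proof -
      have "real n \<le> 2 * 2 ^ k" using k(2) by (metis less_imp_le of_nat_le_iff of_nat_numeral of_nat_power power_Suc)
      then show ?thesis using C n by (simp add: field_simps mult_left_mono)
    qed
    finally show ?thesis .
  qed
  then show ?thesis using C by (intro exI[of _ "2 * C"]) auto
qed

end

section \<open>Volume and second moments\<close>

lemma pmf_finite_approx:
  assumes "0 < \<delta>"
  shows "\<exists>T. finite T \<and> T \<subseteq> set_pmf M \<and> 1 - \<delta> < (\<Sum>x\<in>T. pmf M x)"
proof -
  let ?T = "\<lambda>n. from_nat_into (set_pmf M) ` {..<n::nat}"
  have "(\<lambda>n. measure_pmf.prob M (?T n)) \<longlonglongrightarrow> measure_pmf.prob M (\<Union>n. ?T n)"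
    by (rule measure_pmf.finite_Lim_measure_incseq) (auto simp: incseq_def intro!: image_mono)
  moreover have "(\<Union>n. ?T n) = set_pmf M"
  proof -
    have "(\<Union>n. ?T n) = range (from_nat_into (set_pmf M))" by auto
    then show ?thesis using range_from_nat_into[OF set_pmf_not_empty countable_set_pmf] by simp
  qed
  moreover have "measure_pmf.prob M (set_pmf M) = 1" by (simp add: measure_pmf.prob_eq_1 AE_measure_pmf_iff)
  ultimately have "(\<lambda>n. measure_pmf.prob M (?T n)) \<longlonglongrightarrow> 1" by simp
  then have "eventually (\<lambda>n. 1 - \<delta> < measure_pmf.prob M (?T n)) sequentially"
    by (rule order_tendstoD) (use assms in simp)
  then obtain n where "1 - \<delta> < measure_pmf.prob M (?T n)" by (auto simp: eventually_sequentially)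
  then show ?thesis
    by (intro exI[of _ "?T n"]) (auto simp: measure_measure_pmf_finite from_nat_into set_pmf_not_empty)
qed

text \<open>Two paths into \<open>v\<close> followed by the same map agree up to a point and are disjoint thereafter.\<close>

lemma follows_branch:
  assumes "\<gamma> \<in> paths S l v" "\<gamma>' \<in> paths S l' v" "follows f \<gamma>" "follows f \<gamma>'"
  shows "\<exists>i\<le>l'. i \<le> l \<and> (\<exists>\<delta>\<in>paths (S - set \<gamma>) (l' - i) (\<gamma> ! i).
    follows f \<delta> \<and> \<gamma>' = take (Suc i) \<gamma> @ tl \<delta>)"
proof -
  note g = pathsD[OF assms(1)] and g' = pathsD[OF assms(2)]
  have same: "j = k \<and> take (Suc j) \<gamma> = take (Suc k) \<gamma>'"
    if "j \<le> l" "k \<le> l'" "\<gamma> ! j = \<gamma>' ! k" for j k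
  proof -
    note t = paths_take_drop[OF assms(1) that(1)] and t' = paths_take_drop[OF assms(2) that(2)]
    have "take (Suc j) \<gamma> = take (Suc k) \<gamma>'"
    proof (rule follows_unique[of f])
      show "follows f (take (Suc j) \<gamma>)" "follows f (take (Suc k) \<gamma>')"
        using follows_split[of j \<gamma> f] follows_split[of k \<gamma>' f] assms that g g' by auto
      show "last (take (Suc j) \<gamma>) = last (take (Suc k) \<gamma>')" using t t' that by simp
    qed (use pathsD[OF t(1)] pathsD[OF t'(1)] in auto)
    then have "length (take (Suc j) \<gamma>) = length (take (Suc k) \<gamma>')" by simp
    then have "j = k" using that g(1) g'(1) by simp
    then show ?thesis using \<open>take (Suc j) \<gamma> = take (Suc k) \<gamma>'\<close> by simp
  qed
  let ?I = "{i. i \<le> l \<and> i \<le> l' \<and> \<gamma> ! i = \<gamma>' ! i}"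
  define i where "i = Max ?I"
  have "\<gamma> ! 0 = \<gamma>' ! 0" using g g' by (metis hd_conv_nth)
  then have "0 \<in> ?I" by simp
  then have "?I \<noteq> {}" by blast
  moreover have fin: "finite ?I" by simp
  ultimately have i: "i \<in> ?I" unfolding i_def using Max_in by blast
  then have i': "i \<le> l" "i \<le> l'" "\<gamma> ! i = \<gamma>' ! i" by auto
  note t' = paths_take_drop[OF assms(2) i'(2)]
  have tk: "take (Suc i) \<gamma> = take (Suc i) \<gamma>'" using same[OF i'] by simp
  have "drop i \<gamma>' \<in> paths (S - set \<gamma>) (l' - i) (\<gamma> ! i)"
  proof -
    have "set (tl (drop i \<gamma>')) \<inter> set \<gamma> = {}"
    proof (rule ccontr)
      assume "set (tl (drop i \<gamma>')) \<inter> set \<gamma> \<noteq> {}"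
      then obtain z where z: "z \<in> set (drop (Suc i) \<gamma>')" "z \<in> set \<gamma>" by (auto simp: drop_Suc tl_drop)
      obtain k where k: "k < length (drop (Suc i) \<gamma>')" "z = drop (Suc i) \<gamma>' ! k"
        using z(1) by (metis in_set_conv_nth)
      obtain j where j: "j < length \<gamma>" "z = \<gamma> ! j" using z(2) by (metis in_set_conv_nth)
      have "\<gamma> ! j = \<gamma>' ! (Suc i + k)" "Suc i + k \<le> l'" using k j g' by auto
      then have "j = Suc i + k" using same[of j "Suc i + k"] j g by auto
      then have "Suc i + k \<in> ?I" using \<open>\<gamma> ! j = \<gamma>' ! (Suc i + k)\<close> \<open>Suc i + k \<le> l'\<close> j g by auto
      then have "Suc i + k \<le> i" unfolding i_def by (rule Max_ge[OF fin])
      then show False by simp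
    qed
    then show ?thesis using t'(4) i'(3) by (auto simp: paths_def)
  qed
  moreover have "follows f (drop i \<gamma>')" using follows_split[of i \<gamma>' f] assms i' g' by auto
  moreover have "\<gamma>' = take (Suc i) \<gamma> @ tl (drop i \<gamma>')" using t'(5) tk by simp
  ultimately show ?thesis using i' by blast
qed

definition reach :: "'v set \<Rightarrow> 'v \<Rightarrow> ('v \<Rightarrow> 'v) \<Rightarrow> 'v set" where
  "reach S v f = {last \<gamma> |\<gamma> n. \<gamma> \<in> paths S n v \<and> follows f \<gamma>}"

section \<open>Roots with an arrow, and pairs of paths\<close>

context symmetric_chain
begin

text \<open>If E ignores the arrow of v, allowing this arrow to close cycles changes the
  normalisation by \<open>Z (S - {v}) / Z S\<close>, which is a diagonal Green function.\<close>

lemma prob_remove_root: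
  assumes S: "dom S" "v \<in> S"
    and E: "\<And>f g. (\<And>x. x \<in> S - {v} \<Longrightarrow> f x = g x) \<Longrightarrow> E f \<longleftrightarrow> E g"
  shows "measure_pmf.prob (wired S) {f. E f} \<le> bubble * measure_pmf.prob (wired (S - {v})) {f. E f}"
proof -
  let ?T = "S - {v}"
  have T: "dom ?T" using S by auto
  have "measure_pmf.prob (arrows S) {f. acyc S f \<and> E f} \<le> measure_pmf.prob (arrows S) {f. acyc ?T f \<and> E f}"
    by (rule measure_pmf.finite_measure_mono) (auto intro: acyc_mono)
  also have "\<dots> = measure_pmf.prob (arrows ?T) {f. acyc ?T f \<and> E f}"
  proof (rule prob_Pi_pmf_subset)
    fix f g :: "'v \<Rightarrow> 'v" assume eq: "\<And>u. u \<in> ?T \<Longrightarrow> f u = g u"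
    have "acyc ?T f \<longleftrightarrow> acyc ?T g" by (rule acyc_cong) (rule eq)
    moreover have "E f \<longleftrightarrow> E g" by (rule E) (rule eq)
    ultimately show "(acyc ?T f \<and> E f) \<longleftrightarrow> (acyc ?T g \<and> E g)" by simp
  qed (use S in \<open>auto simp: domD\<close>)
  also have "\<dots> = measure_pmf.prob (wired ?T) {f. E f} * Z ?T"
    using Z_pos[OF T] by (simp add: prob_wired[OF T])
  finally have "measure_pmf.prob (wired S) {f. E f} \<le> measure_pmf.prob (wired ?T) {f. E f} * Z ?T / Z S"
    using Z_pos[OF S(1)] by (simp add: prob_wired[OF S(1)] divide_right_mono)
  also have "\<dots> = gr S v v * measure_pmf.prob (wired ?T) {f. E f}"
    using Z_remove[OF S] Z_pos[OF S(1)] by simp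
  also have "\<dots> \<le> bubble * measure_pmf.prob (wired ?T) {f. E f}"
    by (intro mult_right_mono gr_le_bubble S) auto
  finally show ?thesis .
qed

lemma paths_remove_root: "paths S n v = paths (S - {v}) n v"
  by (auto simp: paths_def) (metis distinct.simps(2) length_0_conv list.collapse nat.simps(3))

lemma finite_reach: "finite S \<Longrightarrow> finite (reach S v f)"
proof (rule finite_subset[of _ "insert v S"])
  show "reach S v f \<subseteq> insert v S"
  proof
    fix u assume "u \<in> reach S v f"
    then obtain \<gamma> n where \<gamma>: "\<gamma> \<in> paths S n v" "u = last \<gamma>" by (auto simp: reach_def)
    note g = pathsD[OF \<gamma>(1)]
    have "u \<in> set \<gamma>" unfolding \<gamma>(2) using g(5) by (rule last_in_set)
    then show "u \<in> insert v S" using g(4,6) by auto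
  qed
qed simp

lemma reach_cong:
  assumes "\<And>x. x \<in> S - {v} \<Longrightarrow> f x = g x"
  shows "reach S v f = reach S v g"
proof -
  have "follows f \<gamma> \<longleftrightarrow> follows g \<gamma>" if \<gamma>: "\<gamma> \<in> paths S n v" for \<gamma> n
    by (rule follows_cong) (use assms pathsD(4,7)[OF \<gamma>] in auto)
  then show ?thesis unfolding reach_def by blast
qed

text \<open>By \<open>follows_branch\<close> the second path leaves \<gamma> at some position i and
  from then on lives in what \<gamma> leaves of S, rooted at a vertex outside of it. Given \<gamma>,
  its expected number is again a first moment, and i has at most l' + 1 values.\<close>

lemma second_moment:
  assumes S: "dom S" "v \<in> V" "v \<notin> S" and fm: "\<And>T x n. dom T \<Longrightarrow> x \<in> V \<Longrightarrow> fm T n x \<le> b'"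
    and b': "0 \<le> b'"
  shows "(\<Sum>\<gamma>\<in>paths S l v. \<Sum>\<gamma>'\<in>paths S l' v. measure_pmf.prob (wired S) {f. follows f \<gamma> \<and> follows f \<gamma>'})
    \<le> real (Suc l') * b'\<^sup>2"
proof -
  have fin: "finite S" using S by (simp add: domD)
  let ?E = "measure_pmf.expectation (wired S)"
  have "(\<Sum>\<gamma>'\<in>paths S l' v. measure_pmf.prob (wired S) {f. follows f \<gamma> \<and> follows f \<gamma>'}) \<le> wt S \<gamma> * (real (Suc l') * b')"
    if \<gamma>: "\<gamma> \<in> paths S l v" for \<gamma>
  proof -
    note g = pathsD[OF \<gamma>]
    let ?D = "\<lambda>i. paths (S - set \<gamma>) (l' - i) (\<gamma> ! i)"
    have finD: "finite (?D i)" for i using fin by (simp add: finite_paths)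
    have count: "(\<Sum>\<gamma>'\<in>paths S l' v. of_bool (follows f \<gamma> \<and> follows f \<gamma>') :: real) \<le>
        (\<Sum>i\<in>{..min l l'}. \<Sum>\<delta>\<in>?D i. of_bool (follows f \<gamma> \<and> follows f \<delta>))" for f
    proof (cases "follows f \<gamma>")
      case True
      let ?A = "{\<gamma>' \<in> paths S l' v. follows f \<gamma>'}" and ?B = "\<lambda>i. {\<delta> \<in> ?D i. follows f \<delta>}"
      have "?A \<subseteq> (\<Union>i\<in>{..min l l'}. (\<lambda>\<delta>. take (Suc i) \<gamma> @ tl \<delta>) ` ?B i)"
      proof
        fix \<gamma>' assume "\<gamma>' \<in> ?A"
        then obtain i \<delta> where "i \<le> l'" "i \<le> l" "\<delta> \<in> ?D i" "follows f \<delta>" "\<gamma>' = take (Suc i) \<gamma> @ tl \<delta>"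
          using follows_branch[OF \<gamma> _ True] by blast
        then show "\<gamma>' \<in> (\<Union>i\<in>{..min l l'}. (\<lambda>\<delta>. take (Suc i) \<gamma> @ tl \<delta>) ` ?B i)" by auto
      qed
      then have "card ?A \<le> card (\<Union>i\<in>{..min l l'}. (\<lambda>\<delta>. take (Suc i) \<gamma> @ tl \<delta>) ` ?B i)"
        by (rule card_mono[rotated]) (use finD in auto)
      also have "\<dots> \<le> (\<Sum>i\<in>{..min l l'}. card ((\<lambda>\<delta>. take (Suc i) \<gamma> @ tl \<delta>) ` ?B i))"
        by (rule card_UN_le) simp
      also have "\<dots> \<le> (\<Sum>i\<in>{..min l l'}. card (?B i))"
        by (intro sum_mono card_image_le) (use finD in auto)
      finally have "real (card ?A) \<le> real (\<Sum>i\<in>{..min l l'}. card (?B i))" by (simp only: of_nat_le_iff)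
      moreover have "(\<Sum>\<gamma>'\<in>paths S l' v. of_bool (follows f \<gamma> \<and> follows f \<gamma>') :: real) = real (card ?A)"
        using True fin by (simp add: of_bool_def sum.If_cases finite_paths Int_def)
      moreover have "(\<Sum>\<delta>\<in>?D i. of_bool (follows f \<gamma> \<and> follows f \<delta>) :: real) = real (card (?B i))" for i
        using True finD[of i] by (simp add: of_bool_def sum.If_cases Int_def)
      ultimately show ?thesis by simp
    qed simp
    have "(\<Sum>\<gamma>'\<in>paths S l' v. measure_pmf.prob (wired S) {f. follows f \<gamma> \<and> follows f \<gamma>'}) =
        ?E (\<lambda>f. \<Sum>\<gamma>'\<in>paths S l' v. of_bool (follows f \<gamma> \<and> follows f \<gamma>'))"
      unfolding expectation_of_bool[symmetric]
      by (rule Bochner_Integration.integral_sum[symmetric]) (rule integrable_pmf_bounded[where K = 1], simp)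
    also have "\<dots> \<le> ?E (\<lambda>f. \<Sum>i\<in>{..min l l'}. \<Sum>\<delta>\<in>?D i. of_bool (follows f \<gamma> \<and> follows f \<delta>))"
      by (rule integral_mono[OF _ _ count];
          (rule Bochner_Integration.integrable_sum)+; rule integrable_pmf_bounded[where K = 1]; simp)
    also have "\<dots> = (\<Sum>i\<in>{..min l l'}. ?E (\<lambda>f. \<Sum>\<delta>\<in>?D i. of_bool (follows f \<gamma> \<and> follows f \<delta>)))"
      by (rule Bochner_Integration.integral_sum; rule Bochner_Integration.integrable_sum; rule integrable_pmf_bounded[where K = 1]; simp)
    also have "\<dots> = (\<Sum>i\<in>{..min l l'}. \<Sum>\<delta>\<in>?D i. measure_pmf.prob (wired S) {f. follows f \<gamma> \<and> follows f \<delta>})"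
      unfolding expectation_of_bool[symmetric]
      by (intro sum.cong refl Bochner_Integration.integral_sum; rule integrable_pmf_bounded[where K = 1]; simp)
    also have "\<dots> = (\<Sum>i\<in>{..min l l'}. \<Sum>\<delta>\<in>?D i. wt S \<gamma> * wt (S - set \<gamma>) \<delta>)"
    proof (intro sum.cong refl)
      fix i \<delta> assume i: "i \<in> {..min l l'}" and \<delta>: "\<delta> \<in> ?D i"
      have "measure_pmf.prob (wired S) {f. follows f \<gamma> \<and> follows f \<delta>} =
          wt S \<gamma> * measure_pmf.prob (wired (S - set \<gamma>)) {f. follows f \<delta>}"
        by (rule prob_follows[OF S(1,3) \<gamma>], rule follows_cong) (use pathsD(4)[OF \<delta>] in auto)
      also have "measure_pmf.prob (wired (S - set \<gamma>)) {f. follows f \<delta>} = wt (S - set \<gamma>) \<delta>"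
      proof (rule prob_follows_wt[OF _ _ \<delta>])
        have "\<gamma> ! i \<in> set \<gamma>" by (rule nth_mem) (use g(1) i in auto)
        then show "\<gamma> ! i \<notin> S - set \<gamma>" by simp
      qed (use S in auto)
      finally show "measure_pmf.prob (wired S) {f. follows f \<gamma> \<and> follows f \<delta>} = wt S \<gamma> * wt (S - set \<gamma>) \<delta>" .
    qed
    also have "\<dots> = wt S \<gamma> * (\<Sum>i\<in>{..min l l'}. fm (S - set \<gamma>) (l' - i) (\<gamma> ! i))"
      by (simp add: fm_def sum_distrib_left)
    also have "\<dots> \<le> wt S \<gamma> * (\<Sum>i\<in>{..min l l'}. b')"
    proof (intro mult_left_mono sum_mono fm wt_nonneg S)
      fix i assume "i \<in> {..min l l'}"
      then have "\<gamma> ! i \<in> set \<gamma>" using g(1) by (intro nth_mem) auto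
      moreover have "set \<gamma> \<subseteq> V" using g(4) S domD(2)[OF S(1)] unfolding g(6) by auto
      ultimately show "\<gamma> ! i \<in> V" by auto
    qed (use S in auto)
    also have "\<dots> \<le> wt S \<gamma> * (real (Suc l') * b')"
      by (intro mult_left_mono wt_nonneg S) (use b' in \<open>auto intro!: mult_right_mono\<close>)
    finally show ?thesis .
  qed
  then have "(\<Sum>\<gamma>\<in>paths S l v. \<Sum>\<gamma>'\<in>paths S l' v. measure_pmf.prob (wired S) {f. follows f \<gamma> \<and> follows f \<gamma>'})
      \<le> (\<Sum>\<gamma>\<in>paths S l v. wt S \<gamma> * (real (Suc l') * b'))" by (rule sum_mono)
  also have "\<dots> = fm S l v * (real (Suc l') * b')" by (simp add: fm_def sum_distrib_right)
  also have "\<dots> \<le> b' * (real (Suc l') * b')" by (intro mult_right_mono fm S) (use b' in auto)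
  finally show ?thesis by (simp add: power2_eq_square mult_ac)
qed

end

context transitive_chain
begin

text \<open>From here on \<open>v \<in> S\<close> has an outgoing arrow itself, which costs a factor \<open>bubble\<close>.\<close>

lemma height_upper:
  "\<exists>C\<ge>1. \<forall>S v n. dom S \<longrightarrow> v \<in> S \<longrightarrow> 0 < n \<longrightarrow> tall S n v \<le> C / real n"
proof -
  obtain C where C: "1 \<le> C" "\<And>S v n. dom S \<Longrightarrow> v \<in> V \<Longrightarrow> v \<notin> S \<Longrightarrow> 0 < n \<Longrightarrow> tall S n v \<le> C / real n"
    using tall_bound by blast
  have "tall S n v \<le> bubble * C / real n" if S: "dom S" "v \<in> S" "0 < n" for S v n
  proof -
    have "tall S n v = measure_pmf.prob (wired S) {f. \<exists>\<gamma>\<in>paths (S - {v}) n v. follows f \<gamma>}"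
      by (simp add: tall_def paths_remove_root[of S])
    also have "\<dots> \<le> bubble * tall (S - {v}) n v"
      unfolding tall_def
    proof (rule prob_remove_root[OF S(1,2)])
      fix f g :: "'v \<Rightarrow> 'v" assume eq: "\<And>x. x \<in> S - {v} \<Longrightarrow> f x = g x"
      have "follows f \<gamma> \<longleftrightarrow> follows g \<gamma>" if "\<gamma> \<in> paths (S - {v}) n v" for \<gamma>
        by (rule follows_cong) (use eq pathsD(4)[OF that] in auto)
      then show "(\<exists>\<gamma>\<in>paths (S - {v}) n v. follows f \<gamma>) \<longleftrightarrow> (\<exists>\<gamma>\<in>paths (S - {v}) n v. follows g \<gamma>)" by auto
    qed
    also have "\<dots> \<le> bubble * (C / real n)"
      by (intro mult_left_mono C(2)) (use S bubble_ge_1 in \<open>auto simp: domD\<close>)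
    finally show ?thesis by simp
  qed
  moreover have "1 \<le> bubble * C" using bubble_ge_1 C(1) mult_mono[of 1 bubble 1 C] by simp
  ultimately show ?thesis by blast
qed

lemma volume_upper:
  "\<exists>C\<ge>1. \<forall>S v R. dom S \<longrightarrow> v \<in> S \<longrightarrow> 1 \<le> R \<longrightarrow>
    measure_pmf.prob (wired S) {f. R \<le> real (card (reach S v f))} \<le> C / sqrt R"
proof -
  obtain C where C: "1 \<le> C" "\<And>S v n. dom S \<Longrightarrow> v \<in> V \<Longrightarrow> v \<notin> S \<Longrightarrow> 0 < n \<Longrightarrow> tall S n v \<le> C / real n"
    using tall_bound by blast
  have main: "measure_pmf.prob (wired S) {f. R \<le> real (card (reach S v f))} \<le> (C + 2 * bubble) / sqrt R"
    if S: "dom S" "v \<in> V" "v \<notin> S" and R: "1 \<le> R" for S v R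
  proof -
    have fin: "finite S" using S by (simp add: domD)
    define n where "n = nat \<lceil>sqrt R\<rceil>"
    have sR: "1 \<le> sqrt R" using R by simp
    have n: "sqrt R \<le> real n" "real n \<le> 2 * sqrt R" "0 < n" using sR unfolding n_def by linarith+
    let ?N = "\<lambda>f. \<Sum>\<gamma>\<in>all_paths S n v. of_bool (follows f \<gamma>) :: real"
    \<comment> \<open>Each vertex of the past is the last vertex of a followed path, so below height
      n the number of paths bounds the number of vertices.\<close>
    have sub: "{f. R \<le> real (card (reach S v f))} \<subseteq> {f. \<exists>\<gamma>\<in>paths S n v. follows f \<gamma>} \<union> {f. R \<le> ?N f}"
    proof
      fix f assume f: "f \<in> {f. R \<le> real (card (reach S v f))}"
      show "f \<in> {f. \<exists>\<gamma>\<in>paths S n v. follows f \<gamma>} \<union> {f. R \<le> ?N f}"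
      proof (cases "\<exists>\<gamma>\<in>paths S n v. follows f \<gamma>")
        case False
        have "reach S v f \<subseteq> last ` {\<gamma> \<in> all_paths S n v. follows f \<gamma>}"
        proof
          fix u assume "u \<in> reach S v f"
          then obtain \<gamma> m where \<gamma>: "\<gamma> \<in> paths S m v" "follows f \<gamma>" "u = last \<gamma>" by (auto simp: reach_def)
          have "m < n"
          proof (rule ccontr)
            assume "\<not> m < n"
            then have nm: "n \<le> m" "n < length \<gamma>" using pathsD(1)[OF \<gamma>(1)] by auto
            have "take (Suc n) \<gamma> \<in> paths S n v" by (rule paths_take_drop(1)[OF \<gamma>(1) nm(1)])
            then show False using False follows_split[OF nm(2), of f] \<gamma>(2) by blast
          qed
          then show "u \<in> last ` {\<gamma> \<in> all_paths S n v. follows f \<gamma>}"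
            using \<gamma> by (auto simp: all_paths_def)
        qed
        moreover have X: "finite {\<gamma> \<in> all_paths S n v. follows f \<gamma>}"
          using finite_all_paths[OF fin, of n v] by simp
        ultimately have "card (reach S v f) \<le> card (last ` {\<gamma> \<in> all_paths S n v. follows f \<gamma>})"
          by (intro card_mono) auto
        also have "\<dots> \<le> card {\<gamma> \<in> all_paths S n v. follows f \<gamma>}" by (rule card_image_le[OF X])
        finally have "card (reach S v f) \<le> card {\<gamma> \<in> all_paths S n v. follows f \<gamma>}" .
        moreover have "?N f = real (card {\<gamma> \<in> all_paths S n v. follows f \<gamma>})"
          using finite_all_paths[OF fin, of n v] by (simp add: of_bool_def sum.If_cases Int_def)
        ultimately show ?thesis using f by simp
      qed auto
    qed
    have "measure_pmf.prob (wired S) {f. R \<le> ?N f} \<le> measure_pmf.expectation (wired S) ?N / R"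
    proof -
      have i: "integrable (measure_pmf (wired S)) ?N"
        by (rule Bochner_Integration.integrable_sum, rule integrable_pmf_bounded[where K = 1]) simp
      have "R * measure_pmf.prob (wired S) {f. R \<le> ?N f} =
          measure_pmf.expectation (wired S) (\<lambda>f. R * of_bool (R \<le> ?N f))"
        by (simp add: expectation_of_bool)
      also have "\<dots> \<le> measure_pmf.expectation (wired S) ?N"
      proof (rule integral_mono[OF _ i])
        show "integrable (measure_pmf (wired S)) (\<lambda>f. R * of_bool (R \<le> ?N f))"
          by (rule integrable_pmf_bounded[where K = R]) (use R in auto)
        show "R * of_bool (R \<le> ?N f) \<le> ?N f" for f by (auto intro: sum_nonneg)
      qed
      finally show ?thesis using R by (simp add: field_simps)
    qed
    also have "measure_pmf.expectation (wired S) ?N = (\<Sum>\<gamma>\<in>all_paths S n v. wt S \<gamma>)"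
    proof -
      have "measure_pmf.expectation (wired S) ?N =
          (\<Sum>\<gamma>\<in>all_paths S n v. measure_pmf.prob (wired S) {f. follows f \<gamma>})"
        unfolding expectation_of_bool[symmetric]
        by (rule Bochner_Integration.integral_sum, rule integrable_pmf_bounded[where K = 1]) simp
      also have "\<dots> = (\<Sum>\<gamma>\<in>all_paths S n v. wt S \<gamma>)"
        by (intro sum.cong refl) (use prob_follows_wt[OF S(1,3)] in \<open>auto simp: all_paths_def\<close>)
      finally show ?thesis .
    qed
    also have "(\<Sum>\<gamma>\<in>all_paths S n v. wt S \<gamma>) = (\<Sum>l<n. fm S l v)"
      unfolding fm_def by (rule sum_all_paths[OF fin])
    also have "\<dots> / R \<le> (\<Sum>l<n. bubble) / R"
      by (intro divide_right_mono sum_mono fm_le_bubble S) (use R in auto)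
    also have "\<dots> \<le> 2 * sqrt R * bubble / R"
      using n R bubble_ge_1 by (auto intro!: divide_right_mono mult_right_mono)
    also have "\<dots> = 2 * bubble / sqrt R"
      using R real_sqrt_mult_self[of R] by (simp add: field_simps)
    finally have "measure_pmf.prob (wired S) {f. R \<le> ?N f} \<le> 2 * bubble / sqrt R" .
    moreover have "tall S n v \<le> C / sqrt R"
    proof -
      have "tall S n v \<le> C / real n" by (rule C(2)[OF S n(3)])
      also have "\<dots> \<le> C / sqrt R" by (rule frac_le) (use n(1) sR C(1) in linarith)+
      finally show ?thesis .
    qed
    moreover have "measure_pmf.prob (wired S) {f. R \<le> real (card (reach S v f))} \<le>
        tall S n v + measure_pmf.prob (wired S) {f. R \<le> ?N f}"
    proof -
      have "measure_pmf.prob (wired S) {f. R \<le> real (card (reach S v f))} \<le>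
          measure_pmf.prob (wired S) ({f. \<exists>\<gamma>\<in>paths S n v. follows f \<gamma>} \<union> {f. R \<le> ?N f})"
        by (rule measure_pmf.finite_measure_mono[OF sub]) simp
      also have "\<dots> \<le> tall S n v + measure_pmf.prob (wired S) {f. R \<le> ?N f}"
        unfolding tall_def by (rule measure_Un_le) auto
      finally show ?thesis .
    qed
    ultimately show ?thesis by (simp add: add_divide_distrib)
  qed
  have "measure_pmf.prob (wired S) {f. R \<le> real (card (reach S v f))} \<le> (bubble * (C + 2 * bubble)) / sqrt R"
    if S: "dom S" "v \<in> S" and R: "1 \<le> R" for S v R
  proof -
    have r: "reach S v f = reach (S - {v}) v f" for f
      unfolding reach_def by (simp add: paths_remove_root[of S])
    have "measure_pmf.prob (wired S) {f. R \<le> real (card (reach S v f))} \<le>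
        bubble * measure_pmf.prob (wired (S - {v})) {f. R \<le> real (card (reach S v f))}"
      by (rule prob_remove_root[OF S]) (use reach_cong[of S v] in metis)
    also have "\<dots> \<le> bubble * ((C + 2 * bubble) / sqrt R)"
      unfolding r by (intro mult_left_mono main) (use S R bubble_ge_1 in \<open>auto simp: domD\<close>)
    finally show ?thesis by simp
  qed
  moreover have "1 \<le> bubble * (C + 2 * bubble)"
    using bubble_ge_1 C(1) mult_mono[of 1 bubble 1 "C + 2 * bubble"] by simp
  ultimately show ?thesis by blast
qed

lemma second_moment_upper:
  assumes S: "dom S" "v \<in> S"
  shows "(\<Sum>\<gamma>\<in>all_paths S n v. \<Sum>\<gamma>'\<in>all_paths S n v. measure_pmf.prob (wired S) {f. follows f \<gamma> \<and> follows f \<gamma>'})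
    \<le> real n ^ 3 * bubble ^ 3"
proof -
  have fin: "finite S" using S by (simp add: domD)
  let ?T = "S - {v}"
  have T: "dom ?T" "v \<in> V" "v \<notin> ?T" "finite ?T" using S by (auto simp: domD)
  have eq: "all_paths S n v = all_paths ?T n v" by (simp add: all_paths_def paths_remove_root[of S])
  have "(\<Sum>\<gamma>\<in>all_paths S n v. \<Sum>\<gamma>'\<in>all_paths S n v. measure_pmf.prob (wired S) {f. follows f \<gamma> \<and> follows f \<gamma>'}) \<le>
      (\<Sum>\<gamma>\<in>all_paths ?T n v. \<Sum>\<gamma>'\<in>all_paths ?T n v. bubble * measure_pmf.prob (wired ?T) {f. follows f \<gamma> \<and> follows f \<gamma>'})"
    unfolding eq
  proof (intro sum_mono prob_remove_root[OF S])
    fix \<gamma> \<gamma>' and f g :: "'v \<Rightarrow> 'v"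
    assume a: "\<gamma> \<in> all_paths ?T n v" "\<gamma>' \<in> all_paths ?T n v" "\<And>x. x \<in> S - {v} \<Longrightarrow> f x = g x"
    have "follows f d \<longleftrightarrow> follows g d" if "d \<in> all_paths ?T n v" for d
      by (rule follows_cong) (use that a(3) in \<open>auto simp: all_paths_def paths_def\<close>)
    then show "(follows f \<gamma> \<and> follows f \<gamma>') \<longleftrightarrow> (follows g \<gamma> \<and> follows g \<gamma>')" using a by simp
  qed
  also have "\<dots> = bubble * (\<Sum>l<n. \<Sum>l'<n. \<Sum>\<gamma>\<in>paths ?T l v. \<Sum>\<gamma>'\<in>paths ?T l' v.
      measure_pmf.prob (wired ?T) {f. follows f \<gamma> \<and> follows f \<gamma>'})"
    unfolding sum_all_paths[OF T(4)] sum_distrib_left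
    by (intro sum.cong refl) (rule sum.swap)
  also have "\<dots> \<le> bubble * (\<Sum>l<n. \<Sum>l'<n. real n * bubble\<^sup>2)"
  proof (intro mult_left_mono sum_mono)
    fix l l' assume l: "l \<in> {..<n}" "l' \<in> {..<n}"
    have "(\<Sum>\<gamma>\<in>paths ?T l v. \<Sum>\<gamma>'\<in>paths ?T l' v. measure_pmf.prob (wired ?T) {f. follows f \<gamma> \<and> follows f \<gamma>'}) \<le> real (Suc l') * bubble\<^sup>2"
      by (rule second_moment[OF T(1-3)]) (use fm_le_bubble bubble_ge_1 in auto)
    also have "\<dots> \<le> real n * bubble\<^sup>2" using l by (intro mult_right_mono) auto
    finally show "(\<Sum>\<gamma>\<in>paths ?T l v. \<Sum>\<gamma>'\<in>paths ?T l' v. measure_pmf.prob (wired ?T) {f. follows f \<gamma> \<and> follows f \<gamma>'}) \<le> real n * bubble\<^sup>2" .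
  qed (use bubble_ge_1 in auto)
  finally show ?thesis by (simp add: power2_eq_square power3_eq_cube mult_ac)
qed

end

section \<open>Lower bound on the first moment in infinite volume\<close>

context transitive_chain
begin

abbreviation fin :: "'v set filter" where "fin \<equiv> finite_subsets_at_top V"

lemma eventually_dom:
  assumes "finite X" "X \<subseteq> V"
  shows "eventually (\<lambda>S. dom S \<and> X \<subseteq> S) fin"
  unfolding eventually_finite_subsets_at_top using assms by (auto simp: dom_def)

text \<open>Monotone convergence along the directed family of finite sets. The set X ensures that
  the arguments of F lie in the domain.\<close>

lemma convergent_mono:
  fixes F :: "'v set \<Rightarrow> real"
  assumes X: "finite X" "X \<subseteq> V"
    and mono: "\<And>S S'. dom S' \<Longrightarrow> X \<subseteq> S \<Longrightarrow> S \<subseteq> S' \<Longrightarrow> F S \<le> F S'"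
    and bd: "\<And>S. dom S \<Longrightarrow> X \<subseteq> S \<Longrightarrow> F S \<le> K"
  shows "(F \<longlongrightarrow> Lim fin F) fin"
proof -
  let ?I = "{S. dom S \<and> X \<subseteq> S}"
  have bdd: "bdd_above (F ` ?I)" by (rule bdd_aboveI[of _ K]) (auto simp: bd)
  have ne: "?I \<noteq> {}" using X by (auto simp: dom_def)
  have "(F \<longlongrightarrow> (SUP S\<in>?I. F S)) fin"
  proof (rule order_tendstoI)
    fix a assume "a < (SUP S\<in>?I. F S)"
    then obtain S where S: "dom S" "X \<subseteq> S" "a < F S" using less_cSUP_iff[OF ne bdd] by auto
    have "eventually (\<lambda>S'. dom S' \<and> S \<subseteq> S') fin" by (rule eventually_dom) (use S in \<open>auto simp: domD\<close>)
    then show "eventually (\<lambda>S'. a < F S') fin"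
      by eventually_elim (use S mono in \<open>auto intro: less_le_trans\<close>)
  next
    fix a assume a: "(SUP S\<in>?I. F S) < a"
    have "eventually (\<lambda>S'. dom S' \<and> X \<subseteq> S') fin" by (rule eventually_dom[OF X])
    then show "eventually (\<lambda>S'. F S' < a) fin"
    proof eventually_elim
      case (elim S)
      then have "F S \<le> (SUP S\<in>?I. F S)" by (intro cSUP_upper bdd) auto
      then show ?case using a by simp
    qed
  qed
  then show ?thesis using tendsto_Lim[of fin F] by simp
qed

text \<open>\<open>decay\<close> and \<open>gr\<close> increase with S while \<open>esc\<close>
  decreases, so the expected numbers for a root inside S, which combine both, need not be monotone.
  Taking the limit of each factor separately avoids this.\<close>

definition decayV :: "'v set \<Rightarrow> real" where "decayV A = Lim fin (\<lambda>S. decay S A)"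
definition greenV :: "'v \<Rightarrow> 'v \<Rightarrow> real" where "greenV x y = Lim fin (\<lambda>S. gr S x y)"
definition escV :: "'v set \<Rightarrow> 'v \<Rightarrow> real" where "escV A y = Lim fin (\<lambda>S. esc S A y)"

lemma decay_le_power: "finite A \<Longrightarrow> dom S \<Longrightarrow> decay S A \<le> bubble ^ card A"
proof (induction A rule: finite_induct)
  case empty
  then show ?case using Z_pos by (simp add: decay_def)
next
  case (insert x A)
  have "decay S (insert x A) \<le> decay S A * bubble"
    using gr_le_bubble[of "S - A" x x] insert bubble_ge_1 decay_pos[of S A]
    by (auto simp: decay_insert dom_diff intro!: mult_left_mono)
  also have "\<dots> \<le> bubble ^ card A * bubble"
    using insert bubble_ge_1 by (intro mult_right_mono) auto
  finally show ?case using insert by (simp add: mult.commute)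
qed

lemma decayV: "finite A \<Longrightarrow> ((\<lambda>S. decay S A) \<longlongrightarrow> decayV A) fin"
  unfolding decayV_def
  by (rule convergent_mono[of "{}"]) (auto intro: decay_mono decay_le_power)

lemma greenV: "x \<in> V \<Longrightarrow> y \<in> V \<Longrightarrow> ((\<lambda>S. gr S x y) \<longlongrightarrow> greenV x y) fin"
  unfolding greenV_def
  by (rule convergent_mono[of "{x, y}"]) (auto intro: gr_mono gr_le_bubble)

lemma escV: assumes "finite A" "A \<subseteq> V" shows "((\<lambda>S. esc S A y) \<longlongrightarrow> escV A y) fin"
proof -
  have "((\<lambda>S. - esc S A y) \<longlongrightarrow> Lim fin (\<lambda>S. - esc S A y)) fin"
    by (rule convergent_mono[of A _ 0]) (use assms in \<open>auto intro: esc_antimono esc_nonneg\<close>)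
  then have h: "((\<lambda>S. esc S A y) \<longlongrightarrow> - Lim fin (\<lambda>S. - esc S A y)) fin" using tendsto_minus by fastforce
  have "Lim fin (\<lambda>S. esc S A y) = - Lim fin (\<lambda>S. - esc S A y)" by (rule tendsto_Lim[OF _ h]) simp
  then show ?thesis unfolding escV_def using h by simp
qed

lemma lim_le:
  assumes "(F \<longlongrightarrow> (l::real)) fin" "(G \<longlongrightarrow> m) fin" "finite X" "X \<subseteq> V"
    "\<And>S. dom S \<Longrightarrow> X \<subseteq> S \<Longrightarrow> F S \<le> G S"
  shows "l \<le> m"
  by (rule tendsto_le[OF _ assms(2,1)])
     (use eventually_dom[OF assms(3,4)] assms(5) in \<open>auto elim: eventually_mono\<close>)

lemma lim_eq:
  assumes "(F \<longlongrightarrow> (l::real)) fin" "(G \<longlongrightarrow> m) fin" "finite X" "X \<subseteq> V"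
    "\<And>S. dom S \<Longrightarrow> X \<subseteq> S \<Longrightarrow> F S = G S"
  shows "l = m"
  using lim_le[OF assms(1-4)] lim_le[OF assms(2,1,3,4)] assms(5) by (simp add: antisym)

lemma escV_nonneg: "finite A \<Longrightarrow> A \<subseteq> V \<Longrightarrow> 0 \<le> escV A y"
  by (rule lim_le[OF tendsto_const escV, where X = A]) (auto intro: esc_nonneg)

lemma escV_le_1: "finite A \<Longrightarrow> A \<subseteq> V \<Longrightarrow> escV A y \<le> 1"
  by (rule lim_le[OF escV tendsto_const, where X = A]) (auto intro: esc_le_1)

lemma escV_antimono: "finite A' \<Longrightarrow> A' \<subseteq> V \<Longrightarrow> A \<subseteq> A' \<Longrightarrow> escV A' y \<le> escV A y"
  by (rule lim_le[OF escV escV, where X = A']) (auto intro: esc_antimono_set finite_subset)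

lemma decayV_nonneg: "finite A \<Longrightarrow> 0 \<le> decayV A"
  by (rule lim_le[OF tendsto_const decayV, where X = "{}"]) (auto intro: less_imp_le decay_pos)

lemma greenV_nonneg: "x \<in> V \<Longrightarrow> y \<in> V \<Longrightarrow> 0 \<le> greenV x y"
  by (rule lim_le[OF tendsto_const greenV, where X = "{x, y}"]) (auto intro: gr_nonneg)

lemma last_visitV:
  assumes "finite A" "A \<subseteq> V" "x \<in> A"
  shows "(\<Sum>a\<in>A. greenV x a * escV A a) = 1"
proof (rule lim_eq[OF _ tendsto_const assms(1,2)])
  show "((\<lambda>S. \<Sum>a\<in>A. gr S x a * esc S A a) \<longlongrightarrow> (\<Sum>a\<in>A. greenV x a * escV A a)) fin"
    by (intro tendsto_sum tendsto_mult greenV escV) (use assms in auto)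
qed (use assms last_visit in auto)

definition wtV :: "'v list \<Rightarrow> real" where "wtV \<gamma> = pw \<gamma> * decayV (set \<gamma>)"

lemma wtV: "((\<lambda>S. wt S \<gamma>) \<longlongrightarrow> wtV \<gamma>) fin"
  unfolding wt_def wtV_def by (intro tendsto_mult tendsto_const decayV) auto

lemma wtV_nonneg: "0 \<le> wtV \<gamma>"
  unfolding wtV_def by (intro mult_nonneg_nonneg path_weight_nonneg decayV_nonneg) auto

lemma wt_le_wtV:
  assumes S: "dom S" shows "wt S \<gamma> \<le> wtV \<gamma>"
proof (rule lim_le[OF tendsto_const wtV, where X = S])
  fix S' assume "dom S'" "S \<subseteq> S'"
  then show "wt S \<gamma> \<le> wt S' \<gamma>" by (rule wt_mono)
qed (use S in \<open>auto simp: domD\<close>)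

text \<open>In finite volume the second piece lives in S without the first piece. Putting these
  vertices back increases its weight, so the identity becomes an inequality.\<close>

lemma wtV_split:
  assumes "i < length \<gamma>"
  shows "wtV \<gamma> \<le> wtV (take (Suc i) \<gamma>) * wtV (drop i \<gamma>)"
proof (rule lim_le[OF wtV tendsto_mult[OF wtV wtV], where X = "{}"])
  fix S assume S: "dom S"
  then show "wt S \<gamma> \<le> wt S (take (Suc i) \<gamma>) * wt S (drop i \<gamma>)"
    unfolding wt_split[OF S assms] by (intro mult_left_mono wt_mono wt_nonneg) auto
qed auto

lemma paths_in_V: "dom T \<Longrightarrow> v \<in> V \<Longrightarrow> \<gamma> \<in> paths T n v \<Longrightarrow> set \<gamma> \<subseteq> V"
  using pathsD(4,6)[of \<gamma> T n v] by (auto dest: domD)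

lemma sum_wtV_le_bubble:
  assumes T: "dom T" "v \<in> V"
  shows "(\<Sum>\<gamma>\<in>paths T n v. wtV \<gamma>) \<le> bubble"
proof (rule lim_le[OF tendsto_sum[OF wtV] tendsto_const, where X = T])
  fix S assume S: "dom S" "T \<subseteq> S"
  have "(\<Sum>\<gamma>\<in>paths T n v. wt S \<gamma>) \<le> fm S n v"
    unfolding fm_def by (intro sum_mono2 finite_paths paths_mono wt_nonneg S) (use S in \<open>auto simp: domD\<close>)
  also have "\<dots> \<le> bubble" by (rule fm_le_bubble[OF S(1) T(2)])
  finally show "(\<Sum>\<gamma>\<in>paths T n v. wt S \<gamma>) \<le> bubble" .
qed (use T in \<open>auto simp: domD\<close>)

lemma sum_wtV_green_le:
  assumes T: "dom T" "v \<in> T"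
  shows "(\<Sum>\<gamma>\<in>paths T n v. wtV \<gamma> * greenV v (last \<gamma>)) \<le> \<beta> n"
proof (rule lim_le[of "\<lambda>S. \<Sum>\<gamma>\<in>paths T n v. wt S \<gamma> * gr S v (last \<gamma>)" _ "\<lambda>_. \<beta> n" _ T])
  show "((\<lambda>S. \<Sum>\<gamma>\<in>paths T n v. wt S \<gamma> * gr S v (last \<gamma>)) \<longlongrightarrow>
      (\<Sum>\<gamma>\<in>paths T n v. wtV \<gamma> * greenV v (last \<gamma>))) fin"
    using T by (intro tendsto_sum tendsto_mult wtV greenV) (auto dest: paths_last_in simp: domD)
  fix S assume S: "dom S" "T \<subseteq> S"
  have "(\<Sum>\<gamma>\<in>paths T n v. wt S \<gamma> * gr S v (last \<gamma>)) \<le> bt S n v"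
    unfolding bt_def
    by (intro sum_mono2 finite_paths paths_mono mult_nonneg_nonneg wt_nonneg gr_nonneg S)
       (use S T in \<open>auto simp: domD dest: paths_last_in\<close>)
  also have "\<dots> \<le> \<beta> n" by (rule bt_le_\<beta>) (use S T in auto)
  finally show "(\<Sum>\<gamma>\<in>paths T n v. wt S \<gamma> * gr S v (last \<gamma>)) \<le> \<beta> n" .
qed (use T in \<open>auto simp: domD\<close>)

text \<open>The expected number of vertices at height \<open>l\<close> in the past of \<open>x\<close> in infinite volume, counted
  through paths in \<open>T\<close>.\<close>

definition em :: "'v set \<Rightarrow> nat \<Rightarrow> 'v \<Rightarrow> real" where
  "em T l x = (\<Sum>\<gamma>\<in>paths T l x. wtV \<gamma> * escV (set \<gamma>) x)"

definition emV :: "nat \<Rightarrow> real" where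
  "emV l = (SUP (T, x)\<in>{(T, x). dom T \<and> x \<in> T}. em T l x)"

lemma em_le_bubble:
  assumes "dom T" "x \<in> V" shows "em T l x \<le> bubble"
proof -
  have "em T l x \<le> (\<Sum>\<gamma>\<in>paths T l x. wtV \<gamma> * 1)"
    unfolding em_def
    by (intro sum_mono mult_left_mono escV_le_1 wtV_nonneg) (use assms paths_in_V in auto)
  then show ?thesis using sum_wtV_le_bubble[OF assms, of l] by simp
qed

lemma bdd_em: "bdd_above ((\<lambda>(T, x). em T l x) ` {(T, x). dom T \<and> x \<in> T})"
  by (rule bdd_aboveI[of _ bubble]) (auto intro!: em_le_bubble dest: domD)

lemma em_le_emV: "dom T \<Longrightarrow> x \<in> T \<Longrightarrow> em T l x \<le> emV l"
  unfolding emV_def by (rule cSUP_upper2[OF bdd_em, of "(T, x)"]) auto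

lemma em_mono:
  assumes "dom T'" "T \<subseteq> T'" "x \<in> V" shows "em T l x \<le> em T' l x"
  unfolding em_def
proof (intro sum_mono2 finite_paths paths_mono)
  fix \<gamma> assume "\<gamma> \<in> paths T' l x - paths T l x"
  then show "0 \<le> wtV \<gamma> * escV (set \<gamma>) x"
    using assms paths_in_V[of T' x \<gamma> l] by (intro mult_nonneg_nonneg wtV_nonneg escV_nonneg) auto
qed (use assms in \<open>auto simp: domD\<close>)

lemma em_nonneg: "dom T \<Longrightarrow> x \<in> V \<Longrightarrow> 0 \<le> em T l x"
  unfolding em_def
  by (intro sum_nonneg mult_nonneg_nonneg wtV_nonneg escV_nonneg) (auto dest: paths_in_V)

lemma singleton_dom: "\<exists>x. x \<in> V \<and> dom {x}"
  using V_nonempty by (auto simp: dom_def)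

lemma emV_nonneg: "0 \<le> emV l"
proof -
  obtain x where x: "x \<in> V" "dom {x}" using singleton_dom by blast
  then show ?thesis using em_nonneg[OF x(2,1), of l] em_le_emV[of "{x}" x l] by simp
qed

lemma emV_le_bubble: "emV l \<le> bubble"
  unfolding emV_def
proof (rule cSUP_least)
  show "{(T, x). dom T \<and> x \<in> T} \<noteq> {}" using singleton_dom by blast
qed (auto intro!: em_le_bubble dest: domD)

lemma auto_filterlim:
  assumes "auto \<phi>" shows "filterlim (\<lambda>S. \<phi> ` S) fin fin"
  unfolding filterlim_finite_subsets_at_top
proof (intro allI impI)
  fix X assume X: "finite X \<and> X \<subseteq> V"
  have b: "bij_betw \<phi> V V" using assms by (simp add: auto_def)
  let ?Y = "inv_into V \<phi> ` X"
  have Y: "finite ?Y" "?Y \<subseteq> V" "\<phi> ` ?Y = X"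
    using X b by (auto simp: bij_betw_def inv_into_into subset_iff image_image f_inv_into_f)
  have "eventually (\<lambda>S. dom S \<and> ?Y \<subseteq> S) fin" by (rule eventually_dom[OF Y(1,2)])
  then show "eventually (\<lambda>S. finite (\<phi> ` S) \<and> X \<subseteq> \<phi> ` S \<and> \<phi> ` S \<subseteq> V) fin"
  proof eventually_elim
    case (elim S)
    then show ?case using auto_dom[OF assms, of S] image_mono[of ?Y S \<phi>] unfolding Y(3) by (simp add: domD)
  qed
qed

lemma auto_decayV:
  assumes "auto \<phi>" "finite A" "A \<subseteq> V" shows "decayV (\<phi> ` A) = decayV A"
proof (rule lim_eq[of "\<lambda>S. decay (\<phi> ` S) (\<phi> ` A)" _ "\<lambda>S. decay S A" _ "{}"])
  show "((\<lambda>S. decay (\<phi> ` S) (\<phi> ` A)) \<longlongrightarrow> decayV (\<phi> ` A)) fin"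
    by (rule filterlim_compose[OF decayV auto_filterlim[OF assms(1)]]) (use assms in auto)
qed (use assms auto_decay decayV in auto)

lemma auto_hit:
  assumes a: "auto \<phi>" and S: "dom S" and "x \<in> V" "z \<in> V"
  shows "ht (\<phi> ` S) (\<phi> x) (\<phi> z) = ht S x z"
proof -
  have inj: "inj_on \<phi> V" by (rule auto_inj[OF a order_refl])
  have mem: "\<phi> x \<in> \<phi> ` S \<longleftrightarrow> x \<in> S"
    using inj S assms(3) by (intro inj_on_image_mem_iff) (auto simp: domD)
  have eq: "\<phi> x = \<phi> z \<longleftrightarrow> x = z" using inj assms(3,4) by (auto dest: inj_onD)
  have "(\<Sum>u\<in>\<phi> ` S. gr (\<phi> ` S) (\<phi> x) u * p u (\<phi> z)) = (\<Sum>u\<in>S. gr S x u * p u z)" if "x \<in> S"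
  proof -
    have "(\<Sum>u\<in>\<phi> ` S. gr (\<phi> ` S) (\<phi> x) u * p u (\<phi> z)) =
        (\<Sum>u\<in>S. gr (\<phi> ` S) (\<phi> x) (\<phi> u) * p (\<phi> u) (\<phi> z))"
      using auto_inj[OF a domD(2)[OF S]] by (simp add: sum.reindex)
    also have "\<dots> = (\<Sum>u\<in>S. gr S x u * p u z)"
    proof (intro sum.cong refl)
      fix u assume u: "u \<in> S"
      have "p (\<phi> u) (\<phi> z) = p u z" using a assms(4) domD(3)[OF S u] by (simp add: auto_def)
      then show "gr (\<phi> ` S) (\<phi> x) (\<phi> u) * p (\<phi> u) (\<phi> z) = gr S x u * p u z"
        using auto_gr[OF a S that u] by simp
    qed
    finally show ?thesis .
  qed
  then show ?thesis unfolding hit_def mem eq by auto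
qed

lemma auto_esc:
  assumes a: "auto \<phi>" and S: "dom S" "A \<subseteq> S" and y: "y \<in> V"
  shows "esc (\<phi> ` S) (\<phi> ` A) (\<phi> y) = esc S A y"
proof -
  have V: "S \<subseteq> V" "A \<subseteq> V" using S by (auto dest: domD)
  have diff: "\<phi> ` (S - A) = \<phi> ` S - \<phi> ` A" by (rule auto_image_diff[OF a V])
  have inj: "inj_on \<phi> S" "inj_on \<phi> A" using auto_inj[OF a] V by auto
  have meet: "meet (\<phi> ` S) (\<phi> ` A) (\<phi> w) = meet S A w" if "w \<in> V" for w
    unfolding meet_def diff[symmetric]
    using auto_hit[OF a dom_diff[OF S(1)] that] V by (simp add: sum.reindex[OF inj(2)] subset_iff)
  have "(\<Sum>w\<in>\<phi> ` S. p (\<phi> y) w * meet (\<phi> ` S) (\<phi> ` A) w) = (\<Sum>w\<in>S. p y w * meet S A w)"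
    unfolding sum.reindex[OF inj(1)] o_def
  proof (intro sum.cong refl)
    fix w assume "w \<in> S"
    then have w: "w \<in> V" using V by auto
    have "p (\<phi> y) (\<phi> w) = p y w" using a y w by (simp add: auto_def)
    then show "p (\<phi> y) (\<phi> w) * meet (\<phi> ` S) (\<phi> ` A) (\<phi> w) = p y w * meet S A w"
      using meet[OF w] by simp
  qed
  then show ?thesis by (simp add: esc_def)
qed

lemma auto_escV:
  assumes "auto \<phi>" "finite A" "A \<subseteq> V" "y \<in> V" shows "escV (\<phi> ` A) (\<phi> y) = escV A y"
proof (rule lim_eq[of "\<lambda>S. esc (\<phi> ` S) (\<phi> ` A) (\<phi> y)" _ "\<lambda>S. esc S A y" _ A])
  have "finite (\<phi> ` A)" "\<phi> ` A \<subseteq> V" using assms by (auto simp: auto_def bij_betw_def)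
  then show "((\<lambda>S. esc (\<phi> ` S) (\<phi> ` A) (\<phi> y)) \<longlongrightarrow> escV (\<phi> ` A) (\<phi> y)) fin"
    by (intro filterlim_compose[OF escV auto_filterlim[OF assms(1)]])
qed (use assms auto_esc escV in auto)

lemma auto_em:
  assumes "auto \<phi>" "dom T" "x \<in> T"
  shows "em T l x \<le> em (\<phi> ` T) l (\<phi> x)"
proof -
  have V: "T \<subseteq> V" "finite T" "x \<in> V" using assms by (auto simp: domD)
  have gV: "set \<gamma> \<subseteq> V" if "\<gamma> \<in> paths T l x" for \<gamma> using paths_in_V[OF assms(2) V(3) that] .
  have inj: "inj_on (map \<phi>) (paths T l x)"
  proof (rule inj_onI)
    fix a b assume ab: "a \<in> paths T l x" "b \<in> paths T l x" "map \<phi> a = map \<phi> b"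
    have "set a \<union> set b \<subseteq> V" using gV[OF ab(1)] gV[OF ab(2)] by simp
    from map_inj_on[OF ab(3) auto_inj[OF assms(1) this]] show "a = b" .
  qed
  have "em T l x = (\<Sum>\<gamma>\<in>paths T l x. wtV (map \<phi> \<gamma>) * escV (set (map \<phi> \<gamma>)) (\<phi> x))"
    unfolding em_def
  proof (intro sum.cong refl)
    fix \<gamma> assume \<gamma>: "\<gamma> \<in> paths T l x"
    have "pw (map \<phi> \<gamma>) = pw \<gamma>"
      by (rule path_weight_map) (use assms gV[OF \<gamma>] in \<open>auto simp: auto_def subset_iff\<close>)
    then show "wtV \<gamma> * escV (set \<gamma>) x = wtV (map \<phi> \<gamma>) * escV (set (map \<phi> \<gamma>)) (\<phi> x)"
      using auto_decayV[OF assms(1) _ gV[OF \<gamma>]] auto_escV[OF assms(1) _ gV[OF \<gamma>] V(3)]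
      by (simp add: wtV_def)
  qed
  also have "\<dots> = (\<Sum>\<gamma>\<in>map \<phi> ` paths T l x. wtV \<gamma> * escV (set \<gamma>) (\<phi> x))"
    by (simp add: sum.reindex[OF inj])
  also have "\<dots> \<le> em (\<phi> ` T) l (\<phi> x)"
    unfolding em_def
  proof (intro sum_mono2 finite_paths)
    show "map \<phi> ` paths T l x \<subseteq> paths (\<phi> ` T) l (\<phi> x)" using auto_paths[OF assms(1) V(1,3)] by blast
    fix \<gamma> assume "\<gamma> \<in> paths (\<phi> ` T) l (\<phi> x) - map \<phi> ` paths T l x"
    then show "0 \<le> wtV \<gamma> * escV (set \<gamma>) (\<phi> x)"
      using paths_in_V[OF auto_dom[OF assms(1,2)], of "\<phi> x" \<gamma> l] auto_dom[OF assms(1,2)] assms(3)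
      by (intro mult_nonneg_nonneg wtV_nonneg escV_nonneg) (auto dest: domD)
  qed (use V in auto)
  finally show ?thesis .
qed

lemma emV_approx:
  assumes "\<delta> > 0" "v \<in> V"
  shows "\<exists>T. dom T \<and> v \<in> T \<and> emV l - \<delta> < em T l v"
proof -
  have ne: "{(S, x). dom S \<and> x \<in> S} \<noteq> {}" using singleton_dom by blast
  have "emV l - \<delta> < emV l" using assms by simp
  then obtain T x where T: "dom T" "x \<in> T" "emV l - \<delta> < em T l x"
    unfolding emV_def using less_cSUP_iff[OF ne bdd_em] by auto
  obtain \<phi> where \<phi>: "auto \<phi>" "\<phi> x = v" using auto_exists[of x v] T assms by (auto simp: domD)
  show ?thesis
    using auto_dom[OF \<phi>(1) T(1)] auto_em[OF \<phi>(1) T(1,2), of l] T \<phi>(2)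
    by (intro exI[of _ "\<phi> ` T"]) auto
qed

text \<open>Decomposing the walk from \<open>v\<close> according to its last visit to a path ending at \<open>v\<close>.\<close>

lemma fm_le_convolution:
  assumes T: "dom T" "v \<in> T"
  shows "fm T n v \<le> (\<Sum>i\<le>n. \<beta> i * emV (n - i))"
proof -
  have finT: "finite T" "v \<in> V" using T by (auto simp: domD)
  let ?K = "\<lambda>\<gamma>' \<gamma>''. (wtV \<gamma>' * greenV v (last \<gamma>')) * (wtV \<gamma>'' * escV (set \<gamma>'') (hd \<gamma>''))"
  have "wt T \<gamma> \<le> (\<Sum>i\<le>n. ?K (take (Suc i) \<gamma>) (drop i \<gamma>))" if \<gamma>: "\<gamma> \<in> paths T n v" for \<gamma>
  proof -
    note g = pathsD[OF \<gamma>]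
    have gV: "set \<gamma> \<subseteq> V" by (rule paths_in_V[OF T(1) finT(2) \<gamma>])
    have vg: "v \<in> set \<gamma>" using g(2,5) by auto
    have bij: "bij_betw ((!) \<gamma>) {..n} (set \<gamma>)" by (rule bij_betw_nth) (use g in auto)
    \<comment> \<open>This time the walk starts at the root. The initial piece then carries the
      Green function from v, a bubble term, and the final piece carries the escape factor of its own
      first vertex, an expected number of vertices.\<close>
    have "1 = (\<Sum>a\<in>set \<gamma>. greenV v a * escV (set \<gamma>) a)"
      using last_visitV[OF g(8) gV vg] by simp
    also have "\<dots> = (\<Sum>i\<le>n. greenV v (\<gamma> ! i) * escV (set \<gamma>) (\<gamma> ! i))"
      by (rule sum.reindex_bij_betw[OF bij, symmetric])
    finally have "wtV \<gamma> = (\<Sum>i\<le>n. wtV \<gamma> * (greenV v (\<gamma> ! i) * escV (set \<gamma>) (\<gamma> ! i)))"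
      by (metis mult_1_right sum_distrib_left)
    also have "\<dots> \<le> (\<Sum>i\<le>n. ?K (take (Suc i) \<gamma>) (drop i \<gamma>))"
    proof (rule sum_mono)
      fix i assume "i \<in> {..n}"
      then have i: "i \<le> n" "i < length \<gamma>" using g by auto
      note t = paths_take_drop[OF \<gamma> i(1)]
      have iV: "\<gamma> ! i \<in> V" using gV nth_mem[OF i(2)] by auto
      have e: "escV (set \<gamma>) (\<gamma> ! i) \<le> escV (set (drop i \<gamma>)) (hd (drop i \<gamma>))"
        unfolding t(3) by (rule escV_antimono[OF g(8) gV set_drop_subset])
      have "wtV \<gamma> * (greenV v (\<gamma> ! i) * escV (set \<gamma>) (\<gamma> ! i)) \<le>
          (wtV (take (Suc i) \<gamma>) * wtV (drop i \<gamma>)) *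
          (greenV v (last (take (Suc i) \<gamma>)) * escV (set (drop i \<gamma>)) (hd (drop i \<gamma>)))"
        unfolding t(2)
        by (intro mult_mono mult_left_mono mult_nonneg_nonneg wtV_split i e wtV_nonneg greenV_nonneg escV_nonneg)
           (use iV finT gV in auto)
      then show "wtV \<gamma> * (greenV v (\<gamma> ! i) * escV (set \<gamma>) (\<gamma> ! i)) \<le> ?K (take (Suc i) \<gamma>) (drop i \<gamma>)"
        by (simp add: mult_ac)
    qed
    finally show ?thesis using wt_le_wtV[OF T(1), of \<gamma>] by linarith
  qed
  then have "fm T n v \<le> (\<Sum>\<gamma>\<in>paths T n v. \<Sum>i\<le>n. ?K (take (Suc i) \<gamma>) (drop i \<gamma>))"
    unfolding fm_def by (rule sum_mono)
  also have "\<dots> = (\<Sum>i\<le>n. \<Sum>\<gamma>\<in>paths T n v. ?K (take (Suc i) \<gamma>) (drop i \<gamma>))" by (rule sum.swap)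
  also have "\<dots> \<le> (\<Sum>i\<le>n. \<beta> i * emV (n - i))"
  proof (rule sum_mono)
    fix i assume "i \<in> {..n}"
    then have i: "i \<le> n" by simp
    have "(\<Sum>\<gamma>\<in>paths T n v. ?K (take (Suc i) \<gamma>) (drop i \<gamma>)) =
        (\<Sum>\<gamma>'\<in>paths T i v. \<Sum>\<gamma>''\<in>paths (T - set \<gamma>') (n - i) (last \<gamma>'). ?K \<gamma>' \<gamma>'')"
      by (rule sum_paths_split[OF finT(1) i])
    also have "\<dots> = (\<Sum>\<gamma>'\<in>paths T i v. (wtV \<gamma>' * greenV v (last \<gamma>')) *
        em (T - set \<gamma>') (n - i) (last \<gamma>'))"
      unfolding em_def sum_distrib_left by (intro sum.cong refl) (auto dest: pathsD)
    also have "\<dots> \<le> (\<Sum>\<gamma>'\<in>paths T i v. (wtV \<gamma>' * greenV v (last \<gamma>')) * emV (n - i))"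
    proof (intro sum_mono mult_left_mono mult_nonneg_nonneg wtV_nonneg greenV_nonneg finT)
      fix \<gamma>' assume g': "\<gamma>' \<in> paths T i v"
      have l: "last \<gamma>' \<in> T" using paths_last_in[OF g'] T by simp
      then show lV: "last \<gamma>' \<in> V" using T by (auto dest: domD)
      have "em (T - set \<gamma>') (n - i) (last \<gamma>') \<le> em T (n - i) (last \<gamma>')"
        by (rule em_mono[OF T(1) _ lV]) auto
      also have "\<dots> \<le> emV (n - i)" by (rule em_le_emV[OF T(1) l])
      finally show "em (T - set \<gamma>') (n - i) (last \<gamma>') \<le> emV (n - i)" .
    qed
    also have "\<dots> = (\<Sum>\<gamma>'\<in>paths T i v. wtV \<gamma>' * greenV v (last \<gamma>')) * emV (n - i)"
      by (rule sum_distrib_right[symmetric])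
    also have "\<dots> \<le> \<beta> i * emV (n - i)" by (intro mult_right_mono sum_wtV_green_le T emV_nonneg)
    finally show "(\<Sum>\<gamma>\<in>paths T n v. ?K (take (Suc i) \<gamma>) (drop i \<gamma>)) \<le> \<beta> i * emV (n - i)" .
  qed
  finally show ?thesis .
qed

section \<open>Divergence of the sum of the first moments\<close>

lemma walk_mass:
  assumes "x \<in> V" "\<delta> > 0"
  shows "\<exists>S. dom S \<and> x \<in> S \<and> 1 - \<delta> < (\<Sum>y\<in>S. pk S n x y)"
  using assms
proof (induction n arbitrary: x \<delta>)
  case 0
  then show ?case by (intro exI[of _ "{x}"]) (auto simp: dom_def)
next
  case (Suc n)
  \<comment> \<open>One factor 1 - d is lost in the first step and one in the remaining n; their
    product exceeds 1 - 2 d, hence 1 - \<delta>. The bound 1/2 keeps the factors positive.\<close>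
  define d where "d = min (\<delta> / 2) (1 / 2)"
  have d: "d > 0" "d \<le> 1 / 2" "2 * d \<le> \<delta>" using Suc.prems by (auto simp: d_def)
  obtain T where T: "finite T" "T \<subseteq> set_pmf (P x)" "1 - d < (\<Sum>w\<in>T. p x w)"
    using pmf_finite_approx[OF d(1), of "P x"] by auto
  have TV: "T \<subseteq> V" using T(2) closed[OF Suc.prems(1)] by auto
  have "\<forall>w\<in>T. \<exists>S. dom S \<and> w \<in> S \<and> 1 - d < (\<Sum>y\<in>S. pk S n w y)"
  proof
    fix w assume "w \<in> T"
    then show "\<exists>S. dom S \<and> w \<in> S \<and> 1 - d < (\<Sum>y\<in>S. pk S n w y)"
      by (intro Suc.IH d) (use TV in auto)
  qed
  from bchoice[OF this] obtain f
    where f: "\<And>w. w \<in> T \<Longrightarrow> dom (f w) \<and> w \<in> f w \<and> 1 - d < (\<Sum>y\<in>f w. pk (f w) n w y)" by auto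
  define S where "S = insert x (\<Union>w\<in>T. f w)"
  have S: "dom S" "x \<in> S" "T \<subseteq> S" using f T Suc.prems by (auto simp: S_def dom_def)
  have fin: "finite S" using S by (simp add: domD)
  have mass: "1 - d \<le> (\<Sum>y\<in>S. pk S n w y)" if "w \<in> T" for w
  proof -
    have sub: "f w \<subseteq> S" using that by (auto simp: S_def)
    have "(\<Sum>y\<in>f w. pk (f w) n w y) \<le> (\<Sum>y\<in>f w. pk S n w y)" by (intro sum_mono kpow_mono fin sub)
    also have "\<dots> \<le> (\<Sum>y\<in>S. pk S n w y)" by (intro sum_mono2 fin sub kpow_nonneg)
    finally show ?thesis using f[OF that] by linarith
  qed
  have "1 - \<delta> < (1 - d) * (1 - d)"
  proof -
    have "(1 - d) * (1 - d) = 1 - 2 * d + d * d" by (simp add: algebra_simps)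
    then show ?thesis using d by (smt (verit) mult_pos_pos)
  qed
  also have "\<dots> \<le> (\<Sum>w\<in>T. p x w) * (1 - d)" using T(3) d by (intro mult_right_mono) auto
  also have "\<dots> \<le> (\<Sum>w\<in>T. p x w * (\<Sum>y\<in>S. pk S n w y))"
    unfolding sum_distrib_right by (intro sum_mono mult_left_mono mass) auto
  also have "\<dots> \<le> (\<Sum>w\<in>S. p x w * (\<Sum>y\<in>S. pk S n w y))"
    by (intro sum_mono2 fin S mult_nonneg_nonneg sum_nonneg kpow_nonneg) auto
  also have "\<dots> = (\<Sum>y\<in>S. \<Sum>w\<in>S. p x w * pk S n w y)"
    by (simp add: sum_distrib_left) (rule sum.swap)
  also have "\<dots> = (\<Sum>y\<in>S. pk S (Suc n) x y)"
    by (intro sum.cong refl kpow_Suc_front[symmetric] fin S)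
  finally show ?case using S by blast
qed

text \<open>At each of N times at least half of the mass is still in S, so the expected time spent
  in S is at least N / 2. Summable first moments would contradict this.\<close>

lemma green_mass:
  assumes "x \<in> V"
  shows "\<exists>S. dom S \<and> x \<in> S \<and> real N / 2 \<le> (\<Sum>y\<in>S. gr S y x)"
proof -
  have "\<forall>n. \<exists>S. dom S \<and> x \<in> S \<and> 1 - 1 / 2 < (\<Sum>y\<in>S. pk S n x y)"
    using walk_mass[OF assms, of "1/2"] by auto
  then obtain f where f: "\<And>n. dom (f n) \<and> x \<in> f n \<and> 1 - 1 / 2 < (\<Sum>y\<in>f n. pk (f n) n x y)" by metis
  define S where "S = (\<Union>n\<le>N. f n)"
  have S: "dom S" "x \<in> S" using f by (auto simp: S_def dom_def)
  have fin: "finite S" using S by (simp add: domD)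
  have mass: "1 / 2 \<le> (\<Sum>y\<in>S. pk S n x y)" if "n \<in> {..<N}" for n
  proof -
    have "n \<in> {..N}" using that by simp
    then have sub: "f n \<subseteq> S" unfolding S_def by blast
    have "(\<Sum>y\<in>f n. pk (f n) n x y) \<le> (\<Sum>y\<in>f n. pk S n x y)" by (intro sum_mono kpow_mono fin sub)
    also have "\<dots> \<le> (\<Sum>y\<in>S. pk S n x y)" by (intro sum_mono2 fin sub kpow_nonneg)
    finally show ?thesis using f[of n] by linarith
  qed
  have "real N / 2 = (\<Sum>n<N. 1 / 2)" by simp
  also have "\<dots> \<le> (\<Sum>n<N. \<Sum>y\<in>S. pk S n x y)" by (rule sum_mono) (rule mass)
  also have "\<dots> = (\<Sum>y\<in>S. \<Sum>n<N. pk S n x y)" by (rule sum.swap)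
  also have "\<dots> \<le> (\<Sum>y\<in>S. gr S y x)"
  proof (rule sum_mono)
    fix y assume y: "y \<in> S"
    have "(\<Sum>n<N. pk S n x y) \<le> gr S x y"
      unfolding green_def by (intro sum_le_suminf summable_pk S y) (auto simp: kpow_nonneg)
    then show "(\<Sum>n<N. pk S n x y) \<le> gr S y x" using gr_sym[OF S y] by simp
  qed
  finally show ?thesis using S by blast
qed

text \<open>Submultiplicativity, together with the divergence of the sum over \<open>n\<close>, bounds the first moments from below.\<close>

definition fmV :: "nat \<Rightarrow> real" where
  "fmV n = (SUP (S, x)\<in>{(S, x). dom S \<and> x \<in> S}. fm S n x)"

lemma bdd_fm: "bdd_above ((\<lambda>(S, x). fm S n x) ` {(S, x). dom S \<and> x \<in> S})"
  by (rule bdd_aboveI[of _ bubble]) (auto intro!: fm_le_bubble dest: domD)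

lemma fm_le_fmV: "dom S \<Longrightarrow> x \<in> S \<Longrightarrow> fm S n x \<le> fmV n"
  unfolding fmV_def by (rule cSUP_upper2[OF bdd_fm, of "(S, x)"]) auto

lemma fmV_least: "(\<And>S x. dom S \<Longrightarrow> x \<in> S \<Longrightarrow> fm S n x \<le> K) \<Longrightarrow> fmV n \<le> K"
  unfolding fmV_def
proof (rule cSUP_least)
  show "{(T, x). dom T \<and> x \<in> T} \<noteq> {}" using singleton_dom by blast
qed auto

lemma fmV_nonneg: "0 \<le> fmV n"
proof -
  obtain x where x: "x \<in> V" "dom {x}" using singleton_dom by blast
  then show ?thesis using fm_nonneg[OF x(2), of n x] fm_le_fmV[of "{x}" x n] by simp
qed

lemma fmV_submult: "fmV (n + m) \<le> fmV n * fmV m"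
proof (rule fmV_least)
  fix S x assume S: "dom S" "x \<in> S"
  have fin: "finite S" using S by (simp add: domD)
  have "fm S (n + m) x = (\<Sum>\<gamma>\<in>paths S (n + m) x. (\<lambda>a b. wt S a * wt (S - set a) b) (take (Suc n) \<gamma>) (drop n \<gamma>))"
    unfolding fm_def by (intro sum.cong refl) (auto dest: pathsD(1) intro!: wt_split S)
  also have "\<dots> = (\<Sum>a\<in>paths S n x. \<Sum>b\<in>paths (S - set a) (n + m - n) (last a). wt S a * wt (S - set a) b)"
    by (rule sum_paths_split[OF fin]) simp
  also have "\<dots> = (\<Sum>a\<in>paths S n x. wt S a * fm (S - set a) m (last a))"
    by (simp add: fm_def sum_distrib_left)
  also have "\<dots> \<le> (\<Sum>a\<in>paths S n x. wt S a * fmV m)"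
  proof (intro sum_mono mult_left_mono wt_nonneg S)
    fix a assume a: "a \<in> paths S n x"
    have "fm (S - set a) m (last a) \<le> fm S m (last a)" by (rule fm_mono[OF S(1)]) auto
    also have "\<dots> \<le> fmV m" using paths_last_in[OF a] S by (intro fm_le_fmV) auto
    finally show "fm (S - set a) m (last a) \<le> fmV m" .
  qed
  also have "\<dots> = fm S n x * fmV m" by (simp add: fm_def sum_distrib_right)
  also have "\<dots> \<le> fmV n * fmV m" by (intro mult_right_mono fm_le_fmV S fmV_nonneg)
  finally show "fm S (n + m) x \<le> fmV n * fmV m" .
qed

text \<open>A value below 1 would force geometric decay and bound the sum over all lengths,
  uniformly in S. But \<open>green_paths\<close> identifies this sum with a total Green function,
  which \<open>green_mass\<close> makes arbitrarily large.\<close>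

lemma fmV_ge_1: "1 \<le> fmV n"
proof (rule ccontr)
  assume "\<not> 1 \<le> fmV n"
  then have less: "fmV n < 1" by simp
  obtain x where x: "x \<in> V" "dom {x}" using singleton_dom by blast
  \<comment> \<open>Length 0 cannot occur: the path consisting of x alone has weight
    \<open>gr {x} x x\<close>, which is at least 1.\<close>
  have n: "0 < n"
  proof (rule ccontr)
    assume "\<not> 0 < n"
    then have n0: "n = 0" by simp
    have "paths {x} 0 x = {[x]}" by (auto simp: paths_def length_Suc_conv)
    then have "fm {x} 0 x = gr {x} x x"
      using decay_insert[OF x(2), of x "{}"] Z_pos[OF x(2)] by (simp add: fm_def wt_def decay_def)
    then have "1 \<le> fm {x} 0 x" using gr_diag_ge_1[OF x(2), of x] by simp
    then show False using less fm_le_fmV[OF x(2), of x 0] n0 by simp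
  qed
  have fmV_le_bubble: "fmV r \<le> bubble" for r by (rule fmV_least) (auto intro: fm_le_bubble dest: domD)
  have pow: "fmV (k * n + r) \<le> fmV n ^ k * bubble" for k r
  proof (induction k)
    case (Suc k)
    have "fmV (Suc k * n + r) \<le> fmV n * fmV (k * n + r)"
      using fmV_submult[of n "k * n + r"] by (simp add: add.assoc)
    also have "\<dots> \<le> fmV n * (fmV n ^ k * bubble)" by (intro mult_left_mono Suc fmV_nonneg)
    finally show ?case by (simp add: mult.assoc)
  qed (simp add: fmV_le_bubble)
  have sum: "(\<Sum>l<K * n. fmV l) \<le> real n * bubble / (1 - fmV n)" for K
  proof -
    have "(\<Sum>l<K * n. fmV l) = (\<Sum>k<K. \<Sum>r<n. fmV (k * n + r))"
    proof (induction K)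
      case (Suc K)
      have "(\<Sum>l<Suc K * n. fmV l) = (\<Sum>l<K * n + n. fmV l)" by (simp add: add.commute)
      also have "\<dots> = (\<Sum>l<K * n. fmV l) + (\<Sum>l\<in>{K * n..<K * n + n}. fmV l)"
      proof -
        have "{..<K * n + n} = {..<K * n} \<union> {K * n..<K * n + n}" by auto
        from arg_cong[OF this, of "sum fmV"] show ?thesis
          by (subst (asm) sum.union_disjoint) auto
      qed
      also have "(\<Sum>l\<in>{K * n..<K * n + n}. fmV l) = (\<Sum>r<n. fmV (K * n + r))"
        by (rule sum.reindex_bij_witness[of _ "\<lambda>r. K * n + r" "\<lambda>l. l - K * n"]) auto
      finally show ?case using Suc by simp
    qed simp
    also have "\<dots> \<le> (\<Sum>k<K. \<Sum>r<n. fmV n ^ k * bubble)" by (intro sum_mono pow)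
    also have "\<dots> = real n * bubble * (\<Sum>k<K. fmV n ^ k)" by (simp add: sum_distrib_left mult_ac)
    also have "\<dots> \<le> real n * bubble * (1 / (1 - fmV n))"
    proof (intro mult_left_mono)
      have "(\<Sum>k<K. fmV n ^ k) \<le> (\<Sum>k. fmV n ^ k)"
        by (intro sum_le_suminf summable_geometric) (use less fmV_nonneg in auto)
      then show "(\<Sum>k<K. fmV n ^ k) \<le> 1 / (1 - fmV n)"
        using suminf_geometric[of "fmV n"] less fmV_nonneg[of n] by simp
    qed (use bubble_ge_1 in auto)
    finally show ?thesis by simp
  qed
  obtain N :: nat where "2 * (real n * bubble / (1 - fmV n)) < real N" using reals_Archimedean2 by blast
  then have N: "real n * bubble / (1 - fmV n) < real N / 2" by linarith
  obtain S where S: "dom S" "x \<in> S" "real N / 2 \<le> (\<Sum>y\<in>S. gr S y x)" using green_mass[OF x(1)] by blast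
  \<comment> \<open>The number of terms is a multiple of n, as the sum over blocks requires, and at
    least \<open>card S\<close>, as equality in \<open>green_paths\<close> requires.\<close>
  have "(\<Sum>y\<in>S. gr S y x) = (\<Sum>l<card S * n. fm S l x)"
    using green_paths(2)[OF S(1,2), of "\<lambda>_. 1" "card S * n"] n by (simp add: fm_def)
  also have "\<dots> \<le> (\<Sum>l<card S * n. fmV l)" by (intro sum_mono fm_le_fmV S)
  also have "\<dots> \<le> real n * bubble / (1 - fmV n)" by (rule sum)
  finally show False using S(3) N by linarith
qed

lemma convolution_ge_1: "1 \<le> (\<Sum>i\<le>n. \<beta> i * emV (n - i))"
proof -
  have "fmV n \<le> (\<Sum>i\<le>n. \<beta> i * emV (n - i))" by (rule fmV_least) (rule fm_le_convolution)
  then show ?thesis using fmV_ge_1[of n] by linarith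
qed

text \<open>Sum the convolution bound over the lengths from n to M n: the \<beta> contribute at most
  \<open>bubble\<close> in total, so (M - 1) n is at most \<open>bubble\<close> times the sum of
  \<open>emV\<close> below M n. Lengths below n account for at most n times \<open>bubble\<close> of
  that sum, and M is chosen to leave at least 2 n for the others.\<close>

lemma first_moment_lower:
  "\<exists>M::nat. 1 \<le> M \<and> (\<forall>n v. 1 \<le> n \<longrightarrow> v \<in> V \<longrightarrow>
    (\<exists>T. dom T \<and> v \<in> T \<and> real n \<le> (\<Sum>l\<in>{n..<M * n}. em T l v)))"
proof -
  define M :: nat where "M = nat \<lceil>bubble * (bubble + 2)\<rceil> + 1"
  have b: "1 \<le> bubble" by (rule bubble_ge_1)
  have M: "bubble * (bubble + 2) \<le> real M - 1" unfolding M_def by simp linarith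
  have M1: "1 \<le> M" by (simp add: M_def)
  have sumV: "2 * real n \<le> (\<Sum>l\<in>{n..<M * n}. emV l)" if n: "1 \<le> n" for n
  proof -
    have nM: "n \<le> M * n" using M1 by (simp add: mult_le_mono1[of 1 M n, simplified])
    have "real (M * n - n) = (\<Sum>m\<in>{n..<M * n}. 1)" by simp
    also have "\<dots> \<le> (\<Sum>m\<in>{n..<M * n}. \<Sum>i\<le>m. \<beta> i * emV (m - i))"
      by (intro sum_mono convolution_ge_1)
    also have "\<dots> \<le> (\<Sum>m\<in>{..<M * n}. \<Sum>i\<le>m. \<beta> i * emV (m - i))"
      by (intro sum_mono2 sum_nonneg mult_nonneg_nonneg \<beta>_nonneg emV_nonneg) auto
    also have "\<dots> = (\<Sum>(m, i)\<in>Sigma {..<M * n} (\<lambda>m. {..m}). \<beta> i * emV (m - i))"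
      by (rule sum.Sigma) auto
    also have "\<dots> = (\<Sum>(i, l)\<in>Sigma {..<M * n} (\<lambda>i. {..<M * n - i}). \<beta> i * emV l)"
      by (rule sum.reindex_bij_witness[of _ "\<lambda>(i, l). (i + l, i)" "\<lambda>(m, i). (i, m - i)"]) auto
    also have "\<dots> = (\<Sum>i<M * n. \<Sum>l<M * n - i. \<beta> i * emV l)" by (rule sum.Sigma[symmetric]) auto
    also have "\<dots> \<le> (\<Sum>i<M * n. \<Sum>l<M * n. \<beta> i * emV l)"
      by (intro sum_mono sum_mono2 mult_nonneg_nonneg \<beta>_nonneg emV_nonneg) auto
    also have "\<dots> = (\<Sum>i<M * n. \<beta> i) * (\<Sum>l<M * n. emV l)" by (simp add: sum_product)
    also have "\<dots> \<le> bubble * (\<Sum>l<M * n. emV l)"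
      by (intro mult_right_mono sum_\<beta>_le_bubble sum_nonneg emV_nonneg)
    also have "(\<Sum>l<M * n. emV l) = (\<Sum>l<n. emV l) + (\<Sum>l\<in>{n..<M * n}. emV l)"
    proof -
      have "{..<M * n} = {..<n} \<union> {n..<M * n}" using nM less_le_trans[OF _ nM] by auto
      from arg_cong[OF this, of "sum emV"] show ?thesis
        by (subst (asm) sum.union_disjoint) auto
    qed
    also have "bubble * \<dots> \<le> bubble * (real n * bubble + (\<Sum>l\<in>{n..<M * n}. emV l))"
    proof -
      have "(\<Sum>l<n. emV l) \<le> (\<Sum>l<n. bubble)" by (intro sum_mono emV_le_bubble)
      then show ?thesis using b by simp
    qed
    finally have "(real M - 1) * real n \<le> bubble * (real n * bubble + (\<Sum>l\<in>{n..<M * n}. emV l))"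
      using nM by (simp add: of_nat_diff algebra_simps)
    moreover have "bubble * (bubble + 2) * real n \<le> (real M - 1) * real n"
      using M by (intro mult_right_mono) auto
    ultimately have "bubble * (2 * real n) \<le> bubble * (\<Sum>l\<in>{n..<M * n}. emV l)"
      by (simp add: algebra_simps)
    then show ?thesis using b by simp
  qed
  have "\<exists>T. dom T \<and> v \<in> T \<and> real n \<le> (\<Sum>l\<in>{n..<M * n}. em T l v)" if n: "1 \<le> n" "v \<in> V" for n v
  proof -
    \<comment> \<open>Fewer than M n lengths are approximated with error d each, so at most n of the
      available 2 n is lost.\<close>
    define d where "d = 1 / real M"
    have d: "d > 0" using M1 by (simp add: d_def)
    obtain f where f: "\<And>l. dom (f l) \<and> v \<in> f l \<and> emV l - d < em (f l) l v"
      using emV_approx[OF d n(2)] by metis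
    define T where "T = (\<Union>l\<le>M * n. f l)"
    have T: "dom T" "v \<in> T" using f by (auto simp: T_def dom_def)
    have "(\<Sum>l\<in>{n..<M * n}. emV l) \<le> (\<Sum>l\<in>{n..<M * n}. em T l v + d)"
    proof (rule sum_mono)
      fix l assume "l \<in> {n..<M * n}"
      then have "l \<in> {..M * n}" by simp
      then have "f l \<subseteq> T" unfolding T_def by blast
      then have "em (f l) l v \<le> em T l v" by (rule em_mono[OF T(1) _ n(2)])
      then show "emV l \<le> em T l v + d" using f[of l] by linarith
    qed
    also have "\<dots> = (\<Sum>l\<in>{n..<M * n}. em T l v) + real (M * n - n) * d" by (simp add: sum.distrib)
    also have "real (M * n - n) * d \<le> real (M * n) * d"
    proof (rule mult_right_mono)
      show "real (M * n - n) \<le> real (M * n)" by (simp only: of_nat_le_iff diff_le_self)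
    qed (use d in simp)
    also have "real (M * n) * d = real n" using M1 by (simp add: d_def)
    finally show ?thesis using sumV[OF n(1)] T by (intro exI[of _ T]) auto
  qed
  then show ?thesis using M1 by blast
qed

end

section \<open>Spanning trees and rooted orientations\<close>

lemma walk_edges_mono:
  assumes "walk G x p y" "edges G \<subseteq> edges G'" "ends G = ends G'"
  shows "walk G' x p y"
  using assms(1)
proof (induction p arbitrary: x)
  case (Cons ez p)
  then show ?case using assms(2,3) by (cases ez) auto
qed simp

lemma walk_edges_subset: "walk G x p y \<Longrightarrow> fst ` set p \<subseteq> edges G"
  by (induction G x p y rule: walk.induct) auto

lemma walk_append: "walk G x p y \<Longrightarrow> walk G y q z \<Longrightarrow> walk G x (p @ q) z"
  by (induction G x p y rule: walk.induct) auto

lemma walk_rev: "walk G x p y \<Longrightarrow> \<exists>q. walk G y q x \<and> length q = length p"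
proof (induction G x p y rule: walk.induct)
  case (2 G x e z p y)
  then obtain q where "walk G y q z" "length q = length p" by auto
  moreover have "walk G z [(e, x)] x" using 2 by (auto simp: insert_commute)
  ultimately have "walk G y (q @ [(e, x)]) x \<and> length (q @ [(e, x)]) = length ((e, z) # p)"
    using walk_append by fastforce
  then show ?case by blast
qed (auto intro: exI[of _ "[]"])

lemma path_suffix:
  "walk G z p y \<Longrightarrow> distinct (z # map snd p) \<Longrightarrow> x \<in> set (z # map snd p) \<Longrightarrow> \<exists>q. path G x q y"
proof (induction G z p y rule: walk.induct)
  case (2 G z e w p y)
  show ?case
  proof (cases "x = z")
    case True
    then have "path G x ((e, w) # p) y" using 2 by (simp add: path_def)
    then show ?thesis by blast
  next
    case False
    then show ?thesis using 2 by auto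
  qed
next
  case (1 G x y)
  then have "path G y [] y" by (simp add: path_def)
  then show ?case using 1 by auto
qed

lemma walk_path: "walk G x p y \<Longrightarrow> \<exists>q. path G x q y"
proof (induction G x p y rule: walk.induct)
  case (2 G x e z p y)
  then obtain q where q: "path G z q y" by auto
  show ?case
  proof (cases "x \<in> set (z # map snd q)")
    case True
    then show ?thesis using path_suffix q unfolding path_def by metis
  next
    case False
    then have "path G x ((e, z) # q) y" using q 2 by (auto simp: path_def)
    then show ?thesis by blast
  qed
qed (auto simp: path_def intro: exI[of _ "[]"])

lemma walk_edge_ends: "walk G x p y \<Longrightarrow> e \<in> fst ` set p \<Longrightarrow> ends G e \<subseteq> set (x # map snd p)"
  by (induction G x p y rule: walk.induct) auto

lemma path_distinct_edges: "walk G x p y \<Longrightarrow> distinct (x # map snd p) \<Longrightarrow> distinct (map fst p)"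
proof (induction G x p y rule: walk.induct)
  case (2 G x e z p y)
  have "e \<notin> fst ` set p"
  proof
    assume "e \<in> fst ` set p"
    then have "ends G e \<subseteq> set (z # map snd p)" using walk_edge_ends 2(2) by fastforce
    then show False using 2 by auto
  qed
  then show ?case using 2 by auto
qed simp

text \<open>A rank function decreasing along the edges \<open>a x\<close> from \<open>x\<close> to \<open>par x\<close> rules out cycles.\<close>

locale rooted_orientation =
  fixes K :: "('x, 'e, 'z) multigraph_scheme" and r :: 'x and a :: "'x \<Rightarrow> 'e"
    and par :: "'x \<Rightarrow> 'x" and R :: "'x \<Rightarrow> nat"
  assumes root: "r \<in> verts K" and edges: "edges K = a ` (verts K - {r})"
    and ends: "x \<in> verts K \<Longrightarrow> x \<noteq> r \<Longrightarrow> ends K (a x) = {x, par x}"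
    and par: "x \<in> verts K \<Longrightarrow> x \<noteq> r \<Longrightarrow> par x \<in> verts K"
    and rank: "x \<in> verts K \<Longrightarrow> x \<noteq> r \<Longrightarrow> R x = Suc (R (par x))"
begin

lemma edge_cases:
  assumes "e \<in> edges K" "ends K e = {x, z}"
  obtains (down) "x \<in> verts K" "x \<noteq> r" "e = a x" "z = par x"
  | (up) "z \<in> verts K" "z \<noteq> r" "e = a z" "x = par z"
proof -
  obtain u where u: "e = a u" "u \<in> verts K" "u \<noteq> r" using assms(1) edges by auto
  then have "{x, z} = {u, par u}" using ends[of u] assms(2) by simp
  then consider "x = u" "z = par u" | "z = u" "x = par u" by (auto simp: doubleton_eq_iff)
  then show thesis
  proof cases
    case 1
    show thesis by (rule down) (use 1 u in simp_all)
  next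
    case 2
    show thesis by (rule up) (use 2 u in simp_all)
  qed
qed

lemma inj_a: "inj_on a (verts K - {r})"
proof (rule inj_onI)
  fix x y assume xy: "x \<in> verts K - {r}" "y \<in> verts K - {r}" "a x = a y"
  then have "{x, par x} = {y, par y}" using ends by (metis DiffD1 DiffD2 singletonI)
  then show "x = y" using rank[of x] rank[of y] xy by (auto simp: doubleton_eq_iff)
qed

lemma rank_root: "x \<in> verts K \<Longrightarrow> x \<noteq> r \<Longrightarrow> R r < R x"
proof (induction "R x" arbitrary: x rule: less_induct)
  case less
  then show ?case using rank[of x] par[of x] by (cases "par x = r") fastforce+
qed

lemma path_to_root:
  "x \<in> verts K \<Longrightarrow> \<exists>p. path K x p r \<and> (\<forall>v\<in>set (map snd p). R v < R x) \<and>
    (x \<noteq> r \<longrightarrow> (\<exists>p'. p = (a x, par x) # p'))"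
proof (induction "R x" arbitrary: x rule: less_induct)
  case less
  show ?case
  proof (cases "x = r")
    case True
    then show ?thesis by (intro exI[of _ "[]"]) (auto simp: path_def)
  next
    case False
    have "R (par x) < R x" using rank[OF less.prems False] by simp
    then obtain p where p: "path K (par x) p r" "\<forall>v\<in>set (map snd p). R v < R (par x)"
      using less.hyps[of "par x"] par[OF less.prems False] by blast
    have small: "R v < R x" if "v \<in> set (par x # map snd p)" for v
      using that p(2) \<open>R (par x) < R x\<close> by (metis less_trans set_ConsD)
    then have "x \<notin> set (par x # map snd p)" by blast
    moreover have "a x \<in> edges K" using edges less.prems False by simp
    ultimately have "path K x ((a x, par x) # p) r"
      using p(1) ends[OF less.prems False] by (simp add: path_def)
    then show ?thesis using small by (intro exI[of _ "(a x, par x) # p"]) simp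
  qed
qed

lemma connected: "connected_graph K"
  unfolding connected_graph_def
proof (intro conjI ballI)
  show "verts K \<noteq> {}" using root by blast
  fix x y assume xy: "x \<in> verts K" "y \<in> verts K"
  obtain p where p: "walk K x p r" using path_to_root[OF xy(1)] by (auto simp: path_def)
  obtain q where "walk K y q r" using path_to_root[OF xy(2)] by (auto simp: path_def)
  then obtain q' where "walk K r q' y" using walk_rev[of K y _ r] by blast
  then show "\<exists>p. walk K x p y" using walk_append[OF p] by metis
qed

text \<open>A trail that avoids the edge of its first vertex towards the parent must move to a
  child. The edge from the child to its parent is then already used, so the trail climbs at every
  step.\<close>

lemma up:
  "walk K x p y \<Longrightarrow> x = r \<or> a x \<notin> fst ` set p \<Longrightarrow> distinct (map fst p) \<Longrightarrow> R x \<le> R y \<and> (p \<noteq> [] \<longrightarrow> R x < R y)"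
proof (induction p arbitrary: x)
  case (Cons ez p)
  obtain e z where ez: "ez = (e, z)" by (cases ez)
  have w: "e \<in> edges K" "ends K e = {x, z}" "walk K z p y" using Cons.prems ez by auto
  from w(1,2) show ?case
  proof (cases rule: edge_cases)
    case down
    then show ?thesis using Cons.prems ez by auto
  next
    case up
    have "R z \<le> R y" using Cons.IH[OF w(3)] Cons.prems up ez by auto
    then show ?thesis using rank[OF up(1,2)] up by auto
  qed
qed simp

text \<open>Ranks fall until the first climb, and after it the trail climbs to its end. A climb into
  y crosses the edge of y.\<close>

lemma last_edge:
  "walk K x p y \<Longrightarrow> p \<noteq> [] \<Longrightarrow> distinct (map fst p) \<Longrightarrow> R y < R x \<or> (y \<noteq> r \<and> fst (last p) = a y)"
proof (induction p arbitrary: x)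
  case (Cons ez p)
  obtain e z where ez: "ez = (e, z)" by (cases ez)
  have w: "e \<in> edges K" "ends K e = {x, z}" "walk K z p y" using Cons.prems ez by auto
  from w(1,2) show ?case
  proof (cases rule: edge_cases)
    case down
    have Rz: "R z < R x" using rank[OF down(1,2)] down by simp
    show ?thesis
    proof (cases "p = []")
      case True
      then show ?thesis using w Rz by auto
    next
      case False
      then show ?thesis using Cons.IH[OF w(3)] Cons.prems Rz ez by auto
    qed
  next
    case up
    show ?thesis
    proof (cases "p = []")
      case True
      then show ?thesis using w up ez by auto
    next
      case False
      have "R z < R y" using rooted_orientation.up[OF rooted_orientation_axioms w(3)] False Cons.prems up ez by auto
      then show ?thesis using Cons.IH[OF w(3) False] Cons.prems False ez by auto
    qed
  qed
qed simp

text \<open>A cycle at x must end with the edge of x. If it also begins with that edge, the edge is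
  repeated; if it begins with a climb, it cannot come back.\<close>

lemma acyclic: "\<not> cycle K x p"
proof
  assume c: "cycle K x p"
  then obtain e z p' where p: "p = (e, z) # p'" by (cases p) (auto simp: cycle_def)
  have w: "e \<in> edges K" "ends K e = {x, z}" "walk K z p' x" "distinct (map fst p)" "walk K x p x" "p \<noteq> []"
    using c p by (auto simp: cycle_def)
  have last: "x \<noteq> r" "fst (last p) = a x" using last_edge[OF w(5,6,4)] by auto
  from w(1,2) show False
  proof (cases rule: edge_cases)
    case down
    show False
    proof (cases "p' = []")
      case True
      then show False using w down rank[OF down(1,2)] by auto
    next
      case False
      then have "last p \<in> set p'" using p by auto
      then have "a x \<in> fst ` set p'" using last by (metis imageI)
      then show False using w(4) p down by auto
    qed
  next
    case up
    have "R z \<le> R x" using rooted_orientation.up[OF rooted_orientation_axioms w(3)] w(4) p up by auto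
    then show False using rank[OF up(1,2)] up by simp
  qed
qed

lemma tree: "tree_graph K"
  using connected acyclic by (auto simp: tree_graph_def)

text \<open>Variant of \<open>up\<close> for paths, where climbing is forced because the parent may
  not be revisited.\<close>

lemma up_path:
  "walk K w p y \<Longrightarrow> w \<in> verts K \<Longrightarrow> w \<noteq> r \<Longrightarrow> par w \<notin> set (map snd p) \<Longrightarrow> distinct (w # map snd p) \<Longrightarrow> R w \<le> R y"
proof (induction p arbitrary: w)
  case (Cons ez p)
  obtain e z where ez: "ez = (e, z)" by (cases ez)
  have wk: "e \<in> edges K" "ends K e = {w, z}" "walk K z p y" using Cons.prems ez by auto
  from wk(1,2) show ?case
  proof (cases rule: edge_cases)
    case down
    then show ?thesis using Cons.prems ez by auto
  next
    case up
    have "R z \<le> R y" by (rule Cons.IH[OF wk(3) up(1,2)]) (use Cons.prems up ez in auto)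
    then show ?thesis using rank[OF up(1,2)] up by auto
  qed
qed simp

lemma first_edge:
  assumes "path K x ((e, w) # p) r"
  shows "x \<in> verts K \<and> x \<noteq> r \<and> e = a x"
proof -
  have w: "e \<in> edges K" "ends K e = {x, w}" "walk K w p r" "distinct (x # w # map snd p)"
    using assms by (auto simp: path_def)
  from w(1,2) show ?thesis
  proof (cases rule: edge_cases)
    case up
    have "R w \<le> R r" by (rule up_path[OF w(3) up(1,2)]) (use w(4) up in auto)
    then show ?thesis using rank_root[OF up(1,2)] by simp
  qed simp
qed

end

text \<open>Let the edge of x be the first edge of a shortest walk to r. These edges already connect
  all vertices, so any further edge would close a cycle.\<close>

lemma spanning_tree_orientation:
  fixes K :: "('x, 'e, 'z) multigraph_scheme"
  assumes tree: "tree_graph K" and r: "r \<in> verts K"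
    and ends: "\<And>e. e \<in> edges K \<Longrightarrow> ends K e \<subseteq> verts K \<and> card (ends K e) \<in> {1, 2}"
  shows "\<exists>a par R. rooted_orientation K r a par R"
proof -
  define d where "d x = (LEAST n. \<exists>p. walk K x p r \<and> length p = n)" for x
  have ex: "\<exists>p. walk K x p r" if "x \<in> verts K" for x
    using tree r that by (auto simp: tree_graph_def connected_graph_def)
  have dle: "d x \<le> length p" if "walk K x p r" for x p
    unfolding d_def by (rule Least_le) (use that in auto)
  have dwalk: "\<exists>p. walk K x p r \<and> length p = d x" if "x \<in> verts K" for x
    unfolding d_def by (rule LeastI_ex) (use ex[OF that] in auto)
  have step: "\<exists>e z. e \<in> edges K \<and> ends K e = {x, z} \<and> z \<in> verts K \<and> d x = Suc (d z)"
    if x: "x \<in> verts K" "x \<noteq> r" for x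
  proof -
    obtain p where p: "walk K x p r" "length p = d x" using dwalk[OF x(1)] by blast
    then obtain e z p' where p': "p = (e, z) # p'" using x by (cases p) auto
    have w: "e \<in> edges K" "ends K e = {x, z}" "walk K z p' r" using p p' by auto
    have z: "z \<in> verts K" using ends[OF w(1)] w(2) by auto
    obtain q where q: "walk K z q r" "length q = d z" using dwalk[OF z] by blast
    have "walk K x ((e, z) # q) r" using w q by simp
    then have "d x \<le> Suc (d z)" using dle q by fastforce
    moreover have "Suc (d z) \<le> d x" using dle[OF w(3)] p p' by simp
    ultimately show ?thesis using w z by auto
  qed
  then obtain a par where a: "\<And>x. x \<in> verts K \<Longrightarrow> x \<noteq> r \<Longrightarrow>
      a x \<in> edges K \<and> ends K (a x) = {x, par x} \<and> par x \<in> verts K \<and> d x = Suc (d (par x))" by metis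
  let ?K = "K\<lparr>edges := a ` (verts K - {r})\<rparr>"
  have ro: "rooted_orientation ?K r a par d"
    by standard (use a r in auto)
  have "e \<in> a ` (verts K - {r})" if e: "e \<in> edges K" for e
  proof (rule ccontr)
    assume n: "e \<notin> a ` (verts K - {r})"
    obtain x y where xy: "ends K e = {x, y}" "x \<in> verts K" "y \<in> verts K"
      using ends[OF e] by (auto simp: card_1_singleton_iff card_2_iff)
    have "\<exists>p. walk ?K y p x"
      using rooted_orientation.connected[OF ro] xy by (auto simp: connected_graph_def)
    then obtain p where p: "path ?K y p x" using walk_path by metis
    have "e \<notin> fst ` set p"
    proof -
      have "fst ` set p \<subseteq> edges ?K" by (rule walk_edges_subset[of ?K y p x]) (use p in \<open>simp add: path_def\<close>)
      then show ?thesis using n by auto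
    qed
    moreover have "distinct (map fst p)"
      by (rule path_distinct_edges[of ?K y p x]) (use p in \<open>simp_all add: path_def\<close>)
    moreover have "walk K y p x"
      by (rule walk_edges_mono[of ?K y p x K]) (use p a in \<open>auto simp: path_def\<close>)
    ultimately have "cycle K x ((e, y) # p)"
      using p xy e by (auto simp: cycle_def path_def)
    then show False using tree by (auto simp: tree_graph_def)
  qed
  then have "edges K = a ` (verts K - {r})" using a by auto
  then have "?K = K" by simp
  then show ?thesis using ro by metis
qed

lemma acyc_rank:
  assumes "acyc W F"
  shows "\<exists>r. (\<forall>x. x \<notin> W \<longrightarrow> r x = 0) \<and> (\<forall>x\<in>W. r x = Suc (r (F x)))"
proof -
  define r where "r x = (LEAST n. (F ^^ n) x \<notin> W)" for x
  have ex: "\<exists>n. (F ^^ n) x \<notin> W" for x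
  proof -
    obtain y where "leads W F x y" using acyc_leads[OF assms] by blast
    then show ?thesis
    proof (induction rule: leads.induct)
      case (stop y)
      then show ?case by (intro exI[of _ 0]) simp
    next
      case (step x y)
      then obtain n where "(F ^^ n) (F x) \<notin> W" by blast
      then show ?case by (intro exI[of _ "Suc n"]) (simp add: funpow_swap1)
    qed
  qed
  have "r x = 0" if "x \<notin> W" for x
    unfolding r_def by (rule Least_eq_0) (use that in simp)
  moreover have "r x = Suc (r (F x))" if "x \<in> W" for x
  proof -
    obtain n where "(F ^^ n) x \<notin> W" using ex by blast
    then have "r x = Suc (LEAST m. (F ^^ Suc m) x \<notin> W)"
      unfolding r_def by (rule Least_Suc) (use that in simp)
    then show ?thesis by (simp add: r_def funpow_swap1)
  qed
  ultimately show ?thesis by blast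
qed

lemma acyc_of_rank:
  assumes "\<And>x. x \<in> W \<Longrightarrow> F x \<in> W \<Longrightarrow> (r (F x) :: nat) < r x"
  shows "acyc W F"
proof -
  have "\<exists>y. leads W F x y" for x
  proof (induction "r x" arbitrary: x rule: less_induct)
    case less
    show ?case
    proof (cases "x \<in> W \<and> F x \<in> W")
      case True
      then show ?thesis using less assms by (meson leads.step)
    next
      case False
      then show ?thesis by (meson leads.intros)
    qed
  qed
  then show ?thesis by (simp add: acyc_def)
qed

section \<open>The uniform spanning tree of the contracted network\<close>

lemma ends_other:
  assumes net: "network G" and e: "e \<in> incident G u"
  shows "ends G e = {u, other_end G u e}"
proof -
  have e': "e \<in> edges G" "u \<in> ends G e" "card (ends G e) \<in> {1, 2}"
    using net e by (auto simp: incident_def network_def)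
  have "\<exists>w. ends G e = {u, w}"
  proof -
    from e'(3) consider "card (ends G e) = 1" | "card (ends G e) = 2" by auto
    then show ?thesis
    proof cases
      case 1
      then have "ends G e = {u, u}" using e'(2) by (auto simp: card_1_singleton_iff)
      then show ?thesis by blast
    next
      case 2
      then obtain x y where "ends G e = {x, y}" by (auto simp: card_2_iff)
      then have "ends G e = {u, x} \<or> ends G e = {u, y}" using e'(2) by auto
      then show ?thesis by blast
    qed
  qed
  then obtain w where w: "ends G e = {u, w}" by blast
  moreover have "other_end G u e = w"
    unfolding other_end_def by (rule the_equality) (use w in \<open>auto simp: doubleton_eq_iff\<close>)
  ultimately show ?thesis by simp
qed

lemma other_end_eq: "e \<in> edges G \<Longrightarrow> ends G e = {u, w} \<Longrightarrow> other_end G u e = w"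
  unfolding other_end_def by (rule the_equality) (auto simp: doubleton_eq_iff)

definition arrow_map :: "('v, 'e, 'x) multigraph_scheme \<Rightarrow> ('v \<Rightarrow> 'e) \<Rightarrow> 'v \<Rightarrow> 'v" where
  "arrow_map G f u = other_end G u (f u)"

text \<open>By \<open>good_spanning\<close> and \<open>spanning_good\<close> these are the spanning
  trees of the contracted network, oriented towards its root. Arrows are edges rather than targets
  because parallel edges give different trees.\<close>

definition good_arrows :: "('v, 'e, 'x) multigraph_scheme \<Rightarrow> 'v set \<Rightarrow> ('v \<Rightarrow> 'e) \<Rightarrow> bool" where
  "good_arrows G W f \<longleftrightarrow> (\<forall>u\<in>W. f u \<in> incident G u) \<and> acyc W (arrow_map G f)"

context
  fixes G :: "('v, 'e) weighted_graph" and W :: "'v set"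
  assumes net: "network G" and W: "finite W" "W \<subseteq> verts G"
begin

abbreviation "proj \<equiv> \<lambda>v. if v \<in> W then Some v else None"

lemma contract_simps [simp]:
  "verts (contract_compl G W) = insert None (Some ` W)"
  "edges (contract_compl G W) = {e \<in> edges G. ends G e \<inter> W \<noteq> {}}"
  "ends (contract_compl G W) e = proj ` ends G e"
  "cond (contract_compl G W) = cond G"
  by (auto simp: contract_compl_def)

abbreviation "tree_of T \<equiv> (contract_compl G W)\<lparr>edges := T\<rparr>"

lemma good_orientation:
  assumes "good_arrows G W f"
  shows "\<exists>par R. rooted_orientation (tree_of (f ` W)) None (\<lambda>x. f (the x)) par R"
proof -
  let ?F = "arrow_map G f"
  have inc: "f u \<in> incident G u" if "u \<in> W" for u using assms that by (auto simp: good_arrows_def)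
  obtain r where r: "\<And>x. x \<notin> W \<Longrightarrow> r x = 0" "\<And>x. x \<in> W \<Longrightarrow> r x = Suc (r (?F x))"
    using acyc_rank[of W ?F] assms by (auto simp: good_arrows_def)
  let ?R = "\<lambda>x. case x of None \<Rightarrow> 0 | Some u \<Rightarrow> r u"
  have "rooted_orientation (tree_of (f ` W)) None (\<lambda>x. f (the x)) (\<lambda>x. proj (?F (the x))) ?R"
  proof
    show "None \<in> verts (tree_of (f ` W))" by simp
    show "edges (tree_of (f ` W)) = (\<lambda>x. f (the x)) ` (verts (tree_of (f ` W)) - {None})" by force
    fix x assume "x \<in> verts (tree_of (f ` W))" "x \<noteq> None"
    then obtain u where u: "x = Some u" "u \<in> W" by auto
    have "ends G (f u) = {u, ?F u}" using ends_other[OF net inc[OF u(2)]] by (simp add: arrow_map_def)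
    then show "ends (tree_of (f ` W)) (f (the x)) = {x, proj (?F (the x))}" using u by simp
    show "proj (?F (the x)) \<in> verts (tree_of (f ` W))" by simp
    show "?R x = Suc (?R (proj (?F (the x))))" using u r by (simp split: option.split)
  qed
  then show ?thesis by blast
qed

lemma good_spanning:
  assumes "good_arrows G W f"
  shows "f ` W \<in> spanning_trees (contract_compl G W)" "inj_on f W"
    "orient_towards (contract_compl G W) (f ` W) None = {(Some u, f u) |u. u \<in> W}"
proof -
  obtain par R where ro: "rooted_orientation (tree_of (f ` W)) None (\<lambda>x. f (the x)) par R"
    using good_orientation[OF assms] by blast
  interpret rooted_orientation "tree_of (f ` W)" None "\<lambda>x. f (the x)" par R by (rule ro)
  have "f ` W \<subseteq> edges (contract_compl G W)"
    using assms by (auto simp: good_arrows_def incident_def)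
  then show "f ` W \<in> spanning_trees (contract_compl G W)" using tree by (simp add: spanning_trees_def)
  show "inj_on f W"
  proof (rule inj_onI)
    fix u w assume uw: "u \<in> W" "w \<in> W" "f u = f w"
    have "Some u = Some w" by (rule inj_onD[OF inj_a]) (use uw in auto)
    then show "u = w" by simp
  qed
  show "orient_towards (contract_compl G W) (f ` W) None = {(Some u, f u) |u. u \<in> W}"
  proof (intro equalityI subsetI)
    fix d assume "d \<in> orient_towards (contract_compl G W) (f ` W) None"
    then obtain x e w p where d: "d = (x, e)" "path (tree_of (f ` W)) x ((e, w) # p) None"
      by (auto simp: orient_towards_def)
    from first_edge[OF d(2)] obtain u where "x = Some u" "u \<in> W" "e = f u" by auto
    then show "d \<in> {(Some u, f u) |u. u \<in> W}" using d by auto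
  next
    fix d assume "d \<in> {(Some u, f u) |u. u \<in> W}"
    then obtain u where u: "d = (Some u, f u)" "u \<in> W" by auto
    then obtain p where "path (tree_of (f ` W)) (Some u) p None" "\<exists>p'. p = (f u, par (Some u)) # p'"
      using path_to_root[of "Some u"] by fastforce
    then show "d \<in> orient_towards (contract_compl G W) (f ` W) None"
      using u by (auto simp: orient_towards_def)
  qed
qed

text \<open>The value \<open>undefined\<close> off W agrees with the default value of the product
  measure of the arrows, so that trees correspond to single points of that measure.\<close>

lemma spanning_good:
  assumes "T \<in> spanning_trees (contract_compl G W)"
  shows "\<exists>f. good_arrows G W f \<and> f ` W = T \<and> (\<forall>u. u \<notin> W \<longrightarrow> f u = undefined)"
proof -
  have T: "T \<subseteq> edges (contract_compl G W)" "tree_graph (tree_of T)"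
    using assms by (auto simp: spanning_trees_def)
  have "\<exists>a par R. rooted_orientation (tree_of T) None a par R"
  proof (rule spanning_tree_orientation[OF T(2)])
    fix e assume "e \<in> edges (tree_of T)"
    then have e: "e \<in> edges G" using T(1) by auto
    then have "card (ends G e) \<in> {1, 2}" using net by (simp add: network_def)
    then have "ends G e \<noteq> {}" by auto
    then obtain x where "x \<in> ends G e" by blast
    then obtain y where xy: "ends G e = {x, y}" using ends_other[OF net, of e x] e by (auto simp: incident_def)
    then have "ends (tree_of T) e = {proj x, proj y}" by simp
    moreover have "card {proj x, proj y} \<in> {1, 2}" by (cases "proj x = proj y") auto
    ultimately show "ends (tree_of T) e \<subseteq> verts (tree_of T) \<and> card (ends (tree_of T) e) \<in> {1, 2}" by auto
  qed simp
  then obtain a par R where ro: "rooted_orientation (tree_of T) None a par R" by blast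
  interpret rooted_orientation "tree_of T" None a par R by (rule ro)
  define f where "f u = (if u \<in> W then a (Some u) else undefined)" for u
  have edgesT: "T = a ` Some ` W" using edges by auto
  have inc: "a (Some u) \<in> incident G u" if "u \<in> W" for u
  proof -
    have "a (Some u) \<in> T" using edgesT that by auto
    moreover have "Some u \<in> ends (tree_of T) (a (Some u))" using ends[of "Some u"] that by simp
    ultimately show ?thesis using T(1) by (auto simp: incident_def split: if_splits)
  qed
  have "acyc W (arrow_map G f)"
  proof (rule acyc_of_rank[where r = "\<lambda>u. R (Some u)"])
    fix u assume u: "u \<in> W" "arrow_map G f u \<in> W"
    have "ends G (a (Some u)) = {u, arrow_map G f u}"
      using ends_other[OF net inc[OF u(1)]] u by (simp add: f_def arrow_map_def)
    then have "{Some u, Some (arrow_map G f u)} = {Some u, par (Some u)}"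
      using ends[of "Some u"] u by simp
    then have "par (Some u) = Some (arrow_map G f u)" by (auto simp: doubleton_eq_iff)
    then show "R (Some (arrow_map G f u)) < R (Some u)" using rank[of "Some u"] u by simp
  qed
  then have "good_arrows G W f" using inc by (auto simp: good_arrows_def f_def)
  moreover have "f ` W = T" unfolding edgesT by (auto simp: f_def image_image)
  ultimately show ?thesis by (auto simp: f_def)
qed

end

section \<open>The random walk on a transitive network\<close>

lemma embed_pmf_pmf [simp]: "embed_pmf (pmf M) = M"
  by (rule type_definition.Rep_inverse[OF td_pmf_embed_pmf])

locale bubble_network =
  fixes G :: "('v, 'e) weighted_graph"
  assumes net: "network G" and trans: "transitive_network G" and bub: "bubble_norm G < \<infinity>"
begin

lemma verts_nonempty: "verts G \<noteq> {}"
  using net by (simp add: network_def connected_graph_def)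

lemma ends_verts: "e \<in> edges G \<Longrightarrow> ends G e \<subseteq> verts G"
  using net by (simp add: network_def)

lemma cond_pos: "e \<in> incident G v \<Longrightarrow> 0 < cond G e"
  using net by (simp add: network_def incident_def)

lemma cond_summable: "v \<in> verts G \<Longrightarrow> cond G summable_on incident G v"
  using net by (simp add: network_def)

text \<open>At a vertex without edges the walk never moves, every return probability is 1 and the
  bubble norm diverges.\<close>

lemma incident_nonempty:
  assumes v: "v \<in> verts G"
  shows "incident G v \<noteq> {}"
proof
  assume "incident G v = {}"
  then have step: "walk_step G v = return_pmf v" by (simp add: walk_step_def)
  have walk: "walk_at G n v = return_pmf v" for n
    by (induction n) (simp_all add: step bind_return_pmf)
  have one: "1 \<le> norm_1_inf G n" for n
  proof -
    have "ennreal (pmf (walk_at G n v) v) \<le> norm_1_inf G n"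
      unfolding norm_1_inf_def by (rule SUP_upper2[OF v], rule SUP_upper[OF v])
    then show ?thesis by (simp add: walk)
  qed
  have "of_nat N \<le> bubble_norm G" for N :: nat
  proof -
    have "(of_nat N :: ennreal) = (\<Sum>n<N. 1)" by simp
    also have "\<dots> \<le> (\<Sum>n<N. of_nat (n + 1) * norm_1_inf G n)"
    proof (rule sum_mono)
      fix n
      have "(1 :: ennreal) * 1 \<le> of_nat (n + 1) * norm_1_inf G n"
        by (rule mult_mono) (use one in auto)
      then show "1 \<le> of_nat (n + 1) * norm_1_inf G n" by simp
    qed
    also have "\<dots> \<le> bubble_norm G" unfolding bubble_norm_def by (rule sum_le_suminf) auto
    finally show ?thesis .
  qed
  moreover obtain N :: nat where "bubble_norm G < of_nat N"
    using ennreal_Ex_less_of_nat bub by (auto simp: top_ennreal_def)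
  ultimately show False by (meson leD)
qed

lemma automorphism_incident:
  assumes "network_automorphism G \<phi> \<psi>" "u \<in> verts G"
  shows "bij_betw \<psi> (incident G u) (incident G (\<phi> u))"
  unfolding bij_betw_def
proof (intro conjI equalityI subsetI)
  note aut = assms(1)[unfolded network_automorphism_def]
  show "inj_on \<psi> (incident G u)"
    using aut by (auto simp: bij_betw_def incident_def intro: inj_on_subset)
  fix e assume "e \<in> \<psi> ` incident G u"
  then show "e \<in> incident G (\<phi> u)" using aut by (auto simp: incident_def bij_betw_def)
next
  note aut = assms(1)[unfolded network_automorphism_def]
  fix e assume e: "e \<in> incident G (\<phi> u)"
  then obtain e' where e': "e = \<psi> e'" "e' \<in> edges G"
    using aut by (metis (no_types, lifting) incident_def bij_betw_def imageE mem_Collect_eq)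
  then obtain w where w: "w \<in> ends G e'" "\<phi> w = \<phi> u" using e aut by (auto simp: incident_def)
  then have "w = u" using aut assms(2) ends_verts[OF e'(2)] by (auto simp: bij_betw_def dest: inj_onD)
  then show "e \<in> \<psi> ` incident G u" using e' w by (auto simp: incident_def)
qed

text \<open>Here transitivity makes the kernel symmetric, and not only reversible with respect to
  the vertex conductances.\<close>

lemma vertex_cond_eq:
  assumes "u \<in> verts G" "v \<in> verts G"
  shows "vertex_cond G u = vertex_cond G v"
proof -
  obtain \<phi> \<psi> where a: "network_automorphism G \<phi> \<psi>" "\<phi> u = v"
    using trans assms unfolding transitive_network_def by blast
  have "vertex_cond G v = (\<Sum>\<^sub>\<infinity>e\<in>incident G u. cond G (\<psi> e))"
    unfolding vertex_cond_def
    using infsum_reindex_bij_betw[OF automorphism_incident[OF a(1) assms(1)], of "cond G"] a(2) by simp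
  also have "\<dots> = vertex_cond G u"
    unfolding vertex_cond_def
    by (rule infsum_cong) (use a(1) in \<open>auto simp: network_automorphism_def incident_def\<close>)
  finally show ?thesis by simp
qed

lemma vertex_cond_pos:
  assumes "v \<in> verts G"
  shows "0 < vertex_cond G v"
proof -
  obtain e where e: "e \<in> incident G v" using incident_nonempty[OF assms] by blast
  have "sum (cond G) {e} \<le> vertex_cond G v"
    unfolding vertex_cond_def
    by (rule finite_sum_le_infsum) (use e cond_summable[OF assms] cond_pos in \<open>auto intro: less_imp_le\<close>)
  then show ?thesis using cond_pos[OF e] by simp
qed

text \<open>A step of the walk before its edge is forgotten. The forest is a set of edges, so
  parallel edges have to be told apart.\<close>

definition edge_step :: "'v \<Rightarrow> 'e pmf" where
  "edge_step u = embed_pmf (\<lambda>e. if e \<in> incident G u then cond G e / vertex_cond G u else 0)"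

lemma pmf_edge_step:
  assumes u: "u \<in> verts G"
  shows "pmf (edge_step u) e = (if e \<in> incident G u then cond G e / vertex_cond G u else 0)"
  unfolding edge_step_def
proof (rule pmf_embed_pmf)
  let ?f = "\<lambda>e. if e \<in> incident G u then cond G e / vertex_cond G u else 0"
  have pos: "0 \<le> ?f e" for e using vertex_cond_pos[OF u] cond_pos[of e u] by (auto intro: less_imp_le)
  then show "0 \<le> ?f e" for e .
  have sm: "(\<lambda>e. cond G e / vertex_cond G u) summable_on incident G u"
    using summable_on_cmult_left[OF cond_summable[OF u], of "inverse (vertex_cond G u)"]
    by (simp add: divide_inverse)
  then have ab: "Infinite_Set_Sum.abs_summable_on (\<lambda>e. cond G e / vertex_cond G u) (incident G u)"
    by (rule abs_summable_equivalent[THEN iffD1, OF summable_on_iff_abs_summable_on_real[THEN iffD1]])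
  have "(\<integral>\<^sup>+e. ennreal (?f e) \<partial>count_space UNIV) =
      (\<integral>\<^sup>+e. ennreal (cond G e / vertex_cond G u) \<partial>count_space (incident G u))"
    by (subst nn_integral_count_space_indicator) (auto intro!: nn_integral_cong simp: indicator_def)
  also have "\<dots> = ennreal (infsetsum (\<lambda>e. cond G e / vertex_cond G u) (incident G u))"
    by (rule nn_integral_conv_infsetsum[OF ab])
       (use vertex_cond_pos[OF u] cond_pos in \<open>auto intro: less_imp_le\<close>)
  also have "infsetsum (\<lambda>e. cond G e / vertex_cond G u) (incident G u) =
      (\<Sum>\<^sub>\<infinity>e\<in>incident G u. cond G e * inverse (vertex_cond G u))"
    using infsetsum_infsum[OF ab] by (simp only: divide_inverse)
  also have "\<dots> = vertex_cond G u * inverse (vertex_cond G u)"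
    unfolding vertex_cond_def by (rule infsum_cmult_left) (use cond_summable[OF u] in simp)
  also have "\<dots> = 1" using vertex_cond_pos[OF u] by simp
  finally show "(\<integral>\<^sup>+e. ennreal (?f e) \<partial>count_space UNIV) = 1" by simp
qed

lemma set_edge_step: "u \<in> verts G \<Longrightarrow> set_pmf (edge_step u) = incident G u"
  using vertex_cond_pos[of u] cond_pos[of _ u] by (force simp: set_pmf_eq pmf_edge_step)

lemma walk_step_eq: "u \<in> verts G \<Longrightarrow> walk_step G u = map_pmf (other_end G u) (edge_step u)"
  using incident_nonempty by (simp add: walk_step_def edge_step_def)

lemma pmf_walk_step_edges:
  assumes u: "u \<in> verts G"
  shows "pmf (walk_step G u) v = measure_pmf.prob (edge_step u) {e \<in> edges G. ends G e = {u, v}}"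
proof -
  have "pmf (walk_step G u) v = measure_pmf.prob (edge_step u) {e. other_end G u e = v}"
    by (simp add: walk_step_eq[OF u] pmf_map vimage_def)
  also have "\<dots> = measure_pmf.prob (edge_step u) {e \<in> edges G. ends G e = {u, v}}"
  proof (rule measure_pmf.finite_measure_eq_AE)
    show "AE e in measure_pmf (edge_step u). e \<in> {e. other_end G u e = v} \<longleftrightarrow>
        e \<in> {e \<in> edges G. ends G e = {u, v}}"
      unfolding AE_measure_pmf_iff set_edge_step[OF u]
      using ends_other[OF net] other_end_eq by (auto simp: incident_def)
  qed auto
  finally show ?thesis .
qed

lemma pmf_walk_step:
  assumes u: "u \<in> verts G"
  shows "pmf (walk_step G u) v = (\<Sum>\<^sub>\<infinity>e\<in>{e \<in> edges G. ends G e = {u, v}}. cond G e) / vertex_cond G u"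
proof -
  let ?E = "{e \<in> edges G. ends G e = {u, v}}"
  have E: "?E \<subseteq> incident G u" by (auto simp: incident_def)
  have "pmf (walk_step G u) v = (\<Sum>\<^sub>\<infinity>e\<in>?E. pmf (edge_step u) e)"
    by (simp add: pmf_walk_step_edges[OF u] measure_pmf_conv_infsetsum infsetsum_infsum[OF pmf_abs_summable])
  also have "\<dots> = (\<Sum>\<^sub>\<infinity>e\<in>?E. cond G e * inverse (vertex_cond G u))"
    by (rule infsum_cong) (use E in \<open>auto simp: pmf_edge_step[OF u] divide_inverse\<close>)
  also have "\<dots> = (\<Sum>\<^sub>\<infinity>e\<in>?E. cond G e) * inverse (vertex_cond G u)"
    by (rule infsum_cmult_left) (use summable_on_subset_banach[OF cond_summable[OF u] E] in simp)
  finally show ?thesis by (simp add: divide_inverse)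
qed

lemma walk_step_sym:
  "u \<in> verts G \<Longrightarrow> v \<in> verts G \<Longrightarrow> pmf (walk_step G u) v = pmf (walk_step G v) u"
  by (simp add: pmf_walk_step vertex_cond_eq[of u v] insert_commute)

lemma walk_step_automorphism:
  assumes a: "network_automorphism G \<phi> \<psi>" and uv: "u \<in> verts G" "v \<in> verts G"
  shows "pmf (walk_step G (\<phi> u)) (\<phi> v) = pmf (walk_step G u) v"
proof -
  note aut = a[unfolded network_automorphism_def]
  let ?E = "\<lambda>u v. {e \<in> edges G. ends G e = {u, v}}"
  have fu: "\<phi> u \<in> verts G" using aut uv by (auto simp: bij_betw_def)
  have bij: "bij_betw \<psi> (?E u v) (?E (\<phi> u) (\<phi> v))"
    unfolding bij_betw_def
  proof (intro conjI equalityI subsetI)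
    show "inj_on \<psi> (?E u v)" using aut by (auto simp: bij_betw_def intro: inj_on_subset)
    show "e \<in> ?E (\<phi> u) (\<phi> v)" if "e \<in> \<psi> ` ?E u v" for e
      using that aut by (auto simp: bij_betw_def)
    show "e \<in> \<psi> ` ?E u v" if e: "e \<in> ?E (\<phi> u) (\<phi> v)" for e
    proof -
      obtain e' where e': "e = \<psi> e'" "e' \<in> edges G"
        using e aut by (metis (no_types, lifting) bij_betw_def imageE mem_Collect_eq)
      then have "\<phi> ` ends G e' = \<phi> ` {u, v}" using e aut by auto
      moreover have "inj_on \<phi> (verts G)" using aut by (simp add: bij_betw_def)
      ultimately have "ends G e' = {u, v}"
        using inj_on_image_eq_iff[of \<phi> "verts G" "ends G e'" "{u, v}"] uv ends_verts[OF e'(2)] by auto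
      then show ?thesis using e' by auto
    qed
  qed
  have "(\<Sum>\<^sub>\<infinity>e\<in>?E (\<phi> u) (\<phi> v). cond G e) = (\<Sum>\<^sub>\<infinity>e\<in>?E u v. cond G (\<psi> e))"
    by (rule infsum_reindex_bij_betw[OF bij, symmetric])
  also have "\<dots> = (\<Sum>\<^sub>\<infinity>e\<in>?E u v. cond G e)" by (rule infsum_cong) (use aut in blast)
  finally have eq: "(\<Sum>\<^sub>\<infinity>e\<in>?E (\<phi> u) (\<phi> v). cond G e) = (\<Sum>\<^sub>\<infinity>e\<in>?E u v. cond G e)" .
  show ?thesis
    unfolding pmf_walk_step[OF fu] pmf_walk_step[OF uv(1)] vertex_cond_eq[OF fu uv(1)] eq by (rule refl)
qed

lemma kpow_le_walk_at: "finite S \<Longrightarrow> kpow (walk_step G) S n x y \<le> pmf (walk_at G n x) y"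
proof (induction n arbitrary: y)
  case 0
  then show ?case by simp
next
  case (Suc n)
  let ?M = "walk_at G n x" and ?g = "\<lambda>w. pmf (walk_step G w) y"
  have "kpow (walk_step G) S (Suc n) x y \<le> (\<Sum>w\<in>S. indicator S w * ?g w * pmf ?M w)"
    using Suc by (auto simp: mult.commute intro!: sum_mono mult_left_mono)
  also have "\<dots> = measure_pmf.expectation ?M (\<lambda>w. indicator S w * ?g w)"
    by (subst integral_measure_pmf_real[OF Suc.prems]) (auto simp: indicator_def split: if_splits)
  also have "\<dots> \<le> measure_pmf.expectation ?M ?g"
    by (rule expectation_mono_bounded[where K = 1 and L = 1]) (auto simp: indicator_def pmf_le_1)
  also have "\<dots> = pmf (walk_at G (Suc n) x) y" by (simp add: pmf_bind)
  finally show ?case .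
qed

definition return_bound :: "nat \<Rightarrow> real" where
  "return_bound n = enn2real (norm_1_inf G n)"

lemma norm_le_1: "norm_1_inf G n \<le> 1"
  unfolding norm_1_inf_def by (intro SUP_least) (simp add: pmf_le_1)

lemma norm_eq: "norm_1_inf G n = ennreal (return_bound n)"
  unfolding return_bound_def
  using norm_le_1[of n] by (metis ennreal_enn2real ennreal_one_less_top le_less_trans)

lemma walk_at_le:
  assumes "x \<in> verts G" "y \<in> verts G"
  shows "pmf (walk_at G n x) y \<le> return_bound n"
proof -
  have "ennreal (pmf (walk_at G n x) y) \<le> norm_1_inf G n"
    unfolding norm_1_inf_def by (rule SUP_upper2[OF assms(1)], rule SUP_upper[OF assms(2)])
  then show ?thesis unfolding norm_eq by (simp add: return_bound_def)
qed

lemma summable_return_bound: "summable (\<lambda>n. real (n + 1) * return_bound n)"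
proof (rule summable_suminf_not_top)
  show "0 \<le> real (n + 1) * return_bound n" for n by (simp add: return_bound_def)
  have "of_nat (n + 1) * norm_1_inf G n = ennreal (real (n + 1) * return_bound n)" for n
    unfolding norm_eq by (simp add: ennreal_mult ennreal_of_nat_eq_real_of_nat return_bound_def)
  then show "(\<Sum>n. ennreal (real (n + 1) * return_bound n)) \<noteq> top"
    using bub by (simp add: bubble_norm_def)
qed

sublocale transitive_chain "verts G" "walk_step G" return_bound
proof
  fix x y assume x: "x \<in> verts G"
  show "set_pmf (walk_step G x) \<subseteq> verts G"
    using ends_other[OF net] ends_verts
    by (fastforce simp: walk_step_eq[OF x] set_edge_step[OF x] incident_def)
  assume y: "y \<in> verts G"
  show "pmf (walk_step G x) y = pmf (walk_step G y) x" by (rule walk_step_sym[OF x y])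
  obtain \<phi> \<psi> where a: "network_automorphism G \<phi> \<psi>" "\<phi> x = y"
    using trans x y unfolding transitive_network_def by blast
  show "\<exists>\<phi>. bij_betw \<phi> (verts G) (verts G) \<and> \<phi> x = y \<and>
      (\<forall>u\<in>verts G. \<forall>w\<in>verts G. pmf (walk_step G (\<phi> u)) (\<phi> w) = pmf (walk_step G u) w)"
  proof (intro exI[of _ \<phi>] conjI ballI)
    show "bij_betw \<phi> (verts G) (verts G)" using a(1) by (simp add: network_automorphism_def)
    show "\<phi> x = y" by (rule a(2))
    fix u w assume "u \<in> verts G" "w \<in> verts G"
    then show "pmf (walk_step G (\<phi> u)) (\<phi> w) = pmf (walk_step G u) w"
      by (rule walk_step_automorphism[OF a(1)])
  qed
next
  fix S n x y assume S: "finite S" "S \<subseteq> verts G" and xy: "x \<in> S" "y \<in> S"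
  show "kpow (walk_step G) S n x y \<le> return_bound n"
    using order_trans[OF kpow_le_walk_at[OF S(1)] walk_at_le[of x y n]] S xy by blast
qed (rule summable_return_bound verts_nonempty)+

section \<open>Conditioned edge arrows as the uniform spanning tree\<close>

definition edge_arrows :: "'v set \<Rightarrow> ('v \<Rightarrow> 'e) pmf" where
  "edge_arrows W = Pi_pmf W undefined edge_step"

definition wired_edges :: "'v set \<Rightarrow> ('v \<Rightarrow> 'e) pmf" where
  "wired_edges W = cond_pmf (edge_arrows W) {f. acyc W (arrow_map G f)}"

lemma prob_edge_arrows:
  assumes W: "dom W" and E: "\<And>f g. (\<And>x. x \<in> W \<Longrightarrow> f x = g x) \<Longrightarrow> E f \<longleftrightarrow> E g"
  shows "measure_pmf.prob (edge_arrows W) {f. E (arrow_map G f)} = measure_pmf.prob (arrows W) {f. E f}"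
proof -
  have "arrows W = Pi_pmf W undefined (\<lambda>x. map_pmf (other_end G x) (edge_step x))"
    by (rule Pi_pmf_cong) (use W in \<open>auto simp: walk_step_eq domD\<close>)
  also have "\<dots> = map_pmf (\<lambda>h x. if x \<in> W then other_end G x (h x) else undefined) (edge_arrows W)"
    unfolding edge_arrows_def by (rule Pi_pmf_map_dep) (use W in \<open>simp add: domD\<close>)
  finally have "measure_pmf.prob (arrows W) {f. E f} =
      measure_pmf.prob (edge_arrows W) {h. E (\<lambda>x. if x \<in> W then other_end G x (h x) else undefined)}"
    by (simp add: vimage_def)
  also have "\<dots> = measure_pmf.prob (edge_arrows W) {f. E (arrow_map G f)}"
    by (intro arg_cong2[where f = measure_pmf.prob] refl Collect_cong E) (simp add: arrow_map_def)
  finally show ?thesis by simp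
qed

lemma prob_edge_arrows_acyc:
  "dom W \<Longrightarrow> measure_pmf.prob (edge_arrows W) {f. acyc W (arrow_map G f)} = Z W"
  unfolding Z_def by (rule prob_edge_arrows) (auto intro: acyc_cong[THEN iffD1])

lemma edge_acyc_nonempty: "dom W \<Longrightarrow> set_pmf (edge_arrows W) \<inter> {f. acyc W (arrow_map G f)} \<noteq> {}"
  using Z_pos[of W] prob_edge_arrows_acyc[of W] by (metis measure_pmf_zero_iff order_less_irrefl)

lemma prob_wired_edges:
  assumes "dom W"
  shows "measure_pmf.prob (wired_edges W) {f. E f} =
    measure_pmf.prob (edge_arrows W) {f. acyc W (arrow_map G f) \<and> E f} / Z W"
proof -
  have "measure (uniform_measure (measure_pmf (edge_arrows W)) {f. acyc W (arrow_map G f)}) {f. E f} =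
      measure_pmf.prob (edge_arrows W) ({f. acyc W (arrow_map G f)} \<inter> {f. E f}) /
      measure_pmf.prob (edge_arrows W) {f. acyc W (arrow_map G f)}"
    by (rule measure_uniform_measure)
       (use Z_pos[OF assms] in \<open>auto simp: prob_edge_arrows_acyc[OF assms] measure_pmf.emeasure_eq_measure\<close>)
  then show ?thesis
    unfolding wired_edges_def cond_pmf.rep_eq[OF edge_acyc_nonempty[OF assms]]
    by (simp add: prob_edge_arrows_acyc[OF assms] Collect_conj_eq)
qed

lemma prob_wired_edges_map:
  assumes W: "dom W" and E: "\<And>f g. (\<And>x. x \<in> W \<Longrightarrow> f x = g x) \<Longrightarrow> E f \<longleftrightarrow> E g"
  shows "measure_pmf.prob (wired_edges W) {f. E (arrow_map G f)} = measure_pmf.prob (wired W) {f. E f}"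
proof -
  have "measure_pmf.prob (edge_arrows W) {f. acyc W (arrow_map G f) \<and> E (arrow_map G f)} =
      measure_pmf.prob (arrows W) {f. acyc W f \<and> E f}"
  proof (rule prob_edge_arrows[OF W, where E = "\<lambda>f. acyc W f \<and> E f"])
    fix f g :: "'v \<Rightarrow> 'v" assume eq: "\<And>x. x \<in> W \<Longrightarrow> f x = g x"
    have "acyc W f \<longleftrightarrow> acyc W g" by (rule acyc_cong) (rule eq)
    moreover have "E f \<longleftrightarrow> E g" by (rule E) (rule eq)
    ultimately show "acyc W f \<and> E f \<longleftrightarrow> acyc W g \<and> E g" by simp
  qed
  then show ?thesis by (simp add: prob_wired_edges[OF W] prob_wired[OF W])
qed

lemma set_wired_edges:
  assumes W: "dom W" and f: "f \<in> set_pmf (wired_edges W)"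
  shows "good_arrows G W f" "u \<notin> W \<Longrightarrow> f u = undefined"
proof -
  have f': "f \<in> set_pmf (edge_arrows W)" "acyc W (arrow_map G f)"
    using f unfolding wired_edges_def by (subst (asm) set_cond_pmf[OF edge_acyc_nonempty[OF W]]; auto)+
  then have "f \<in> PiE_dflt W undefined (set_pmf \<circ> edge_step)"
    using set_Pi_pmf[of W undefined edge_step] W by (simp add: edge_arrows_def domD)
  then show "good_arrows G W f" "u \<notin> W \<Longrightarrow> f u = undefined"
    using f'(2) W set_edge_step by (auto simp: good_arrows_def PiE_dflt_def domD)
qed

text \<open>The denominator is the same for all f, so the law is proportional to the weight of the
  tree formed by the arrows.\<close>

lemma pmf_wired_edges:
  assumes W: "dom W" and f: "good_arrows G W f" "\<And>u. u \<notin> W \<Longrightarrow> f u = undefined"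
  shows "pmf (wired_edges W) f = (\<Prod>u\<in>W. cond G (f u)) / ((\<Prod>u\<in>W. vertex_cond G u) * Z W)"
proof -
  have "pmf (wired_edges W) f = pmf (edge_arrows W) f / Z W"
    unfolding wired_edges_def
    using f W by (subst pmf_cond[OF edge_acyc_nonempty[OF W]])
      (auto simp: good_arrows_def prob_edge_arrows_acyc)
  also have "pmf (edge_arrows W) f = (\<Prod>u\<in>W. pmf (edge_step u) (f u))"
    unfolding edge_arrows_def by (rule pmf_Pi') (use W f in \<open>auto simp: domD\<close>)
  also have "\<dots> = (\<Prod>u\<in>W. cond G (f u) / vertex_cond G u)"
    by (rule prod.cong) (use f W in \<open>auto simp: good_arrows_def pmf_edge_step domD\<close>)
  finally show ?thesis by (simp add: prod_dividef)
qed

lemma good_arrows_inj: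
  assumes W: "dom W" and fg: "good_arrows G W f" "good_arrows G W g" "f ` W = g ` W" "u \<in> W"
  shows "f u = g u"
proof -
  have "{(Some u, f u) |u. u \<in> W} = {(Some u, g u) |u. u \<in> W}"
    using good_spanning(3)[OF net domD(1,2)[OF W] fg(1)] good_spanning(3)[OF net domD(1,2)[OF W] fg(2)]
      fg(3) by simp
  then have "(Some u, f u) \<in> {(Some u, g u) |u. u \<in> W}" using fg(4) by blast
  then show ?thesis by auto
qed

text \<open>Arrows are determined by their tree, and both laws are proportional to the tree weight
  on the same set of trees. The constant of proportionality follows from the total mass being
  one.\<close>

lemma ust_eq:
  assumes W: "dom W"
  shows "ust (contract_compl G W) = map_pmf (\<lambda>f. f ` W) (wired_edges W)" (is "_ = ?M")
proof -
  define \<kappa> where "\<kappa> = 1 / ((\<Prod>u\<in>W. vertex_cond G u) * Z W)"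
  let ?G = "contract_compl G W"
  have net': "network G" "finite W" "W \<subseteq> verts G" using net W by (auto simp: domD)
  have sub: "set_pmf ?M \<subseteq> spanning_trees ?G"
    using set_wired_edges[OF W] good_spanning(1)[OF net'] by auto
  have pm: "pmf ?M T = tree_weight ?G T * \<kappa>" if T: "T \<in> spanning_trees ?G" for T
  proof -
    obtain g where g: "good_arrows G W g" "g ` W = T" "\<And>u. u \<notin> W \<Longrightarrow> g u = undefined"
      using spanning_good[OF net' T] by blast
    have "pmf ?M T = measure_pmf.prob (wired_edges W) {f. f ` W = T}"
      by (simp add: pmf_map vimage_def)
    also have "\<dots> = measure_pmf.prob (wired_edges W) {g}"
    proof (rule measure_pmf.finite_measure_eq_AE)
      have "f = g" if f: "f \<in> set_pmf (wired_edges W)" "f ` W = T" for f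
      proof
        fix u show "f u = g u"
        proof (cases "u \<in> W")
          case True
          show ?thesis
            by (rule good_arrows_inj[OF W set_wired_edges(1)[OF W f(1)] g(1) _ True]) (use f g in simp)
        next
          case False
          then show ?thesis using g set_wired_edges(2)[OF W f(1)] by simp
        qed
      qed
      then show "AE f in measure_pmf (wired_edges W). f \<in> {f. f ` W = T} \<longleftrightarrow> f \<in> {g}"
        using g by (auto simp: AE_measure_pmf_iff)
    qed auto
    also have "\<dots> = (\<Prod>u\<in>W. cond G (g u)) * \<kappa>"
      by (simp add: measure_pmf_single pmf_wired_edges[OF W g(1,3)] \<kappa>_def)
    also have "(\<Prod>u\<in>W. cond G (g u)) = tree_weight ?G T"
      unfolding tree_weight_def g(2)[symmetric]
      by (subst prod.reindex[OF good_spanning(2)[OF net' g(1)]]) (simp add: contract_compl_def)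
    finally show ?thesis .
  qed
  have "\<kappa> \<noteq> 0"
  proof -
    have "(\<Prod>u\<in>W. vertex_cond G u) > 0" by (rule prod_pos) (use W vertex_cond_pos in \<open>auto simp: domD\<close>)
    then show ?thesis using Z_pos[OF W] by (simp add: \<kappa>_def)
  qed
  have "1 = infsum (pmf ?M) (spanning_trees ?G)"
    using infsetsum_pmf_eq_1[OF sub] by (simp add: infsetsum_infsum[OF pmf_abs_summable])
  also have "\<dots> = (\<Sum>\<^sub>\<infinity>T\<in>spanning_trees ?G. tree_weight ?G T * \<kappa>)"
    by (rule infsum_cong) (rule pm)
  also have "\<dots> = (\<Sum>\<^sub>\<infinity>T\<in>spanning_trees ?G. tree_weight ?G T) * \<kappa>"
    by (rule infsum_cmult_left')
  finally have "\<kappa> = 1 / (\<Sum>\<^sub>\<infinity>T\<in>spanning_trees ?G. tree_weight ?G T)"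
    using \<open>\<kappa> \<noteq> 0\<close> by (metis mult_zero_left nonzero_eq_divide_eq mult.commute zero_neq_one)
  then have eq: "pmf ?M = (\<lambda>T. if T \<in> spanning_trees ?G
     then tree_weight ?G T / (\<Sum>\<^sub>\<infinity>T'\<in>spanning_trees ?G. tree_weight ?G T') else 0)"
    using pm sub by (auto simp: fun_eq_iff pmf_eq_0_set_pmf)
  show ?thesis unfolding ust_def eq[symmetric] by simp
qed

definition config :: "'v set \<Rightarrow> ('v \<Rightarrow> 'e) \<Rightarrow> 'v \<times> 'e \<Rightarrow> bool" where
  "config W f = (\<lambda>(u, e)\<in>oriented_edges G. u \<in> W \<and> e = f u)"

lemma wired_tree_law_integral:
  fixes F :: "('v \<times> 'e \<Rightarrow> bool) \<Rightarrow> real"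
  assumes W: "dom W" and F: "F \<in> borel_measurable (config_space G)"
  shows "(\<integral>\<omega>. F \<omega> \<partial>wired_tree_law G W) = measure_pmf.expectation (wired_edges W) (\<lambda>f. F (config W f))"
proof -
  let ?h = "\<lambda>T. \<lambda>(u, e)\<in>oriented_edges G. (Some u, e) \<in> orient_towards (contract_compl G W) T None"
  have net': "network G" "finite W" "W \<subseteq> verts G" using net W by (auto simp: domD)
  have h: "?h \<in> measure_pmf (ust (contract_compl G W)) \<rightarrow>\<^sub>M config_space G"
    by (auto simp: config_space_def space_PiM)
  have "(\<integral>\<omega>. F \<omega> \<partial>wired_tree_law G W) = measure_pmf.expectation (ust (contract_compl G W)) (\<lambda>T. F (?h T))"
    unfolding wired_tree_law_def by (rule integral_distr[OF h F])
  also have "\<dots> = measure_pmf.expectation (wired_edges W) (\<lambda>f. F (?h (f ` W)))"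
    by (simp add: ust_eq[OF W])
  also have "\<dots> = measure_pmf.expectation (wired_edges W) (\<lambda>f. F (config W f))"
  proof (rule integral_cong_AE)
    have "?h (f ` W) = config W f" if "f \<in> set_pmf (wired_edges W)" for f
      unfolding config_def
      by (rule restrict_ext)
         (auto simp: good_spanning(3)[OF net' set_wired_edges(1)[OF W that]])
    then show "AE f in measure_pmf (wired_edges W). F (?h (f ` W)) = F (config W f)"
      by (simp add: AE_measure_pmf_iff)
  qed auto
  finally show ?thesis .
qed

end

section \<open>Finitary properties of sets of edges\<close>

text \<open>Increasing properties that are witnessed by finitely many elements: the open upper sets of the
  space of configurations.\<close>

definition finitary :: "('a set \<Rightarrow> bool) \<Rightarrow> bool" where
  "finitary Q \<longleftrightarrow> (\<forall>F. Q F \<longrightarrow> (\<exists>J. finite J \<and> J \<subseteq> F \<and> (\<forall>F'. J \<subseteq> F' \<longrightarrow> Q F')))"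

lemma finitary_witness:
  "finitary Q \<Longrightarrow> Q F \<Longrightarrow> \<exists>J. finite J \<and> J \<subseteq> F \<and> (\<forall>F'. J \<subseteq> F' \<longrightarrow> Q F')"
  by (simp add: finitary_def)

lemma finitary_mono: "finitary Q \<Longrightarrow> Q F \<Longrightarrow> F \<subseteq> F' \<Longrightarrow> Q F'"
  unfolding finitary_def by (meson order_trans)

lemma finitary_const: "finitary (\<lambda>_. c)"
  unfolding finitary_def by (meson empty_subsetI finite.emptyI)

lemma finitary_mem: "finitary (\<lambda>F. d \<in> F)"
  unfolding finitary_def by (metis empty_subsetI finite.emptyI finite_insert insert_subset subset_iff)

lemma finitary_conj:
  assumes "finitary P" "finitary Q"
  shows "finitary (\<lambda>F. P F \<and> Q F)"
  unfolding finitary_def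
proof (intro allI impI)
  fix F assume PQ: "P F \<and> Q F"
  obtain J where J: "finite J" "J \<subseteq> F" "\<And>F'. J \<subseteq> F' \<Longrightarrow> P F'"
    using assms(1) PQ unfolding finitary_def by meson
  obtain K where K: "finite K" "K \<subseteq> F" "\<And>F'. K \<subseteq> F' \<Longrightarrow> Q F'"
    using assms(2) PQ unfolding finitary_def by meson
  show "\<exists>J. finite J \<and> J \<subseteq> F \<and> (\<forall>F'. J \<subseteq> F' \<longrightarrow> P F' \<and> Q F')"
    by (rule exI[of _ "J \<union> K"]) (use J K in auto)
qed

lemma finitary_ex: "(\<And>i. finitary (Q i)) \<Longrightarrow> finitary (\<lambda>F. \<exists>i. Q i F)"
  unfolding finitary_def by meson

lemma finitary_ball:
  assumes "finite X" "\<And>i. i \<in> X \<Longrightarrow> finitary (Q i)"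
  shows "finitary (\<lambda>F. \<forall>i\<in>X. Q i F)"
  using assms
proof (induction X rule: finite_induct)
  case empty
  then show ?case using finitary_const[of True] by simp
next
  case (insert i X)
  then show ?case using finitary_conj[of "Q i" "\<lambda>F. \<forall>i\<in>X. Q i F"] by simp
qed

lemma finitary_imp: "(c \<Longrightarrow> finitary Q) \<Longrightarrow> finitary (\<lambda>F. c \<and> Q F)"
  using finitary_const[of False] by (cases c) auto

section \<open>Directed paths and the past\<close>

fun flow_path :: "('v, 'e, 'x) multigraph_scheme \<Rightarrow> ('v \<times> 'e) set \<Rightarrow> 'v list \<Rightarrow> bool" where
  "flow_path G F (a # b # r) \<longleftrightarrow> (\<exists>e. (b, e) \<in> F \<and> ends G e = {b, a}) \<and> flow_path G F (b # r)"
| "flow_path G F _ \<longleftrightarrow> True"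

lemma finitary_flow_path: "finitary (\<lambda>F. flow_path G F \<gamma>)"
proof (induction \<gamma> rule: induct_list012)
  case (3 a b r)
  have "finitary (\<lambda>F. (b, e) \<in> F \<and> ends G e = {b, a})" for e
    by (rule finitary_conj[OF finitary_mem finitary_const])
  then show ?case using 3(2) by (simp add: finitary_conj finitary_ex)
qed (simp_all add: finitary_const)

lemma flow_path_snoc:
  "\<gamma> \<noteq> [] \<Longrightarrow> flow_path G F (\<gamma> @ [x]) \<longleftrightarrow>
    flow_path G F \<gamma> \<and> (\<exists>e. (x, e) \<in> F \<and> ends G e = {x, last \<gamma>})"
  by (induction G F \<gamma> rule: flow_path.induct) auto

lemma flow_path_prefix: "flow_path G F (xs @ ys) \<Longrightarrow> flow_path G F xs"
proof (induction xs rule: induct_list012)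
  case (3 a b r)
  then show ?case by simp
qed auto

lemma flow_path_flows_to:
  "flow_path G F \<gamma> \<Longrightarrow> x \<in> set \<gamma> \<Longrightarrow> flows_to G F x (hd \<gamma>)"
proof (induction \<gamma> rule: induct_list012)
  case (3 a b r)
  have ba: "flows_to G F b a" using 3 unfolding flows_to_def by auto
  show ?case
  proof (cases "x \<in> set (b # r)")
    case True
    then have "flows_to G F x b" using 3 by auto
    then show ?thesis using ba unfolding flows_to_def by simp
  next
    case False
    then show ?thesis using 3 by (simp add: flows_to_def)
  qed
qed (auto simp: flows_to_def)

lemma flows_to_path:
  assumes "flows_to G F x v"
  shows "\<exists>\<gamma>. flow_path G F \<gamma> \<and> \<gamma> \<noteq> [] \<and> hd \<gamma> = v \<and> last \<gamma> = x \<and> distinct \<gamma>"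
  using assms unfolding flows_to_def
proof (induction rule: converse_rtranclp_induct)
  case base
  show ?case by (rule exI[of _ "[v]"]) simp
next
  case (step x y)
  then obtain \<gamma> where \<gamma>: "flow_path G F \<gamma>" "\<gamma> \<noteq> []" "hd \<gamma> = v" "last \<gamma> = y" "distinct \<gamma>" by blast
  show ?case
  proof (cases "x \<in> set \<gamma>")
    case True
    then obtain xs ys where s: "\<gamma> = xs @ x # ys" by (meson split_list)
    then have "flow_path G F (xs @ [x])" using \<gamma>(1) flow_path_prefix[of G F "xs @ [x]" ys] by simp
    then show ?thesis using \<gamma> s by (intro exI[of _ "xs @ [x]"]) (auto simp: hd_append)
  next
    case False
    then show ?thesis
      using \<gamma> step(1) by (intro exI[of _ "\<gamma> @ [x]"]) (auto simp: flow_path_snoc)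
  qed
qed

lemma flows_to_iff:
  "flows_to G F x v \<longleftrightarrow> (\<exists>\<gamma>. flow_path G F \<gamma> \<and> \<gamma> \<noteq> [] \<and> hd \<gamma> = v \<and> last \<gamma> = x \<and> distinct \<gamma>)"
  using flows_to_path flow_path_flows_to by (metis last_in_set)

lemma finitary_flows_to: "finitary (\<lambda>F. flows_to G F x v)"
  unfolding flows_to_iff
  by (intro finitary_ex finitary_conj finitary_const finitary_flow_path)

lemma past_simps [simp]:
  "verts (past G F v) = {u. flows_to G F u v}"
  "edges (past G F v) = {e \<in> snd ` F. \<forall>u\<in>ends G e. flows_to G F u v}"
  "ends (past G F v) = ends G"
  by (auto simp: past_def Let_def)

text \<open>A fixed walk uses finitely many edges, but an edge belongs to the past only if all of
  its ends flow to v; finiteness of the sets of ends keeps this condition finitary.\<close>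

lemma finitary_walk_past:
  fixes G :: "('v, 'e, 'x) multigraph_scheme"
  assumes "\<And>e. e \<in> fst ` set p \<Longrightarrow> finite (ends G e)"
  shows "finitary (\<lambda>F. walk (past G F v) x p y)"
  using assms
proof (induction p arbitrary: x)
  case Nil
  show ?case by (simp add: finitary_const)
next
  case (Cons ez p)
  obtain e z where ez: "ez = (e, z)" by (cases ez)
  have "(\<lambda>F :: ('v \<times> 'e) set. e \<in> snd ` F) = (\<lambda>F. \<exists>u. (u, e) \<in> F)" by (force simp: fun_eq_iff)
  moreover have "finitary (\<lambda>F :: ('v \<times> 'e) set. \<exists>u. (u, e) \<in> F)" by (intro finitary_ex finitary_mem)
  ultimately have "finitary (\<lambda>F :: ('v \<times> 'e) set. e \<in> snd ` F)" by (simp only:)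
  moreover have "finitary (\<lambda>F. \<forall>u\<in>ends G e. flows_to G F u v)"
    by (intro finitary_ball finitary_flows_to Cons.prems) (simp add: ez)
  moreover have "finitary (\<lambda>F. walk (past G F v) z p y)" by (rule Cons.IH) (use Cons.prems in auto)
  ultimately show ?case by (simp add: ez finitary_conj finitary_const)
qed

lemma flow_path_walk:
  "flow_path G F \<gamma> \<Longrightarrow> \<gamma> \<noteq> [] \<Longrightarrow> hd \<gamma> = w \<Longrightarrow> flows_to G F w v \<Longrightarrow>
    \<exists>p. walk (past G F v) (last \<gamma>) p w \<and> length p = length \<gamma> - 1"
proof (induction \<gamma> arbitrary: w rule: induct_list012)
  case (3 a b r)
  obtain e where e: "(b, e) \<in> F" "ends G e = {b, a}" using 3(3) by auto
  have "flows_to G F b a" using e unfolding flows_to_def by auto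
  then have b: "flows_to G F b v" using 3(5,6) unfolding flows_to_def by auto
  then obtain p where p: "walk (past G F v) (last (b # r)) p b" "length p = length (b # r) - 1"
    using 3(2)[of b] 3(3) by auto
  have "walk (past G F v) b [(e, a)] a" using e b 3(5,6) by force
  then have "walk (past G F v) (last (b # r)) (p @ [(e, a)]) a" using walk_append[OF p(1)] by blast
  then show ?case using p 3(5) by (intro exI[of _ "p @ [(e, a)]"]) simp
qed auto

text \<open>Every vertex of the past has a directed path to v with at most n vertices, hence n - 1
  edges, and two vertices are joined through v.\<close>

lemma diam_past_le:
  assumes "\<And>\<gamma>. flow_path G F \<gamma> \<Longrightarrow> distinct \<gamma> \<Longrightarrow> \<gamma> \<noteq> [] \<Longrightarrow> hd \<gamma> = v \<Longrightarrow> length \<gamma> \<le> n"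
  shows "graph_diam (past G F v) \<le> enat (2 * (n - 1))"
  unfolding graph_diam_def
proof (intro SUP_least)
  have to_v: "\<exists>p. walk (past G F v) x p v \<and> length p \<le> n - 1" if x: "flows_to G F x v" for x
  proof -
    obtain \<gamma> where \<gamma>: "flow_path G F \<gamma>" "\<gamma> \<noteq> []" "hd \<gamma> = v" "last \<gamma> = x" "distinct \<gamma>"
      using flows_to_path[OF x] by blast
    have "flows_to G F v v" by (simp add: flows_to_def)
    then obtain p where "walk (past G F v) x p v" "length p = length \<gamma> - 1"
      using flow_path_walk[OF \<gamma>(1-3)] \<gamma>(4) by blast
    then show ?thesis using assms[OF \<gamma>(1,5,2,3)] by auto
  qed
  fix x y assume "x \<in> verts (past G F v)" "y \<in> verts (past G F v)"
  then have xy: "flows_to G F x v" "flows_to G F y v" by auto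
  obtain p where p: "walk (past G F v) x p v" "length p \<le> n - 1" using to_v[OF xy(1)] by blast
  obtain q where q: "walk (past G F v) y q v" "length q \<le> n - 1" using to_v[OF xy(2)] by blast
  obtain q' where q': "walk (past G F v) v q' y" "length q' = length q" using walk_rev[OF q(1)] by blast
  have "graph_dist (past G F v) x y \<le> enat (length (p @ q'))"
    unfolding graph_dist_def by (rule INF_lower) (use walk_append[OF p(1) q'(1)] in simp)
  also have "\<dots> \<le> enat (2 * (n - 1))" using p q q' by simp
  finally show "graph_dist (past G F v) x y \<le> enat (2 * (n - 1))" .
qed

lemma flow_path_follows:
  assumes "good_arrows G W f" "F \<subseteq> (\<lambda>u. (u, f u)) ` W" "flow_path G F \<gamma>"
  shows "set (tl \<gamma>) \<subseteq> W \<and> follows (arrow_map G f) \<gamma>"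
  using assms(3)
proof (induction \<gamma> rule: induct_list012)
  case (3 a b r)
  then obtain e where e: "(b, e) \<in> F" "ends G e = {b, a}" by auto
  then have b: "b \<in> W" "e = f b" using assms(2) by auto
  then have "e \<in> edges G" using assms(1) by (auto simp: good_arrows_def incident_def)
  then have "arrow_map G f b = a" using other_end_eq[of e G b a] e b by (simp add: arrow_map_def)
  then show ?case using 3 b by auto
qed auto

text \<open>The rank of the arrow map changes by one along each edge.\<close>

lemma flow_path_geodesic:
  assumes good: "good_arrows G W f"
    and \<gamma>: "flow_path G F \<gamma>" "F \<subseteq> (\<lambda>u. (u, f u)) ` W" "\<gamma> \<noteq> []"
    and p: "walk H (last \<gamma>) p (hd \<gamma>)" "fst ` set p \<subseteq> snd ` F" "ends H = ends G"
  shows "length \<gamma> - 1 \<le> length p"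
proof -
  obtain r where r: "\<And>x. x \<in> W \<Longrightarrow> r x = Suc (r (arrow_map G f x))"
    using acyc_rank[of W "arrow_map G f"] good by (auto simp: good_arrows_def)
  have "r (last \<gamma>) = r (hd \<gamma>) + (length \<gamma> - 1)"
    using flow_path_follows[OF good \<gamma>(2,1)] \<gamma>(3)
  proof (induction \<gamma> rule: induct_list012)
    case (3 a b s)
    then show ?case using r[of b] by auto
  qed auto
  moreover have "r x \<le> r y + length p" if "walk H x p y" "fst ` set p \<subseteq> snd ` F" for x y
    using that
  proof (induction p arbitrary: x)
    case (Cons ez p)
    obtain e z where ez: "ez = (e, z)" by (cases ez)
    have "e \<in> snd ` F" using Cons.prems(2) ez by simp
    then obtain u where u: "u \<in> W" "e = f u" using \<gamma>(2) by fastforce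
    then have e: "e \<in> edges G" "u \<in> ends G e" using good by (auto simp: good_arrows_def incident_def)
    have xz: "ends G e = {x, z}" using Cons.prems(1) p(3) unfolding ez by simp
    then have "u = x \<or> u = z" using e(2) by simp
    moreover have "other_end G x e = z" by (rule other_end_eq[OF e(1) xz])
    moreover have "other_end G z e = x" by (rule other_end_eq[OF e(1)]) (simp add: xz insert_commute)
    ultimately have "(u = x \<and> arrow_map G f u = z) \<or> (u = z \<and> arrow_map G f u = x)"
      unfolding arrow_map_def u(2)[symmetric] by blast
    then have "r x = Suc (r z) \<or> r z = Suc (r x)" using r[OF u(1)] by metis
    then have "r x \<le> Suc (r z)" by linarith
    moreover have "r z \<le> r y + length p" by (rule Cons.IH) (use Cons.prems ez in auto)
    ultimately show ?case by simp
  qed auto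
  ultimately show ?thesis using p by fastforce
qed

section \<open>Passing to the infinite-volume limit\<close>

context bubble_network
begin

lemma edges_config:
  assumes "good_arrows G S f"
  shows "config_edges G (config S f) = (\<lambda>u. (u, f u)) ` S"
  using assms by (auto simp: config_edges_def config_def good_arrows_def incident_def oriented_edges_def)

lemma wired_edges_prob_mono:
  assumes S: "dom S" and AB: "\<And>f. good_arrows G S f \<Longrightarrow> A f \<Longrightarrow> B f"
  shows "measure_pmf.prob (wired_edges S) {f. A f} \<le> measure_pmf.prob (wired_edges S) {f. B f}"
  by (rule measure_pmf.finite_measure_mono_AE)
     (use set_wired_edges(1)[OF S] AB in \<open>auto simp: AE_measure_pmf_iff\<close>)

lemma prob_wired_edges_tall:
  assumes S: "dom S"
  shows "measure_pmf.prob (wired_edges S) {f. \<exists>\<gamma>\<in>paths S n v. follows (arrow_map G f) \<gamma>} = tall S n v"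
  unfolding tall_def
proof (rule prob_wired_edges_map[OF S, where E = "\<lambda>f. \<exists>\<gamma>\<in>paths S n v. follows f \<gamma>"])
  fix f g :: "'v \<Rightarrow> 'v" assume eq: "\<And>x. x \<in> S \<Longrightarrow> f x = g x"
  have "follows f \<gamma> \<longleftrightarrow> follows g \<gamma>" if "\<gamma> \<in> paths S n v" for \<gamma>
    by (rule follows_cong, rule eq) (use pathsD(4)[OF that] in blast)
  then show "(\<exists>\<gamma>\<in>paths S n v. follows f \<gamma>) \<longleftrightarrow> (\<exists>\<gamma>\<in>paths S n v. follows g \<gamma>)" by blast
qed

end

locale wusf_limit = bubble_network G for G :: "('v, 'e) weighted_graph" +
  fixes \<mu> :: "('v \<times> 'e \<Rightarrow> bool) measure" and W :: "nat \<Rightarrow> 'v set"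
  assumes prob_mu: "prob_space \<mu>" and sets_mu: "sets \<mu> = sets (config_space G)"
    and exh: "exhaustion G W"
    and conv: "weak_conv_in (config_topology G) (\<lambda>n. wired_tree_law G (W n)) \<mu>"
begin

sublocale mu: prob_space \<mu> by (rule prob_mu)

lemma dom_W: "dom (W k)"
  using exh by (auto simp: dom_def exhaustion_def)

lemma incseq_W: "incseq W"
  using exh by (simp add: exhaustion_def)

lemma filterlim_W: "filterlim W fin sequentially"
proof -
  have "eventually (\<lambda>k. A \<subseteq> W k) sequentially" if A: "finite A" "A \<subseteq> verts G" for A
    using A
  proof (induction A rule: finite_induct)
    case (insert a A)
    have "verts G = (\<Union>n. W n)" using exh by (simp add: exhaustion_def)
    then obtain k where "a \<in> W k" using insert.prems by blast
    then have "eventually (\<lambda>k. a \<in> W k) sequentially"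
      using incseqD[OF incseq_W] by (auto simp: eventually_sequentially)
    moreover have "eventually (\<lambda>k. A \<subseteq> W k) sequentially" using insert by auto
    ultimately show ?case by eventually_elim auto
  qed auto
  then show ?thesis
    unfolding filterlim_finite_subsets_at_top using dom_W by (auto simp: dom_def)
qed

lemma eventually_W: "v \<in> verts G \<Longrightarrow> eventually (\<lambda>k. v \<in> W k) sequentially"
  using filterlim_W[unfolded filterlim_finite_subsets_at_top, rule_format, of "{v}"]
  by (auto elim: eventually_mono)

lemma countable_verts: "countable (verts G)"
proof -
  have "verts G = (\<Union>n. W n)" using exh by (simp add: exhaustion_def)
  moreover have "countable (\<Union>n. W n)"
    using exh by (intro countable_UN) (auto simp: exhaustion_def intro: countable_finite)
  ultimately show ?thesis by (simp only:)
qed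

text \<open>Vertices may have infinite degree, but the edges at a vertex form the support of the law
  of a step, which is countable.\<close>

lemma countable_edges: "countable (edges G)"
proof (rule countable_subset)
  show "edges G \<subseteq> (\<Union>v\<in>verts G. set_pmf (edge_step v))"
  proof
    fix e assume e: "e \<in> edges G"
    then have "card (ends G e) \<in> {1, 2}" using net by (simp add: network_def)
    then have "ends G e \<noteq> {}" by auto
    then obtain v where "v \<in> ends G e" by blast
    then have "v \<in> verts G" "e \<in> incident G v" using ends_verts[OF e] e by (auto simp: incident_def)
    then show "e \<in> (\<Union>v\<in>verts G. set_pmf (edge_step v))" using set_edge_step by auto
  qed
  show "countable (\<Union>v\<in>verts G. set_pmf (edge_step v))" using countable_verts by auto
qed

lemma countable_oriented: "countable (oriented_edges G)"
proof (rule countable_subset)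
  show "oriented_edges G \<subseteq> verts G \<times> edges G" using ends_verts by (auto simp: oriented_edges_def)
  show "countable (verts G \<times> edges G)" using countable_verts countable_edges by simp
qed

section \<open>Weak convergence tested on finite windows of edges\<close>

definition window :: "nat \<Rightarrow> ('v \<times> 'e) set" where
  "window m = {d \<in> oriented_edges G. to_nat_on (oriented_edges G) d < m}"

lemma window: "finite (window m)" "window m \<subseteq> oriented_edges G" "incseq window"
proof -
  show "finite (window m)"
  proof (rule inj_on_finite[of "to_nat_on (oriented_edges G)" _ "{..<m}"])
    show "inj_on (to_nat_on (oriented_edges G)) (window m)"
      using inj_on_to_nat_on[OF countable_oriented] by (rule inj_on_subset) (auto simp: window_def)
  qed (auto simp: window_def)
qed (auto simp: window_def incseq_def)

lemma window_covers:
  assumes "finite J" "J \<subseteq> oriented_edges G"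
  shows "eventually (\<lambda>m. J \<subseteq> window m) sequentially"
  using assms
proof (induction J rule: finite_induct)
  case (insert d J)
  have "eventually (\<lambda>m. d \<in> window m) sequentially"
    using eventually_gt_at_top[of "to_nat_on (oriented_edges G) d"]
    by eventually_elim (use insert in \<open>auto simp: window_def\<close>)
  moreover have "eventually (\<lambda>m. J \<subseteq> window m) sequentially" using insert by auto
  ultimately show ?case by eventually_elim auto
qed auto

lemma measurable_finite_coords:
  fixes H :: "('v \<times> 'e \<Rightarrow> bool) \<Rightarrow> real"
  assumes J: "finite J" "J \<subseteq> oriented_edges G" and H: "\<And>\<omega> \<omega>'. (\<And>d. d \<in> J \<Longrightarrow> \<omega> d = \<omega>' d) \<Longrightarrow> H \<omega> = H \<omega>'"
  shows "H \<in> borel_measurable (config_space G)"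
proof -
  have "(\<lambda>\<omega>. restrict \<omega> J) \<in> config_space G \<rightarrow>\<^sub>M PiM J (\<lambda>_. count_space UNIV)"
    unfolding config_space_def by (rule measurable_restrict_subset[OF J(2)])
  moreover have "PiM J (\<lambda>_. count_space UNIV) = count_space (PiE J (\<lambda>_. UNIV :: bool set))"
    by (rule count_space_PiM_finite) (use J in auto)
  moreover have "H \<in> count_space (PiE J (\<lambda>_. UNIV)) \<rightarrow>\<^sub>M borel" by simp
  ultimately have "(\<lambda>\<omega>. H (restrict \<omega> J)) \<in> borel_measurable (config_space G)"
    by (metis measurable_compose)
  moreover have "H (restrict \<omega> J) = H \<omega>" for \<omega> by (rule H) simp
  ultimately show ?thesis by simp
qed

lemma continuous_finite_coords:
  fixes H :: "('v \<times> 'e \<Rightarrow> bool) \<Rightarrow> real"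
  assumes J: "finite J" and H: "\<And>\<omega> \<omega>'. (\<And>d. d \<in> J \<Longrightarrow> \<omega> d = \<omega>' d) \<Longrightarrow> H \<omega> = H \<omega>'"
  shows "continuous_map (config_topology G) euclideanreal H"
  unfolding continuous_map_def
proof (intro conjI allI impI)
  let ?X = "config_topology G" and ?D = "oriented_edges G"
  have top: "topspace ?X = PiE ?D (\<lambda>_. UNIV)" by (simp add: config_topology_def)
  show "H \<in> topspace ?X \<rightarrow> topspace euclideanreal" by simp
  fix U
  show "openin ?X {\<omega> \<in> topspace ?X. H \<omega> \<in> U}"
  proof (subst openin_subopen, intro ballI)
    fix \<omega> assume \<omega>: "\<omega> \<in> {\<omega> \<in> topspace ?X. H \<omega> \<in> U}"
    let ?B = "PiE ?D (\<lambda>d. if d \<in> J then {\<omega> d} else UNIV)"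
    have "openin ?X ?B"
      unfolding config_topology_def openin_PiE_gen
      by (rule disjI2) (use J in \<open>auto intro: finite_subset[of _ J]\<close>)
    moreover have "\<omega> \<in> ?B" using \<omega> by (auto simp: top PiE_iff)
    moreover have "?B \<subseteq> {\<omega> \<in> topspace ?X. H \<omega> \<in> U}"
    proof
      fix \<omega>' assume \<omega>': "\<omega>' \<in> ?B"
      have "\<omega>' d = \<omega> d" if "d \<in> J" for d
      proof (cases "d \<in> ?D")
        case True
        then show ?thesis using \<omega>' that by (auto simp: PiE_iff)
      next
        case False
        have "\<omega> \<in> PiE ?D (\<lambda>_. UNIV)" using \<omega> by (simp add: top)
        then show ?thesis using PiE_arb[OF \<omega>' False] PiE_arb[of \<omega> ?D "\<lambda>_. UNIV" d] False by simp
      qed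
      then have "H \<omega>' = H \<omega>" by (rule H)
      then show "\<omega>' \<in> {\<omega> \<in> topspace ?X. H \<omega> \<in> U}" using \<omega> \<omega>' by (auto simp: top PiE_iff)
    qed
    ultimately show "\<exists>T. openin ?X T \<and> \<omega> \<in> T \<and> T \<subseteq> {\<omega> \<in> topspace ?X. H \<omega> \<in> U}" by blast
  qed
qed

text \<open>Indicators of events depending on finitely many coordinates are continuous in the
  product topology, so weak convergence gives convergence of their probabilities.\<close>

lemma prob_tendsto:
  assumes J: "finite J" "J \<subseteq> oriented_edges G"
    and E: "\<And>\<omega> \<omega>'. (\<And>d. d \<in> J \<Longrightarrow> \<omega> d = \<omega>' d) \<Longrightarrow> E \<omega> \<longleftrightarrow> E \<omega>'"
  shows "{\<omega> \<in> space \<mu>. E \<omega>} \<in> sets \<mu>"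
    "(\<lambda>k. measure_pmf.prob (wired_edges (W k)) {f. E (config (W k) f)}) \<longlonglongrightarrow> measure \<mu> {\<omega> \<in> space \<mu>. E \<omega>}"
proof -
  let ?H = "\<lambda>\<omega>. of_bool (E \<omega>) :: real"
  have H: "?H \<omega> = ?H \<omega>'" if eq: "\<And>d. d \<in> J \<Longrightarrow> \<omega> d = \<omega>' d" for \<omega> \<omega>'
  proof -
    have "E \<omega> \<longleftrightarrow> E \<omega>'" by (rule E) (rule eq)
    then show ?thesis by simp
  qed
  have meas: "?H \<in> borel_measurable (config_space G)"
    by (rule measurable_finite_coords[OF J]) (rule H)
  then have "?H \<in> borel_measurable \<mu>" using measurable_cong_sets[OF sets_mu refl] by blast
  then have "?H -` {1} \<inter> space \<mu> \<in> sets \<mu>" by (rule measurable_sets) simp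
  moreover have "?H -` {1} \<inter> space \<mu> = {\<omega> \<in> space \<mu>. E \<omega>}" by auto
  ultimately show sets: "{\<omega> \<in> space \<mu>. E \<omega>} \<in> sets \<mu>" by simp
  have cont: "continuous_map (config_topology G) euclideanreal ?H"
    by (rule continuous_finite_coords[OF J(1)]) (rule H)
  have bd: "bounded (?H ` topspace (config_topology G))"
    by (rule bounded_subset[of "{0, 1}"]) auto
  have "(\<lambda>k. \<integral>\<omega>. ?H \<omega> \<partial>wired_tree_law G (W k)) \<longlonglongrightarrow> (\<integral>\<omega>. ?H \<omega> \<partial>\<mu>)"
    using conv cont bd unfolding weak_conv_in_def by blast
  moreover have "(\<integral>\<omega>. ?H \<omega> \<partial>wired_tree_law G (W k)) =
      measure_pmf.prob (wired_edges (W k)) {f. E (config (W k) f)}" for k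
    by (simp only: wired_tree_law_integral[OF dom_W meas] expectation_of_bool)
  moreover have "(\<integral>\<omega>. ?H \<omega> \<partial>\<mu>) = measure \<mu> {\<omega> \<in> space \<mu>. E \<omega>}"
  proof -
    have "(\<integral>\<omega>. ?H \<omega> \<partial>\<mu>) = (\<integral>\<omega>. indicator {\<omega> \<in> space \<mu>. E \<omega>} \<omega> \<partial>\<mu>)"
      by (rule Bochner_Integration.integral_cong) (auto simp: indicator_def)
    then show ?thesis using sets by (simp add: sets.sets_into_space Int_absorb2)
  qed
  ultimately show "(\<lambda>k. measure_pmf.prob (wired_edges (W k)) {f. E (config (W k) f)}) \<longlonglongrightarrow>
      measure \<mu> {\<omega> \<in> space \<mu>. E \<omega>}" by simp
qed

lemma prob_window_tendsto:
  "{\<omega> \<in> space \<mu>. Q (config_edges G \<omega> \<inter> window m)} \<in> sets \<mu>"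
  "(\<lambda>k. measure_pmf.prob (wired_edges (W k)) {f. Q (config_edges G (config (W k) f) \<inter> window m)})
    \<longlonglongrightarrow> measure \<mu> {\<omega> \<in> space \<mu>. Q (config_edges G \<omega> \<inter> window m)}"
proof -
  have "config_edges G \<omega> \<inter> window m = config_edges G \<omega>' \<inter> window m"
    if "\<And>d. d \<in> window m \<Longrightarrow> \<omega> d = \<omega>' d" for \<omega> \<omega>'
    using that window(2) by (auto simp: config_edges_def)
  then have *: "Q (config_edges G \<omega> \<inter> window m) \<longleftrightarrow> Q (config_edges G \<omega>' \<inter> window m)"
    if "\<And>d. d \<in> window m \<Longrightarrow> \<omega> d = \<omega>' d" for \<omega> \<omega>' using that by metis
  show "{\<omega> \<in> space \<mu>. Q (config_edges G \<omega> \<inter> window m)} \<in> sets \<mu>"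
    by (rule prob_tendsto(1)[OF window(1,2), where E = "\<lambda>\<omega>. Q (config_edges G \<omega> \<inter> window m)"]) (rule *)
  show "(\<lambda>k. measure_pmf.prob (wired_edges (W k)) {f. Q (config_edges G (config (W k) f) \<inter> window m)})
    \<longlonglongrightarrow> measure \<mu> {\<omega> \<in> space \<mu>. Q (config_edges G \<omega> \<inter> window m)}"
    by (rule prob_tendsto(2)[OF window(1,2), where E = "\<lambda>\<omega>. Q (config_edges G \<omega> \<inter> window m)"]) (rule *)
qed

lemma finitary_window:
  assumes Q: "finitary Q"
  shows "{\<omega> \<in> space \<mu>. Q (config_edges G \<omega>)} = (\<Union>m. {\<omega> \<in> space \<mu>. Q (config_edges G \<omega> \<inter> window m)})"
    "incseq (\<lambda>m. {\<omega> \<in> space \<mu>. Q (config_edges G \<omega> \<inter> window m)})"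
proof -
  show "{\<omega> \<in> space \<mu>. Q (config_edges G \<omega>)} = (\<Union>m. {\<omega> \<in> space \<mu>. Q (config_edges G \<omega> \<inter> window m)})"
  proof (intro equalityI subsetI)
    fix \<omega> assume \<omega>: "\<omega> \<in> {\<omega> \<in> space \<mu>. Q (config_edges G \<omega>)}"
    then have "Q (config_edges G \<omega>)" by simp
    then obtain J where J: "finite J" "J \<subseteq> config_edges G \<omega>" "\<forall>F. J \<subseteq> F \<longrightarrow> Q F"
      using finitary_witness[OF Q] by metis
    have "J \<subseteq> oriented_edges G" using J(2) by (auto simp: config_edges_def)
    from window_covers[OF J(1) this] obtain m where m: "J \<subseteq> window m"
      by (meson eventually_happens trivial_limit_sequentially)
    have "Q (config_edges G \<omega> \<inter> window m)"
      by (rule J(3)[rule_format]) (use J(2) m in blast)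
    then show "\<omega> \<in> (\<Union>m. {\<omega> \<in> space \<mu>. Q (config_edges G \<omega> \<inter> window m)})" using \<omega> by blast
  next
    fix \<omega> assume "\<omega> \<in> (\<Union>m. {\<omega> \<in> space \<mu>. Q (config_edges G \<omega> \<inter> window m)})"
    then obtain m where "\<omega> \<in> space \<mu>" "Q (config_edges G \<omega> \<inter> window m)" by blast
    then show "\<omega> \<in> {\<omega> \<in> space \<mu>. Q (config_edges G \<omega>)}"
      using finitary_mono[OF Q _ Int_lower1] by simp
  qed
  show "incseq (\<lambda>m. {\<omega> \<in> space \<mu>. Q (config_edges G \<omega> \<inter> window m)})"
  proof (rule incseq_SucI, rule subsetI)
    fix m \<omega> assume "\<omega> \<in> {\<omega> \<in> space \<mu>. Q (config_edges G \<omega> \<inter> window m)}"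
    moreover have "window m \<subseteq> window (Suc m)" using window(3) by (simp add: incseq_SucD)
    ultimately show "\<omega> \<in> {\<omega> \<in> space \<mu>. Q (config_edges G \<omega> \<inter> window (Suc m))}"
      using finitary_mono[OF Q, of "config_edges G \<omega> \<inter> window m" "config_edges G \<omega> \<inter> window (Suc m)"] by auto
  qed
qed

lemma finitary_sets:
  "finitary Q \<Longrightarrow> {\<omega> \<in> space \<mu>. Q (config_edges G \<omega>)} \<in> sets \<mu>"
  unfolding finitary_window(1) using prob_window_tendsto(1) by blast

lemma finitary_measure_le:
  assumes Q: "finitary Q"
    and le: "eventually (\<lambda>k. measure_pmf.prob (wired_edges (W k)) {f. Q (config_edges G (config (W k) f))} \<le> B) sequentially"
  shows "measure \<mu> {\<omega> \<in> space \<mu>. Q (config_edges G \<omega>)} \<le> B"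
proof -
  let ?A = "\<lambda>m. {\<omega> \<in> space \<mu>. Q (config_edges G \<omega> \<inter> window m)}"
  have "measure \<mu> (?A m) \<le> B" for m
  proof (rule tendsto_upperbound[OF prob_window_tendsto(2)])
    show "eventually (\<lambda>k. measure_pmf.prob (wired_edges (W k))
        {f. Q (config_edges G (config (W k) f) \<inter> window m)} \<le> B) sequentially"
      using le
    proof eventually_elim
      case (elim k)
      have "measure_pmf.prob (wired_edges (W k)) {f. Q (config_edges G (config (W k) f) \<inter> window m)} \<le>
          measure_pmf.prob (wired_edges (W k)) {f. Q (config_edges G (config (W k) f))}"
        by (rule wired_edges_prob_mono[OF dom_W], rule finitary_mono[OF Q _ Int_lower1])
      then show ?case using elim by simp
    qed
  qed simp
  moreover have "(\<lambda>m. measure \<mu> (?A m)) \<longlonglongrightarrow> measure \<mu> {\<omega> \<in> space \<mu>. Q (config_edges G \<omega>)}"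
    unfolding finitary_window(1)[OF Q]
    by (rule mu.finite_Lim_measure_incseq) (use prob_window_tendsto(1) finitary_window(2)[OF Q] in auto)
  ultimately show ?thesis by (meson LIMSEQ_le_const2)
qed

text \<open>In contrast to the upper bound, the window must be fixed before the limit in k;
  otherwise the edges that realise the event could move off as k grows.\<close>

lemma finitary_measure_ge:
  assumes Q: "finitary Q"
    and ge: "eventually (\<lambda>k. a \<le> measure_pmf.prob (wired_edges (W k)) {f. Q (config_edges G (config (W k) f) \<inter> window m)}) sequentially"
  shows "a \<le> measure \<mu> {\<omega> \<in> space \<mu>. Q (config_edges G \<omega>)}"
proof -
  have "a \<le> measure \<mu> {\<omega> \<in> space \<mu>. Q (config_edges G \<omega> \<inter> window m)}"
    by (rule tendsto_lowerbound[OF prob_window_tendsto(2) ge]) simp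
  also have "\<dots> \<le> measure \<mu> {\<omega> \<in> space \<mu>. Q (config_edges G \<omega>)}"
    by (rule mu.finite_measure_mono[OF _ finitary_sets[OF Q]]) (use finitary_mono[OF Q _ Int_lower1] in auto)
  finally show ?thesis .
qed

section \<open>The upper bounds\<close>

lemma long_path_upper:
  assumes C: "\<forall>S v n. dom S \<longrightarrow> v \<in> S \<longrightarrow> 0 < n \<longrightarrow> tall S n v \<le> C / real n"
    and v: "v \<in> verts G" and n: "0 < n"
  shows "measure \<mu> {\<omega> \<in> space \<mu>. \<exists>\<gamma>. (distinct \<gamma> \<and> length \<gamma> = Suc n \<and> hd \<gamma> = v) \<and>
    flow_path G (config_edges G \<omega>) \<gamma>} \<le> C / real n"
proof (rule finitary_measure_le)
  show "finitary (\<lambda>F. \<exists>\<gamma>. (distinct \<gamma> \<and> length \<gamma> = Suc n \<and> hd \<gamma> = v) \<and> flow_path G F \<gamma>)"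
    by (intro finitary_ex finitary_conj finitary_const finitary_flow_path)
  show "eventually (\<lambda>k. measure_pmf.prob (wired_edges (W k)) {f. \<exists>\<gamma>. (distinct \<gamma> \<and> length \<gamma> = Suc n \<and> hd \<gamma> = v) \<and>
      flow_path G (config_edges G (config (W k) f)) \<gamma>} \<le> C / real n) sequentially"
    using eventually_W[OF v]
  proof eventually_elim
    case (elim k)
    have "measure_pmf.prob (wired_edges (W k)) {f. \<exists>\<gamma>. (distinct \<gamma> \<and> length \<gamma> = Suc n \<and> hd \<gamma> = v) \<and>
        flow_path G (config_edges G (config (W k) f)) \<gamma>} \<le>
      measure_pmf.prob (wired_edges (W k)) {f. \<exists>\<gamma>\<in>paths (W k) n v. follows (arrow_map G f) \<gamma>}"
    proof (rule wired_edges_prob_mono[OF dom_W])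
      fix f assume good: "good_arrows G (W k) f" and "\<exists>\<gamma>. (distinct \<gamma> \<and> length \<gamma> = Suc n \<and> hd \<gamma> = v) \<and>
        flow_path G (config_edges G (config (W k) f)) \<gamma>"
      then obtain \<gamma> where \<gamma>: "distinct \<gamma>" "length \<gamma> = Suc n" "hd \<gamma> = v"
        "flow_path G (config_edges G (config (W k) f)) \<gamma>" by blast
      then show "\<exists>\<gamma>\<in>paths (W k) n v. follows (arrow_map G f) \<gamma>"
        using flow_path_follows[OF good, of "config_edges G (config (W k) f)" \<gamma>] edges_config[OF good]
        by (intro bexI[of _ \<gamma>]) (auto simp: paths_def)
    qed
    also have "\<dots> = tall (W k) n v" by (rule prob_wired_edges_tall[OF dom_W])
    also have "\<dots> \<le> C / real n" by (rule C[rule_format, OF dom_W elim n])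
    finally show ?case .
  qed
qed

lemma diam_upper:
  assumes C: "0 \<le> C" "\<forall>S v n. dom S \<longrightarrow> v \<in> S \<longrightarrow> 0 < n \<longrightarrow> tall S n v \<le> C / real n"
    and v: "v \<in> verts G" and R: "1 \<le> (R :: real)"
  shows "measure \<mu> {\<omega> \<in> space \<mu>. ereal R \<le> ereal_of_enat (graph_diam (past G (config_edges G \<omega>) v))}
    \<le> 2 * C / R"
proof -
  \<comment> \<open>Without a directed path of length n the diameter is at most 2 (n - 1), and this
    n makes that smaller than R.\<close>
  define n where "n = nat \<lceil>R / 2\<rceil>"
  have n: "0 < n" "R / 2 \<le> real n" "real n - 1 < R / 2" unfolding n_def using R by linarith+
  have "measure \<mu> {\<omega> \<in> space \<mu>. ereal R \<le> ereal_of_enat (graph_diam (past G (config_edges G \<omega>) v))} \<le>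
    measure \<mu> {\<omega> \<in> space \<mu>. \<exists>\<gamma>. (distinct \<gamma> \<and> length \<gamma> = Suc n \<and> hd \<gamma> = v) \<and>
      flow_path G (config_edges G \<omega>) \<gamma>}"
  proof (rule mu.finite_measure_mono, rule subsetI)
    fix \<omega> assume \<omega>: "\<omega> \<in> {\<omega> \<in> space \<mu>. ereal R \<le> ereal_of_enat (graph_diam (past G (config_edges G \<omega>) v))}"
    let ?F = "config_edges G \<omega>"
    have "\<exists>\<gamma>. (distinct \<gamma> \<and> length \<gamma> = Suc n \<and> hd \<gamma> = v) \<and> flow_path G ?F \<gamma>"
    proof (rule ccontr)
      assume no: "\<not> ?thesis"
      have "graph_diam (past G ?F v) \<le> enat (2 * (n - 1))"
      proof (rule diam_past_le)
        fix \<gamma> assume \<gamma>: "flow_path G ?F \<gamma>" "distinct \<gamma>" "\<gamma> \<noteq> []" "hd \<gamma> = v"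
        show "length \<gamma> \<le> n"
        proof (rule ccontr)
          assume len: "\<not> length \<gamma> \<le> n"
          have "flow_path G ?F (take (Suc n) \<gamma>)"
            using flow_path_prefix[of G ?F "take (Suc n) \<gamma>" "drop (Suc n) \<gamma>"] \<gamma>(1) by simp
          then show False using no \<gamma> len by (auto simp: hd_take)
        qed
      qed
      then have "ereal_of_enat (graph_diam (past G ?F v)) \<le> ereal_of_enat (enat (2 * (n - 1)))"
        by (simp only: ereal_of_enat_le_iff)
      then have "ereal R \<le> ereal_of_enat (enat (2 * (n - 1)))" using \<omega> by (blast intro: order_trans)
      then have "R \<le> 2 * (real n - 1)" using n(1) by (simp add: of_nat_diff)
      then show False using n(3) by simp
    qed
    then show "\<omega> \<in> {\<omega> \<in> space \<mu>. \<exists>\<gamma>. (distinct \<gamma> \<and> length \<gamma> = Suc n \<and> hd \<gamma> = v) \<and>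
        flow_path G (config_edges G \<omega>) \<gamma>}"
      using \<omega> by blast
  next
    show "{\<omega> \<in> space \<mu>. \<exists>\<gamma>. (distinct \<gamma> \<and> length \<gamma> = Suc n \<and> hd \<gamma> = v) \<and>
      flow_path G (config_edges G \<omega>) \<gamma>} \<in> sets \<mu>"
      by (intro finitary_sets[where Q = "\<lambda>F. \<exists>\<gamma>. (distinct \<gamma> \<and> length \<gamma> = Suc n \<and> hd \<gamma> = v) \<and> flow_path G F \<gamma>"]
          finitary_ex finitary_conj finitary_const finitary_flow_path)
  qed
  also have "\<dots> \<le> C / real n" by (rule long_path_upper[OF C(2) v n(1)])
  also have "\<dots> \<le> C / (R / 2)" by (rule divide_left_mono) (use C R n in auto)
  finally show ?thesis by (simp add: mult.commute)
qed

text \<open>Expressed through finite subsets the event is finitary, and infinite pasts are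
  included.\<close>

lemma num_verts_ge_iff:
  fixes H :: "('v, 'e) multigraph"
  assumes "0 \<le> R"
  shows "ereal R \<le> ereal_of_enat (num_verts H) \<longleftrightarrow> (\<exists>X. (finite X \<and> R \<le> real (card X)) \<and> X \<subseteq> verts H)"
proof (cases "finite (verts H)")
  case True
  have "R \<le> real (card (verts H))" if "finite X" "R \<le> real (card X)" "X \<subseteq> verts H" for X
    using card_mono[OF True that(3)] that(2) by linarith
  then show ?thesis using True by (auto simp: num_verts_def)
next
  case False
  then obtain X where "finite X" "card X = nat \<lceil>R\<rceil>" "X \<subseteq> verts H"
    using infinite_arbitrarily_large by blast
  moreover have "R \<le> real (nat \<lceil>R\<rceil>)" by linarith
  ultimately show ?thesis using False by (auto simp: num_verts_def)
qed

lemma finitary_num_verts: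
  "0 \<le> R \<Longrightarrow> finitary (\<lambda>F. ereal R \<le> ereal_of_enat (num_verts (past G F v)))"
proof -
  assume R: "0 \<le> R"
  have "finitary (\<lambda>F. \<exists>X. (finite X \<and> R \<le> real (card X)) \<and> (\<forall>u\<in>X. flows_to G F u v))"
    by (intro finitary_ex finitary_imp finitary_ball finitary_flows_to) simp
  then show ?thesis unfolding num_verts_ge_iff[OF R] by (simp add: subset_iff Ball_def)
qed

lemma num_verts_upper:
  assumes C: "\<forall>S v R. dom S \<longrightarrow> v \<in> S \<longrightarrow> 1 \<le> R \<longrightarrow>
      measure_pmf.prob (wired S) {f. R \<le> real (card (reach S v f))} \<le> C / sqrt R"
    and v: "v \<in> verts G" and R: "1 \<le> (R :: real)"
  shows "measure \<mu> {\<omega> \<in> space \<mu>. ereal R \<le> ereal_of_enat (num_verts (past G (config_edges G \<omega>) v))}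
    \<le> C / sqrt R"
proof (rule finitary_measure_le[OF finitary_num_verts])
  show "eventually (\<lambda>k. measure_pmf.prob (wired_edges (W k))
      {f. ereal R \<le> ereal_of_enat (num_verts (past G (config_edges G (config (W k) f)) v))} \<le> C / sqrt R) sequentially"
    using eventually_W[OF v]
  proof eventually_elim
    case (elim k)
    have "measure_pmf.prob (wired_edges (W k))
        {f. ereal R \<le> ereal_of_enat (num_verts (past G (config_edges G (config (W k) f)) v))} \<le>
      measure_pmf.prob (wired_edges (W k)) {f. R \<le> real (card (reach (W k) v (arrow_map G f)))}"
    proof (rule wired_edges_prob_mono[OF dom_W])
      fix f assume good: "good_arrows G (W k) f"
        and "ereal R \<le> ereal_of_enat (num_verts (past G (config_edges G (config (W k) f)) v))"
      then obtain X where X: "finite X" "R \<le> real (card X)"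
        "\<And>u. u \<in> X \<Longrightarrow> flows_to G (config_edges G (config (W k) f)) u v"
        using num_verts_ge_iff[of R] R by auto
      have "X \<subseteq> reach (W k) v (arrow_map G f)"
      proof
        fix u assume "u \<in> X"
        then obtain \<gamma> where \<gamma>: "flow_path G (config_edges G (config (W k) f)) \<gamma>" "\<gamma> \<noteq> []" "hd \<gamma> = v"
          "last \<gamma> = u" "distinct \<gamma>" using flows_to_path[OF X(3)] by blast
        have "\<gamma> \<in> paths (W k) (length \<gamma> - 1) v" "follows (arrow_map G f) \<gamma>"
          using flow_path_follows[OF good _ \<gamma>(1)] edges_config[OF good] \<gamma> by (auto simp: paths_def)
        then show "u \<in> reach (W k) v (arrow_map G f)" using \<gamma>(4) unfolding reach_def by blast
      qed
      moreover have "finite (reach (W k) v (arrow_map G f))"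
        by (rule finite_reach) (use dom_W in \<open>simp add: dom_def\<close>)
      ultimately have "card X \<le> card (reach (W k) v (arrow_map G f))" by (rule card_mono[rotated])
      then show "R \<le> real (card (reach (W k) v (arrow_map G f)))" using X(2) by linarith
    qed
    also have "\<dots> = measure_pmf.prob (wired (W k)) {f. R \<le> real (card (reach (W k) v f))}"
    proof (rule prob_wired_edges_map[OF dom_W, where E = "\<lambda>f. R \<le> real (card (reach (W k) v f))"])
      fix f g :: "'v \<Rightarrow> 'v" assume eq: "\<And>x. x \<in> W k \<Longrightarrow> f x = g x"
      have "follows f \<gamma> \<longleftrightarrow> follows g \<gamma>" if "\<gamma> \<in> paths (W k) n v" for \<gamma> n
        by (rule follows_cong, rule eq) (use pathsD(4)[OF that] in blast)
      then have "reach (W k) v f = reach (W k) v g" unfolding reach_def by blast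
      then show "R \<le> real (card (reach (W k) v f)) \<longleftrightarrow> R \<le> real (card (reach (W k) v g))" by simp
    qed
    also have "\<dots> \<le> C / sqrt R" by (rule C[rule_format, OF dom_W elim R])
    finally show ?case .
  qed
qed (use R in simp)

end

section \<open>The lower bounds\<close>

text \<open>Where N is at least t, the inequality of arithmetic and geometric means bounds N by N *
  N / (2 \<alpha>) + \<alpha> / 2; elsewhere N is at most t on N > 0. The event N > 0 is itself
  rare, so the latter part costs at most half of the mean even for t much larger than the
  mean.\<close>

lemma second_moment_lower:
  fixes N :: "'a \<Rightarrow> real"
  assumes N: "\<And>x. 0 \<le> N x" "\<And>x. N x \<le> K"
    and a: "0 < a" "a \<le> measure_pmf.expectation p N"
    and s: "0 < s" "measure_pmf.expectation p (\<lambda>x. N x * N x) \<le> s"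
    and t: "0 \<le> t" "t * measure_pmf.prob p {x. 0 < N x} \<le> a / 2"
  shows "a\<^sup>2 / (4 * s) \<le> measure_pmf.prob p {x. t \<le> N x}"
proof -
  \<comment> \<open>With this value the quadratic term contributes at most a / 4 of the remaining a
    / 2.\<close>
  define \<alpha> where "\<alpha> = 2 * s / a"
  have \<alpha>: "0 < \<alpha>" using a s by (simp add: \<alpha>_def)
  let ?h = "\<lambda>x. t * of_bool (0 < N x) + (N x * N x / (2 * \<alpha>) + \<alpha> / 2 * of_bool (t \<le> N x))"
  have int: "integrable (measure_pmf p) (\<lambda>x. of_bool (E x) :: real)" for E
    by (rule integrable_pmf_bounded[where K = 1]) simp
  have K: "0 \<le> K" using N(1)[of undefined] N(2)[of undefined] by linarith
  have intN: "integrable (measure_pmf p) N"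
    by (rule integrable_pmf_bounded[where K = K]) (use N in auto)
  have intNN: "integrable (measure_pmf p) (\<lambda>x. N x * N x)"
    by (rule integrable_pmf_bounded[where K = "K * K"]) (use N K in \<open>auto intro!: mult_mono\<close>)
  have le: "N x \<le> ?h x" for x
  proof (cases "t \<le> N x")
    case True
    have "0 \<le> (N x - \<alpha>)\<^sup>2" by simp
    then have "2 * \<alpha> * N x \<le> N x * N x + \<alpha> * \<alpha>" by (simp add: power2_eq_square algebra_simps)
    then have "N x \<le> N x * N x / (2 * \<alpha>) + \<alpha> / 2" using \<alpha> by (simp add: field_simps)
    moreover have "0 \<le> t * of_bool (0 < N x)" using t(1) by simp
    ultimately show ?thesis using True by simp
  next
    case False
    then have "N x \<le> t * of_bool (0 < N x)" using N(1)[of x] by auto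
    moreover have "0 \<le> N x * N x / (2 * \<alpha>) + \<alpha> / 2 * of_bool (t \<le> N x)" using \<alpha> by simp
    ultimately show ?thesis by linarith
  qed
  have "a \<le> measure_pmf.expectation p N" by (rule a(2))
  also have "\<dots> \<le> measure_pmf.expectation p ?h"
    by (rule integral_mono[OF intN _ le]) (intro Bochner_Integration.integrable_add integrable_mult_right
        integrable_divide int intNN)
  also have "\<dots> = t * measure_pmf.prob p {x. 0 < N x} +
      (measure_pmf.expectation p (\<lambda>x. N x * N x) / (2 * \<alpha>) + \<alpha> / 2 * measure_pmf.prob p {x. t \<le> N x})"
    using int intNN by (simp add: expectation_of_bool)
  also have "\<dots> \<le> a / 2 + (s / (2 * \<alpha>) + \<alpha> / 2 * measure_pmf.prob p {x. t \<le> N x})"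
    using t(2) s(2) \<alpha> by (intro add_mono divide_right_mono) auto
  finally have "a / 2 \<le> s / (2 * \<alpha>) + \<alpha> / 2 * measure_pmf.prob p {x. t \<le> N x}" by linarith
  moreover have "s / (2 * \<alpha>) = a / 4" using a s by (simp add: \<alpha>_def)
  moreover have "\<alpha> / 2 = s / a" by (simp add: \<alpha>_def)
  ultimately have "a / 2 \<le> a / 4 + s / a * measure_pmf.prob p {x. t \<le> N x}" by (simp only:)
  then have "a / 4 \<le> s / a * measure_pmf.prob p {x. t \<le> N x}" by linarith
  then show ?thesis using a s by (simp add: field_simps power2_eq_square)
qed

lemma flow_path_iff_pred:
  "follows g \<gamma> \<Longrightarrow> flow_path G F \<gamma> \<longleftrightarrow> (\<forall>b\<in>set (tl \<gamma>). \<exists>e. (b, e) \<in> F \<and> ends G e = {b, g b})"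
  by (induction g \<gamma> rule: follows.induct) auto

text \<open>Distances are natural numbers or infinite: if all of them are below R, they are bounded
  by the largest natural number below R, and so is their supremum.\<close>

lemma diam_ge_iff:
  assumes "1 \<le> R"
  shows "ereal R \<le> ereal_of_enat (graph_diam H) \<longleftrightarrow>
    (\<exists>x\<in>verts H. \<exists>y\<in>verts H. \<forall>p. walk H x p y \<longrightarrow> R \<le> real (length p))"
proof
  assume diam: "ereal R \<le> ereal_of_enat (graph_diam H)"
  define n where "n = nat \<lceil>R\<rceil> - 1"
  have n: "real n < R" "\<And>m :: nat. real m < R \<Longrightarrow> m \<le> n" unfolding n_def using assms by linarith+
  show "\<exists>x\<in>verts H. \<exists>y\<in>verts H. \<forall>p. walk H x p y \<longrightarrow> R \<le> real (length p)"
  proof (rule ccontr)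
    assume no: "\<not> ?thesis"
    have "graph_diam H \<le> enat n"
      unfolding graph_diam_def
    proof (intro SUP_least)
      fix x y assume "x \<in> verts H" "y \<in> verts H"
      then obtain p where p: "walk H x p y" "real (length p) < R" using no by force
      have "graph_dist H x y \<le> enat (length p)"
        unfolding graph_dist_def by (rule INF_lower) (use p in simp)
      also have "\<dots> \<le> enat n" using n(2)[OF p(2)] by simp
      finally show "graph_dist H x y \<le> enat n" .
    qed
    then have "ereal_of_enat (graph_diam H) \<le> ereal_of_enat (enat n)" by (simp only: ereal_of_enat_le_iff)
    then have "ereal R \<le> ereal_of_enat (enat n)" using diam by (rule order_trans[rotated])
    then show False using n(1) by simp
  qed
next
  assume "\<exists>x\<in>verts H. \<exists>y\<in>verts H. \<forall>p. walk H x p y \<longrightarrow> R \<le> real (length p)"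
  then obtain x y where xy: "x \<in> verts H" "y \<in> verts H" "\<And>p. walk H x p y \<Longrightarrow> R \<le> real (length p)" by blast
  have "enat (nat \<lceil>R\<rceil>) \<le> graph_dist H x y"
    unfolding graph_dist_def
  proof (rule INF_greatest)
    fix p assume "p \<in> {p. walk H x p y}"
    then have "R \<le> real (length p)" using xy(3) by simp
    then have "nat \<lceil>R\<rceil> \<le> length p" by linarith
    then show "enat (nat \<lceil>R\<rceil>) \<le> enat (length p)" by simp
  qed
  also have "\<dots> \<le> graph_diam H"
    unfolding graph_diam_def by (rule SUP_upper2[OF xy(1)], rule SUP_upper[OF xy(2)])
  finally have "ereal_of_enat (enat (nat \<lceil>R\<rceil>)) \<le> ereal_of_enat (graph_diam H)"
    by (simp only: ereal_of_enat_le_iff)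
  moreover have "ereal R \<le> ereal_of_enat (enat (nat \<lceil>R\<rceil>))" by simp linarith
  ultimately show "ereal R \<le> ereal_of_enat (graph_diam H)" by (rule order_trans[rotated])
qed

context wusf_limit
begin

text \<open>Every finite part occurs in an oriented tree along the exhaustion. Properties of finite
  trees that concern finitely many edges at a time thus carry over to the infinite forest.\<close>

definition consistent :: "('v \<times> 'e) set \<Rightarrow> bool" where
  "consistent F \<longleftrightarrow> (\<forall>K. finite K \<longrightarrow> K \<subseteq> F \<longrightarrow>
    (\<exists>k f. good_arrows G (W k) f \<and> K \<subseteq> (\<lambda>u. (u, f u)) ` W k))"

text \<open>There are only countably many finite sets of oriented edges. Those contained in no tree
  along the exhaustion have probability 0 there, hence also in the limit.\<close>

lemma AE_consistent: "AE \<omega> in \<mu>. consistent (config_edges G \<omega>)"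
proof -
  let ?good = "\<lambda>K. \<exists>k f. good_arrows G (W k) f \<and> K \<subseteq> (\<lambda>u. (u, f u)) ` W k"
  let ?K = "{K. finite K \<and> K \<subseteq> oriented_edges G \<and> \<not> ?good K}"
  have cnt: "countable ?K"
    by (rule countable_subset[OF _ countable_Collect_finite_subset[OF countable_oriented]]) auto
  have null: "AE \<omega> in \<mu>. \<not> K \<subseteq> config_edges G \<omega>" if K: "K \<in> ?K" for K
  proof -
    have fin: "finitary (\<lambda>F. K \<subseteq> F)"
      unfolding subset_iff Ball_def[symmetric] by (intro finitary_ball finitary_mem) (use K in simp)
    have "measure \<mu> {\<omega> \<in> space \<mu>. K \<subseteq> config_edges G \<omega>} \<le> 0"
    proof (rule finitary_measure_le[OF fin], rule always_eventually, rule allI)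
      fix k
      have "measure_pmf.prob (wired_edges (W k)) {f. K \<subseteq> config_edges G (config (W k) f)} \<le>
          measure_pmf.prob (wired_edges (W k)) {f. False}"
      proof (rule wired_edges_prob_mono[OF dom_W])
        fix f assume f: "good_arrows G (W k) f" "K \<subseteq> config_edges G (config (W k) f)"
        have "?good K" using f edges_config[OF f(1)] by auto
        then show False using K by blast
      qed
      then show "measure_pmf.prob (wired_edges (W k)) {f. K \<subseteq> config_edges G (config (W k) f)} \<le> 0" by simp
    qed
    then have "measure \<mu> {\<omega> \<in> space \<mu>. K \<subseteq> config_edges G \<omega>} = 0"
      using measure_nonneg by (rule antisym)
    then have "AE \<omega> in \<mu>. \<omega> \<notin> {\<omega> \<in> space \<mu>. K \<subseteq> config_edges G \<omega>}"
      using mu.prob_eq_0[OF finitary_sets[OF fin]] by simp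
    then show ?thesis by (rule AE_mp) (rule AE_I2, simp)
  qed
  have "AE \<omega> in \<mu>. \<forall>K\<in>?K. \<not> K \<subseteq> config_edges G \<omega>"
    unfolding AE_ball_countable[OF cnt] using null by blast
  then show ?thesis
  proof eventually_elim
    case (elim \<omega>)
    show ?case
      unfolding consistent_def
    proof (intro allI impI)
      fix K assume K: "finite K" "K \<subseteq> config_edges G \<omega>"
      then have "K \<subseteq> oriented_edges G" by (auto simp: config_edges_def)
      then show "?good K" using elim K by blast
    qed
  qed
qed

lemma consistent_geodesic:
  assumes F: "consistent F" and \<gamma>: "flow_path G F \<gamma>" "\<gamma> \<noteq> []" "hd \<gamma> = v"
    and ws: "walk (past G F v) (last \<gamma>) ws v"
  shows "length \<gamma> - 1 \<le> length ws"
proof -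
  obtain J where J: "finite J" "J \<subseteq> F" "\<forall>F'. J \<subseteq> F' \<longrightarrow> flow_path G F' \<gamma>"
    using finitary_witness[OF finitary_flow_path \<gamma>(1)] by metis
  have "fst ` set ws \<subseteq> snd ` F" using walk_edges_subset[OF ws] by auto
  then obtain J' where J': "J' \<subseteq> F" "finite J'" "fst ` set ws = snd ` J'"
    using finite_subset_image[of "fst ` set ws" snd F] by auto
  have "finite (J \<union> J')" "J \<union> J' \<subseteq> F" using J J' by auto
  then obtain k f where f: "good_arrows G (W k) f" "J \<union> J' \<subseteq> (\<lambda>u. (u, f u)) ` W k"
    using F[unfolded consistent_def, rule_format, of "J \<union> J'"] by metis
  show ?thesis
  proof (rule flow_path_geodesic[OF f(1) _ f(2) \<gamma>(2), where H = "past G F v"])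
    show "flow_path G (J \<union> J') \<gamma>" using J(3) by blast
    show "walk (past G F v) (last \<gamma>) ws (hd \<gamma>)" using ws \<gamma>(3) by simp
  qed (use J' in auto)
qed

lemma consistent_last_inj:
  assumes F: "consistent F"
    and \<gamma>: "flow_path G F \<gamma>" "\<gamma> \<noteq> []" "distinct \<gamma>" and \<gamma>': "flow_path G F \<gamma>'" "\<gamma>' \<noteq> []" "distinct \<gamma>'"
    and eq: "hd \<gamma> = hd \<gamma>'" "last \<gamma> = last \<gamma>'"
  shows "\<gamma> = \<gamma>'"
proof -
  obtain J where J: "finite J" "J \<subseteq> F" "\<forall>F'. J \<subseteq> F' \<longrightarrow> flow_path G F' \<gamma>"
    using finitary_witness[OF finitary_flow_path \<gamma>(1)] by metis
  obtain J' where J': "finite J'" "J' \<subseteq> F" "\<forall>F'. J' \<subseteq> F' \<longrightarrow> flow_path G F' \<gamma>'"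
    using finitary_witness[OF finitary_flow_path \<gamma>'(1)] by metis
  have "finite (J \<union> J')" "J \<union> J' \<subseteq> F" using J J' by auto
  then obtain k f where f: "good_arrows G (W k) f" "J \<union> J' \<subseteq> (\<lambda>u. (u, f u)) ` W k"
    using F[unfolded consistent_def, rule_format, of "J \<union> J'"] by metis
  have "follows (arrow_map G f) \<gamma>" "follows (arrow_map G f) \<gamma>'"
    using flow_path_follows[OF f] J(3)[rule_format, of "J \<union> J'"] J'(3)[rule_format, of "J \<union> J'"] by auto
  then show ?thesis using \<gamma> \<gamma>' eq by (intro follows_unique)
qed

lemma walk_past_steps:
  assumes "F \<subseteq> oriented_edges G"
  shows "walk (past G F v) x ws y \<Longrightarrow> ws \<in> lists (edges G \<times> verts G)"
proof (induction ws arbitrary: x)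
  case (Cons ez ws)
  obtain e z where ez: "ez = (e, z)" by (cases ez)
  have "e \<in> edges G" using Cons.prems ez assms by (auto simp: oriented_edges_def)
  moreover have "z \<in> ends G e" using Cons.prems ez by auto
  ultimately show ?case using Cons ends_verts[of e] ez by auto
qed simp

lemma flows_to_verts:
  assumes "F \<subseteq> oriented_edges G" "v \<in> verts G" "flows_to G F x v"
  shows "x \<in> verts G"
  using assms(3,2) unfolding flows_to_def
proof (induction rule: converse_rtranclp_induct)
  case (step x y)
  then show ?case using assms(1) ends_verts by (auto simp: oriented_edges_def)
qed

text \<open>Further edges can shorten distances, so this event is not of the increasing kind handled
  by \<open>finitary_sets\<close>. It is a countable union over pairs x, y: both flow to v, and none
  of the countably many walks with fewer than R steps joins them in the past.\<close>

lemma diam_sets: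
  assumes v: "v \<in> verts G" and R: "1 \<le> R"
  shows "{\<omega> \<in> space \<mu>. ereal R \<le> ereal_of_enat (graph_diam (past G (config_edges G \<omega>) v))} \<in> sets \<mu>"
proof -
  let ?L = "{p \<in> lists (edges G \<times> verts G). real (length p) < R}"
  let ?fl = "\<lambda>x. {\<omega> \<in> space \<mu>. flows_to G (config_edges G \<omega>) x v}"
  let ?wk = "\<lambda>x y p. {\<omega> \<in> space \<mu>. walk (past G (config_edges G \<omega>) v) x p y}"
  have L: "countable ?L"
    by (rule countable_subset[OF _ countable_lists[of "edges G \<times> verts G"]])
       (use countable_verts countable_edges in auto)
  have sub: "config_edges G \<omega> \<subseteq> oriented_edges G" for \<omega> by (auto simp: config_edges_def)
  have eq: "{\<omega> \<in> space \<mu>. ereal R \<le> ereal_of_enat (graph_diam (past G (config_edges G \<omega>) v))} =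
      (\<Union>x\<in>verts G. \<Union>y\<in>verts G. (?fl x \<inter> ?fl y) - (\<Union>p\<in>?L. ?wk x y p))"
    unfolding diam_ge_iff[OF R] past_simps
  proof (intro equalityI subsetI)
    fix \<omega> assume "\<omega> \<in> {\<omega> \<in> space \<mu>. \<exists>x\<in>{u. flows_to G (config_edges G \<omega>) u v}.
        \<exists>y\<in>{u. flows_to G (config_edges G \<omega>) u v}.
        \<forall>p. walk (past G (config_edges G \<omega>) v) x p y \<longrightarrow> R \<le> real (length p)}"
    then obtain x y where *: "\<omega> \<in> space \<mu>" "flows_to G (config_edges G \<omega>) x v"
      "flows_to G (config_edges G \<omega>) y v"
      "\<forall>p. walk (past G (config_edges G \<omega>) v) x p y \<longrightarrow> R \<le> real (length p)" by auto
    have "x \<in> verts G" "y \<in> verts G" using flows_to_verts[OF sub v] *(2,3) by auto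
    then show "\<omega> \<in> (\<Union>x\<in>verts G. \<Union>y\<in>verts G. (?fl x \<inter> ?fl y) - (\<Union>p\<in>?L. ?wk x y p))"
      using * by fastforce
  next
    fix \<omega> assume "\<omega> \<in> (\<Union>x\<in>verts G. \<Union>y\<in>verts G. (?fl x \<inter> ?fl y) - (\<Union>p\<in>?L. ?wk x y p))"
    then obtain x y where *: "\<omega> \<in> space \<mu>" "flows_to G (config_edges G \<omega>) x v"
      "flows_to G (config_edges G \<omega>) y v" "\<And>p. p \<in> ?L \<Longrightarrow> \<omega> \<notin> ?wk x y p" by auto
    have "R \<le> real (length p)" if w: "walk (past G (config_edges G \<omega>) v) x p y" for p
    proof (rule ccontr)
      assume "\<not> R \<le> real (length p)"
      then have "p \<in> ?L" using walk_past_steps[OF sub w] by simp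
      then show False using *(1,4) w by blast
    qed
    then show "\<omega> \<in> {\<omega> \<in> space \<mu>. \<exists>x\<in>{u. flows_to G (config_edges G \<omega>) u v}.
        \<exists>y\<in>{u. flows_to G (config_edges G \<omega>) u v}.
        \<forall>p. walk (past G (config_edges G \<omega>) v) x p y \<longrightarrow> R \<le> real (length p)}"
      using * by blast
  qed
  have wk: "?wk x y p \<in> sets \<mu>" if p: "p \<in> ?L" for x y p
  proof (rule finitary_sets[OF finitary_walk_past])
    fix e assume "e \<in> fst ` set p"
    then have "e \<in> edges G" using p by (auto simp: lists_eq_set)
    then have "card (ends G e) \<in> {1, 2}" using net by (simp add: network_def)
    then show "finite (ends G e)" by (auto intro: card_ge_0_finite)
  qed
  have fl: "?fl x \<in> sets \<mu>" for x by (rule finitary_sets[OF finitary_flows_to])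
  show ?thesis
    unfolding eq by (intro sets.countable_UN'' countable_verts L sets.Diff sets.Int fl wk)
qed

text \<open>Restricting the edges to a window changes only the factor of each single arrow.
  Acyclicity depends on the targets alone, so the factors \<open>decay\<close> and
  \<open>esc\<close> stay as they are.\<close>

lemma prob_flow_window:
  assumes S: "dom S" and \<gamma>: "distinct \<gamma>" "\<gamma> \<noteq> []" "set \<gamma> \<subseteq> S"
    and g: "\<And>f. follows f \<gamma> \<longleftrightarrow> (\<forall>a\<in>set (tl \<gamma>). f a = g a)"
  shows "measure_pmf.prob (wired_edges S) {f. flow_path G (config_edges G (config S f) \<inter> window m) \<gamma>} =
    (\<Prod>b\<in>set (tl \<gamma>). measure_pmf.prob (edge_step b) {e. (b, e) \<in> window m \<and> ends G e = {b, g b}}) *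
    (decay S (set \<gamma>) * esc S (set \<gamma>) (hd \<gamma>))"
proof -
  let ?B = "\<lambda>b. {e. (b, e) \<in> window m \<and> ends G e = {b, g b}}"
  have fg: "follows g \<gamma>" using g by blast
  have tl: "set (tl \<gamma>) \<subseteq> S" using \<gamma>(2,3) by (cases \<gamma>) auto
  have iff: "flow_path G (config_edges G (config S f) \<inter> window m) \<gamma> \<longleftrightarrow> (\<forall>b\<in>set (tl \<gamma>). f b \<in> ?B b)"
    if "good_arrows G S f" for f
    unfolding flow_path_iff_pred[OF fg] edges_config[OF that] using tl by auto
  have "measure_pmf.prob (wired_edges S) {f. flow_path G (config_edges G (config S f) \<inter> window m) \<gamma>} =
      measure_pmf.prob (wired_edges S) {f. \<forall>b\<in>set (tl \<gamma>). f b \<in> ?B b}"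
    by (rule antisym; rule wired_edges_prob_mono[OF S]) (use iff in blast)+
  also have "\<dots> = measure_pmf.prob (edge_arrows S)
      {f. acyc S (arrow_map G f) \<and> (\<forall>b\<in>set (tl \<gamma>). f b \<in> ?B b)} / Z S"
    by (rule prob_wired_edges[OF S])
  also have "measure_pmf.prob (edge_arrows S) {f. acyc S (arrow_map G f) \<and> (\<forall>b\<in>set (tl \<gamma>). f b \<in> ?B b)} =
      measure_pmf.prob (Pi_pmf S undefined edge_step)
        {f. acyc S (\<lambda>u. other_end G u (f u)) \<and> (\<forall>b\<in>set (tl \<gamma>). f b \<in> ?B b)}"
    by (simp add: edge_arrows_def arrow_map_def[abs_def])
  also have "\<dots> = (\<Prod>b\<in>set (tl \<gamma>). measure_pmf.prob (edge_step b) (?B b)) *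
      (Z (S - set \<gamma>) * esc S (set \<gamma>) (hd \<gamma>))"
  proof (rule prob_follows_escape[OF S \<gamma>(3,1,2)])
    show "map_pmf (other_end G u) (edge_step u) = walk_step G u" if "u \<in> S" for u
      using walk_step_eq[of u] S that by (simp add: domD)
    fix f assume f: "\<And>a. a \<in> set (tl \<gamma>) \<Longrightarrow> f a \<in> ?B a"
    have "other_end G a (f a) = g a" if "a \<in> set (tl \<gamma>)" for a
      by (rule other_end_eq) (use f[OF that] window(2) in \<open>auto simp: oriented_edges_def\<close>)
    then show "follows (\<lambda>u. other_end G u (f u)) \<gamma>" unfolding g by blast
  qed
  finally show ?thesis by (simp add: decay_def)
qed

lemma eventually_subset_W:
  "finite A \<Longrightarrow> A \<subseteq> verts G \<Longrightarrow> eventually (\<lambda>k. A \<subseteq> W k) sequentially"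
  using filterlim_W[unfolded filterlim_finite_subsets_at_top, rule_format, of A]
  by (auto elim: eventually_mono)

lemma window_prob_tendsto:
  assumes "b \<in> verts G"
  shows "(\<lambda>m. measure_pmf.prob (edge_step b) {e. (b, e) \<in> window m \<and> ends G e = {b, c}})
    \<longlonglongrightarrow> pmf (walk_step G b) c"
proof -
  let ?A = "\<lambda>m. {e. (b, e) \<in> window m \<and> ends G e = {b, c}}"
  have "(\<Union>m. ?A m) = {e \<in> edges G. ends G e = {b, c}}"
  proof (intro equalityI subsetI)
    fix e assume "e \<in> (\<Union>m. ?A m)"
    then show "e \<in> {e \<in> edges G. ends G e = {b, c}}" using window(2) by (auto simp: oriented_edges_def)
  next
    fix e assume e: "e \<in> {e \<in> edges G. ends G e = {b, c}}"
    have "eventually (\<lambda>m. {(b, e)} \<subseteq> window m) sequentially"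
      by (rule window_covers) (use e in \<open>auto simp: oriented_edges_def\<close>)
    then obtain m where "{(b, e)} \<subseteq> window m" by (meson eventually_happens trivial_limit_sequentially)
    then show "e \<in> (\<Union>m. ?A m)" using e by auto
  qed
  moreover have "(\<lambda>m. measure_pmf.prob (edge_step b) (?A m)) \<longlonglongrightarrow> measure_pmf.prob (edge_step b) (\<Union>m. ?A m)"
    by (rule measure_pmf.finite_Lim_measure_incseq) (use window(3) in \<open>auto simp: incseq_def\<close>)
  ultimately show ?thesis using pmf_walk_step_edges[OF assms] by simp
qed

text \<open>The order of the choices matters: the paths lie in a fixed finite T, then m is taken so
  large that the infinite-volume first moment inside the window is still above n / 2, and only then
  k tends to infinity.\<close>

lemma many_paths:
  assumes C: "1 \<le> C" "\<forall>S v n. dom S \<longrightarrow> v \<in> S \<longrightarrow> 0 < n \<longrightarrow> tall S n v \<le> C / real n"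
    and M: "1 \<le> M" and n: "1 \<le> n" and v: "v \<in> verts G" and T: "dom T" "v \<in> T"
    and first: "real n \<le> (\<Sum>l\<in>{n..<M * n}. em T l v)"
  defines "\<Gamma> \<equiv> \<Union>l\<in>{n..<M * n}. paths T l v"
  shows "1 / (64 * real M ^ 3 * bubble ^ 3) / real n \<le> measure \<mu> {\<omega> \<in> space \<mu>.
    \<exists>X. (X \<subseteq> \<Gamma> \<and> (real n)\<^sup>2 / (8 * C) \<le> real (card X)) \<and>
      (\<forall>\<gamma>\<in>X. flow_path G (config_edges G \<omega>) \<gamma>)}"
proof -
  \<comment> \<open>The probability of finding any path is at most C / n, so t times it is at most n
    / 8, below the n / 4 that \<open>second_moment_lower\<close> permits for a mean of n /
    2.\<close>
  define t where "t = (real n)\<^sup>2 / (8 * C)"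
  let ?Q = "\<lambda>F. \<exists>X. (X \<subseteq> \<Gamma> \<and> t \<le> real (card X)) \<and> (\<forall>\<gamma>\<in>X. flow_path G F \<gamma>)"
  have finT: "finite T" "T \<subseteq> verts G" using T by (auto simp: domD)
  have fin\<Gamma>: "finite \<Gamma>" unfolding \<Gamma>_def by (simp add: finite_paths finT)
  have \<Gamma>D: "\<exists>l. n \<le> l \<and> l < M * n \<and> \<gamma> \<in> paths T l v" if "\<gamma> \<in> \<Gamma>" for \<gamma>
    using that unfolding \<Gamma>_def by auto
  have \<gamma>: "distinct \<gamma>" "\<gamma> \<noteq> []" "hd \<gamma> = v" "set \<gamma> \<subseteq> T" "set (tl \<gamma>) \<subseteq> T" if mem: "\<gamma> \<in> \<Gamma>" for \<gamma>
  proof -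
    obtain l where l: "\<gamma> \<in> paths T l v" using \<Gamma>D[OF mem] by blast
    show "distinct \<gamma>" "\<gamma> \<noteq> []" "hd \<gamma> = v" "set \<gamma> \<subseteq> T" "set (tl \<gamma>) \<subseteq> T"
      using pathsD[OF l] T(2) by simp_all
  qed
  have "\<exists>g. (\<forall>f. follows f \<gamma> \<longleftrightarrow> (\<forall>a\<in>set (tl \<gamma>). f a = g a)) \<and>
      pw \<gamma> = (\<Prod>a\<in>set (tl \<gamma>). pmf (walk_step G a) (g a))" if "\<gamma> \<in> \<Gamma>" for \<gamma>
    by (rule follows_assign) (rule \<gamma>(1)[OF that])
  then obtain g where g: "\<And>\<gamma> f. \<gamma> \<in> \<Gamma> \<Longrightarrow> follows f \<gamma> \<longleftrightarrow> (\<forall>a\<in>set (tl \<gamma>). f a = g \<gamma> a)"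
    "\<And>\<gamma>. \<gamma> \<in> \<Gamma> \<Longrightarrow> pw \<gamma> = (\<Prod>a\<in>set (tl \<gamma>). pmf (walk_step G a) (g \<gamma> a))" by metis
  define w where "w m \<gamma> = (\<Prod>b\<in>set (tl \<gamma>).
    measure_pmf.prob (edge_step b) {e. (b, e) \<in> window m \<and> ends G e = {b, g \<gamma> b}})" for m \<gamma>
  have w: "(\<lambda>m. w m \<gamma>) \<longlonglongrightarrow> pw \<gamma>" if mem: "\<gamma> \<in> \<Gamma>" for \<gamma>
    unfolding w_def g(2)[OF mem]
    by (intro tendsto_prod window_prob_tendsto) (use \<gamma>(5)[OF mem] finT in blast)
  have lim: "(\<lambda>m. \<Sum>\<gamma>\<in>\<Gamma>. w m \<gamma> * (decayV (set \<gamma>) * escV (set \<gamma>) v)) \<longlonglongrightarrow>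
      (\<Sum>\<gamma>\<in>\<Gamma>. pw \<gamma> * (decayV (set \<gamma>) * escV (set \<gamma>) v))"
    by (intro tendsto_sum tendsto_mult w tendsto_const)
  have "(\<Sum>\<gamma>\<in>\<Gamma>. pw \<gamma> * (decayV (set \<gamma>) * escV (set \<gamma>) v)) = (\<Sum>l\<in>{n..<M * n}. em T l v)"
    unfolding \<Gamma>_def em_def wtV_def
    by (subst sum.UNION_disjoint) (auto simp: finite_paths finT mult.assoc dest!: pathsD(1))
  then have "real n / 2 < (\<Sum>\<gamma>\<in>\<Gamma>. pw \<gamma> * (decayV (set \<gamma>) * escV (set \<gamma>) v))"
    using first n by simp
  then have "eventually (\<lambda>m. real n / 2 < (\<Sum>\<gamma>\<in>\<Gamma>. w m \<gamma> * (decayV (set \<gamma>) * escV (set \<gamma>) v))) sequentially"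
    by (rule order_tendstoD(1)[OF lim])
  then obtain m where m: "real n / 2 < (\<Sum>\<gamma>\<in>\<Gamma>. w m \<gamma> * (decayV (set \<gamma>) * escV (set \<gamma>) v))"
    by (meson eventually_happens trivial_limit_sequentially)
  have "(\<lambda>k. \<Sum>\<gamma>\<in>\<Gamma>. w m \<gamma> * (decay (W k) (set \<gamma>) * esc (W k) (set \<gamma>) v)) \<longlonglongrightarrow>
      (\<Sum>\<gamma>\<in>\<Gamma>. w m \<gamma> * (decayV (set \<gamma>) * escV (set \<gamma>) v))"
  proof (intro tendsto_sum tendsto_mult tendsto_const)
    fix \<gamma> assume "\<gamma> \<in> \<Gamma>"
    then have A: "finite (set \<gamma>)" "set \<gamma> \<subseteq> verts G" using \<gamma>(4) finT by blast+
    show "(\<lambda>k. decay (W k) (set \<gamma>)) \<longlonglongrightarrow> decayV (set \<gamma>)"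
      by (rule filterlim_compose[OF decayV[OF A(1)] filterlim_W])
    show "(\<lambda>k. esc (W k) (set \<gamma>) v) \<longlonglongrightarrow> escV (set \<gamma>) v"
      by (rule filterlim_compose[OF escV[OF A] filterlim_W])
  qed
  then have ev: "eventually (\<lambda>k. real n / 2 < (\<Sum>\<gamma>\<in>\<Gamma>. w m \<gamma> * (decay (W k) (set \<gamma>) * esc (W k) (set \<gamma>) v))) sequentially"
    by (rule order_tendstoD(1)[OF _ m])
  have "1 / (64 * real M ^ 3 * bubble ^ 3) / real n \<le> measure \<mu> {\<omega> \<in> space \<mu>. ?Q (config_edges G \<omega>)}"
  proof (rule finitary_measure_ge[where m = m])
    show "finitary ?Q"
      by (intro finitary_ex finitary_imp finitary_ball finitary_flow_path) (use fin\<Gamma> finite_subset in blast)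
    show "eventually (\<lambda>k. 1 / (64 * real M ^ 3 * bubble ^ 3) / real n \<le> measure_pmf.prob (wired_edges (W k))
        {f. ?Q (config_edges G (config (W k) f) \<inter> window m)}) sequentially"
      using ev eventually_subset_W[OF finT]
    proof eventually_elim
      case (elim k)
      let ?S = "W k" and ?p = "wired_edges (W k)"
      define E where "E \<gamma> f = flow_path G (config_edges G (config ?S f) \<inter> window m) \<gamma>" for \<gamma> f
      define N where "N f = (\<Sum>\<gamma>\<in>\<Gamma>. of_bool (E \<gamma> f) :: real)" for f
      have S: "dom ?S" "v \<in> ?S" "finite ?S" using dom_W elim T by (auto simp: domD)
      have inS: "set \<gamma> \<subseteq> ?S" "set (tl \<gamma>) \<subseteq> ?S" if "\<gamma> \<in> \<Gamma>" for \<gamma>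
        using \<gamma>(4,5)[OF that] elim by auto
      have Efol: "follows (arrow_map G f) \<gamma>" if "good_arrows G ?S f" "E \<gamma> f" for \<gamma> f
        using flow_path_follows[OF that(1) _ that(2)[unfolded E_def]] edges_config[OF that(1)] by auto
      have int: "integrable (measure_pmf ?p) (\<lambda>f. of_bool (A f) :: real)" for A
        by (rule integrable_pmf_bounded[where K = 1]) simp
      have N0: "0 \<le> N f" for f unfolding N_def by (rule sum_nonneg) simp
      have NK: "N f \<le> real (card \<Gamma>)" for f
        unfolding N_def by (rule order_trans[OF sum_bounded_above[where K = 1]]) auto
      have EN: "measure_pmf.expectation ?p N = (\<Sum>\<gamma>\<in>\<Gamma>. w m \<gamma> * (decay ?S (set \<gamma>) * esc ?S (set \<gamma>) v))"
      proof -
        have "measure_pmf.expectation ?p N = (\<Sum>\<gamma>\<in>\<Gamma>. measure_pmf.prob ?p {f. E \<gamma> f})"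
          unfolding N_def using int by (simp add: expectation_of_bool)
        also have "\<dots> = (\<Sum>\<gamma>\<in>\<Gamma>. w m \<gamma> * (decay ?S (set \<gamma>) * esc ?S (set \<gamma>) v))"
        proof (rule sum.cong[OF refl])
          fix \<delta> assume mem: "\<delta> \<in> \<Gamma>"
          show "measure_pmf.prob ?p {f. E \<delta> f} = w m \<delta> * (decay ?S (set \<delta>) * esc ?S (set \<delta>) v)"
            unfolding E_def w_def
            using prob_flow_window[OF S(1) \<gamma>(1,2)[OF mem] inS(1)[OF mem] g(1)[OF mem], of m] \<gamma>(3)[OF mem]
            by simp
        qed
        finally show ?thesis .
      qed
      have ENN: "measure_pmf.expectation ?p (\<lambda>f. N f * N f) \<le> real (M * n) ^ 3 * bubble ^ 3"
      proof -
        have "measure_pmf.expectation ?p (\<lambda>f. N f * N f) =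
            measure_pmf.expectation ?p (\<lambda>f. \<Sum>\<gamma>\<in>\<Gamma>. \<Sum>\<gamma>'\<in>\<Gamma>. of_bool (E \<gamma> f \<and> E \<gamma>' f))"
          unfolding N_def sum_product of_bool_conj ..
        also have "\<dots> = (\<Sum>\<gamma>\<in>\<Gamma>. \<Sum>\<gamma>'\<in>\<Gamma>. measure_pmf.prob ?p {f. E \<gamma> f \<and> E \<gamma>' f})"
          using int by (simp add: expectation_of_bool)
        also have "\<dots> \<le> (\<Sum>\<gamma>\<in>\<Gamma>. \<Sum>\<gamma>'\<in>\<Gamma>. measure_pmf.prob (wired ?S) {f. follows f \<gamma> \<and> follows f \<gamma>'})"
        proof (intro sum_mono)
          fix \<delta> \<delta>' assume mem: "\<delta> \<in> \<Gamma>" "\<delta>' \<in> \<Gamma>"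
          have "measure_pmf.prob ?p {f. E \<delta> f \<and> E \<delta>' f} \<le>
              measure_pmf.prob ?p {f. follows (arrow_map G f) \<delta> \<and> follows (arrow_map G f) \<delta>'}"
            by (rule wired_edges_prob_mono[OF S(1)]) (use Efol in blast)
          also have "\<dots> = measure_pmf.prob (wired ?S) {f. follows f \<delta> \<and> follows f \<delta>'}"
          proof (rule prob_wired_edges_map[OF S(1), where E = "\<lambda>f. follows f \<delta> \<and> follows f \<delta>'"])
            fix f h :: "'v \<Rightarrow> 'v" assume eq: "\<And>x. x \<in> ?S \<Longrightarrow> f x = h x"
            have "follows f \<delta> \<longleftrightarrow> follows h \<delta>" by (rule follows_cong, rule eq) (use inS(2)[OF mem(1)] in blast)
            moreover have "follows f \<delta>' \<longleftrightarrow> follows h \<delta>'"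
              by (rule follows_cong, rule eq) (use inS(2)[OF mem(2)] in blast)
            ultimately show "follows f \<delta> \<and> follows f \<delta>' \<longleftrightarrow> follows h \<delta> \<and> follows h \<delta>'" by simp
          qed
          finally show "measure_pmf.prob ?p {f. E \<delta> f \<and> E \<delta>' f} \<le>
            measure_pmf.prob (wired ?S) {f. follows f \<delta> \<and> follows f \<delta>'}" .
        qed
        also have "\<dots> \<le> (\<Sum>\<gamma>\<in>all_paths ?S (M * n) v. \<Sum>\<gamma>'\<in>all_paths ?S (M * n) v.
            measure_pmf.prob (wired ?S) {f. follows f \<gamma> \<and> follows f \<gamma>'})"
        proof -
          have sub: "\<Gamma> \<subseteq> all_paths ?S (M * n) v"
            unfolding \<Gamma>_def all_paths_def using paths_mono[OF elim(2)] by fastforce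
          have finA: "finite (all_paths ?S (M * n) v)" by (rule finite_all_paths[OF S(3)])
          show ?thesis
            by (rule order_trans[OF sum_mono[OF sum_mono2[OF finA sub]] sum_mono2[OF finA sub]])
               (auto intro: sum_nonneg)
        qed
        also have "\<dots> \<le> real (M * n) ^ 3 * bubble ^ 3" by (rule second_moment_upper[OF S(1,2)])
        finally show ?thesis .
      qed
      have Npos: "measure_pmf.prob ?p {f. 0 < N f} \<le> C / real n"
      proof -
        have "measure_pmf.prob ?p {f. 0 < N f} \<le> measure_pmf.prob ?p {f. \<exists>\<gamma>\<in>paths ?S n v. follows (arrow_map G f) \<gamma>}"
        proof (rule wired_edges_prob_mono[OF S(1)])
          fix f assume f: "good_arrows G ?S f" "0 < N f"
          have "\<exists>\<delta>\<in>\<Gamma>. E \<delta> f"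
          proof (rule ccontr)
            assume "\<not> ?thesis"
            then have "N f = 0" unfolding N_def by simp
            then show False using f(2) by simp
          qed
          then obtain \<delta> where \<delta>: "\<delta> \<in> \<Gamma>" "E \<delta> f" by blast
          obtain l where l: "n \<le> l" "\<delta> \<in> paths T l v" using \<Gamma>D[OF \<delta>(1)] by blast
          have len: "n < length \<delta>" using pathsD(1)[OF l(2)] l(1) by simp
          have "follows (arrow_map G f) (take (Suc n) \<delta>)"
            using Efol[OF f(1) \<delta>(2)] follows_split[OF len] by blast
          moreover have "take (Suc n) \<delta> \<in> paths ?S n v"
          proof -
            have "set (tl (take (Suc n) \<delta>)) \<subseteq> ?S"
              using inS(2)[OF \<delta>(1)] by (metis order_trans set_take_subset take_tl tl_take)
            then show ?thesis using \<gamma>[OF \<delta>(1)] len by (simp add: paths_def hd_take)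
          qed
          ultimately show "\<exists>\<gamma>\<in>paths ?S n v. follows (arrow_map G f) \<gamma>" by blast
        qed
        also have "\<dots> = tall ?S n v" by (rule prob_wired_edges_tall[OF S(1)])
        also have "\<dots> \<le> C / real n" by (rule C(2)[rule_format, OF S(1,2)]) (use n in simp)
        finally show ?thesis .
      qed
      have b: "1 \<le> bubble" by (rule bubble_ge_1)
      have "(real n / 2)\<^sup>2 / (4 * (real (M * n) ^ 3 * bubble ^ 3)) \<le> measure_pmf.prob ?p {f. t \<le> N f}"
      proof (rule second_moment_lower[where K = "real (card \<Gamma>)", OF N0 NK])
        show "0 < real n / 2" using n by simp
        show "real n / 2 \<le> measure_pmf.expectation ?p N" using elim(1) EN by simp
        show "0 < real (M * n) ^ 3 * bubble ^ 3" using M n b by simp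
        show "measure_pmf.expectation ?p (\<lambda>f. N f * N f) \<le> real (M * n) ^ 3 * bubble ^ 3" by (rule ENN)
        show "0 \<le> t" using C by (simp add: t_def)
        have "t * measure_pmf.prob ?p {f. 0 < N f} \<le> t * (C / real n)"
          by (rule mult_left_mono[OF Npos]) (use C in \<open>simp add: t_def\<close>)
        also have "\<dots> = real n / 8" using C n by (simp add: t_def power2_eq_square)
        finally show "t * measure_pmf.prob ?p {f. 0 < N f} \<le> real n / 2 / 2" by simp
      qed
      also have "\<dots> \<le> measure_pmf.prob ?p {f. ?Q (config_edges G (config ?S f) \<inter> window m)}"
      proof (rule wired_edges_prob_mono[OF S(1)])
        fix f assume "t \<le> N f"
        moreover have "N f = real (card (\<Gamma> \<inter> {\<gamma>. E \<gamma> f}))"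
          unfolding N_def using fin\<Gamma> by (subst sum_of_bool_eq) auto
        ultimately show "?Q (config_edges G (config ?S f) \<inter> window m)"
          by (intro exI[of _ "\<Gamma> \<inter> {\<gamma>. E \<gamma> f}"]) (auto simp: E_def)
      qed
      finally have main: "(real n / 2)\<^sup>2 / (4 * (real (M * n) ^ 3 * bubble ^ 3)) \<le>
        measure_pmf.prob ?p {f. ?Q (config_edges G (config ?S f) \<inter> window m)}" .
      have "1 / (64 * real M ^ 3 * bubble ^ 3) / real n \<le> (real n / 2)\<^sup>2 / (4 * (real (M * n) ^ 3 * bubble ^ 3))"
        using M n b by (simp add: power2_eq_square power3_eq_cube field_simps)
      then show ?case using main by (rule order_trans)
    qed
  qed
  then show ?thesis unfolding t_def .
qed

text \<open>A single path gives the diameter, since it is a geodesic to v. Different paths have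
  different last vertices, so their number bounds the number of vertices from below.\<close>

lemma many_paths_past:
  assumes F: "consistent F" and v: "0 < t" "1 \<le> n"
    and X: "X \<subseteq> (\<Union>l\<in>{n..<N}. paths T l v)" "t \<le> real (card X)" "\<And>\<gamma>. \<gamma> \<in> X \<Longrightarrow> flow_path G F \<gamma>"
    and fin: "finite X"
  shows "ereal (real n) \<le> ereal_of_enat (graph_diam (past G F v))"
    "ereal t \<le> ereal_of_enat (num_verts (past G F v))"
proof -
  have \<gamma>: "distinct \<gamma>" "\<gamma> \<noteq> []" "hd \<gamma> = v" "n \<le> length \<gamma> - 1" if "\<gamma> \<in> X" for \<gamma>
    using X(1) that by (fastforce dest: pathsD)+
  have flows: "flows_to G F (last \<gamma>) v" if "\<gamma> \<in> X" for \<gamma>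
    using flow_path_flows_to[OF X(3)[OF that], of "last \<gamma>"] \<gamma>[OF that] by simp
  have "X \<noteq> {}" using X(2) v(1) by auto
  then obtain \<delta> where \<delta>: "\<delta> \<in> X" by blast
  have "\<forall>ws. walk (past G F v) (last \<delta>) ws v \<longrightarrow> real n \<le> real (length ws)"
    using consistent_geodesic[OF F X(3)[OF \<delta>] \<gamma>(2,3)[OF \<delta>]] \<gamma>(4)[OF \<delta>] by fastforce
  moreover have "last \<delta> \<in> verts (past G F v)" "v \<in> verts (past G F v)"
    using flows[OF \<delta>] by (auto simp: flows_to_def)
  ultimately show "ereal (real n) \<le> ereal_of_enat (graph_diam (past G F v))"
    using diam_ge_iff[of "real n" "past G F v"] v(2) by auto
  have "inj_on last X"
    by (rule inj_onI, rule consistent_last_inj[OF F]) (use X(3) \<gamma> in auto)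
  then have "card (last ` X) = card X" by (rule card_image)
  moreover have "last ` X \<subseteq> verts (past G F v)" using flows by auto
  ultimately show "ereal t \<le> ereal_of_enat (num_verts (past G F v))"
    using num_verts_ge_iff[of t "past G F v"] v(1) X(2) fin by (metis finite_imageI less_imp_le)
qed

lemma past_lower:
  assumes C: "1 \<le> C" "\<forall>S v n. dom S \<longrightarrow> v \<in> S \<longrightarrow> 0 < n \<longrightarrow> tall S n v \<le> C / real n"
    and M: "1 \<le> M" "\<forall>n v. 1 \<le> n \<longrightarrow> v \<in> verts G \<longrightarrow>
      (\<exists>T. dom T \<and> v \<in> T \<and> real n \<le> (\<Sum>l\<in>{n..<M * n}. em T l v))"
    and v: "v \<in> verts G" and n: "1 \<le> n"
  shows "R \<le> real n \<Longrightarrow> 1 \<le> R \<Longrightarrow> 1 / (64 * real M ^ 3 * bubble ^ 3) / real n \<le>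
      measure \<mu> {\<omega> \<in> space \<mu>. ereal R \<le> ereal_of_enat (graph_diam (past G (config_edges G \<omega>) v))}"
    "R \<le> (real n)\<^sup>2 / (8 * C) \<Longrightarrow> 1 \<le> R \<Longrightarrow> 1 / (64 * real M ^ 3 * bubble ^ 3) / real n \<le>
      measure \<mu> {\<omega> \<in> space \<mu>. ereal R \<le> ereal_of_enat (num_verts (past G (config_edges G \<omega>) v))}"
proof -
  obtain T where T: "dom T" "v \<in> T" "real n \<le> (\<Sum>l\<in>{n..<M * n}. em T l v)" using M(2)[rule_format, OF n v] by blast
  let ?\<Gamma> = "\<Union>l\<in>{n..<M * n}. paths T l v" and ?t = "(real n)\<^sup>2 / (8 * C)"
  let ?A = "{\<omega> \<in> space \<mu>. \<exists>X. (X \<subseteq> ?\<Gamma> \<and> ?t \<le> real (card X)) \<and> (\<forall>\<gamma>\<in>X. flow_path G (config_edges G \<omega>) \<gamma>)}"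
  note A = many_paths[OF C M(1) n v T]
  have t: "0 < ?t" using n C by simp
  have fin: "finite ?\<Gamma>" using T(1) by (simp add: finite_paths domD)
  have ae: "AE \<omega> in \<mu>. \<omega> \<in> ?A \<longrightarrow> ereal (real n) \<le> ereal_of_enat (graph_diam (past G (config_edges G \<omega>) v)) \<and>
      ereal ?t \<le> ereal_of_enat (num_verts (past G (config_edges G \<omega>) v))"
    using AE_consistent
  proof eventually_elim
    case (elim \<omega>)
    show ?case
    proof
      assume "\<omega> \<in> ?A"
      then obtain X where X: "X \<subseteq> ?\<Gamma>" "?t \<le> real (card X)" "\<And>\<gamma>. \<gamma> \<in> X \<Longrightarrow> flow_path G (config_edges G \<omega>) \<gamma>"
        by auto
      have "finite X" using X(1) fin by (rule finite_subset)
      from many_paths_past[OF elim t n X this]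
      show "ereal (real n) \<le> ereal_of_enat (graph_diam (past G (config_edges G \<omega>) v)) \<and>
        ereal ?t \<le> ereal_of_enat (num_verts (past G (config_edges G \<omega>) v))" by blast
    qed
  qed
  show "1 / (64 * real M ^ 3 * bubble ^ 3) / real n \<le>
      measure \<mu> {\<omega> \<in> space \<mu>. ereal R \<le> ereal_of_enat (graph_diam (past G (config_edges G \<omega>) v))}"
    if R: "R \<le> real n" "1 \<le> R"
  proof (rule order_trans[OF A], rule mu.finite_measure_mono_AE[OF _ diam_sets[OF v R(2)]])
    show "AE \<omega> in \<mu>. \<omega> \<in> ?A \<longrightarrow>
        \<omega> \<in> {\<omega> \<in> space \<mu>. ereal R \<le> ereal_of_enat (graph_diam (past G (config_edges G \<omega>) v))}"
      using ae
    proof eventually_elim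
      case (elim \<omega>)
      show ?case
      proof
        assume "\<omega> \<in> ?A"
        then have "ereal (real n) \<le> ereal_of_enat (graph_diam (past G (config_edges G \<omega>) v))" "\<omega> \<in> space \<mu>"
          using elim by auto
        moreover have "ereal R \<le> ereal (real n)" using R by simp
        ultimately show "\<omega> \<in> {\<omega> \<in> space \<mu>. ereal R \<le> ereal_of_enat (graph_diam (past G (config_edges G \<omega>) v))}"
          by (blast intro: order_trans)
      qed
    qed
  qed
  show "1 / (64 * real M ^ 3 * bubble ^ 3) / real n \<le>
      measure \<mu> {\<omega> \<in> space \<mu>. ereal R \<le> ereal_of_enat (num_verts (past G (config_edges G \<omega>) v))}"
    if R: "R \<le> ?t" "1 \<le> R"
  proof (rule order_trans[OF A], rule mu.finite_measure_mono_AE[OF _ finitary_sets[OF finitary_num_verts]])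
    show "AE \<omega> in \<mu>. \<omega> \<in> ?A \<longrightarrow>
        \<omega> \<in> {\<omega> \<in> space \<mu>. ereal R \<le> ereal_of_enat (num_verts (past G (config_edges G \<omega>) v))}"
      using ae
    proof eventually_elim
      case (elim \<omega>)
      show ?case
      proof
        assume "\<omega> \<in> ?A"
        then have "ereal ?t \<le> ereal_of_enat (num_verts (past G (config_edges G \<omega>) v))" "\<omega> \<in> space \<mu>"
          using elim by auto
        moreover have "ereal R \<le> ereal ?t" using R by simp
        ultimately show "\<omega> \<in> {\<omega> \<in> space \<mu>. ereal R \<le> ereal_of_enat (num_verts (past G (config_edges G \<omega>) v))}"
          by (blast intro: order_trans)
      qed
    qed
  qed (use R in simp)
qed

end

theorem theorem1p1:
  fixes G :: "('v, 'e) weighted_graph"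
  assumes "network G"
    and "transitive_network G"
    and "bubble_norm G < \<infinity>"
  shows "\<exists>c C :: real. 0 < c \<and> c \<le> C \<and>
    (\<forall>\<mu>. oriented_wusf G \<mu> \<longrightarrow>
      (\<forall>v\<in>verts G. \<forall>R::real. R \<ge> 1 \<longrightarrow>
        c * R powr (-1) \<le>
          measure \<mu> {\<omega> \<in> space \<mu>. ereal R \<le> ereal_of_enat (graph_diam (past G (config_edges G \<omega>) v))} \<and>
        measure \<mu> {\<omega> \<in> space \<mu>. ereal R \<le> ereal_of_enat (graph_diam (past G (config_edges G \<omega>) v))}
          \<le> C * R powr (-1) \<and>
        c * R powr (-1/2) \<le>
          measure \<mu> {\<omega> \<in> space \<mu>. ereal R \<le> ereal_of_enat (num_verts (past G (config_edges G \<omega>) v))} \<and>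
        measure \<mu> {\<omega> \<in> space \<mu>. ereal R \<le> ereal_of_enat (num_verts (past G (config_edges G \<omega>) v))}
          \<le> C * R powr (-1/2)))"
proof -
  interpret bubble_network G by standard (rule assms)+
  obtain C1 where C1: "1 \<le> C1" "\<forall>S v n. dom S \<longrightarrow> v \<in> S \<longrightarrow> 0 < n \<longrightarrow> tall S n v \<le> C1 / real n"
    using height_upper by blast
  obtain C2 where C2: "1 \<le> C2" "\<forall>S v R. dom S \<longrightarrow> v \<in> S \<longrightarrow> 1 \<le> R \<longrightarrow>
      measure_pmf.prob (wired S) {f. R \<le> real (card (reach S v f))} \<le> C2 / sqrt R"
    using volume_upper by blast
  obtain M :: nat where M: "1 \<le> M" "\<forall>n v. 1 \<le> n \<longrightarrow> v \<in> verts G \<longrightarrow>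
      (\<exists>T. dom T \<and> v \<in> T \<and> real n \<le> (\<Sum>l\<in>{n..<M * n}. em T l v))"
    using first_moment_lower by blast
  define c0 where "c0 = 1 / (64 * real M ^ 3 * bubble ^ 3)"
  have c0: "0 < c0" "c0 \<le> 1"
  proof -
    have "1 \<le> real M ^ 3" "1 \<le> bubble ^ 3" using M(1) bubble_ge_1 by (auto intro: one_le_power)
    then have "1 * 1 \<le> real M ^ 3 * bubble ^ 3" by (intro mult_mono) auto
    then show "0 < c0" "c0 \<le> 1" by (auto simp: c0_def)
  qed
  \<comment> \<open>For the volume the height n is sqrt (8 C1 R) rounded up, which makes n^2 / (8
    C1) at least R. Rounding at most doubles it, whence the factor 2.\<close>
  define c where "c = c0 / (2 * sqrt (8 * C1))"
  define C where "C = 2 * C1 + C2"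
  have s1: "1 \<le> sqrt (8 * C1)" using C1 by simp
  have c: "0 < c" "c \<le> c0 / 2"
    using c0 s1 by (auto simp: c_def field_simps)
  have "c \<le> C" using c c0 C1 C2 by (simp add: C_def)
  moreover have "c * R powr (-1) \<le>
          measure \<mu> {\<omega> \<in> space \<mu>. ereal R \<le> ereal_of_enat (graph_diam (past G (config_edges G \<omega>) v))} \<and>
        measure \<mu> {\<omega> \<in> space \<mu>. ereal R \<le> ereal_of_enat (graph_diam (past G (config_edges G \<omega>) v))}
          \<le> C * R powr (-1) \<and>
        c * R powr (-1/2) \<le>
          measure \<mu> {\<omega> \<in> space \<mu>. ereal R \<le> ereal_of_enat (num_verts (past G (config_edges G \<omega>) v))} \<and>
        measure \<mu> {\<omega> \<in> space \<mu>. ereal R \<le> ereal_of_enat (num_verts (past G (config_edges G \<omega>) v))}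
          \<le> C * R powr (-1/2)"
    if wusf: "oriented_wusf G \<mu>" and v: "v \<in> verts G" and R: "1 \<le> R" for \<mu> v and R :: real
  proof -
    obtain W where "prob_space \<mu>" "sets \<mu> = sets (config_space G)" "exhaustion G W"
      "weak_conv_in (config_topology G) (\<lambda>n. wired_tree_law G (W n)) \<mu>"
      using wusf by (auto simp: oriented_wusf_def)
    then interpret wusf_limit G \<mu> W
      by (intro wusf_limit.intro wusf_limit_axioms.intro bubble_network_axioms)
    have pow: "R powr (-1) = 1 / R" "R powr (-1/2) = 1 / sqrt R"
      using R powr_minus_divide[of R 1] powr_minus_divide[of R "1/2"] by (simp_all add: powr_half_sqrt)
    let ?D = "measure \<mu> {\<omega> \<in> space \<mu>. ereal R \<le> ereal_of_enat (graph_diam (past G (config_edges G \<omega>) v))}"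
    let ?N = "measure \<mu> {\<omega> \<in> space \<mu>. ereal R \<le> ereal_of_enat (num_verts (past G (config_edges G \<omega>) v))}"
    have "?D \<le> 2 * C1 / R" by (rule diam_upper[OF _ C1(2) v R]) (use C1 in auto)
    also have "\<dots> \<le> C / R" using C2 R by (intro divide_right_mono) (auto simp: C_def)
    finally have d_up: "?D \<le> C / R" .
    have "?N \<le> C2 / sqrt R" by (rule num_verts_upper[OF C2(2) v R])
    also have "\<dots> \<le> C / sqrt R" using C1 R by (intro divide_right_mono) (auto simp: C_def)
    finally have n_up: "?N \<le> C / sqrt R" .
    have d_low: "c / R \<le> ?D"
    proof -
      define n where "n = nat \<lceil>R\<rceil>"
      have n: "1 \<le> n" "R \<le> real n" "real n \<le> 2 * R" unfolding n_def using R by linarith+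
      have "c / R \<le> c0 / 2 / R" using c R by (intro divide_right_mono) auto
      also have "\<dots> = c0 / (2 * R)" by simp
      also have "\<dots> \<le> c0 / real n" using n c0 by (intro divide_left_mono) auto
      also have "\<dots> \<le> ?D" unfolding c0_def by (rule past_lower(1)[OF C1 M v n(1,2) R])
      finally show ?thesis .
    qed
    have n_low: "c / sqrt R \<le> ?N"
    proof -
      define x where "x = sqrt (8 * C1 * R)"
      define n where "n = nat \<lceil>x\<rceil>"
      have "1 * 1 \<le> 8 * C1 * R" using C1 R by (intro mult_mono) auto
      then have x: "1 \<le> x" "x\<^sup>2 = 8 * C1 * R" by (auto simp: x_def)
      have n: "1 \<le> n" "x \<le> real n" "real n \<le> 2 * x" unfolding n_def using x by linarith+
      have "x\<^sup>2 \<le> (real n)\<^sup>2" by (rule power_mono) (use n x in auto)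
      then have Rn: "R \<le> (real n)\<^sup>2 / (8 * C1)" using x C1 by (simp add: field_simps)
      have "c / sqrt R = c0 / (2 * x)" by (simp add: c_def x_def real_sqrt_mult)
      also have "\<dots> \<le> c0 / real n" using n c0 x by (intro divide_left_mono) auto
      also have "\<dots> \<le> ?N" unfolding c0_def by (rule past_lower(2)[OF C1 M v n(1) Rn R])
      finally show ?thesis .
    qed
    show ?thesis using d_up n_up d_low n_low unfolding pow by simp
  qed
  ultimately show ?thesis using c(1) by blast
qed

end
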